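(* Let $\mathbb{E}^n$ be either $\mathbb{R}^n$ (with $n\ge2$) or the Heisenberg group $\mathbb{H}_n$, and let $\Omega\subset\mathbb{E}^n$ be open and bounded. Let $\beta\in\{0,1\}$ and let $g\in L^1(\Omega)$ be such that $\nabla_{\mathbb{E}}g\in L^{(Q_{\mathbb{E}},1)}\log^\beta L(\Omega;\mathbb{R}^{m_{\mathbb{E}}})$. Then for any $1<\theta<Q_{\mathbb{E}}$ and any $\tau\in(0,1/4)$ there is a constant $c>0$, depending only on $n,Q_{\mathbb{E}},\theta,\tau$, such that $$\mathfrak{S}_{[g,\theta^*,\tau,\beta]}(x_0,r)\le c\,\mathcal{S}_{[\nabla_{\mathbb{E}}g,\theta,\tau,\beta]}(x_0,r)\le c\,\|\nabla_{\mathbb{E}}g\|_{L^{(Q_{\mathbb{E}},1)}\log^\beta L(B_r(x_0);\mathbb{R}^{m_{\mathbb{E}}})}$$ whenever $B_r(x_0)\subset\Omega$, the value of $c$ being allowed to differ between the two inequalities. In particular, for any $1<q<\infty$ and any $\tau\in(0,1/4)$, $\mathfrak{S}_{[g,q,\tau,\beta]}(x_0,r)\to0$ as $r\to0$, locally uniformly in $x_0\in\Omega$.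
   Context: $\mathbb{E}^n=\mathbb{R}^n$: $\nabla_{\mathbb{E}}=\nabla$, $Q_{\mathbb{E}}=n$, $m_{\mathbb{E}}=n$, Euclidean metric and Lebesgue measure. $\mathbb{E}^n=\mathbb{H}_n$: $\mathbb{R}^{2n+1}$ with group law $x\cdot y=\big(x_1+y_1,\dots,x_{2n}+y_{2n},t+s+\frac12\sum_{i=1}^n(x_iy_{n+i}-x_{n+i}y_i)\big)$; $X_i=\partial_{x_i}-\frac{x_{n+i}}2\partial_t$, $X_{n+i}=\partial_{x_{n+i}}+\frac{x_i}2\partial_t$; $\nabla_{\mathbb{E}}g=(X_1g,\dots,X_{2n}g)$ in the weak sense, $Q_{\mathbb{E}}=2n+2$, $m_{\mathbb{E}}=2n$, Korányi metric $d(x,y)=\rho(y^{-1}\cdot x)$, $\rho(x',t)=(|x'|^4+t^2)^{1/4}$, Lebesgue measure. $B_r(x)$ are metric balls ($r>0$) and $(h)_B=\frac1{|B|}\int_Bh$. $\theta^*=\frac{Q_{\mathbb{E}}\theta}{Q_{\mathbb{E}}-\theta}$. With $r_j=\tau^jr$, $$\mathcal{S}_{[G,\theta,\tau,\beta]}(x_0,r)=\sum_{j=0}^\infty r_j\log^\beta\left(\tfrac1{r_j}\right)\left(\tfrac1{|B_{r_j}|}\int_{B_{r_j}(x_0)}|G|^\theta\right)^{1/\theta},$$ $$\mathfrak{S}_{[h,q,\tau,\beta]}(x_0,r)=\sum_{j=0}^\infty\log^\beta\left(\tfrac1{r_j}\right)\left(\tfrac1{|B_{r_j}|}\int_{B_{r_j}(x_0)}|h-(h)_{B_{r_j}(x_0)}|^q\right)^{1/q}.$$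 Lorentz–Zygmund norm: for measurable $F$ on $U$, with $F^*$ the nonincreasing rearrangement of $|F|$ and $F^{**}(\rho)=\frac1\rho\int_0^\rho F^*$, $$\|F\|_{L^{(Q_{\mathbb{E}},1)}\log^\beta L(U)}=\int_0^{|U|}\rho^{1/Q_{\mathbb{E}}}(1+|\log\rho|)^\beta F^{**}(\rho)\,\frac{d\rho}\rho,$$ and $F\in L^{(Q_{\mathbb{E}},1)}\log^\beta L(U)$ means that this is finite (equivalently, the same expression with $F^*$ in place of $F^{**}$ is finite). For $\beta=0$ this is the Lorentz space $L^{(Q_{\mathbb{E}},1)}$.
   Formalization: The weight log^β(1/r_j) is read as |log(1/r_j)|^β, which is the same when β=0 or r≤1; for β=1 and r>1 the signed weight is negative and the first inequality fails, e.g. for rapidly oscillating g supported in B_r minus B_{τr}. *)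

theory Defs
  imports "HOL-Analysis.Analysis"
begin

text \<open>
  The data in which Euclidean space and the Heisenberg group differ: the metric, the
  homogeneous dimension \<open>Q\<close> and the horizontal frame, where \<open>frame E i x\<close> is the direction of
  the \<open>i\<close>-th vector field at \<open>x\<close>.  The horizontal dimension \<open>m\<close> is \<open>CARD('m)\<close>.  Underlying
  set, topology, boundedness and Lebesgue measure are those of the Euclidean space \<open>'a\<close> (the
  Koranyi metric has the same open sets and the same bounded sets as the Euclidean one).
\<close>

record ('a, 'm) ambient =
  gdist :: "'a \<Rightarrow> 'a \<Rightarrow> real"
  hdim :: real
  frame :: "'m \<Rightarrow> 'a \<Rightarrow> 'a"

definition euclid :: "(real^'n, 'n::finite) ambient" where
  "euclid = \<lparr>gdist = dist, hdim = real CARD('n), frame = (\<lambda>i x. axis i 1)\<rparr>"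

text \<open>
  A point of the \<open>n\<close>-th Heisenberg group is \<open>(a, b, t)\<close> with \<open>a = (x_1, ..., x_n)\<close>,
  \<open>b = (x_{n+1}, ..., x_{2n})\<close> and \<open>n = CARD('n)\<close>.
\<close>

type_synonym 'n heis = "(real^'n) \<times> (real^'n) \<times> real"

fun heis_mult :: "'n::finite heis \<Rightarrow> 'n heis \<Rightarrow> 'n heis" where
  "heis_mult (a, b, t) (a', b', s) =
     (a + a', b + b', t + s + (\<Sum>i\<in>UNIV. a $ i * b' $ i - b $ i * a' $ i) / 2)"

text \<open>The group inverse of \<open>y\<close> is \<open>- y\<close>.\<close>

lemma heis_mult_uminus: "heis_mult (- y) y = 0" "heis_mult y (- y) = 0"
  by (cases y; simp add: zero_prod_def algebra_simps)+

fun koranyi_norm :: "'n::finite heis \<Rightarrow> real" where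
  "koranyi_norm (a, b, t) = root 4 (norm (a, b) ^ 4 + t\<^sup>2)"

definition koranyi_dist :: "'n::finite heis \<Rightarrow> 'n heis \<Rightarrow> real" where
  "koranyi_dist x y = koranyi_norm (heis_mult (- y) x)"

text \<open>\<open>Inl i\<close> stands for the index \<open>i\<close> and \<open>Inr i\<close> for the index \<open>n + i\<close>.\<close>

fun heis_frame :: "'n + 'n \<Rightarrow> 'n::finite heis \<Rightarrow> 'n heis" where
  "heis_frame (Inl i) (a, b, t) = (axis i 1, 0, - (b $ i) / 2)"
| "heis_frame (Inr i) (a, b, t) = (0, axis i 1, a $ i / 2)"

definition heisenberg :: "('n::finite heis, 'n + 'n) ambient" where
  "heisenberg =
     \<lparr>gdist = koranyi_dist, hdim = 2 * real CARD('n) + 2, frame = heis_frame\<rparr>"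

definition gball :: "('a, 'm) ambient \<Rightarrow> 'a \<Rightarrow> real \<Rightarrow> 'a set" where
  "gball E x r = {y. gdist E x y < r}"

primrec C_diff :: "nat \<Rightarrow> ('a::euclidean_space \<Rightarrow> real) \<Rightarrow> bool" where
  "C_diff 0 f = continuous_on UNIV f"
| "C_diff (Suc k) f =
     ((\<forall>x. f differentiable (at x)) \<and>
      (\<forall>b\<in>Basis. C_diff k (\<lambda>x. frechet_derivative f (at x) b)))"

definition test_function :: "'a::euclidean_space set \<Rightarrow> ('a \<Rightarrow> real) \<Rightarrow> bool" where
  "test_function \<Omega> \<phi> \<longleftrightarrow>
     (\<forall>k. C_diff k \<phi>) \<and> (\<exists>K. compact K \<and> K \<subseteq> \<Omega> \<and> (\<forall>x. x \<notin> K \<longrightarrow> \<phi> x = 0))"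

text \<open>
  The frame fields of both spaces are divergence free, so the formal adjoint of such a field
  \<open>X\<close> is \<open>- X\<close>.
\<close>

definition weak_gradient ::
  "('a::euclidean_space, 'm::finite) ambient \<Rightarrow> 'a set \<Rightarrow> ('a \<Rightarrow> real) \<Rightarrow> ('a \<Rightarrow> real^'m) \<Rightarrow> bool"
where
  "weak_gradient E \<Omega> g G \<longleftrightarrow>
     (\<forall>K. compact K \<and> K \<subseteq> \<Omega> \<longrightarrow> set_integrable lebesgue K g \<and> set_integrable lebesgue K G) \<and>
     (\<forall>i \<phi>. test_function \<Omega> \<phi> \<longrightarrow>
        (LINT x:\<Omega>|lebesgue. g x * frechet_derivative \<phi> (at x) (frame E i x)) =
        - (LINT x:\<Omega>|lebesgue. G x $ i * \<phi> x))"

definition rearrangement ::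
  "'a::euclidean_space set \<Rightarrow> ('a \<Rightarrow> 'b::real_normed_vector) \<Rightarrow> real \<Rightarrow> ennreal"
where
  "rearrangement U F s =
     (INF l\<in>{l. 0 \<le> l \<and> emeasure lebesgue {x\<in>U. l < norm (F x)} \<le> ennreal s}. ennreal l)"

definition max_rearrangement ::
  "'a::euclidean_space set \<Rightarrow> ('a \<Rightarrow> 'b::real_normed_vector) \<Rightarrow> real \<Rightarrow> ennreal"
where
  "max_rearrangement U F \<rho> =
     (\<integral>\<^sup>+s\<in>{0<..<\<rho>}. rearrangement U F s \<partial>lborel) / ennreal \<rho>"

definition lz_norm ::
  "real \<Rightarrow> nat \<Rightarrow> 'a::euclidean_space set \<Rightarrow> ('a \<Rightarrow> 'b::real_normed_vector) \<Rightarrow> ennreal"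
where
  "lz_norm Q \<beta> U F =
     (\<integral>\<^sup>+\<rho>\<in>{\<rho>. 0 < \<rho> \<and> ennreal \<rho> < emeasure lebesgue U}.
        ennreal (\<rho> powr (1 / Q) * (1 + \<bar>ln \<rho>\<bar>) ^ \<beta> / \<rho>) * max_rearrangement U F \<rho> \<partial>lborel)"

definition lz_space ::
  "real \<Rightarrow> nat \<Rightarrow> 'a::euclidean_space set \<Rightarrow> ('a \<Rightarrow> 'b::real_normed_vector) set"
where
  "lz_space Q \<beta> U = {F. set_borel_measurable lebesgue U F \<and> lz_norm Q \<beta> U F < \<infinity>}"

definition sobolev_exp :: "real \<Rightarrow> real \<Rightarrow> real" where
  "sobolev_exp Q \<theta> = Q * \<theta> / (Q - \<theta>)"

definition mean_on :: "('a::euclidean_space \<Rightarrow> real) \<Rightarrow> 'a set \<Rightarrow> real" where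
  "mean_on h B = (LINT x:B|lebesgue. h x) / measure lebesgue B"

text \<open>Only used with positive exponents \<open>p\<close>.\<close>

definition ennreal_powr :: "ennreal \<Rightarrow> real \<Rightarrow> ennreal" where
  "ennreal_powr x p = (if x = \<infinity> then \<infinity> else ennreal (enn2real x powr p))"

definition Lp_mean ::
  "real \<Rightarrow> ('a::euclidean_space \<Rightarrow> 'b::real_normed_vector) \<Rightarrow> 'a set \<Rightarrow> ennreal"
where
  "Lp_mean p F B =
     ennreal_powr ((\<integral>\<^sup>+x\<in>B. ennreal (norm (F x) powr p) \<partial>lebesgue) / emeasure lebesgue B) (1 / p)"

text \<open>
  The absolute value leaves the weight \<open>ln (1 / \<rho>) ^ \<beta>\<close> unchanged if \<open>\<rho> \<le> 1\<close> or \<open>\<beta> = 0\<close>.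
  For radii above \<open>1\<close> and \<open>\<beta> = 1\<close> the signed weight is negative; it would reverse the
  comparison between corresponding terms of the two sums below.
\<close>

definition log_weight :: "nat \<Rightarrow> real \<Rightarrow> real" where
  "log_weight \<beta> \<rho> = \<bar>ln (1 / \<rho>)\<bar> ^ \<beta>"

definition potential_sum ::
  "('a::euclidean_space, 'm) ambient \<Rightarrow> ('a \<Rightarrow> 'b::real_normed_vector) \<Rightarrow>
   real \<Rightarrow> real \<Rightarrow> nat \<Rightarrow> 'a \<Rightarrow> real \<Rightarrow> ennreal"
where
  "potential_sum E G \<theta> \<tau> \<beta> x0 r =
     (\<Sum>j. ennreal (\<tau> ^ j * r * log_weight \<beta> (\<tau> ^ j * r)) * Lp_mean \<theta> G (gball E x0 (\<tau> ^ j * r)))"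

definition oscillation_sum ::
  "('a::euclidean_space, 'm) ambient \<Rightarrow> ('a \<Rightarrow> real) \<Rightarrow>
   real \<Rightarrow> real \<Rightarrow> nat \<Rightarrow> 'a \<Rightarrow> real \<Rightarrow> ennreal"
where
  "oscillation_sum E h q \<tau> \<beta> x0 r =
     (\<Sum>j. ennreal (log_weight \<beta> (\<tau> ^ j * r)) *
           Lp_mean q (\<lambda>x. h x - mean_on h (gball E x0 (\<tau> ^ j * r))) (gball E x0 (\<tau> ^ j * r)))"

definition admissible ::
  "('a::euclidean_space, 'm::finite) ambient \<Rightarrow> 'a set \<Rightarrow> nat \<Rightarrow>
   ('a \<Rightarrow> real) \<Rightarrow> ('a \<Rightarrow> real^'m) \<Rightarrow> bool"
where
  "admissible E \<Omega> \<beta> g G \<longleftrightarrow>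
     open \<Omega> \<and> bounded \<Omega> \<and> \<beta> \<in> {0, 1} \<and> set_integrable lebesgue \<Omega> g \<and>
     weak_gradient E \<Omega> g G \<and> G \<in> lz_space (hdim E) \<beta> \<Omega>"

end

theory Submission imports Defs begin

text \<open>
  Euclidean space and the Heisenberg group are treated at once as groups of step at most two.
  The derivative of a bump function along group translations and dilations is a horizontal
  divergence, because the vertical direction is a commutator of horizontal ones. Testing the weak
  gradient against it along a chain of bumps that stay inside the ball and shrink to a point
  bounds \<open>\<bar>g x - a\<bar>\<close>, with \<open>a\<close> independent of \<open>x\<close>, by a dyadic sum of averages of \<open>\<bar>G\<bar>\<close>. Hedberg's
  trick and the strong type bound for the maximal function turn this into the Sobolev--Poincare
  inequality on each ball, without enlarging it, and the first inequality is its sum over the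
  radii \<open>\<tau> ^ j * r\<close>. For the second one, each ball is cut into the layers between the values
  of the rearrangement at the volumes of the smaller balls; as \<open>\<theta> < Q\<close>, summing over the balls
  first gives geometric series and leaves a discretisation of the Lorentz--Zygmund integral.
  The oscillation sums vanish because the
  Lorentz--Zygmund norm is absolutely continuous.
\<close>

section \<open>Smooth functions and bump functions\<close>

text \<open>The weak gradient may be paired only with smooth functions supported inside \<Omega>, so
  the derivative falls on the bump and not on g. The obstacle is to have the ball itself on both
  sides of the inequality: all bumps must stay inside it, also near its boundary. Hence each point x
  of the ball needs a direction in which a cone of small balls, twisted by the group law, opens into
  the ball. For the Koranyi ball the horizontal gradient that provides this direction degenerates at
  the poles, where a second-order vertical term has to take over. The exponents come from two bounds
  on the term of scale s in the chain: s times the maximal function M, and s^(1 - Q/\<theta>) times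
  the L^\<theta> norm of G. Balancing them leaves M^(1 - \<theta>/Q), and the power that turns this
  into M^\<theta> is the Sobolev conjugate of \<theta>. In the Lorentz bound the logarithmic weight
  has to be moved from one radius to another that is i steps smaller. This costs a factor linear in
  i, which the geometric decay absorbs.\<close>

definition flat_exp :: "nat \<Rightarrow> real \<Rightarrow> real" where
  "flat_exp n t = (if 0 < t then (1 / t) ^ n * exp (- (1 / t)) else 0)"

lemma flat_exp_tendsto_0: "(flat_exp n \<longlongrightarrow> 0) (at_right 0)"
proof -
  have "((\<lambda>u. u ^ n / exp u) \<longlongrightarrow> 0) (at_top :: real filter)"
    by (rule tendsto_power_div_exp_0)
  then have "((\<lambda>t::real. (inverse t) ^ n / exp (inverse t)) \<longlongrightarrow> 0) (at_right 0)"
    by (rule filterlim_compose[OF _ filterlim_inverse_at_top_right])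
  moreover have "\<forall>\<^sub>F t in at_right 0. inverse t ^ n / exp (inverse t) = flat_exp n t"
    by (auto simp: eventually_at_right_field flat_exp_def exp_minus field_simps intro: exI[of _ 1])
  ultimately show ?thesis by (rule Lim_transform_eventually)
qed

text \<open>The power of \<open>1 / t\<close> is carried along because differentiation then stays
  inside the family, so one clause of \<open>smooth_fn\<close> covers all derivatives of the
  exponential. At 0 the difference quotient from the right is \<open>flat_exp (Suc n)\<close>
  itself.\<close>

lemma flat_exp_has_derivative:
  "(flat_exp n has_real_derivative flat_exp (n + 2) t - real n * flat_exp (n + 1) t) (at t)"
proof -
  consider "t < 0" | "t = 0" | "0 < t" by linarith
  then show ?thesis
  proof cases
    case 1
    have "((\<lambda>_. 0::real) has_real_derivative 0) (at t)" by simp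
    then have "(flat_exp n has_real_derivative 0) (at t)"
      by (rule DERIV_cong_ev[THEN iffD1, rotated 3, OF _ refl _ refl])
        (use 1 in \<open>auto simp: flat_exp_def eventually_at_topological eventually_nhds intro!: exI[of _ "{..<0}"]\<close>)
    with 1 show ?thesis by (simp add: flat_exp_def)
  next
    case 2
    have "((\<lambda>h. flat_exp n h / h) \<longlongrightarrow> 0) (at_left 0)"
      by (rule Lim_transform_eventually[OF tendsto_const])
        (auto simp: flat_exp_def eventually_at_left_field intro: exI[of _ "-1"])
    moreover have "((\<lambda>h. flat_exp n h / h) \<longlongrightarrow> 0) (at_right 0)"
      by (rule Lim_transform_eventually[OF flat_exp_tendsto_0[of "Suc n"]])
        (auto simp: flat_exp_def eventually_at_right_field field_simps intro: exI[of _ 1])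
    ultimately have "((\<lambda>h. flat_exp n h / h) \<longlongrightarrow> 0) (at 0)"
      by (simp add: filterlim_split_at)
    then show ?thesis using 2 by (simp add: DERIV_def flat_exp_def)
  next
    case 3
    have u: "((\<lambda>t. 1 / t) has_real_derivative - ((1 / t) * (1 / t))) (at t)"
      using 3 by (auto intro!: derivative_eq_intros simp: power2_eq_square)
    have "((\<lambda>t. (1 / t) ^ n * exp (- (1 / t))) has_real_derivative
        (real n * ((1 / t) ^ (n - Suc 0) * - ((1 / t) * (1 / t)))) * exp (- (1 / t))
          + (exp (- (1 / t)) * - (- ((1 / t) * (1 / t)))) * (1 / t) ^ n) (at t)"
      using DERIV_mult[OF DERIV_power[OF u, of n] DERIV_fun_exp[OF DERIV_minus[OF u]]]
      by (simp only: mult_ac)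
    moreover have "real n * ((1 / t) ^ (n - Suc 0) * - (u * u)) * e + (e * - (- (u * u))) * u ^ n =
        u ^ (n + 2) * e - real n * (u ^ (n + 1) * e)" if "u = 1 / t" for u e
      unfolding that[symmetric] by (cases n) (simp_all add: algebra_simps)
    ultimately have "((\<lambda>t. (1 / t) ^ n * exp (- (1 / t))) has_real_derivative
        (1 / t) ^ (n + 2) * exp (- (1 / t)) - real n * ((1 / t) ^ (n + 1) * exp (- (1 / t)))) (at t)"
      by simp
    then have "(flat_exp n has_real_derivative
        (1 / t) ^ (n + 2) * exp (- (1 / t)) - real n * ((1 / t) ^ (n + 1) * exp (- (1 / t)))) (at t)"
      by (rule DERIV_cong_ev[THEN iffD1, rotated 3, OF _ refl _ refl])
        (use 3 in \<open>auto simp: flat_exp_def eventually_nhds intro!: exI[of _ "{0<..}"]\<close>)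
    with 3 show ?thesis by (simp add: flat_exp_def)
  qed
qed

text \<open>
  An algebra of smooth functions that is closed under differentiation and under substitution and
  contains bump functions; a syntactic class suffices, and avoids a theory of smooth maps.
\<close>

inductive smooth_fn :: "('a::euclidean_space \<Rightarrow> real) \<Rightarrow> bool" where
  const: "smooth_fn (\<lambda>_. c)"
| inner: "smooth_fn (\<lambda>x. x \<bullet> a)"
| add: "smooth_fn f \<Longrightarrow> smooth_fn g \<Longrightarrow> smooth_fn (\<lambda>x. f x + g x)"
| mult: "smooth_fn f \<Longrightarrow> smooth_fn g \<Longrightarrow> smooth_fn (\<lambda>x. f x * g x)"
| flat: "smooth_fn f \<Longrightarrow> smooth_fn (\<lambda>x. flat_exp n (f x))"

section \<open>Directional derivatives of smooth functions\<close>

definition pd :: "'a \<Rightarrow> ('a::euclidean_space \<Rightarrow> real) \<Rightarrow> 'a \<Rightarrow> real" where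
  "pd v f x = frechet_derivative f (at x) v"

lemma smooth_fn_cmult: "smooth_fn f \<Longrightarrow> smooth_fn (\<lambda>x. c * f x)"
  by (intro smooth_fn.mult smooth_fn.const)

lemma smooth_fn_minus: "smooth_fn f \<Longrightarrow> smooth_fn (\<lambda>x. - f x)"
  using smooth_fn_cmult[of f "-1"] by simp

lemma smooth_fn_diff: "smooth_fn f \<Longrightarrow> smooth_fn g \<Longrightarrow> smooth_fn (\<lambda>x. f x - g x)"
  using smooth_fn.add[OF _ smooth_fn_minus, of f g] by simp

lemma smooth_fn_divide: "smooth_fn f \<Longrightarrow> smooth_fn (\<lambda>x. f x / c)"
  using smooth_fn_cmult[of f "1 / c"] by simp

lemma smooth_fn_sum: "(\<And>i. i \<in> I \<Longrightarrow> smooth_fn (f i)) \<Longrightarrow> smooth_fn (\<lambda>x. \<Sum>i\<in>I. f i x)"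
  by (induction I rule: infinite_finite_induct) (auto intro: smooth_fn.intros)

lemma smooth_fn_linear: "linear f \<Longrightarrow> smooth_fn f"
proof -
  assume "linear f"
  then have "f (\<Sum>b\<in>Basis. (x \<bullet> b) *\<^sub>R b) = (\<Sum>b\<in>Basis. (x \<bullet> b) * f b)" for x
    by (simp only: linear_sum linear_scale real_scaleR_def)
  then have "f = (\<lambda>x. \<Sum>b\<in>Basis. (x \<bullet> b) * f b)"
    unfolding euclidean_representation by (rule ext)
  moreover have "smooth_fn (\<lambda>x. \<Sum>b\<in>Basis. (x \<bullet> b) * f b)"
    by (intro smooth_fn_sum smooth_fn.intros)
  ultimately show ?thesis by simp
qed

lemma smooth_fn_compose:
  assumes "smooth_fn f" and "\<And>b. b \<in> Basis \<Longrightarrow> smooth_fn (\<lambda>x. T x \<bullet> b)"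
  shows "smooth_fn (\<lambda>x. f (T x))"
  using assms(1)
proof induction
  case (inner a)
  have "(\<lambda>x. T x \<bullet> a) = (\<lambda>x. \<Sum>b\<in>Basis. (T x \<bullet> b) * (a \<bullet> b))"
    by (intro ext euclidean_inner)
  moreover have "smooth_fn (\<lambda>x. \<Sum>b\<in>Basis. (T x \<bullet> b) * (a \<bullet> b))"
    by (intro smooth_fn_sum smooth_fn.mult smooth_fn.const assms(2))
  ultimately show ?case by simp
qed (auto intro: smooth_fn.intros)

text \<open>The derivative and the smoothness of its values are built in one induction, by an
  explicit formula for each constructor; uniqueness of derivatives identifies them with
  \<open>frechet_derivative\<close> afterwards.\<close>

lemma smooth_fn_has_derivative_ex:
  assumes "smooth_fn f"
  shows "\<exists>D. (\<forall>x. (f has_derivative D x) (at x)) \<and> (\<forall>v. smooth_fn (\<lambda>x. D x v))"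
  using assms
proof induction
  case (const c)
  show ?case by (rule exI[of _ "\<lambda>_ _. 0"]) (auto intro: smooth_fn.intros)
next
  case (inner a)
  show ?case
    by (rule exI[of _ "\<lambda>_ v. v \<bullet> a"]) (auto intro!: smooth_fn.intros derivative_eq_intros)
next
  case (add f g)
  then obtain D D' where "\<And>x. (f has_derivative D x) (at x)" "\<And>v. smooth_fn (\<lambda>x. D x v)"
    "\<And>x. (g has_derivative D' x) (at x)" "\<And>v. smooth_fn (\<lambda>x. D' x v)" by blast
  then show ?case
    by (intro exI[of _ "\<lambda>x v. D x v + D' x v"]) (auto intro!: smooth_fn.intros derivative_intros)
next
  case (mult f g)
  then obtain D D' where "\<And>x. (f has_derivative D x) (at x)" "\<And>v. smooth_fn (\<lambda>x. D x v)"
    "\<And>x. (g has_derivative D' x) (at x)" "\<And>v. smooth_fn (\<lambda>x. D' x v)" by blast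
  with mult show ?case
    by (intro exI[of _ "\<lambda>x v. f x * D' x v + D x v * g x"])
       (auto intro!: smooth_fn.intros derivative_intros)
next
  case (flat f n)
  then obtain D where D: "\<And>x. (f has_derivative D x) (at x)" "\<And>v. smooth_fn (\<lambda>x. D x v)" by blast
  let ?d = "\<lambda>t. flat_exp (n + 2) t - real n * flat_exp (n + 1) t"
  have "((\<lambda>x. flat_exp n (f x)) has_derivative (\<lambda>v. ?d (f x) * D x v)) (at x)" for x
    using has_derivative_compose[OF D(1) flat_exp_has_derivative[of n, unfolded has_field_derivative_def]]
    by (simp add: o_def)
  with D(2) flat.hyps show ?case
    by (intro exI[of _ "\<lambda>x v. ?d (f x) * D x v"])
      (auto intro!: smooth_fn.flat smooth_fn.mult smooth_fn_diff smooth_fn_cmult)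
qed

lemma smooth_fn_has_derivative:
  assumes "smooth_fn f"
  shows "(f has_derivative (\<lambda>v. pd v f x)) (at x)"
proof -
  obtain D where D: "(f has_derivative D) (at x)"
    using smooth_fn_has_derivative_ex[OF assms] by blast
  then show ?thesis
    using frechet_derivative_at[OF D] by (simp add: pd_def)
qed

lemma smooth_fn_pd: "smooth_fn f \<Longrightarrow> smooth_fn (pd v f)"
proof -
  assume f: "smooth_fn f"
  obtain D where D: "\<forall>x. (f has_derivative D x) (at x)" "smooth_fn (\<lambda>x. D x v)"
    using smooth_fn_has_derivative_ex[OF f] by blast
  have "pd v f = (\<lambda>x. D x v)"
    using frechet_derivative_at[OF D(1)[rule_format]] by (auto simp: pd_def fun_eq_iff)
  with D(2) show ?thesis by simp
qed

lemma pd_eqI: "(f has_derivative D) (at x) \<Longrightarrow> pd v f x = D v"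
  by (simp add: pd_def frechet_derivative_at[symmetric])

lemma smooth_fn_continuous_on: "smooth_fn f \<Longrightarrow> continuous_on S f"
  by (meson continuous_at_imp_continuous_on has_derivative_continuous smooth_fn_has_derivative)

lemma linear_pd: "smooth_fn f \<Longrightarrow> linear (\<lambda>v. pd v f x)"
  using smooth_fn_has_derivative has_derivative_linear by blast

lemma pd_add: "smooth_fn f \<Longrightarrow> smooth_fn g \<Longrightarrow> pd v (\<lambda>x. f x + g x) x = pd v f x + pd v g x"
  by (rule pd_eqI[where D = "\<lambda>v. pd v f x + pd v g x"])
     (intro derivative_intros smooth_fn_has_derivative)

lemma pd_mult:
  "smooth_fn f \<Longrightarrow> smooth_fn g \<Longrightarrow> pd v (\<lambda>x. f x * g x) x = pd v f x * g x + f x * pd v g x"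
  by (rule pd_eqI[where D = "\<lambda>v. pd v f x * g x + f x * pd v g x"])
     (auto intro!: derivative_eq_intros smooth_fn_has_derivative)

lemma pd_const: "pd v (\<lambda>_. c) x = 0"
  by (rule pd_eqI[where D = "\<lambda>_. 0"]) simp

lemma pd_linear: "linear f \<Longrightarrow> pd v f x = f v"
  by (rule pd_eqI) (simp add: linear_imp_has_derivative)

lemma pd_minus: "smooth_fn f \<Longrightarrow> pd v (\<lambda>x. - f x) x = - pd v f x"
  by (rule pd_eqI[where D = "\<lambda>v. - pd v f x"]) (intro derivative_intros smooth_fn_has_derivative)

lemma pd_diff: "smooth_fn f \<Longrightarrow> smooth_fn g \<Longrightarrow> pd v (\<lambda>x. f x - g x) x = pd v f x - pd v g x"
  by (rule pd_eqI[where D = "\<lambda>v. pd v f x - pd v g x"])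
     (intro derivative_intros smooth_fn_has_derivative)

lemma pd_cmult: "smooth_fn f \<Longrightarrow> pd v (\<lambda>x. c * f x) x = c * pd v f x"
  by (rule pd_eqI[where D = "\<lambda>v. c * pd v f x"])
     (auto intro!: derivative_eq_intros smooth_fn_has_derivative)

lemma pd_sum:
  "(\<And>i. i \<in> I \<Longrightarrow> smooth_fn (f i)) \<Longrightarrow> pd v (\<lambda>x. \<Sum>i\<in>I. f i x) x = (\<Sum>i\<in>I. pd v (f i) x)"
  by (rule pd_eqI[where D = "\<lambda>v. \<Sum>i\<in>I. pd v (f i) x"])
     (intro has_derivative_sum smooth_fn_has_derivative)

lemma pd_flat:
  "smooth_fn f \<Longrightarrow> pd v (\<lambda>x. flat_exp n (f x)) x =
     (flat_exp (n + 2) (f x) - real n * flat_exp (n + 1) (f x)) * pd v f x"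
  by (rule pd_eqI)
     (rule has_derivative_compose[OF smooth_fn_has_derivative
        flat_exp_has_derivative[of n, unfolded has_field_derivative_def]])

text \<open>Structural induction takes the place of an analytic argument: products and compositions
  inherit the symmetry from the Leibniz and chain rules, and linear functions have second derivative
  0.\<close>

lemma pd_commute:
  assumes "smooth_fn f"
  shows "pd a (pd b f) x = pd b (pd a f) x"
  using assms
proof (induction arbitrary: x)
  case (const c)
  then show ?case by (simp add: pd_const[abs_def])
next
  case (inner d)
  have "pd b (\<lambda>x. x \<bullet> d) = (\<lambda>_. b \<bullet> d)" for b
    by (intro ext pd_linear bounded_linear.linear bounded_linear_inner_left)
  then show ?case by (simp add: pd_const)
next
  case (add f g)
  have "pd b (\<lambda>x. f x + g x) = (\<lambda>x. pd b f x + pd b g x)" for b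
    using add by (intro ext pd_add)
  with add show ?case by (simp add: pd_add smooth_fn_pd)
next
  case (mult f g)
  have "pd b (\<lambda>x. f x * g x) = (\<lambda>x. pd b f x * g x + f x * pd b g x)" for b
    using mult by (intro ext pd_mult)
  with mult show ?case by (simp add: pd_add pd_mult smooth_fn_pd smooth_fn.intros)
next
  case (flat f n)
  have "pd b (\<lambda>x. flat_exp n (f x)) =
     (\<lambda>x. (flat_exp (n + 2) (f x) - real n * flat_exp (n + 1) (f x)) * pd b f x)" for b
    using flat by (intro ext pd_flat)
  with flat show ?case
    apply (simp add: pd_diff pd_cmult pd_flat pd_mult smooth_fn_pd smooth_fn.intros smooth_fn_diff
        smooth_fn_cmult)
    apply (simp add: algebra_simps)
    done
qed

lemma C_diff_smooth_fn: "smooth_fn f \<Longrightarrow> C_diff k f"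
proof (induction k arbitrary: f)
  case 0
  then show ?case by (simp add: smooth_fn_continuous_on)
next
  case (Suc k)
  have "(\<lambda>x. frechet_derivative f (at x) b) = pd b f" for b
    by (simp add: pd_def fun_eq_iff)
  with Suc show ?case
    by (auto intro: smooth_fn_pd differentiableI smooth_fn_has_derivative)
qed

lemma smooth_fn_eq_0_outside_pd:
  assumes "smooth_fn f" "closed K" "\<And>x. x \<notin> K \<Longrightarrow> f x = 0" "x \<notin> K"
  shows "pd v f x = 0"
proof -
  have "((\<lambda>_. 0) has_derivative (\<lambda>_. 0)) (at x)" by simp
  then have "(f has_derivative (\<lambda>_. 0)) (at x)"
    by (rule has_derivative_transform_within_open[where s = "- K"]) (use assms in auto)
  then show ?thesis by (rule pd_eqI)
qed

lemma bump_exists: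
  assumes "0 < a"
  obtains \<phi> :: "'a::euclidean_space \<Rightarrow> real" where "smooth_fn \<phi>" "\<And>x. 0 \<le> \<phi> x"
    "\<And>x. x \<notin> cball 0 a \<Longrightarrow> \<phi> x = 0" "\<And>x. norm x < a \<Longrightarrow> 0 < \<phi> x"
proof
  \<comment> \<open>The bump is exp (- 1 / (a^2 - |x|^2)), extended by 0; the squared norm is
    written in coordinates to fit the clauses of \<open>smooth_fn\<close>.\<close>
  let ?f = "\<lambda>x::'a. a\<^sup>2 - (\<Sum>b\<in>Basis. (x \<bullet> b) * (x \<bullet> b))"
  have f: "?f x = a\<^sup>2 - (norm x)\<^sup>2" for x
    by (simp add: power2_norm_eq_inner euclidean_inner[of x x])
  show "smooth_fn (\<lambda>x. flat_exp 0 (?f x))"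
    by (intro smooth_fn.flat smooth_fn_diff smooth_fn.const smooth_fn_sum smooth_fn.mult smooth_fn.inner)
  show "flat_exp 0 (?f x) \<ge> 0" for x by (simp add: flat_exp_def)
  show "flat_exp 0 (?f x) = 0" if "x \<notin> cball 0 a" for x
    using that assms by (auto simp: f flat_exp_def not_less not_le intro!: power_mono)
  show "flat_exp 0 (?f x) > 0" if "norm x < a" for x
    using that by (simp only: f) (simp add: flat_exp_def power_strict_mono)
qed

section \<open>The maximal function\<close>

lemma sigma_finite_lebesgue: "sigma_finite_measure (lebesgue :: 'a::euclidean_space measure)"
proof
  obtain A :: "'a set set" where "countable A" "A \<subseteq> sets lborel" "\<Union> A = UNIV"
    "\<forall>a\<in>A. emeasure lborel a \<noteq> \<infinity>"
    using lborel.sigma_finite_countable by auto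
  then show "\<exists>A. countable A \<and> A \<subseteq> sets (lebesgue :: 'a measure) \<and> \<Union> A = space lebesgue \<and>
      (\<forall>a\<in>A. emeasure lebesgue a \<noteq> \<infinity>)"
    by (intro exI[of _ A]) (auto simp: subset_iff)
qed

lemma ennreal_divide_mult: "b \<noteq> 0 \<Longrightarrow> b \<noteq> \<infinity> \<Longrightarrow> a / b * b = (a :: ennreal)"
  by (simp add: ennreal_divide_times less_top)

lemma borel_measurable_lebesgue_continuous:
  fixes c :: "'a::euclidean_space \<Rightarrow> 'b::topological_space"
  assumes "continuous_on UNIV c"
  shows "c \<in> borel_measurable lebesgue"
proof -
  have "c \<in> borel_measurable lborel" using borel_measurable_continuous_onI[OF assms] by simp
  then show ?thesis by (rule measurable_completion)
qed

text \<open>Truncation in height and in space leaves a bounded function of bounded support; this is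
  an almost everywhere limit of continuous functions, and clipping them keeps them dominated. Each
  of the two dominated convergences contributes an error below e / 2.\<close>

lemma integrable_approx_continuous:
  fixes g :: "'a::euclidean_space \<Rightarrow> real"
  assumes g: "integrable lebesgue g" and "0 < e"
  obtains c where "continuous_on UNIV c" "(\<integral>\<^sup>+x. ennreal \<bar>g x - c x\<bar> \<partial>lebesgue) < ennreal e"
proof -
  have [measurable]: "g \<in> borel_measurable lebesgue" using g by simp
  define t where "t N x = indicator (cball 0 (real N)) x * max (- real N) (min (real N) (g x))" for N x
  have t_abs: "\<bar>t N x\<bar> \<le> \<bar>g x\<bar>" for N x
    by (auto simp: t_def indicator_def)
  have "(\<lambda>x. max (- real N) (min (real N) (g x))) \<in> borel_measurable lebesgue" for N
    by (intro borel_measurable_max borel_measurable_min borel_measurable_const) measurable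
  then have [measurable]: "t N \<in> borel_measurable lebesgue" for N
    unfolding t_def by (intro borel_measurable_times borel_measurable_indicator) auto
  have "(\<lambda>N. \<integral>x. \<bar>g x - t N x\<bar> \<partial>lebesgue) \<longlonglongrightarrow> (\<integral>x. (0::real) \<partial>(lebesgue :: 'a measure))"
  proof (rule integral_dominated_convergence[where w = "\<lambda>x. 2 * \<bar>g x\<bar>"])
    show "AE x in lebesgue. (\<lambda>N. \<bar>g x - t N x\<bar>) \<longlonglongrightarrow> 0"
    proof (rule AE_I2)
      fix x
      obtain N0 :: nat where N0: "max (norm x) \<bar>g x\<bar> \<le> real N0" using real_arch_simple by blast
      have "t N x = g x" if "N0 \<le> N" for N
      proof -
        have "max (norm x) \<bar>g x\<bar> \<le> real N" using N0 that by linarith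
        then show ?thesis by (auto simp: t_def)
      qed
      then have "\<forall>\<^sub>F N in sequentially. 0 = \<bar>g x - t N x\<bar>"
        unfolding eventually_sequentially by (intro exI[of _ N0]) simp
      then show "(\<lambda>N. \<bar>g x - t N x\<bar>) \<longlonglongrightarrow> 0"
        by (rule Lim_transform_eventually[OF tendsto_const])
    qed
    show "AE x in lebesgue. norm \<bar>g x - t N x\<bar> \<le> 2 * \<bar>g x\<bar>" for N
    proof (rule AE_I2)
      fix x show "norm \<bar>g x - t N x\<bar> \<le> 2 * \<bar>g x\<bar>" using t_abs[of N x] by simp
    qed
  qed (use g in auto)
  then have "\<forall>\<^sub>F N in sequentially. (\<integral>x. \<bar>g x - t N x\<bar> \<partial>lebesgue) < e / 2"
    using \<open>0 < e\<close> by (intro order_tendstoD(2)[where y = 0]) auto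
  then obtain N where N: "(\<integral>x. \<bar>g x - t N x\<bar> \<partial>lebesgue) < e / 2"
    by (auto simp: eventually_sequentially)
  have t_int: "integrable lebesgue (t N)"
    by (rule Bochner_Integration.integrable_bound[OF g]) (use t_abs in auto)
  have "t N measurable_on UNIV"
    by (rule lebesgue_measurable_imp_measurable_on) auto
  then obtain Z h where Z: "negligible Z" and h: "\<And>n. continuous_on UNIV (h n)"
    and lim: "\<And>x. x \<notin> Z \<Longrightarrow> (\<lambda>n. h n x) \<longlonglongrightarrow> t N x"
    by (auto simp: measurable_on_def)
  \<comment> \<open>Clipping at height N and the cutoff, which equals 1 on the ball of radius N, do
    not change the limit \<open>t N x\<close>; together they provide an integrable majorant.\<close>
  define k where "k n x = max (- real N) (min (real N) (h n x)) * max 0 (min 1 (real N + 1 - norm x))" for n x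
  have k: "continuous_on UNIV (k n)" for n
    unfolding k_def by (intro continuous_intros h)
  have [measurable]: "k n \<in> borel_measurable lebesgue" for n
    by (rule borel_measurable_lebesgue_continuous[OF k])
    have kb: "\<bar>k n x\<bar> \<le> real N * indicator (cball 0 (real N + 1)) x" for n x
    proof -
      have "\<bar>max (- real N) (min (real N) (h n x))\<bar> \<le> real N" by auto
      moreover have "\<bar>max 0 (min 1 (real N + 1 - norm x))\<bar> \<le> indicator (cball 0 (real N + 1)) x"
        by (auto simp: indicator_def)
      ultimately show ?thesis unfolding k_def abs_mult by (intro mult_mono) auto
    qed
  have "(\<lambda>n. \<integral>x. \<bar>t N x - k n x\<bar> \<partial>lebesgue) \<longlonglongrightarrow> (\<integral>x. (0::real) \<partial>(lebesgue :: 'a measure))"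
  proof (rule integral_dominated_convergence[where w = "\<lambda>x. 2 * real N * indicator (cball 0 (real N + 1)) x"])
    have "AE x in lebesgue. x \<notin> Z"
      using Z by (intro AE_not_in) (simp add: negligible_iff_null_sets)
    then show "AE x in lebesgue. (\<lambda>n. \<bar>t N x - k n x\<bar>) \<longlonglongrightarrow> 0"
    proof eventually_elim
      case (elim x)
      have "(\<lambda>n. k n x) \<longlonglongrightarrow> max (- real N) (min (real N) (t N x)) * max 0 (min 1 (real N + 1 - norm x))"
        unfolding k_def by (intro tendsto_intros lim elim)
      also have "max (- real N) (min (real N) (t N x)) * max 0 (min 1 (real N + 1 - norm x)) = t N x"
        by (auto simp: t_def indicator_def)
      finally have "(\<lambda>n. \<bar>t N x - k n x\<bar>) \<longlonglongrightarrow> \<bar>t N x - t N x\<bar>" by (intro tendsto_intros)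
      then show ?case by simp
    qed
    have tb: "\<bar>t N x\<bar> \<le> real N * indicator (cball 0 (real N + 1)) x" for x
      by (auto simp: t_def indicator_def)
    show "AE x in lebesgue. norm \<bar>t N x - k n x\<bar> \<le> 2 * real N * indicator (cball 0 (real N + 1)) x" for n
    proof (rule AE_I2)
      fix x show "norm \<bar>t N x - k n x\<bar> \<le> 2 * real N * indicator (cball 0 (real N + 1)) x"
        using tb[of x] kb[of n x] by simp
    qed
    show "integrable lebesgue (\<lambda>x::'a. 2 * real N * indicator (cball 0 (real N + 1)) x :: real)"
      by (intro integrable_mult_right integrable_real_indicator)
         (use emeasure_bounded_finite[OF bounded_cball, of 0 "real N + 1"] in auto)
  qed auto
  then have "\<forall>\<^sub>F n in sequentially. (\<integral>x. \<bar>t N x - k n x\<bar> \<partial>lebesgue) < e / 2"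
    using \<open>0 < e\<close> by (intro order_tendstoD(2)[where y = 0]) auto
  then obtain n where n: "(\<integral>x. \<bar>t N x - k n x\<bar> \<partial>lebesgue) < e / 2"
    by (auto simp: eventually_sequentially)
  have k_int: "integrable lebesgue (k n)"
  proof (rule Bochner_Integration.integrable_bound)
    show "integrable lebesgue (\<lambda>x::'a. real N * indicator (cball 0 (real N + 1)) x :: real)"
      by (intro integrable_mult_right integrable_real_indicator)
         (use emeasure_bounded_finite[OF bounded_cball, of 0 "real N + 1"] in auto)
    show "AE x in lebesgue. norm (k n x) \<le> norm (real N * indicator (cball 0 (real N + 1)) x :: real)"
    proof (rule AE_I2)
      fix x show "norm (k n x) \<le> norm (real N * indicator (cball 0 (real N + 1)) x :: real)"
        using kb[of n x] by simp
    qed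
  qed auto
  have eq: "(\<integral>\<^sup>+x. ennreal \<bar>g x - k n x\<bar> \<partial>lebesgue) = ennreal (\<integral>x. \<bar>g x - k n x\<bar> \<partial>lebesgue)"
    using g k_int by (intro nn_integral_eq_integral) auto
  have "(\<integral>x. \<bar>g x - k n x\<bar> \<partial>lebesgue) \<le> (\<integral>x. \<bar>g x - t N x\<bar> + \<bar>t N x - k n x\<bar> \<partial>lebesgue)"
    using g k_int t_int by (intro integral_mono) auto
  also have "\<dots> = (\<integral>x. \<bar>g x - t N x\<bar> \<partial>lebesgue) + (\<integral>x. \<bar>t N x - k n x\<bar> \<partial>lebesgue)"
    using g k_int t_int by (intro Bochner_Integration.integral_add) auto
  also have "\<dots> < e" using N n by simp
  finally show thesis using \<open>0 < e\<close> by (intro that[OF k[of n]]) (simp add: eq ennreal_lessI)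
qed

lemma nn_integral_powr_below:
  assumes "0 < p" "0 \<le> (y::real)"
  shows "(\<integral>\<^sup>+l. ennreal (l powr (p - 1)) * indicator {0<..<y} l \<partial>lborel) = ennreal (y powr p / p)"
proof -
  have "((\<lambda>x. x powr (p - 1)) has_integral (y powr p / p)) {0..y}"
    using has_integral_powr_from_0[of "p - 1" y] assms by simp
  then have "(\<integral>\<^sup>+l. ennreal (l powr (p - 1)) * indicator {0..y} l \<partial>lborel) = ennreal (y powr p / p)"
    by (intro nn_integral_has_integral_lebesgue') auto
  moreover have "(\<integral>\<^sup>+l. ennreal (l powr (p - 1)) * indicator {0..y} l \<partial>lborel) =
     (\<integral>\<^sup>+l. ennreal (l powr (p - 1)) * indicator {0<..<y} l \<partial>lborel)"
  proof (rule nn_integral_cong_AE)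
    have "AE l in lborel. l \<noteq> 0 \<and> l \<noteq> y"
      using AE_lborel_singleton[of 0] AE_lborel_singleton[of y] by auto
    then show "AE l in lborel. ennreal (l powr (p - 1)) * indicator {0..y} l =
      ennreal (l powr (p - 1)) * indicator {0<..<y} l"
      by eventually_elim (auto simp: indicator_def)
  qed
  ultimately show ?thesis by simp
qed

text \<open>Stated for extended \<open>y\<close> because the maximal function may be infinite; at
  \<open>y = \<infinity>\<close> the integral dominates the layer cake of every finite
  height.\<close>

lemma nn_integral_layer_cake:
  assumes "0 < p"
  shows "(\<integral>\<^sup>+l. ennreal (p * l powr (p - 1)) * indicator {l. 0 < l \<and> ennreal l < y} l \<partial>lborel)
    = ennreal_powr y p"
proof (cases "y = \<infinity>")
  case False
  then obtain t where t: "y = ennreal t" "0 \<le> t" by (cases y) auto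
  have "(\<integral>\<^sup>+l. ennreal (p * l powr (p - 1)) * indicator {l. 0 < l \<and> ennreal l < y} l \<partial>lborel) =
     (\<integral>\<^sup>+l. ennreal p * (ennreal (l powr (p - 1)) * indicator {0<..<t} l) \<partial>lborel)"
    using assms t
    by (intro nn_integral_cong) (auto simp: indicator_def ennreal_mult ennreal_less_iff)
  also have "\<dots> = ennreal p * ennreal (t powr p / p)"
    using assms t by (subst nn_integral_cmult) (auto simp: nn_integral_powr_below)
  also have "\<dots> = ennreal_powr y p"
    using assms t by (simp add: ennreal_powr_def ennreal_mult[symmetric])
  finally show ?thesis .
next
  case True
  have ge: "of_nat n \<le>
    (\<integral>\<^sup>+l. ennreal (p * l powr (p - 1)) * indicator {l. 0 < l \<and> ennreal l < y} l \<partial>lborel)" for n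
  proof -
    define t where "t = real n powr (1 / p)"
    have "of_nat n = ennreal p * ennreal (t powr p / p)"
      using assms by (simp add: ennreal_mult[symmetric] t_def powr_powr ennreal_of_nat_eq_real_of_nat)
    also have "\<dots> = (\<integral>\<^sup>+l. ennreal p * (ennreal (l powr (p - 1)) * indicator {0<..<t} l) \<partial>lborel)"
      using assms by (subst nn_integral_cmult) (auto simp: nn_integral_powr_below t_def)
    also have "\<dots> \<le> (\<integral>\<^sup>+l. ennreal (p * l powr (p - 1)) * indicator {l. 0 < l \<and> ennreal l < y} l \<partial>lborel)"
      using assms True
      by (intro nn_integral_mono) (auto simp: indicator_def ennreal_mult)
    finally show ?thesis .
  qed
  have "(\<integral>\<^sup>+l. ennreal (p * l powr (p - 1)) * indicator {l. 0 < l \<and> ennreal l < y} l \<partial>lborel) = \<infinity>"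
  proof (rule ccontr)
    assume "(\<integral>\<^sup>+l. ennreal (p * l powr (p - 1)) * indicator {l. 0 < l \<and> ennreal l < y} l \<partial>lborel) \<noteq> \<infinity>"
    then obtain n where "(\<integral>\<^sup>+l. ennreal (p * l powr (p - 1)) * indicator {l. 0 < l \<and> ennreal l < y} l \<partial>lborel) < of_nat n"
      using ennreal_Ex_less_of_nat[of "(\<integral>\<^sup>+l. ennreal (p * l powr (p - 1)) * indicator {l. 0 < l \<and> ennreal l < y} l \<partial>lborel)"] by (auto simp: less_top)
    with ge[of n] show False by (simp add: not_le[symmetric])
  qed
  with True show ?thesis by (simp add: ennreal_powr_def)
qed

text \<open>What covering arguments and differentiation of integrals use of the metric: volumes
  proportional to r^Q with the same factor at every centre, and an engulfing constant A.\<close>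

locale homogeneous_balls =
  fixes Bl :: "'a::euclidean_space \<Rightarrow> real \<Rightarrow> 'a set" and Q \<omega> A :: real
  assumes open_ball: "open (Bl x r)"
    and centre: "0 < r \<Longrightarrow> x \<in> Bl x r"
    and emeasure_ball: "0 < r \<Longrightarrow> emeasure lebesgue (Bl x r) = ennreal (\<omega> * r powr Q)"
    and pos: "0 < \<omega>" "0 < Q" "1 \<le> A"
    and engulf: "0 < s \<Longrightarrow> s \<le> r \<Longrightarrow> Bl x r \<inter> Bl y s \<noteq> {} \<Longrightarrow> Bl y s \<subseteq> Bl x (A * r)"
    and shrink: "open U \<Longrightarrow> x \<in> U \<Longrightarrow> \<exists>r>0. Bl x r \<subseteq> U"
    and ball_mono: "r \<le> s \<Longrightarrow> Bl x r \<subseteq> Bl x s"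
begin

lemma ball_sets [measurable]: "Bl x r \<in> sets lebesgue" "Bl x r \<in> sets borel"
  using open_ball[of x r] by auto

text \<open>Greedy selection: take a ball of largest radius, discard the balls that meet it, which
  lie in its enlargement by A, and recurse on those disjoint from it.\<close>

lemma vitali_finite:
  assumes "finite P" "\<And>x r. (x, r) \<in> P \<Longrightarrow> 0 < r"
  shows "\<exists>P'\<subseteq>P. disjoint_family_on (\<lambda>(x, r). Bl x r) P' \<and>
    (\<forall>(y, s)\<in>P. \<exists>(x, r)\<in>P'. Bl y s \<subseteq> Bl x (A * r))"
  using assms
proof (induction P rule: finite_psubset_induct)
  case (psubset P)
  show ?case
  proof (cases "P = {}")
    case False
    obtain x r where xr: "(x, r) \<in> P" and r: "\<And>y s. (y, s) \<in> P \<Longrightarrow> s \<le> r"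
    proof -
      have "Max (snd ` P) \<in> snd ` P" using False psubset by (intro Max_in) auto
      then obtain q where "q \<in> P" "Max (snd ` P) = snd q" by auto
      moreover have "s \<le> Max (snd ` P)" if "(y, s) \<in> P" for y s
        using that psubset.hyps by (intro Max_ge) (auto intro: rev_image_eqI)
      ultimately show thesis by (intro that[of "fst q" "snd q"]) auto
    qed
    define P1 where "P1 = {p \<in> P. (case p of (y, s) \<Rightarrow> Bl x r \<inter> Bl y s = {})}"
    have P1: "P1 \<subset> P" using xr psubset.prems[OF xr] centre[of r x] by (auto simp: P1_def)
    then have "\<exists>P'\<subseteq>P1. disjoint_family_on (\<lambda>(x, r). Bl x r) P' \<and>
        (\<forall>(y, s)\<in>P1. \<exists>(x, r)\<in>P'. Bl y s \<subseteq> Bl x (A * r))"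
      by (intro psubset.IH) (use psubset.prems in auto)
    then obtain P' where P': "P' \<subseteq> P1" "disjoint_family_on (\<lambda>(x, r). Bl x r) P'"
      "\<forall>(y, s)\<in>P1. \<exists>(x, r)\<in>P'. Bl y s \<subseteq> Bl x (A * r)"
      by auto
    show ?thesis
    proof (intro exI[of _ "insert (x, r) P'"] conjI)
      show "insert (x, r) P' \<subseteq> P" using P'(1) xr by (auto simp: P1_def)
      show "disjoint_family_on (\<lambda>(x, r). Bl x r) (insert (x, r) P')"
        using P' by (fastforce simp: disjoint_family_on_def P1_def)
      show "\<forall>(y, s)\<in>P. \<exists>(x, r)\<in>insert (x, r) P'. Bl y s \<subseteq> Bl x (A * r)"
      proof clarify
        fix y s assume ys: "(y, s) \<in> P"
        show "\<exists>(x, r)\<in>insert (x, r) P'. Bl y s \<subseteq> Bl x (A * r)"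
        proof (cases "(y, s) \<in> P1")
          case True then show ?thesis using P'(3) by fastforce
        next
          case False
          then show ?thesis using engulf[of s r x y] ys r[OF ys] psubset.prems[OF ys] by (auto simp: P1_def)
        qed
      qed
    qed
  qed (auto simp: disjoint_family_on_def)
qed

text \<open>The uncentred maximal function: its superlevel sets are unions of open balls, which
  yields measurability and the covers for the weak type bound.\<close>

definition max_fn :: "('a \<Rightarrow> ennreal) \<Rightarrow> 'a \<Rightarrow> ennreal" where
  "max_fn f x = (SUP (y, r)\<in>{(y, r). 0 < r \<and> x \<in> Bl y r}.
     (\<integral>\<^sup>+z\<in>Bl y r. f z \<partial>lebesgue) / emeasure lebesgue (Bl y r))"

lemma max_fn_greater_eq:
  "{x. l < max_fn f x} = (\<Union>(y, r)\<in>{(y, r). 0 < r \<and>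
     l < (\<integral>\<^sup>+z\<in>Bl y r. f z \<partial>lebesgue) / emeasure lebesgue (Bl y r)}. Bl y r)"
  by (auto simp: max_fn_def less_SUP_iff)

lemma open_max_fn_greater: "open {x. l < max_fn f x}"
  unfolding max_fn_greater_eq using open_ball by (auto intro!: open_UN)

lemma max_fn_measurable [measurable]: "max_fn f \<in> borel_measurable lebesgue"
  by (rule borel_measurableI_greater) (use open_max_fn_greater in auto)

lemma emeasure_ball_pos:
  assumes "0 < r" shows "emeasure lebesgue (Bl x r) \<noteq> 0" "emeasure lebesgue (Bl x r) \<noteq> \<infinity>"
  using emeasure_ball[OF assms, of x] pos assms by (auto simp: zero_less_mult_iff)

lemma nn_integral_ball_le_max_fn:
  assumes "0 < r" "x \<in> Bl y r"
  shows "(\<integral>\<^sup>+z\<in>Bl y r. f z \<partial>lebesgue) \<le> max_fn f x * emeasure lebesgue (Bl y r)"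
proof -
  have "(\<integral>\<^sup>+z\<in>Bl y r. f z \<partial>lebesgue) / emeasure lebesgue (Bl y r) \<le> max_fn f x"
    unfolding max_fn_def using assms by (intro SUP_upper2[of "(y, r)"]) auto
  then show ?thesis
    using mult_right_mono[OF _ zero_le, of _ "max_fn f x" "emeasure lebesgue (Bl y r)"]
      ennreal_divide_mult[OF emeasure_ball_pos[OF assms(1)]] by metis
qed

text \<open>Finitely many balls with large average cover a compact set. The integral is collected on
  a disjoint selection of them, and their enlargements, larger in volume by the factor A^Q, still
  cover.\<close>

lemma weak_type_compact:
  assumes f[measurable]: "f \<in> borel_measurable lebesgue" and K: "compact K" "K \<subseteq> {x. l < max_fn f x}"
  shows "l * emeasure lebesgue K \<le> ennreal (A powr Q) * (\<integral>\<^sup>+x. f x \<partial>lebesgue)"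
proof -
  define C where "C = {(y, r). 0 < r \<and> l < (\<integral>\<^sup>+z\<in>Bl y r. f z \<partial>lebesgue) / emeasure lebesgue (Bl y r)}"
  have "K \<subseteq> (\<Union>p\<in>C. (case p of (y, r) \<Rightarrow> Bl y r))"
    using K(2) unfolding max_fn_greater_eq C_def .
  then obtain P where P: "P \<subseteq> C" "finite P" "K \<subseteq> (\<Union>p\<in>P. (case p of (y, r) \<Rightarrow> Bl y r))"
    by (rule compactE_image[OF K(1), of C "\<lambda>(y, r). Bl y r", rotated]) (auto intro: open_ball)
  obtain P' where P': "P' \<subseteq> P" "disjoint_family_on (\<lambda>(x, r). Bl x r) P'"
    "\<forall>(y, s)\<in>P. \<exists>(x, r)\<in>P'. Bl y s \<subseteq> Bl x (A * r)"
    using vitali_finite[OF P(2)] P(1) by (auto simp: C_def)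
  have fin: "finite P'" using P' P finite_subset by auto
  have K': "K \<subseteq> (\<Union>(x, r)\<in>P'. Bl x (A * r))" using P(3) P'(3) by fastforce
  have "l * emeasure lebesgue K \<le> l * (\<Sum>(x, r)\<in>P'. emeasure lebesgue (Bl x (A * r)))"
  proof (intro mult_left_mono)
    have "emeasure lebesgue K \<le> emeasure lebesgue (\<Union>p\<in>P'. (case p of (x, r) \<Rightarrow> Bl x (A * r)))"
      using K' fin by (intro emeasure_mono) auto
    also have "\<dots> \<le> (\<Sum>p\<in>P'. emeasure lebesgue (case p of (x, r) \<Rightarrow> Bl x (A * r)))"
      using fin by (intro emeasure_subadditive_finite) auto
    finally show "emeasure lebesgue K \<le> (\<Sum>(x, r)\<in>P'. emeasure lebesgue (Bl x (A * r)))"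
      by (simp add: case_prod_unfold)
  qed simp
  also have "\<dots> = (\<Sum>(x, r)\<in>P'. l * emeasure lebesgue (Bl x (A * r)))"
    by (simp add: sum_distrib_left case_prod_unfold)
  also have "\<dots> \<le> (\<Sum>(x, r)\<in>P'. ennreal (A powr Q) * (\<integral>\<^sup>+z\<in>Bl x r. f z \<partial>lebesgue))"
  proof (intro sum_mono, clarify)
    fix x r assume "(x, r) \<in> P'"
    then have r: "0 < r" and l: "l < (\<integral>\<^sup>+z\<in>Bl x r. f z \<partial>lebesgue) / emeasure lebesgue (Bl x r)"
      using P' P by (auto simp: C_def)
    have "l * emeasure lebesgue (Bl x r) \<le> (\<integral>\<^sup>+z\<in>Bl x r. f z \<partial>lebesgue)"
      using mult_right_mono[OF less_imp_le[OF l] zero_le, of "emeasure lebesgue (Bl x r)"]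
      by (simp only: ennreal_divide_mult[OF emeasure_ball_pos[OF r]])
    then have "ennreal (A powr Q) * (l * emeasure lebesgue (Bl x r)) \<le>
        ennreal (A powr Q) * (\<integral>\<^sup>+z\<in>Bl x r. f z \<partial>lebesgue)"
      by (intro mult_left_mono) auto
    moreover have "emeasure lebesgue (Bl x (A * r)) = ennreal (A powr Q) * emeasure lebesgue (Bl x r)"
    proof -
      have "0 < A * r" using r pos by simp
      then show ?thesis using r pos
        by (simp only: emeasure_ball) (simp add: powr_mult ennreal_mult[symmetric] mult_ac)
    qed
    ultimately show "l * emeasure lebesgue (Bl x (A * r)) \<le> ennreal (A powr Q) * (\<integral>\<^sup>+z\<in>Bl x r. f z \<partial>lebesgue)"
      by (simp add: mult_ac)
  qed
  also have "\<dots> = ennreal (A powr Q) * (\<Sum>p\<in>P'. (\<integral>\<^sup>+z\<in>(case p of (x, r) \<Rightarrow> Bl x r). f z \<partial>lebesgue))"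
    by (simp add: sum_distrib_left case_prod_unfold)
  also have "(\<Sum>p\<in>P'. (\<integral>\<^sup>+z\<in>(case p of (x, r) \<Rightarrow> Bl x r). f z \<partial>lebesgue)) =
      (\<integral>\<^sup>+z. (\<Sum>p\<in>P'. f z * indicator (case p of (x, r) \<Rightarrow> Bl x r) z) \<partial>lebesgue)"
    by (subst nn_integral_sum) (auto split: prod.splits)
  also have "\<dots> \<le> (\<integral>\<^sup>+z. f z \<partial>lebesgue)"
  proof (intro nn_integral_mono)
    fix z
    have "(\<Sum>p\<in>P'. f z * indicator (case p of (x, r) \<Rightarrow> Bl x r) z) =
        f z * indicator (\<Union>p\<in>P'. (case p of (x, r) \<Rightarrow> Bl x r)) z"
      using P'(2) fin by (subst indicator_UN_disjoint) (auto simp: sum_distrib_left)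
    then show "(\<Sum>p\<in>P'. f z * indicator (case p of (x, r) \<Rightarrow> Bl x r) z) \<le> f z"
      by (auto simp: indicator_def)
  qed
  finally show ?thesis by (simp add: mult_left_mono)
qed

text \<open>The open superlevel set is exhausted by compact sets, and the bound passes to the
  supremum.\<close>

lemma weak_type:
  assumes f[measurable]: "f \<in> borel_measurable lebesgue"
  shows "l * emeasure lebesgue {x. l < max_fn f x} \<le> ennreal (A powr Q) * (\<integral>\<^sup>+x. f x \<partial>lebesgue)"
proof -
  obtain K :: "nat \<Rightarrow> 'a set" where K: "\<And>n. compact (K n)" "\<And>n. K n \<subseteq> {x. l < max_fn f x}"
    "\<And>n. K n \<subseteq> interior (K (Suc n))" "\<Union> (range K) = {x. l < max_fn f x}"
    using open_Union_compact_subsets[OF open_max_fn_greater[of l f]] by metis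
  have inc: "incseq K" using K(3) interior_subset by (intro incseq_SucI) blast
  have "l * emeasure lebesgue {x. l < max_fn f x} = l * (SUP n. emeasure lebesgue (K n))"
    using SUP_emeasure_incseq[of K lebesgue] K(4) inc lmeasurable_compact[OF K(1)]
    by (simp add: fmeasurableD image_subset_iff)
  also have "\<dots> = (SUP n. l * emeasure lebesgue (K n))" by (simp add: SUP_mult_left_ennreal)
  also have "\<dots> \<le> ennreal (A powr Q) * (\<integral>\<^sup>+x. f x \<partial>lebesgue)"
    using weak_type_compact[OF f K(1,2)] by (intro SUP_least)
  finally show ?thesis .
qed

lemma max_fn_mono_add:
  assumes [measurable]: "f \<in> borel_measurable lebesgue" "h \<in> borel_measurable lebesgue"
    and "\<And>x. f x \<le> h x + l"
  shows "max_fn f x \<le> max_fn h x + l"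
  unfolding max_fn_def[of f]
proof (intro SUP_least, clarify)
  fix y r assume r: "0 < r" "x \<in> Bl y r"
  have "(\<integral>\<^sup>+z\<in>Bl y r. f z \<partial>lebesgue) \<le> (\<integral>\<^sup>+z. h z * indicator (Bl y r) z + l * indicator (Bl y r) z \<partial>lebesgue)"
    using assms(3) by (intro nn_integral_mono) (auto simp: indicator_def)
  also have "\<dots> = (\<integral>\<^sup>+z\<in>Bl y r. h z \<partial>lebesgue) + l * emeasure lebesgue (Bl y r)"
    by (subst nn_integral_add) (auto simp: nn_integral_cmult_indicator)
  also have "\<dots> \<le> (max_fn h x + l) * emeasure lebesgue (Bl y r)"
    using nn_integral_ball_le_max_fn[OF r, of h] by (simp add: distrib_right add_right_mono)
  finally show "(\<integral>\<^sup>+z\<in>Bl y r. f z \<partial>lebesgue) / emeasure lebesgue (Bl y r) \<le> max_fn h x + l"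
    using emeasure_ball_pos[OF r(1), of y]
    by (simp add: divide_le_posI_ennreal mult.commute zero_less_iff_neq_zero)
qed

text \<open>
  Only the part of \<open>F\<close> above height \<open>l / 2\<close> contributes to the superlevel set of its maximal
  function at height \<open>l\<close>; this truncation is what interpolates the weak type bound.
\<close>

lemma weak_type_truncated:
  assumes F[measurable]: "F \<in> borel_measurable lebesgue" and "0 < (l::real)"
  shows "emeasure lebesgue {x. ennreal l < max_fn F x} \<le>
    ennreal (2 * A powr Q / l) * (\<integral>\<^sup>+x. F x * indicator {x. ennreal (l / 2) < F x} x \<partial>lebesgue)"
proof -
  define h where "h x = F x * indicator {x. ennreal (l / 2) < F x} x" for x
  have h[measurable]: "h \<in> borel_measurable lebesgue" unfolding h_def by measurable
  have "{x. ennreal l < max_fn F x} \<subseteq> {x. ennreal (l / 2) < max_fn h x}"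
  proof clarify
    fix x assume l: "ennreal l < max_fn F x"
    have "max_fn F x \<le> max_fn h x + ennreal (l / 2)"
      by (rule max_fn_mono_add) (auto simp: h_def indicator_def)
    with l have "ennreal (l / 2) + ennreal (l / 2) < max_fn h x + ennreal (l / 2)"
      using assms(2) by (simp add: ennreal_plus[symmetric] del: ennreal_plus)
    then show "ennreal (l / 2) < max_fn h x"
      by (metis add_right_mono leD not_le_imp_less)
  qed
  then have "emeasure lebesgue {x. ennreal l < max_fn F x} \<le> emeasure lebesgue {x. ennreal (l / 2) < max_fn h x}"
    using open_max_fn_greater by (intro emeasure_mono) auto
  also have "\<dots> = ennreal (2 / l) * (ennreal (l / 2) * emeasure lebesgue {x. ennreal (l / 2) < max_fn h x})"
    using assms(2) by (simp add: mult.assoc[symmetric] ennreal_mult[symmetric])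
  also have "\<dots> \<le> ennreal (2 / l) * (ennreal (A powr Q) * (\<integral>\<^sup>+x. h x \<partial>lebesgue))"
    by (intro mult_left_mono weak_type h) auto
  also have "\<dots> = ennreal (2 * A powr Q / l) * (\<integral>\<^sup>+x. h x \<partial>lebesgue)"
    using assms(2) by (simp add: mult.assoc[symmetric] ennreal_mult[symmetric])
  finally show ?thesis by (simp add: h_def)
qed

text \<open>Marcinkiewicz interpolation: layer cake, the truncated weak type bound at each height l,
  and an exchange of integrals. The inner integral of l^(p - 2) up to \<open>2 * F x\<close>
  produces the factor 2^(p - 1) / (p - 1).\<close>

lemma strong_type:
  fixes F :: "'a \<Rightarrow> real"
  assumes F[measurable]: "F \<in> borel_measurable lebesgue" and F0: "\<And>x. 0 \<le> F x" and p: "1 < p"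
  shows "(\<integral>\<^sup>+x. ennreal_powr (max_fn F x) p \<partial>lebesgue) \<le>
    ennreal (2 powr p * A powr Q * p / (p - 1)) * (\<integral>\<^sup>+x. ennreal (F x powr p) \<partial>lebesgue)"
proof -
  interpret L: sigma_finite_measure "lebesgue :: 'a measure" by (rule sigma_finite_lebesgue)
  interpret pair_sigma_finite "lebesgue :: 'a measure" "lborel :: real measure" ..
  let ?c = "2 * A powr Q * p"
  have c0: "0 \<le> ?c" using p by simp
  have [measurable]: "(\<lambda>(x, l). ennreal l < max_fn F x) \<in> measurable (lebesgue \<Otimes>\<^sub>M lborel) (count_space UNIV)"
    by measurable
  have "(\<integral>\<^sup>+x. ennreal_powr (max_fn F x) p \<partial>lebesgue) =
     (\<integral>\<^sup>+x. (\<integral>\<^sup>+l. ennreal (p * l powr (p - 1)) * indicator {l. 0 < l \<and> ennreal l < max_fn F x} l \<partial>lborel) \<partial>lebesgue)"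
    using p by (subst nn_integral_layer_cake) auto
  also have "\<dots> = (\<integral>\<^sup>+l. (\<integral>\<^sup>+x. ennreal (p * l powr (p - 1)) * indicator {l. 0 < l \<and> ennreal l < max_fn F x} l \<partial>lebesgue) \<partial>lborel)"
    by (rule Fubini'[symmetric]) measurable
  also have "\<dots> \<le> (\<integral>\<^sup>+l. (\<integral>\<^sup>+x. ennreal (?c * l powr (p - 2)) * (ennreal (F x) * indicator {l. 0 < l \<and> l < 2 * F x} l) \<partial>lebesgue) \<partial>lborel)"
  proof (rule nn_integral_mono)
    fix l :: real
    show "(\<integral>\<^sup>+x. ennreal (p * l powr (p - 1)) * indicator {l. 0 < l \<and> ennreal l < max_fn F x} l \<partial>lebesgue) \<le>
      (\<integral>\<^sup>+x. ennreal (?c * l powr (p - 2)) * (ennreal (F x) * indicator {l. 0 < l \<and> l < 2 * F x} l) \<partial>lebesgue)"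
    proof (cases "0 < l")
      case True
      have "(\<integral>\<^sup>+x. ennreal (p * l powr (p - 1)) * indicator {l. 0 < l \<and> ennreal l < max_fn F x} l \<partial>lebesgue)
        = (\<integral>\<^sup>+x. ennreal (p * l powr (p - 1)) * indicator {x. ennreal l < max_fn F x} x \<partial>lebesgue)"
        using True by (intro nn_integral_cong) (auto simp: indicator_def)
      also have "\<dots> = ennreal (p * l powr (p - 1)) * emeasure lebesgue {x. ennreal l < max_fn F x}"
        using open_max_fn_greater by (intro nn_integral_cmult_indicator) auto
      also have "\<dots> \<le> ennreal (p * l powr (p - 1)) * (ennreal (2 * A powr Q / l) *
          (\<integral>\<^sup>+x. ennreal (F x) * indicator {x. ennreal (l / 2) < ennreal (F x)} x \<partial>lebesgue))"
        using True by (intro mult_left_mono weak_type_truncated) auto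
      also have "\<dots> = ennreal (?c * l powr (p - 2)) *
          (\<integral>\<^sup>+x. ennreal (F x) * indicator {x. ennreal (l / 2) < ennreal (F x)} x \<partial>lebesgue)"
      proof -
        have "l powr (p - 1) / l = l powr (p - 2)"
          using True by (simp add: powr_diff field_simps powr_numeral power2_eq_square)
        then have "p * l powr (p - 1) * (2 * A powr Q / l) = ?c * l powr (p - 2)"
          by (metis mult.assoc mult.commute times_divide_eq_right)
        then show ?thesis using p True
          by (simp only: mult.assoc[symmetric] ennreal_mult[symmetric]) (simp add: ennreal_mult[symmetric])
      qed
      also have "\<dots> = (\<integral>\<^sup>+x. ennreal (?c * l powr (p - 2)) * (ennreal (F x) * indicator {l. 0 < l \<and> l < 2 * F x} l) \<partial>lebesgue)"
        using True F0 by (subst nn_integral_cmult[symmetric])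
          (auto simp: indicator_def ennreal_less_iff intro!: nn_integral_cong)
      finally show ?thesis .
    qed simp
  qed
  also have "\<dots> = (\<integral>\<^sup>+x. (\<integral>\<^sup>+l. ennreal (?c * l powr (p - 2)) * (ennreal (F x) * indicator {l. 0 < l \<and> l < 2 * F x} l) \<partial>lborel) \<partial>lebesgue)"
    by (rule Fubini') measurable
  also have "\<dots> = (\<integral>\<^sup>+x. ennreal (2 powr p * A powr Q * p / (p - 1)) * ennreal (F x powr p) \<partial>lebesgue)"
  proof (intro nn_integral_cong)
    fix x
    have "(\<integral>\<^sup>+l. ennreal (?c * l powr (p - 2)) * (ennreal (F x) * indicator {l. 0 < l \<and> l < 2 * F x} l) \<partial>lborel)
      = (\<integral>\<^sup>+l. ennreal (?c * F x) * (ennreal (l powr ((p - 1) - 1)) * indicator {0<..<2 * F x} l) \<partial>lborel)"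
      using p F0[of x] by (intro nn_integral_cong) (auto simp: indicator_def ennreal_mult[symmetric] mult_ac)
    also have "\<dots> = ennreal (?c * F x) * ennreal ((2 * F x) powr (p - 1) / (p - 1))"
      using p F0[of x] nn_integral_powr_below[of "p - 1" "2 * F x"] by (subst nn_integral_cmult) auto
    also have "\<dots> = ennreal (2 powr p * A powr Q * p / (p - 1)) * ennreal (F x powr p)"
    proof -
      have "?c * F x * ((2 * F x) powr (p - 1) / (p - 1)) = 2 powr p * A powr Q * p / (p - 1) * F x powr p"
        using p F0[of x] by (cases "F x = 0") (simp_all add: powr_mult powr_diff)
      then show ?thesis using p F0[of x] c0 by (simp add: ennreal_mult[symmetric])
    qed
    finally show "(\<integral>\<^sup>+l. ennreal (?c * l powr (p - 2)) * (ennreal (F x) * indicator {l. 0 < l \<and> l < 2 * F x} l) \<partial>lborel)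
      = ennreal (2 powr p * A powr Q * p / (p - 1)) * ennreal (F x powr p)" .
  qed
  also have "\<dots> = ennreal (2 powr p * A powr Q * p / (p - 1)) * (\<integral>\<^sup>+x. ennreal (F x powr p) \<partial>lebesgue)"
    by (intro nn_integral_cmult) measurable
  finally show ?thesis .
qed

text \<open>Compare g with a continuous c that is close in L^1. Where |g - c| and its maximal
  function are below e / 3, the mean oscillation of g is at most e: one third comes from the average
  of |g - c|, one from its value at x, one from the continuity of c. The weak type bound and
  Chebyshev's inequality make the remaining set small.\<close>

lemma lebesgue_point_eps:
  fixes g :: "'a \<Rightarrow> real"
  assumes g: "integrable lebesgue g" and e: "0 < e"
  shows "AE x in lebesgue. \<exists>d>0. \<forall>r. 0 < r \<and> r < d \<longrightarrow>
    (\<integral>\<^sup>+y\<in>Bl x r. ennreal \<bar>g y - g x\<bar> \<partial>lebesgue) \<le> ennreal e * emeasure lebesgue (Bl x r)"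
proof -
  have [measurable]: "g \<in> borel_measurable lebesgue" using g by simp
  define N where "N = {x. \<not> (\<exists>d>0. \<forall>r. 0 < r \<and> r < d \<longrightarrow>
    (\<integral>\<^sup>+y\<in>Bl x r. ennreal \<bar>g y - g x\<bar> \<partial>lebesgue) \<le> ennreal e * emeasure lebesgue (Bl x r))}"
  have "negligible N"
    unfolding negligible_outer_le
  proof (intro allI impI)
    fix \<eta> :: real assume eta: "0 < \<eta>"
    \<comment> \<open>The exceptional sets have measure at most k times the L^1 distance of g and c:
      3 / e from the height, A^Q from the weak type bound, 1 from Chebyshev's inequality.\<close>
    define k where "k = 3 / e * (A powr Q + 1)"
    have k: "0 < k" unfolding k_def using e by (intro mult_pos_pos add_nonneg_pos) auto
    obtain c where c: "continuous_on UNIV c" "(\<integral>\<^sup>+x. ennreal \<bar>g x - c x\<bar> \<partial>lebesgue) < ennreal (\<eta> / k)"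
      using integrable_approx_continuous[OF g, of "\<eta> / k"] eta k by auto
    have [measurable]: "c \<in> borel_measurable lebesgue"
      by (rule borel_measurable_lebesgue_continuous[OF c(1)])
    let ?f = "\<lambda>x. ennreal \<bar>g x - c x\<bar>"
    have fm[measurable]: "?f \<in> borel_measurable lebesgue" by measurable
    define S1 where "S1 = {x. ennreal (e / 3) < max_fn ?f x}"
    define S2 where "S2 = {x \<in> space lebesgue. ennreal (e / 3) \<le> ?f x}"
    have S1[measurable]: "S1 \<in> sets lebesgue" using open_max_fn_greater unfolding S1_def by auto
    have S2[measurable]: "S2 \<in> sets lebesgue" unfolding S2_def by measurable
    have "ennreal (e / 3) * emeasure lebesgue (S1 \<union> S2) \<le>
        ennreal (e / 3) * emeasure lebesgue S1 + ennreal (e / 3) * emeasure lebesgue S2"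
      unfolding distrib_left[symmetric] by (intro mult_left_mono emeasure_subadditive) auto
    also have "\<dots> \<le> ennreal (A powr Q) * (\<integral>\<^sup>+x. ?f x \<partial>lebesgue) + (\<integral>\<^sup>+x. ?f x \<partial>lebesgue)"
    proof (intro add_mono)
      show "ennreal (e / 3) * emeasure lebesgue S1 \<le> ennreal (A powr Q) * (\<integral>\<^sup>+x. ?f x \<partial>lebesgue)"
        unfolding S1_def by (rule weak_type) measurable
      have "ennreal (e / 3) * emeasure lebesgue S2 = (\<integral>\<^sup>+x. ennreal (e / 3) * indicator S2 x \<partial>lebesgue)"
        by (simp add: nn_integral_cmult_indicator)
      also have "\<dots> \<le> (\<integral>\<^sup>+x. ?f x \<partial>lebesgue)"
        by (intro nn_integral_mono) (auto simp: indicator_def S2_def)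
      finally show "ennreal (e / 3) * emeasure lebesgue S2 \<le> (\<integral>\<^sup>+x. ?f x \<partial>lebesgue)" .
    qed
    also have "\<dots> = ennreal (A powr Q + 1) * (\<integral>\<^sup>+x. ?f x \<partial>lebesgue)"
      by (simp add: distrib_right)
    also have "\<dots> \<le> ennreal (A powr Q + 1) * ennreal (\<eta> / k)"
      using c(2) by (intro mult_left_mono) auto
    finally have "ennreal (3 / e) * (ennreal (e / 3) * emeasure lebesgue (S1 \<union> S2)) \<le>
        ennreal (3 / e) * (ennreal (A powr Q + 1) * ennreal (\<eta> / k))"
      by (intro mult_left_mono) auto
    also have "ennreal (3 / e) * (ennreal (e / 3) * emeasure lebesgue (S1 \<union> S2)) = emeasure lebesgue (S1 \<union> S2)"
      using e by (simp add: mult.assoc[symmetric] ennreal_mult[symmetric])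
    also have "ennreal (3 / e) * (ennreal (A powr Q + 1) * ennreal (\<eta> / k)) = ennreal (k * (\<eta> / k))"
    proof -
      have "3 / e * ((A powr Q + 1) * (\<eta> / k)) = k * (\<eta> / k)" by (simp only: k_def mult.assoc)
      then show ?thesis using e eta k by (simp add: ennreal_mult[symmetric] del: ennreal_plus)
    qed
    finally have S: "emeasure lebesgue (S1 \<union> S2) \<le> ennreal \<eta>" using k by simp
    have "N \<subseteq> S1 \<union> S2"
    proof
      fix x assume x: "x \<in> N"
      show "x \<in> S1 \<union> S2"
      proof (rule ccontr)
        assume "x \<notin> S1 \<union> S2"
        then have M: "max_fn ?f x \<le> ennreal (e / 3)" and f: "\<bar>g x - c x\<bar> < e / 3"
          using e by (auto simp: S1_def S2_def not_less not_le ennreal_less_iff)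
        have "open (c -` {c x - e / 3<..<c x + e / 3})"
          using c(1) by (intro open_vimage) auto
        then obtain d where d: "0 < d" "Bl x d \<subseteq> c -` {c x - e / 3<..<c x + e / 3}"
          using shrink[of _ x] e by fastforce
        have "(\<integral>\<^sup>+y\<in>Bl x r. ennreal \<bar>g y - g x\<bar> \<partial>lebesgue) \<le> ennreal e * emeasure lebesgue (Bl x r)"
          if r: "0 < r" "r < d" for r
        proof -
          have "(\<integral>\<^sup>+y\<in>Bl x r. ennreal \<bar>g y - g x\<bar> \<partial>lebesgue) \<le>
            (\<integral>\<^sup>+y. ?f y * indicator (Bl x r) y + ennreal (2 * e / 3) * indicator (Bl x r) y \<partial>lebesgue)"
          proof (intro nn_integral_mono)
            fix y
            show "ennreal \<bar>g y - g x\<bar> * indicator (Bl x r) y \<le>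
              ?f y * indicator (Bl x r) y + ennreal (2 * e / 3) * indicator (Bl x r) y"
            proof (cases "y \<in> Bl x r")
              case True
              then have "y \<in> Bl x d" using ball_mono[of r d x] r by auto
              then have "\<bar>c y - c x\<bar> < e / 3" using subsetD[OF d(2)] by (fastforce simp: abs_diff_less_iff simp del: less_divide_eq_numeral1)
              then have "\<bar>g y - g x\<bar> \<le> \<bar>g y - c y\<bar> + 2 * e / 3" using f by linarith
              then show ?thesis using True e by (simp add: ennreal_plus[symmetric] del: ennreal_plus)
            qed simp
          qed
          also have "\<dots> = (\<integral>\<^sup>+y\<in>Bl x r. ?f y \<partial>lebesgue) + ennreal (2 * e / 3) * emeasure lebesgue (Bl x r)"
            by (subst nn_integral_add) (auto simp: nn_integral_cmult_indicator)
          also have "\<dots> \<le> ennreal (e / 3) * emeasure lebesgue (Bl x r) + ennreal (2 * e / 3) * emeasure lebesgue (Bl x r)"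
            using nn_integral_ball_le_max_fn[OF r(1) centre[OF r(1)], of ?f] M
            by (intro add_right_mono) (meson mult_right_mono order_trans zero_le)
          also have "\<dots> = ennreal e * emeasure lebesgue (Bl x r)"
            using e by (simp add: distrib_right[symmetric] ennreal_plus[symmetric] del: ennreal_plus)
          finally show ?thesis .
        qed
        with d(1) x show False by (auto simp: N_def)
      qed
    qed
    moreover have "S1 \<union> S2 \<in> lmeasurable" using S by (intro fmeasurableI) (auto simp: le_less_trans)
    moreover have "measure lebesgue (S1 \<union> S2) \<le> \<eta>"
      using S eta by (simp add: measure_def enn2real_leI)
    ultimately show "\<exists>T. N \<subseteq> T \<and> T \<in> lmeasurable \<and> measure lebesgue T \<le> \<eta>" by blast
  qed
  then have "AE x in lebesgue. x \<notin> N"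
    by (intro AE_not_in) (simp add: negligible_iff_null_sets)
  then show ?thesis by eventually_elim (auto simp: N_def)
qed

lemma lebesgue_point:
  fixes g :: "'a \<Rightarrow> real"
  assumes g: "integrable lebesgue g"
  shows "AE x in lebesgue. \<forall>e>0. \<exists>d>0. \<forall>r. 0 < r \<and> r < d \<longrightarrow>
    (\<integral>\<^sup>+y\<in>Bl x r. ennreal \<bar>g y - g x\<bar> \<partial>lebesgue) \<le> ennreal e * emeasure lebesgue (Bl x r)"
proof -
  have "AE x in lebesgue. \<forall>n. \<exists>d>0. \<forall>r. 0 < r \<and> r < d \<longrightarrow>
    (\<integral>\<^sup>+y\<in>Bl x r. ennreal \<bar>g y - g x\<bar> \<partial>lebesgue) \<le> ennreal (inverse (real (Suc n))) * emeasure lebesgue (Bl x r)"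
    by (subst AE_all_countable) (intro allI lebesgue_point_eps g, simp)
  then show ?thesis
  proof eventually_elim
    case (elim x)
    show ?case
    proof (intro allI impI)
      fix e :: real assume "0 < e"
      then obtain n where n: "inverse (real (Suc n)) < e" using reals_Archimedean by blast
      have "ennreal (inverse (real (Suc n))) * emeasure lebesgue (Bl x r) \<le> ennreal e * emeasure lebesgue (Bl x r)" for r
        using n by (intro mult_right_mono ennreal_leI) auto
      with elim[rule_format, of n] show "\<exists>d>0. \<forall>r. 0 < r \<and> r < d \<longrightarrow>
        (\<integral>\<^sup>+y\<in>Bl x r. ennreal \<bar>g y - g x\<bar> \<partial>lebesgue) \<le> ennreal e * emeasure lebesgue (Bl x r)"
        by (meson order_trans)
    qed
  qed
qed

end

section \<open>Groups of step two\<close>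

text \<open>The Baker-Campbell-Hausdorff product in exponential coordinates, with Lie bracket
  \<open>[x, y] = B x y *\<^sub>R T\<close>.\<close>

definition step_mult :: "('a \<Rightarrow> 'a \<Rightarrow> real) \<Rightarrow> 'a \<Rightarrow> 'a \<Rightarrow> 'a \<Rightarrow> 'a::real_vector" where
  "step_mult B T x y = x + y + (B x y / 2) *\<^sub>R T"

text \<open>If x is split into a horizontal part and \<open>f x *\<^sub>R T\<close>, the first is
  scaled by \<rho> and the second by \<rho>^2; for \<open>T = 0\<close> this is scalar
  multiplication.\<close>

definition step_dil :: "('a \<Rightarrow> real) \<Rightarrow> 'a \<Rightarrow> real \<Rightarrow> 'a \<Rightarrow> 'a::real_vector" where
  "step_dil f T \<rho> x = \<rho> *\<^sub>R x + ((\<rho>\<^sup>2 - \<rho>) * f x) *\<^sub>R T"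

text \<open>
  Groups of step at most two whose centre is spanned by \<open>T\<close>: the Heisenberg group, and for
  \<open>T = 0\<close> Euclidean space. Here \<open>f\<close> is the vertical coordinate and \<open>N\<close> the homogeneous gauge.
  The last but one assumption is an interior cone condition for the unit ball, with cones
  twisted by the group law.
\<close>

locale step_two =
  fixes E :: "('a::euclidean_space, 'm::finite) ambient"
    and B :: "'a \<Rightarrow> 'a \<Rightarrow> real" and f :: "'a \<Rightarrow> real" and T :: 'a and e :: "'m \<Rightarrow> 'a"
    and N :: "'a \<Rightarrow> real" and Q :: real
  assumes bilin: "bilinear B" and alt: "B x x = 0" and vert: "B T y = 0"
    and f_lin: "linear f"
    and T0: "T = 0 \<Longrightarrow> f x = 0" "T = 0 \<Longrightarrow> B x y = 0" "T \<noteq> 0 \<Longrightarrow> f T = 1"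
    and decomp: "x = (\<Sum>i\<in>UNIV. (x \<bullet> e i) *\<^sub>R e i) + f x *\<^sub>R T"
    and e: "e i \<bullet> e i = 1" "T \<bullet> e i = 0" "f (e i) = 0"
    and bracket: "\<exists>i j. B (e i) (e j) *\<^sub>R T = T"
    and frame_eq: "frame E i x = e i + (B x (e i) / 2) *\<^sub>R T"
    and Q_eq: "Q = real CARD('m) + 2 * f T"
    and gdist_eq: "gdist E x y = N (step_mult B T (- y) x)"
    and N_cont: "continuous_on UNIV N"
    and N_dil: "0 < \<rho> \<Longrightarrow> N (step_dil f T \<rho> x) = \<rho> * N x"
    and N_minus: "N (- x) = N x"
    and N_nonneg: "0 \<le> N x"
    and N_bounded: "bounded {x. N x \<le> 1}"
    and N_convex: "convex {x. N x < 1}"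
    and cone: "\<exists>c R. 0 < c \<and> c < 1 \<and> (\<forall>x. N x < 1 \<longrightarrow> (\<exists>p. norm p \<le> R \<and>
       (\<forall>s w. 0 < s \<and> s \<le> 1 \<and> N w < 1 \<longrightarrow>
          N (step_mult B T x (step_dil f T s (step_mult B T p (step_dil f T c w)))) < 1)))"
    and nn_integral_transform: "F \<in> borel_measurable borel \<Longrightarrow> 0 < \<rho> \<Longrightarrow>
       ennreal (\<rho> powr Q) * (\<integral>\<^sup>+w. F (step_mult B T z (step_dil f T \<rho> w)) \<partial>lborel)
         = (\<integral>\<^sup>+y. F y \<partial>lborel)"
begin

section \<open>Algebra of the group law and the dilations\<close>

abbreviation gmult where "gmult \<equiv> step_mult B T"
abbreviation dil where "dil \<equiv> step_dil f T"
abbreviation X where "X i \<xi> w \<equiv> pd (e i + (B w (e i) / 2) *\<^sub>R T) \<xi> w"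

lemmas mult_def = step_mult_def[of B T]
lemmas dil_def = step_dil_def[of f T]

lemma vert': "B y T = 0"
proof -
  have "B (y + T) (y + T) = 0" by (rule alt)
  then have "B y y + B y T + (B T y + B T T) = 0"
    by (simp only: bilinear_ladd[OF bilin] bilinear_radd[OF bilin] add_ac)
  then show ?thesis by (simp add: alt vert)
qed

lemma skew: "B y x = - B x y"
proof -
  have "B (y + x) (y + x) = 0" by (rule alt)
  then have "B y y + B y x + (B x y + B x x) = 0"
    by (simp only: bilinear_ladd[OF bilin] bilinear_radd[OF bilin] add_ac)
  then show ?thesis by (simp add: alt)
qed

lemma B_simps:
  "B (x + y) z = B x z + B y z" "B x (y + z) = B x y + B x z" "B (k *\<^sub>R x) y = k * B x y"
  "B x (k *\<^sub>R y) = k * B x y" "B (- x) y = - B x y" "B x (- y) = - B x y"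
  "B (x - y) z = B x z - B y z" "B x (y - z) = B x y - B x z" "B x x = 0" "B T x = 0" "B x T = 0"
  "B 0 x = 0" "B x 0 = 0"
  using bilinear_ladd[OF bilin] bilinear_radd[OF bilin] bilinear_lmul[OF bilin] bilinear_rmul[OF bilin]
    bilinear_lneg[OF bilin] bilinear_rneg[OF bilin] bilinear_lsub[OF bilin] bilinear_rsub[OF bilin]
    bilinear_lzero[OF bilin] bilinear_rzero[OF bilin] alt vert vert' by auto

lemma f_simps:
  "f (x + y) = f x + f y" "f (k *\<^sub>R x) = k * f x" "f (- x) = - f x" "f (x - y) = f x - f y" "f 0 = 0"
  using f_lin by (auto simp: linear_add linear_scale linear_neg linear_diff linear_0)

lemma f_mult: "f (gmult x y) = f x + f y + B x y / 2"
  by (cases "T = 0") (simp_all add: mult_def f_simps T0)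

lemma f_dil: "f (dil \<rho> x) = \<rho>\<^sup>2 * f x"
  by (cases "T = 0") (simp_all add: dil_def f_simps T0 algebra_simps)

lemma B_dil: "B (dil \<rho> x) y = \<rho> * B x y" "B x (dil \<rho> y) = \<rho> * B x y"
  by (simp_all add: dil_def B_simps)

lemma B_mult: "B (gmult x y) z = B x z + B y z" "B z (gmult x y) = B z x + B z y"
  by (simp_all add: mult_def B_simps)

lemma mult_assoc: "gmult (gmult x y) z = gmult x (gmult y z)"
  unfolding mult_def by (simp add: B_simps algebra_simps add_divide_distrib)

lemma mult_minus: "gmult (- x) x = 0" "gmult x (- x) = 0"
  by (simp_all add: mult_def B_simps)

lemma mult_0: "gmult 0 x = x" "gmult x 0 = x"
  by (simp_all add: mult_def B_simps)

lemma mult_cancel: "gmult (- x) (gmult x y) = y" "gmult x (gmult (- x) y) = y"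
  by (simp_all add: mult_assoc[symmetric] mult_minus mult_0)

lemma minus_mult: "- gmult x y = gmult (- y) (- x)"
  using skew[of x y] by (simp add: mult_def B_simps)

lemma dil_mult: "dil \<rho> (gmult x y) = gmult (dil \<rho> x) (dil \<rho> y)"
proof -
  have "dil \<rho> (gmult x y) = \<rho> *\<^sub>R x + \<rho> *\<^sub>R y
      + (\<rho> * B x y / 2 + (\<rho>\<^sup>2 - \<rho>) * (f x + f y + B x y / 2)) *\<^sub>R T"
    unfolding dil_def f_mult by (simp add: mult_def scaleR_add_left scaleR_add_right)
  also have "\<rho> * B x y / 2 + (\<rho>\<^sup>2 - \<rho>) * (f x + f y + B x y / 2) =
      (\<rho>\<^sup>2 - \<rho>) * f x + (\<rho>\<^sup>2 - \<rho>) * f y + \<rho> * (\<rho> * B x y) / 2"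
    by (simp add: field_simps power2_eq_square)
  finally show ?thesis
    by (simp add: mult_def B_dil) (simp add: dil_def scaleR_add_left)
qed

lemma dil_dil: "dil \<rho> (dil \<sigma> x) = dil (\<rho> * \<sigma>) x"
proof -
  have "dil \<rho> (dil \<sigma> x) = (\<rho> * \<sigma>) *\<^sub>R x + (\<rho> * ((\<sigma>\<^sup>2 - \<sigma>) * f x) + (\<rho>\<^sup>2 - \<rho>) * (\<sigma>\<^sup>2 * f x)) *\<^sub>R T"
    unfolding dil_def[of \<rho>] f_dil by (simp add: dil_def scaleR_add_left scaleR_add_right)
  also have "\<rho> * ((\<sigma>\<^sup>2 - \<sigma>) * f x) + (\<rho>\<^sup>2 - \<rho>) * (\<sigma>\<^sup>2 * f x) = ((\<rho> * \<sigma>)\<^sup>2 - \<rho> * \<sigma>) * f x"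
    by (simp add: algebra_simps power2_eq_square)
  finally show ?thesis by (simp add: dil_def)
qed

lemma dil_1: "dil 1 x = x" and dil_0: "dil \<rho> 0 = 0" and dil_minus: "dil \<rho> (- x) = - dil \<rho> x"
  by (simp_all add: dil_def f_simps)

lemma dil_add: "dil \<rho> (x + y) = dil \<rho> x + dil \<rho> y" and dil_scale: "dil \<rho> (k *\<^sub>R x) = k *\<^sub>R dil \<rho> x"
  by (simp_all add: dil_def f_simps algebra_simps)

lemma dil_inverse: "0 < \<rho> \<Longrightarrow> dil (1 / \<rho>) (dil \<rho> x) = x" "0 < \<rho> \<Longrightarrow> dil \<rho> (dil (1 / \<rho>) x) = x"
  by (simp_all add: dil_dil dil_1)

lemma N_0: "N 0 = 0"
  using N_dil[of 2 0] by (simp add: dil_0)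

lemma gball_eq: "gball E x r = {y. N (gmult (- x) y) < r}"
  using N_minus[of "gmult (- x) _"] by (simp add: gball_def gdist_eq minus_mult)

lemma mem_gball_iff: "0 < r \<Longrightarrow> gmult x (dil r w) \<in> gball E x r \<longleftrightarrow> N w < 1"
  by (simp add: gball_eq mult_cancel N_dil)

lemma gball_image: "0 < r \<Longrightarrow> y \<in> gball E x r \<longleftrightarrow> (\<exists>w. N w < 1 \<and> y = gmult x (dil r w))"
  using mem_gball_iff[of r x "dil (1 / r) (gmult (- x) y)"] mem_gball_iff[of r x]
  by (auto simp: dil_inverse mult_cancel)

section \<open>Topology and volume of the balls\<close>

lemma continuous_mult: "continuous_on S (gmult x)"
  unfolding mult_def
  by (intro continuous_intros linear_continuous_on)
     (use bilin in \<open>auto simp: bilinear_def linear_conv_bounded_linear[symmetric]\<close>)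

lemma continuous_dil: "continuous_on S (dil \<rho>)"
  unfolding dil_def
  by (intro continuous_intros linear_continuous_on)
     (use f_lin in \<open>auto simp: linear_conv_bounded_linear[symmetric]\<close>)

lemma open_gball: "open (gball E x r)"
proof -
  have "continuous_on UNIV (\<lambda>y. N (gmult (- x) y))"
    by (rule continuous_on_compose2[OF N_cont continuous_mult]) auto
  then show ?thesis
    unfolding gball_eq by (intro open_Collect_less continuous_intros) auto
qed

lemma compact_unit: "compact {x. N x \<le> 1}"
  by (intro compact_eq_bounded_closed[THEN iffD2] conjI N_bounded closed_Collect_le N_cont
      continuous_on_const)

text \<open>\<open>N (gmult x y)\<close> is continuous on the compact set of pairs of gauge at most
  1, hence bounded there; dilations are automorphisms and carry the bound to every size m.\<close>

lemma quasi_triangle_ex: "\<exists>K\<ge>1. \<forall>m x y. 0 < m \<and> N x \<le> m \<and> N y \<le> m \<longrightarrow> N (gmult x y) \<le> K * m"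
proof -
  let ?U = "{x. N x \<le> 1}"
  have "bounded_bilinear B" using bilin bilinear_conv_bounded_bilinear by blast
  then have "continuous_on UNIV (\<lambda>q. B (fst q) (snd q))"
    by (rule bounded_bilinear.continuous_on) (intro continuous_intros)+
  then have "continuous_on UNIV (\<lambda>q. gmult (fst q) (snd q))"
    unfolding mult_def by (intro continuous_intros) auto
  then have "continuous_on (?U \<times> ?U) (\<lambda>q. N (gmult (fst q) (snd q)))"
    by (intro continuous_on_compose2[OF N_cont]) (auto intro: continuous_on_subset)
  then have "compact ((\<lambda>q. N (gmult (fst q) (snd q))) ` (?U \<times> ?U))"
    by (intro compact_continuous_image compact_Times compact_unit)
  then obtain k where k: "\<And>x y. N x \<le> 1 \<Longrightarrow> N y \<le> 1 \<Longrightarrow> \<bar>N (gmult x y)\<bar> \<le> k"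
    by (fastforce dest!: compact_imp_bounded simp: bounded_iff)
  show ?thesis
  proof (intro exI[of _ "max 1 k"] conjI allI impI)
    fix m x y assume m: "0 < m \<and> N x \<le> m \<and> N y \<le> m"
    have "N (gmult (dil (1 / m) x) (dil (1 / m) y)) \<le> k"
      using k[of "dil (1 / m) x" "dil (1 / m) y"] m by (simp add: N_dil field_simps)
    then have "N (gmult x y) \<le> k * m"
      using m by (simp add: dil_mult[symmetric] N_dil field_simps)
    also have "\<dots> \<le> max 1 k * m" using m by (intro mult_right_mono) auto
    finally show "N (gmult x y) \<le> max 1 k * m" .
  qed simp
qed

definition K where "K = (SOME K. K \<ge> 1 \<and> (\<forall>m x y. 0 < m \<and> N x \<le> m \<and> N y \<le> m \<longrightarrow> N (gmult x y) \<le> K * m))"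

lemma K: "1 \<le> K" "0 < m \<Longrightarrow> N x \<le> m \<Longrightarrow> N y \<le> m \<Longrightarrow> N (gmult x y) \<le> K * m"
  using someI_ex[OF quasi_triangle_ex] unfolding K_def by blast+

lemma Q_pos: "0 < Q"
  using T0 f_simps(5) by (cases "T = 0") (auto simp: Q_eq intro!: add_pos_nonneg)

lemma emeasure_transform:
  assumes "A \<in> sets borel" "0 < \<rho>"
  shows "emeasure lborel A = ennreal (\<rho> powr Q) * emeasure lborel {w. gmult z (dil \<rho> w) \<in> A}"
proof -
  have "(\<lambda>w. gmult z (dil \<rho> w)) \<in> borel_measurable borel"
    by (intro borel_measurable_continuous_onI continuous_on_compose2[OF continuous_mult continuous_dil]) auto
  then have [measurable]: "{w. gmult z (dil \<rho> w) \<in> A} \<in> sets borel"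
    using measurable_sets[of "\<lambda>w. gmult z (dil \<rho> w)" borel borel A] assms by (simp add: vimage_def)
  have "emeasure lborel A = (\<integral>\<^sup>+y. indicator A y \<partial>lborel)"
    using assms by simp
  also have "\<dots> = ennreal (\<rho> powr Q) * (\<integral>\<^sup>+w. indicator A (gmult z (dil \<rho> w)) \<partial>lborel)"
    using assms by (subst nn_integral_transform) auto
  also have "(\<integral>\<^sup>+w. indicator A (gmult z (dil \<rho> w)) \<partial>lborel) = (\<integral>\<^sup>+w. indicator {w. gmult z (dil \<rho> w) \<in> A} w \<partial>lborel)"
    by (intro nn_integral_cong) (auto simp: indicator_def)
  finally show ?thesis by simp
qed

definition \<omega> where "\<omega> = measure lborel {w. N w < 1}"

lemma open_unit: "open {w. N w < 1}"
  using open_gball[of 0 1] by (simp add: gball_eq mult_0)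

lemma emeasure_unit: "emeasure lborel {w. N w < 1} = ennreal \<omega>" and omega_pos: "0 < \<omega>"
proof -
  have "{w. N w < 1} \<subseteq> {w. N w \<le> 1}" by auto
  then have fin: "emeasure lborel {w. N w < 1} \<noteq> \<infinity>"
    using emeasure_bounded_finite[OF bounded_subset[OF N_bounded]] by (metis less_irrefl)
  then show om: "emeasure lborel {w. N w < 1} = ennreal \<omega>"
    unfolding \<omega>_def by (intro emeasure_eq_ennreal_measure) simp
  have "0 \<in> {w. N w < 1}" by (simp add: N_0)
  then obtain d where d: "0 < d" "ball 0 d \<subseteq> {w. N w < 1}"
    using open_unit open_contains_ball by blast
  have "0 < emeasure lborel (ball (0::'a) d)"
    using content_ball_pos[OF d(1), of "0::'a"] by (simp add: measure_def enn2real_positive_iff)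
  also have "\<dots> \<le> emeasure lborel {w. N w < 1}"
    using d(2) open_unit by (intro emeasure_mono) auto
  finally show "0 < \<omega>" by (simp add: om)
qed

lemma emeasure_gball: "0 < r \<Longrightarrow> emeasure lebesgue (gball E x r) = ennreal (\<omega> * r powr Q)"
proof -
  assume r: "0 < r"
  have "emeasure lebesgue (gball E x r) = emeasure lborel (gball E x r)"
    using open_gball[of x r] by simp
  also have "\<dots> = ennreal (r powr Q) * emeasure lborel {w. N w < 1}"
    using open_gball r by (subst emeasure_transform[where z = x and \<rho> = r]) (auto simp: mem_gball_iff)
  finally show ?thesis
    using omega_pos by (simp add: emeasure_unit ennreal_mult[symmetric] mult.commute)
qed

text \<open>The map from (s, w) to \<open>gmult x (dil s w)\<close> is uniformly continuous for s in
  [0, 1] and w in the compact unit ball, and at s = 0 it collapses to x. This compares group balls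
  with Euclidean neighbourhoods.\<close>

lemma gball_shrink:
  assumes "open U" "x \<in> U"
  shows "\<exists>r>0. gball E x r \<subseteq> U"
proof -
  let ?D = "cbox 0 (1::real) \<times> {w. N w \<le> 1}"
  have fl: "bounded_linear f" using f_lin by (simp add: linear_conv_bounded_linear)
  have Bl: "bounded_linear (B x)" using bilin by (auto simp: bilinear_def linear_conv_bounded_linear[symmetric])
  obtain d where d: "0 < d" "ball x d \<subseteq> U" using assms open_contains_ball by blast
  have "continuous_on ?D (\<lambda>q. gmult x (dil (fst q) (snd q)))"
    unfolding mult_def dil_def
    by (intro continuous_intros bounded_linear.continuous_on[OF Bl] bounded_linear.continuous_on[OF fl])
       auto
  then have "uniformly_continuous_on ?D (\<lambda>q. gmult x (dil (fst q) (snd q)))"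
    by (intro compact_uniformly_continuous compact_Times compact_unit) auto
  then obtain \<delta> where \<delta>: "0 < \<delta>" "\<And>q q'. q \<in> ?D \<Longrightarrow> q' \<in> ?D \<Longrightarrow> dist q' q < \<delta> \<Longrightarrow>
      dist (gmult x (dil (fst q') (snd q'))) (gmult x (dil (fst q) (snd q))) < d"
    unfolding uniformly_continuous_on_def using d(1) by metis
  define r where "r = min 1 (\<delta> / 2)"
  have r: "0 < r" "r \<le> 1" "r < \<delta>" using \<delta>(1) by (auto simp: r_def)
  have "gball E x r \<subseteq> ball x d"
  proof
    fix y assume "y \<in> gball E x r"
    then obtain w where w: "N w < 1" "y = gmult x (dil r w)" using gball_image[OF r(1)] by auto
    have "dist (gmult x (dil r w)) (gmult x (dil 0 w)) < d"
      using \<delta>(2)[of "(0, w)" "(r, w)"] w(1) r by (simp add: dist_Pair_Pair)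
    then show "y \<in> ball x d" by (simp add: w(2) dil_def mult_0 dist_commute)
  qed
  with d(2) r(1) show ?thesis by blast
qed

text \<open>Two uses of the quasi-triangle inequality put the points of \<open>gball E y s\<close>
  within K * K * r of x; the factor 2 restores the strict inequality in the definition of a
  ball.\<close>

sublocale homogeneous_balls "gball E" Q \<omega> "2 * K * K"
proof
  show "open (gball E x r)" for x r by (rule open_gball)
  show "x \<in> gball E x r" if "0 < r" for x r
    using that by (simp add: gball_eq mult_minus N_0)
  show "emeasure lebesgue (gball E x r) = ennreal (\<omega> * r powr Q)" if "0 < r" for x r
    using that by (rule emeasure_gball)
  show "0 < \<omega>" "0 < Q" by (rule omega_pos, rule Q_pos)
  have "1 * 1 \<le> K * K" using K(1) by (intro mult_mono) auto
  then show "1 \<le> 2 * K * K" by simp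
  show "\<exists>r>0. gball E x r \<subseteq> U" if "open U" "x \<in> U" for U x
    using that by (rule gball_shrink)
  show "gball E x r \<subseteq> gball E x s" if "r \<le> s" for x r s
    using that by (auto simp: gball_eq)
  show "gball E y s \<subseteq> gball E x (2 * K * K * r)"
    if s: "0 < s" "s \<le> r" and int: "gball E x r \<inter> gball E y s \<noteq> {}" for x y s r
  proof
    fix v assume v: "v \<in> gball E y s"
    obtain z where z: "N (gmult (- x) z) < r" "N (gmult (- y) z) < s"
      using int by (auto simp: gball_eq)
    have "N (gmult (- z) y) \<le> s" using z(2) N_minus[of "gmult (- y) z"] by (simp add: minus_mult)
    moreover have "N (gmult (- y) v) \<le> s" using v by (simp add: gball_eq)
    ultimately have "N (gmult (gmult (- z) y) (gmult (- y) v)) \<le> K * s"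
      using s(1) by (intro K(2))
    then have "N (gmult (- z) v) \<le> K * s" by (simp add: mult_assoc mult_cancel)
    also have "\<dots> \<le> K * r" using s K(1) by (intro mult_left_mono) auto
    finally have zv: "N (gmult (- z) v) \<le> K * r" .
    have xz: "N (gmult (- x) z) \<le> K * r"
      using z(1) mult_right_mono[OF K(1), of r] s by linarith
    have "0 < K * r" using K(1) s by (intro mult_pos_pos) auto
    then have "N (gmult (gmult (- x) z) (gmult (- z) v)) \<le> K * (K * r)"
      using xz zv by (rule K(2))
    then have "N (gmult (- x) v) \<le> K * (K * r)" by (simp add: mult_assoc mult_cancel)
    moreover have "0 < K * (K * r)" using K(1) s by (intro mult_pos_pos) auto
    ultimately show "v \<in> gball E x (2 * K * K * r)" by (simp add: gball_eq)
  qed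
qed

end

section \<open>Horizontal divergences\<close>

text \<open>The mean value inequality bounds the difference quotients in s by L, so
  \<open>\<bar>g y\<bar> * L\<close> is a majorant for dominated convergence.\<close>

lemma has_derivative_parametric_integral:
  fixes \<Phi> D :: "real \<Rightarrow> 'a \<Rightarrow> real"
  assumes g: "integrable M g" and s: "s \<in> {a..b}"
    and deriv: "\<And>s y. s \<in> {a..b} \<Longrightarrow> ((\<lambda>s. \<Phi> s y) has_real_derivative D s y) (at s within {a..b})"
    and bound: "\<And>s y. s \<in> {a..b} \<Longrightarrow> \<bar>D s y\<bar> \<le> L"
    and meas: "\<And>s. \<Phi> s \<in> borel_measurable M" "\<And>s. D s \<in> borel_measurable M"
    and int: "\<And>s. s \<in> {a..b} \<Longrightarrow> integrable M (\<lambda>y. g y * \<Phi> s y)"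
  shows "((\<lambda>s. \<integral>y. g y * \<Phi> s y \<partial>M) has_real_derivative (\<integral>y. g y * D s y \<partial>M)) (at s within {a..b})"
  unfolding has_field_derivative_iff tendsto_at_iff_sequentially
proof (intro allI impI)
  fix X :: "nat \<Rightarrow> real" assume X: "\<forall>i. X i \<in> {a..b} - {s}" "X \<longlonglongrightarrow> s"
  have [measurable]: "g \<in> borel_measurable M" using g by simp
  note meas[measurable]
  have lip: "\<bar>(\<Phi> (X i) y - \<Phi> s y) / (X i - s)\<bar> \<le> L" for i y
  proof -
    have "norm (\<Phi> (X i) y - \<Phi> s y) \<le> L * norm (X i - s)"
    proof (rule field_differentiable_bound)
      show "convex {a..b}" by simp
      show "((\<lambda>s. \<Phi> s y) has_field_derivative D z y) (at z within {a..b})" if "z \<in> {a..b}" for z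
        using that by (rule deriv)
    qed (use X s bound in auto)
    moreover have "X i \<noteq> s" using X by auto
    ultimately show ?thesis by (simp add: abs_divide divide_le_eq)
  qed
  have "(\<lambda>i. \<integral>y. g y * ((\<Phi> (X i) y - \<Phi> s y) / (X i - s)) \<partial>M) \<longlonglongrightarrow> (\<integral>y. g y * D s y \<partial>M)"
  proof (rule integral_dominated_convergence[where w = "\<lambda>y. \<bar>g y\<bar> * L"])
    show "AE y in M. (\<lambda>i. g y * ((\<Phi> (X i) y - \<Phi> s y) / (X i - s))) \<longlonglongrightarrow> g y * D s y"
      using deriv[OF s] X
      by (intro AE_I2 tendsto_mult tendsto_const)
        (auto simp: has_field_derivative_iff tendsto_at_iff_sequentially o_def)
    show "AE y in M. norm (g y * ((\<Phi> (X i) y - \<Phi> s y) / (X i - s))) \<le> \<bar>g y\<bar> * L" for i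
      unfolding real_norm_def abs_mult by (intro AE_I2 mult_left_mono lip) auto
  qed (use g in auto)
  moreover have "(\<integral>y. g y * ((\<Phi> (X i) y - \<Phi> s y) / (X i - s)) \<partial>M) =
      ((\<integral>y. g y * \<Phi> (X i) y \<partial>M) - (\<integral>y. g y * \<Phi> s y \<partial>M)) / (X i - s)" for i
  proof -
    have "(\<integral>y. g y * ((\<Phi> (X i) y - \<Phi> s y) / (X i - s)) \<partial>M) =
        (\<integral>y. (g y * \<Phi> (X i) y - g y * \<Phi> s y) / (X i - s) \<partial>M)"
      by (intro Bochner_Integration.integral_cong) (auto simp: algebra_simps)
    also have "\<dots> = (\<integral>y. g y * \<Phi> (X i) y - g y * \<Phi> s y \<partial>M) / (X i - s)"
      by simp
    finally show ?thesis using int X s by (simp add: Bochner_Integration.integral_diff)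
  qed
  ultimately show "((\<lambda>z. ((\<integral>y. g y * \<Phi> z y \<partial>M) - (\<integral>y. g y * \<Phi> s y \<partial>M)) / (z - s)) \<circ> X)
      \<longlonglongrightarrow> (\<integral>y. g y * D s y \<partial>M)"
    unfolding o_def by (simp only:)
qed

lemma bounded_compact_support:
  fixes \<xi> :: "'a::euclidean_space \<Rightarrow> real"
  assumes "smooth_fn \<xi>" "compact S" "\<And>w. w \<notin> S \<Longrightarrow> \<xi> w = 0"
  shows "\<exists>M\<ge>0. \<forall>w. \<bar>\<xi> w\<bar> \<le> M"
proof -
  have "compact (\<xi> ` S)" by (intro compact_continuous_image smooth_fn_continuous_on assms)
  then obtain M where "\<forall>x\<in>\<xi> ` S. norm x \<le> M" using compact_imp_bounded bounded_iff by blast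
  with assms(3) have "\<bar>\<xi> w\<bar> \<le> max M 0" for w by (cases "w \<in> S") (auto simp: le_max_iff_disj)
  then show ?thesis by (intro exI[of _ "max M 0"]) auto
qed

context step_two begin

section \<open>Horizontal vector fields and their commutators\<close>

lemma linear_B: "linear (B x)" using bilin by (simp add: bilinear_def)

lemma X_eq: "smooth_fn \<xi> \<Longrightarrow> X i \<xi> w = pd (e i) \<xi> w + B w (e i) / 2 * pd T \<xi> w"
  by (simp add: linear_add[OF linear_pd] linear_scale[OF linear_pd])

lemma smooth_X: "smooth_fn \<xi> \<Longrightarrow> smooth_fn (X i \<xi>)"
proof -
  assume \<xi>: "smooth_fn \<xi>"
  have "linear (\<lambda>w. B w (e i))" using bilin by (simp add: bilinear_def)
  then have "smooth_fn (\<lambda>w. pd (e i) \<xi> w + B w (e i) / 2 * pd T \<xi> w)"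
    by (intro smooth_fn.add smooth_fn.mult smooth_fn_pd \<xi> smooth_fn_divide smooth_fn_linear)
  then show ?thesis by (simp add: X_eq[OF \<xi>])
qed

lemma X_mult: "smooth_fn \<xi> \<Longrightarrow> smooth_fn \<eta> \<Longrightarrow> X i (\<lambda>w. \<xi> w * \<eta> w) w = X i \<xi> w * \<eta> w + \<xi> w * X i \<eta> w"
  by (rule pd_mult)

lemma X_support: "smooth_fn \<xi> \<Longrightarrow> compact S \<Longrightarrow> (\<And>w. w \<notin> S \<Longrightarrow> \<xi> w = 0) \<Longrightarrow> w \<notin> S \<Longrightarrow> X i \<xi> w = 0"
  by (rule smooth_fn_eq_0_outside_pd) (auto intro: compact_imp_closed)

text \<open>Each field contributes one half of the bracket through the derivative of its
  coefficient, by skew symmetry of B; the second derivatives cancel.\<close>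

lemma X_commutator:
  assumes \<xi>: "smooth_fn \<xi>"
  shows "X i (X j \<xi>) w - X j (X i \<xi>) w = B (e i) (e j) * pd T \<xi> w"
proof -
  have lin: "linear (\<lambda>w. B w (e j))" for j using bilin by (simp add: bilinear_def)
  have s: "smooth_fn (\<lambda>w. B w (e j) / 2)" for j by (intro smooth_fn_divide smooth_fn_linear lin)
  have pdB: "pd v (\<lambda>w. B w (e j) / 2) w = B v (e j) / 2" for v j
    by (rule pd_linear) (auto intro!: linearI simp: B_simps add_divide_distrib)
  have Xj: "X j \<xi> = (\<lambda>w. pd (e j) \<xi> w + B w (e j) / 2 * pd T \<xi> w)" for j
    by (rule ext) (rule X_eq[OF \<xi>])
  have "X i (X j \<xi>) w = pd (e i) (X j \<xi>) w + B w (e i) / 2 * pd T (X j \<xi>) w" for i j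
    by (rule X_eq[OF smooth_X[OF \<xi>]])
  then have "X i (X j \<xi>) w = pd (e i) (pd (e j) \<xi>) w
      + (B (e i) (e j) / 2 * pd T \<xi> w + B w (e j) / 2 * pd (e i) (pd T \<xi>) w)
      + B w (e i) / 2 * (pd T (pd (e j) \<xi>) w + B w (e j) / 2 * pd T (pd T \<xi>) w)" for i j
    unfolding Xj using \<xi> s by (simp add: pd_add pd_mult smooth_fn_pd smooth_fn.mult pdB B_simps
        del: times_divide_eq_left times_divide_eq_right)
  then show ?thesis
    using pd_commute[OF \<xi>, of "e i" "e j"] pd_commute[OF \<xi>, of "e i" T] pd_commute[OF \<xi>, of "e j" T]
      skew[of "e i" "e j"]
    by (simp add: algebra_simps)
qed

text \<open>
  The vertical derivative \<open>T\<close> is a commutator of horizontal ones, hence a horizontal divergence.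
  So is therefore the derivative of a bump function along any one-parameter family of group
  translations and dilations; \<open>A\<close>, \<open>C j\<close> and \<open>D\<close> belong to the generators of dilations,
  horizontal and vertical translations.
\<close>

lemma vertical_divergence:
  assumes \<xi>: "smooth_fn \<xi>" "compact S" "\<And>w. w \<notin> S \<Longrightarrow> \<xi> w = 0"
  shows "\<exists>Y. (\<forall>i. smooth_fn (Y i) \<and> (\<forall>w. w \<notin> S \<longrightarrow> Y i w = 0)) \<and>
    (\<forall>w. (\<Sum>i\<in>UNIV. X i (Y i) w) = pd T \<xi> w)"
proof -
  obtain i1 i2 where b: "B (e i1) (e i2) *\<^sub>R T = T" using bracket by blast
  have bT: "B (e i1) (e i2) * pd T \<xi> w = pd T \<xi> w" for w
    using linear_scale[OF linear_pd[where x = w, OF \<xi>(1)], of "B (e i1) (e i2)" T] unfolding b by simp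
  show ?thesis
  proof (cases "i1 = i2")
    case True
    then have "T = 0" using b by (simp add: B_simps)
    then have "pd T \<xi> w = 0" for w using linear_0[OF linear_pd[OF \<xi>(1)]] by simp
    moreover have "X i (\<lambda>_. 0) w = 0" for i w by (rule pd_const)
    ultimately show ?thesis by (intro exI[of _ "\<lambda>_ _. 0"]) (auto intro: smooth_fn.const)
  next
    case False
    \<comment> \<open>The field with components \<open>X i2 \<xi>\<close> and
      \<open>- X i1 \<xi>\<close> has the commutator as its divergence, which is
      \<open>B (e i1) (e i2) * pd T \<xi>\<close>; by the choice of the indices this is
      \<open>pd T \<xi>\<close>.\<close>
    define Y where "Y i = (if i = i1 then X i2 \<xi> else if i = i2 then (\<lambda>w. - X i1 \<xi> w) else (\<lambda>_. 0))" for i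
    have "smooth_fn (Y i)" for i
      unfolding Y_def by (auto intro!: smooth_X \<xi> smooth_fn_minus smooth_fn.const)
    moreover have "Y i w = 0" if "w \<notin> S" for i w
      using X_support[OF \<xi> that] by (simp add: Y_def)
    moreover have "(\<Sum>i\<in>UNIV. X i (Y i) w) = pd T \<xi> w" for w
    proof -
      have "X i (Y i) w = 0" if "i \<notin> {i1, i2}" for i
      proof -
        have "Y i = (\<lambda>_. 0)" using that by (auto simp: Y_def)
        then show ?thesis by (simp add: pd_const)
      qed
      then have "(\<Sum>i\<in>UNIV. X i (Y i) w) = (\<Sum>i\<in>{i1, i2}. X i (Y i) w)"
        by (intro sum.mono_neutral_right) auto
      also have "\<dots> = X i1 (X i2 \<xi>) w + X i2 (\<lambda>w. - X i1 \<xi> w) w"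
        using False by (simp add: Y_def)
      also have "X i2 (\<lambda>w. - X i1 \<xi> w) w = - X i2 (X i1 \<xi>) w"
        by (rule pd_minus[OF smooth_X[OF \<xi>(1)]])
      finally show ?thesis using X_commutator[OF \<xi>(1), of i1 w i2] bT by simp
    qed
    ultimately show ?thesis by blast
  qed
qed

text \<open>The fields \<open>X i\<close> are invariant under left translations. Moving the centre
  of a bump, however, differentiates it along \<open>e j + (B (e j) w / 2) *\<^sub>R T\<close>, the
  generator of left translations, and changing its radius along \<open>w + f w *\<^sub>R T\<close>,
  the generator of dilations. The discrepancies are vertical derivatives, which
  \<open>vertical_divergence\<close> absorbs.\<close>

lemma divergence_forms:
  assumes \<phi>: "smooth_fn \<phi>" "compact S" "\<And>w. w \<notin> S \<Longrightarrow> \<phi> w = 0"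
  shows "\<exists>A C D M. 0 \<le> M \<and> (\<forall>i. smooth_fn (A i) \<and> (\<forall>j. smooth_fn (C j i)) \<and> smooth_fn (D i)) \<and>
    (\<forall>i w. w \<notin> S \<longrightarrow> A i w = 0 \<and> (\<forall>j. C j i w = 0) \<and> D i w = 0) \<and>
    (\<forall>i w. \<bar>A i w\<bar> \<le> M \<and> (\<forall>j. \<bar>C j i w\<bar> \<le> M) \<and> \<bar>D i w\<bar> \<le> M) \<and>
    (\<forall>i w. \<bar>X i (A i) w\<bar> \<le> M \<and> (\<forall>j. \<bar>X i (C j i) w\<bar> \<le> M) \<and> \<bar>X i (D i) w\<bar> \<le> M) \<and>
    (\<forall>w. (\<Sum>i\<in>UNIV. X i (A i) w) = Q * \<phi> w + pd (w + f w *\<^sub>R T) \<phi> w) \<and>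
    (\<forall>j w. (\<Sum>i\<in>UNIV. X i (C j i) w) = pd (e j + (B (e j) w / 2) *\<^sub>R T) \<phi> w) \<and>
    (\<forall>w. (\<Sum>i\<in>UNIV. X i (D i) w) = pd T \<phi> w)"
proof -
  have smf: "smooth_fn (\<lambda>w. 2 * f w)" by (intro smooth_fn_cmult smooth_fn_linear f_lin)
  have smB: "smooth_fn (B (e j))" for j by (intro smooth_fn_linear linear_B)
  note lp = linear_pd[OF \<phi>(1)]
  have "\<exists>Y. (\<forall>i. smooth_fn (Y i) \<and> (\<forall>w. w \<notin> S \<longrightarrow> Y i w = 0)) \<and>
      (\<forall>w. (\<Sum>i\<in>UNIV. X i (Y i) w) = pd T (\<lambda>w. 2 * f w * \<phi> w) w)"
    by (rule vertical_divergence[OF _ \<phi>(2)]) (auto intro: smf \<phi> smooth_fn.mult simp: \<phi>(3))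
  then obtain YA where YA: "\<And>i. smooth_fn (YA i)" "\<And>i w. w \<notin> S \<Longrightarrow> YA i w = 0"
    "\<And>w. (\<Sum>i\<in>UNIV. X i (YA i) w) = pd T (\<lambda>w. 2 * f w * \<phi> w) w" by blast
  have "\<forall>j. \<exists>Y. (\<forall>i. smooth_fn (Y i) \<and> (\<forall>w. w \<notin> S \<longrightarrow> Y i w = 0)) \<and>
      (\<forall>w. (\<Sum>i\<in>UNIV. X i (Y i) w) = pd T (\<lambda>w. B (e j) w * \<phi> w) w)"
    by (rule allI, rule vertical_divergence[OF _ \<phi>(2)]) (auto intro: smB \<phi> smooth_fn.mult simp: \<phi>(3))
  from choice[OF this] obtain YC where YC: "\<And>i j. smooth_fn (YC j i)"
    "\<And>i j w. w \<notin> S \<Longrightarrow> YC j i w = 0"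
    "\<And>j w. (\<Sum>i\<in>UNIV. X i (YC j i) w) = pd T (\<lambda>w. B (e j) w * \<phi> w) w" by blast
  obtain D where D: "\<And>i. smooth_fn (D i)" "\<And>i w. w \<notin> S \<Longrightarrow> D i w = 0"
    "\<And>w. (\<Sum>i\<in>UNIV. X i (D i) w) = pd T \<phi> w"
    using vertical_divergence[OF \<phi>] by blast
  \<comment> \<open>The fields \<open>(w \<bullet> e i) * \<phi> w\<close> have as divergence
    \<open>CARD('m)\<close> times \<phi> plus the derivative of \<phi> along the horizontal part of
    w. What is missing to the dilation generator and to Q is exactly the vertical derivative of
    \<open>2 * f w * \<phi> w\<close>, supplied by \<open>YA\<close>.\<close>
  define A where "A i = (\<lambda>w. (w \<bullet> e i) * \<phi> w + YA i w)" for i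
  \<comment> \<open>\<open>X j \<phi>\<close> and the derivative along the generator of translations
    differ by \<open>B (e j) w * pd T \<phi> w\<close>; this is a vertical derivative because
    \<open>B (e j)\<close> vanishes on T.\<close>
  define C where "C j i = (\<lambda>w. (if i = j then 1 else 0) * \<phi> w + YC j i w)" for i j
  have smA: "smooth_fn (A i)" for i
    unfolding A_def by (intro smooth_fn.add smooth_fn.mult smooth_fn.inner \<phi> YA)
  have smC: "smooth_fn (C j i)" for i j
    unfolding C_def by (intro smooth_fn.add smooth_fn_cmult \<phi> YC)
  have A0: "A i w = 0" "C j i w = 0" if "w \<notin> S" for i j w
    using that by (simp_all add: A_def C_def \<phi>(3) YA YC)
  have SA: "(\<Sum>i\<in>UNIV. X i (A i) w) = Q * \<phi> w + pd (w + f w *\<^sub>R T) \<phi> w" for w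
  proof -
    have lin_e: "linear (\<lambda>w. w \<bullet> e i)" for i by (intro bounded_linear.linear bounded_linear_inner_left)
    have "X i (A i) w = X i (\<lambda>w. w \<bullet> e i) w * \<phi> w + (w \<bullet> e i) * X i \<phi> w + X i (YA i) w" for i
      unfolding A_def by (subst pd_add) (auto intro!: smooth_fn.intros \<phi> YA simp: X_mult smooth_fn.inner \<phi>)
    moreover have "X i (\<lambda>w. w \<bullet> e i) w = 1" for i
      by (subst pd_linear[OF lin_e]) (simp add: inner_add_left e)
    ultimately have "(\<Sum>i\<in>UNIV. X i (A i) w) = real CARD('m) * \<phi> w + (\<Sum>i\<in>UNIV. (w \<bullet> e i) * X i \<phi> w)
        + pd T (\<lambda>w. 2 * f w * \<phi> w) w"
      by (simp add: sum.distrib YA(3))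
    also have "pd T (\<lambda>w. 2 * f w * \<phi> w) w = 2 * f T * \<phi> w + 2 * f w * pd T \<phi> w"
      using pd_linear[OF linear_compose_scale_right[OF f_lin, of 2], of T w]
      by (subst pd_mult[OF smf \<phi>(1)]) simp
    also have "(\<Sum>i\<in>UNIV. (w \<bullet> e i) * X i \<phi> w) = pd (\<Sum>i\<in>UNIV. (w \<bullet> e i) *\<^sub>R (e i + (B w (e i) / 2) *\<^sub>R T)) \<phi> w"
      by (simp only: linear_sum[OF lp] linear_scale[OF lp] real_scaleR_def)
    also have "(\<Sum>i\<in>UNIV. (w \<bullet> e i) *\<^sub>R (e i + (B w (e i) / 2) *\<^sub>R T)) = w - f w *\<^sub>R T"
    proof -
      have "(\<Sum>i\<in>UNIV. (w \<bullet> e i) * B w (e i)) = B w (\<Sum>i\<in>UNIV. (w \<bullet> e i) *\<^sub>R e i)"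
        by (simp add: linear_sum[OF linear_B] linear_scale[OF linear_B])
      also have "(\<Sum>i\<in>UNIV. (w \<bullet> e i) *\<^sub>R e i) = w - f w *\<^sub>R T"
        using decomp[of w] by (metis add_diff_cancel_right')
      \<comment> \<open>The twists of the frame add up to B applied twice to w, which is 0: the
        field with coefficients \<open>w \<bullet> e i\<close> has no vertical component.\<close>
      finally have *: "(\<Sum>i\<in>UNIV. (w \<bullet> e i) * B w (e i)) = 0" by (simp add: B_simps)
      have "(\<Sum>i\<in>UNIV. (w \<bullet> e i) *\<^sub>R (e i + (B w (e i) / 2) *\<^sub>R T)) =
          (\<Sum>i\<in>UNIV. (w \<bullet> e i) *\<^sub>R e i) + ((\<Sum>i\<in>UNIV. (w \<bullet> e i) * B w (e i)) / 2) *\<^sub>R T"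
        by (simp add: scaleR_add_right sum.distrib sum_divide_distrib scaleR_sum_left)
      then show ?thesis using * decomp[of w] by (metis add_diff_cancel_right' add.right_neutral div_0 scaleR_zero_left)
    qed
    also have "pd (w - f w *\<^sub>R T) \<phi> w = pd (w + f w *\<^sub>R T) \<phi> w - 2 * f w * pd T \<phi> w"
      by (simp add: linear_add[OF lp] linear_diff[OF lp] linear_scale[OF lp])
    finally show ?thesis by (simp add: Q_eq algebra_simps)
  qed
  have SC: "(\<Sum>i\<in>UNIV. X i (C j i) w) = pd (e j + (B (e j) w / 2) *\<^sub>R T) \<phi> w" for j w
  proof -
    have "X i (C j i) w = (if i = j then 1 else 0) * X i \<phi> w + X i (YC j i) w" for i
      unfolding C_def by (subst pd_add) (auto intro!: smooth_fn_cmult \<phi> YC smooth_fn.const simp: pd_cmult \<phi> simp del: mult_1_left)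
    then have "(\<Sum>i\<in>UNIV. X i (C j i) w) = (\<Sum>i\<in>UNIV. (if i = j then 1 else 0) * X i \<phi> w) + pd T (\<lambda>w. B (e j) w * \<phi> w) w"
      by (simp only: sum.distrib YC(3))
    also have "(\<Sum>i\<in>UNIV. (if i = j then 1 else 0) * X i \<phi> w) = X j \<phi> w"
      by (simp add: if_distrib[where f = "\<lambda>c. c * _"] cong: if_cong)
    also have "pd T (\<lambda>w. B (e j) w * \<phi> w) w = B (e j) w * pd T \<phi> w"
      by (subst pd_mult[OF smB \<phi>(1)]) (simp add: pd_linear[OF linear_B] B_simps)
    finally show ?thesis
      using skew[of w "e j"] by (simp add: linear_add[OF lp] linear_diff[OF lp] linear_scale[OF lp])
  qed
  define mx where "mx \<xi> = (SOME M. 0 \<le> M \<and> (\<forall>w. \<bar>\<xi> w\<bar> \<le> M))" for \<xi> :: "'a \<Rightarrow> real"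
  have mx: "0 \<le> mx \<xi> \<and> (\<forall>w. \<bar>\<xi> w\<bar> \<le> mx \<xi>)"
    if "smooth_fn \<xi>" "\<And>w. w \<notin> S \<Longrightarrow> \<xi> w = 0" for \<xi>
    unfolding mx_def by (rule someI_ex) (rule bounded_compact_support[OF that(1) \<phi>(2) that(2)])
  define M1 M2 M3 M4 M5 M6 where M_defs: "M1 i = mx (A i)" "M2 i = mx (X i (A i))" "M3 i = mx (D i)"
    "M4 i = mx (X i (D i))" "M5 j i = mx (C j i)" "M6 j i = mx (X i (C j i))" for i j
  have M: "\<And>i. 0 \<le> M1 i" "\<And>i w. \<bar>A i w\<bar> \<le> M1 i" "\<And>i. 0 \<le> M2 i" "\<And>i w. \<bar>X i (A i) w\<bar> \<le> M2 i"
    "\<And>i. 0 \<le> M3 i" "\<And>i w. \<bar>D i w\<bar> \<le> M3 i" "\<And>i. 0 \<le> M4 i" "\<And>i w. \<bar>X i (D i) w\<bar> \<le> M4 i"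
    "\<And>i j. 0 \<le> M5 j i" "\<And>i j w. \<bar>C j i w\<bar> \<le> M5 j i" "\<And>i j. 0 \<le> M6 j i" "\<And>i j w. \<bar>X i (C j i) w\<bar> \<le> M6 j i"
    unfolding M_defs
    using mx[OF smA A0(1)] mx[OF smooth_X[OF smA] X_support[OF smA \<phi>(2) A0(1)]]
      mx[OF D(1,2)] mx[OF smooth_X[OF D(1)] X_support[OF D(1) \<phi>(2) D(2)]]
      mx[OF smC A0(2)] mx[OF smooth_X[OF smC] X_support[OF smC \<phi>(2) A0(2)]] by simp_all
  define M where "M = (\<Sum>i\<in>UNIV. M1 i) + (\<Sum>i\<in>UNIV. M2 i) + (\<Sum>i\<in>UNIV. M3 i) + (\<Sum>i\<in>UNIV. M4 i)
    + (\<Sum>q\<in>UNIV. M5 (fst q) (snd q)) + (\<Sum>q\<in>UNIV. M6 (fst q) (snd q))"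
  have nn: "0 \<le> (\<Sum>i\<in>UNIV. M1 i)" "0 \<le> (\<Sum>i\<in>UNIV. M2 i)" "0 \<le> (\<Sum>i\<in>UNIV. M3 i)" "0 \<le> (\<Sum>i\<in>UNIV. M4 i)"
    "0 \<le> (\<Sum>q\<in>UNIV. M5 (fst q) (snd q))" "0 \<le> (\<Sum>q\<in>UNIV. M6 (fst q) (snd q))"
    using M by (auto intro!: sum_nonneg)
  have le: "M1 i \<le> M" "M2 i \<le> M" "M3 i \<le> M" "M4 i \<le> M" for i
    using nn M member_le_sum[of i UNIV M1] member_le_sum[of i UNIV M2] member_le_sum[of i UNIV M3]
      member_le_sum[of i UNIV M4] unfolding M_def by auto
  have le2: "M5 j i \<le> M" "M6 j i \<le> M" for i j
    using nn M member_le_sum[of "(j, i)" UNIV "\<lambda>q. M5 (fst q) (snd q)"]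
      member_le_sum[of "(j, i)" UNIV "\<lambda>q. M6 (fst q) (snd q)"] unfolding M_def by auto
  have "0 \<le> M" using nn by (simp add: M_def)
  moreover have "\<bar>A i w\<bar> \<le> M" "\<bar>X i (A i) w\<bar> \<le> M" "\<bar>D i w\<bar> \<le> M" "\<bar>X i (D i) w\<bar> \<le> M"
    "\<bar>C j i w\<bar> \<le> M" "\<bar>X i (C j i) w\<bar> \<le> M" for i j w
    using M(2)[of i w] M(4)[of i w] M(6)[of i w] M(8)[of i w] M(10)[of j i w] M(12)[of i w j] le[of i] le2[of j i]
    by linarith+
  ultimately show ?thesis
    using smA smC D A0 SA SC by (intro exI[of _ A] exI[of _ C] exI[of _ D] exI[of _ M]) auto
qed

text \<open>Coordinates in which a bump with centre z and radius \<rho> becomes a fixed profile: the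
  inverse of \<open>\<lambda>w. gmult z (dil \<rho> w)\<close>, an affine map with linear part
  \<open>L\<close>.\<close>

definition W where "W z \<rho> y = dil (1 / \<rho>) (gmult (- z) y)"

definition L where "L z \<rho> v = dil (1 / \<rho>) (v - (B z v / 2) *\<^sub>R T)"

lemma W_eq: "W z \<rho> y = L z \<rho> y + W z \<rho> 0"
proof -
  have "gmult (- z) y = (y - (B z y / 2) *\<^sub>R T) + gmult (- z) 0"
    by (simp add: mult_def B_simps)
  then show ?thesis by (simp only: W_def L_def dil_add)
qed

lemma linear_L: "linear (L z \<rho>)"
proof (rule linearI)
  show "L z \<rho> (x + y) = L z \<rho> x + L z \<rho> y" for x y
    unfolding L_def dil_add[symmetric] by (rule arg_cong[where f = "dil (1 / \<rho>)"])
      (simp add: B_simps add_divide_distrib scaleR_add_left)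
  show "L z \<rho> (c *\<^sub>R x) = c *\<^sub>R L z \<rho> x" for c x
    unfolding L_def dil_scale[symmetric] by (rule arg_cong[where f = "dil (1 / \<rho>)"])
      (simp add: B_simps scaleR_diff_right)
qed

lemma smooth_W: "smooth_fn \<xi> \<Longrightarrow> smooth_fn (\<lambda>y. \<xi> (W z \<rho> y))"
proof (erule smooth_fn_compose)
  fix b :: 'a
  have "linear (\<lambda>y. L z \<rho> y \<bullet> b)"
    using linear_compose[OF linear_L bounded_linear.linear[OF bounded_linear_inner_left]] by (simp add: o_def)
  then have "smooth_fn (\<lambda>y. L z \<rho> y \<bullet> b + W z \<rho> 0 \<bullet> b)"
    by (intro smooth_fn.add smooth_fn_linear smooth_fn.const)
  then show "smooth_fn (\<lambda>y. W z \<rho> y \<bullet> b)"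
    by (simp only: inner_add_left[symmetric] W_eq[symmetric])
qed

lemma pd_W:
  assumes "smooth_fn \<xi>"
  shows "pd v (\<lambda>y. \<xi> (W z \<rho> y)) y = pd (L z \<rho> v) \<xi> (W z \<rho> y)"
proof (rule pd_eqI)
  have "(L z \<rho> has_derivative L z \<rho>) (at y)"
    using linear_L by (simp add: linear_imp_has_derivative)
  then have "((\<lambda>y. L z \<rho> y + W z \<rho> 0) has_derivative L z \<rho>) (at y)"
    by (auto intro: derivative_eq_intros)
  then have "(W z \<rho> has_derivative L z \<rho>) (at y)" by (simp only: W_eq[symmetric])
  then show "((\<lambda>y. \<xi> (W z \<rho> y)) has_derivative (\<lambda>v. pd (L z \<rho> v) \<xi> (W z \<rho> y))) (at y)"
    by (rule has_derivative_compose[OF _ smooth_fn_has_derivative[OF assms]])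
qed

lemma dil_frame: "dil \<rho> (e i + k *\<^sub>R T) = \<rho> *\<^sub>R e i + (\<rho>\<^sup>2 * k) *\<^sub>R T"
  by (cases "T = 0") (simp_all add: step_dil_def f_simps T0 e algebra_simps)

text \<open>Left invariance removes the translation by z, and a horizontal field is homogeneous of
  degree one under dilations.\<close>

lemma X_W:
  assumes "smooth_fn \<xi>" "0 < \<rho>"
  shows "X i (\<lambda>y. \<xi> (W z \<rho> y)) y = X i \<xi> (W z \<rho> y) / \<rho>"
proof -
  have BW: "B (W z \<rho> y) (e i) = (B y (e i) - B z (e i)) / \<rho>"
    by (simp add: W_def B_dil B_mult B_simps)
  have "L z \<rho> (e i + (B y (e i) / 2) *\<^sub>R T) = dil (1 / \<rho>) (e i + ((B y (e i) - B z (e i)) / 2) *\<^sub>R T)"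
    by (simp add: L_def B_simps diff_divide_distrib scaleR_diff_left add_diff_eq)
  also have "\<dots> = (1 / \<rho>) *\<^sub>R (e i + (B (W z \<rho> y) (e i) / 2) *\<^sub>R T)"
    unfolding dil_frame BW scaleR_add_right scaleR_scaleR by (simp add: power2_eq_square)
  finally have "L z \<rho> (e i + (B y (e i) / 2) *\<^sub>R T) = (1 / \<rho>) *\<^sub>R (e i + (B (W z \<rho> y) (e i) / 2) *\<^sub>R T)" .
  then show ?thesis
    by (simp add: pd_W[OF assms(1)] linear_scale[OF linear_pd[OF assms(1)]])
qed

lemma W_inverse: "0 < \<rho> \<Longrightarrow> gmult z (dil \<rho> (W z \<rho> y)) = y"
  by (simp add: W_def dil_inverse mult_cancel)

text \<open>The velocity is decomposed along the generators of dilations and of horizontal and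
  vertical translations. The coefficient \<open>f z' - B (z s) z' / 2\<close> is the vertical part
  of the derivative of \<open>gmult (- z s) (z t)\<close> at t = s, the velocity of the centre
  pulled back to the identity. It is divided by \<rho>^2 because vertical directions have degree
  two.\<close>

lemma W_time_derivative:
  assumes z: "(z has_vector_derivative z') (at s within S)"
    and \<rho>: "(\<rho> has_real_derivative \<rho>') (at s within S)" and pos: "0 < \<rho> s"
    and w: "w = W (z s) (\<rho> s) y"
  shows "((\<lambda>s. W (z s) (\<rho> s) y) has_vector_derivative
    - ((\<rho>' / \<rho> s) *\<^sub>R (w + f w *\<^sub>R T)
       + (\<Sum>j\<in>UNIV. (z' \<bullet> e j / \<rho> s) *\<^sub>R (e j + (B (e j) w / 2) *\<^sub>R T))
       + ((f z' - B (z s) z' / 2) / (\<rho> s)\<^sup>2) *\<^sub>R T)) (at s within S)"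
proof -
  define u where "u t = gmult (- z t) y" for t
  define u' where "u' = - z' - (B z' y / 2) *\<^sub>R T"
  define r' where "r' = - (\<rho>' / (\<rho> s)\<^sup>2)"
  have lB: "bounded_linear (\<lambda>v. B v y)" using bilin by (auto simp: bilinear_def linear_conv_bounded_linear[symmetric])
  have lf: "bounded_linear f" using f_lin by (simp add: linear_conv_bounded_linear)
  have u_eq: "u = (\<lambda>t. - z t + y + (B (- z t) y / 2) *\<^sub>R T)" by (simp add: u_def mult_def fun_eq_iff)
  have ud: "(u has_vector_derivative u') (at s within S)"
  proof -
    have "((\<lambda>t. B (z t) y) has_real_derivative B z' y) (at s within S)"
      using bounded_linear.has_vector_derivative[OF lB z] by (simp add: has_real_derivative_iff_has_vector_derivative)
    then have "((\<lambda>t. - z t + y + (- B (z t) y / 2) *\<^sub>R T) has_vector_derivative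
        - z' + 0 + (- B z' y / 2) *\<^sub>R T) (at s within S)"
      by (auto intro!: derivative_eq_intros z)
    then show ?thesis by (simp add: u_eq u'_def B_simps)
  qed
  have rd: "((\<lambda>t. 1 / \<rho> t) has_real_derivative r') (at s within S)"
    using \<rho> pos by (auto intro!: derivative_eq_intros simp: r'_def power2_eq_square)
  have fd: "((\<lambda>t. f (u t)) has_real_derivative f u') (at s within S)"
    using bounded_linear.has_vector_derivative[OF lf ud] by (simp add: has_real_derivative_iff_has_vector_derivative)
  have cd: "((\<lambda>t. ((1 / \<rho> t)\<^sup>2 - 1 / \<rho> t) * f (u t)) has_real_derivative
      ((2 * (1 / \<rho> s) * r' - r') * f (u s) + ((1 / \<rho> s)\<^sup>2 - 1 / \<rho> s) * f u')) (at s within S)"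
    by (rule derivative_eq_intros rd fd refl)+ simp
  have "((\<lambda>t. (1 / \<rho> t) *\<^sub>R u t + (((1 / \<rho> t)\<^sup>2 - 1 / \<rho> t) * f (u t)) *\<^sub>R T) has_vector_derivative
      ((1 / \<rho> s) *\<^sub>R u' + r' *\<^sub>R u s) +
      ((2 * (1 / \<rho> s) * r' - r') * f (u s) + ((1 / \<rho> s)\<^sup>2 - 1 / \<rho> s) * f u') *\<^sub>R T) (at s within S)"
    using has_vector_derivative_add[OF has_vector_derivative_scaleR[OF rd ud]
      has_vector_derivative_scaleR[OF cd has_vector_derivative_const[of T]]] by simp
  moreover have "W (z t) (\<rho> t) y = (1 / \<rho> t) *\<^sub>R u t + (((1 / \<rho> t)\<^sup>2 - 1 / \<rho> t) * f (u t)) *\<^sub>R T" for t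
    by (simp add: W_def u_def dil_def)
  moreover have "((1 / \<rho> s) *\<^sub>R u' + r' *\<^sub>R u s) +
      ((2 * (1 / \<rho> s) * r' - r') * f (u s) + ((1 / \<rho> s)\<^sup>2 - 1 / \<rho> s) * f u') *\<^sub>R T =
    - ((\<rho>' / \<rho> s) *\<^sub>R (w + f w *\<^sub>R T)
       + (\<Sum>j\<in>UNIV. (z' \<bullet> e j / \<rho> s) *\<^sub>R (e j + (B (e j) w / 2) *\<^sub>R T))
       + ((f z' - B (z s) z' / 2) / (\<rho> s)\<^sup>2) *\<^sub>R T)"
  proof -
    define R where "R = \<rho> s"
    have R: "0 < R" using pos by (simp add: R_def)
    have us: "u s = R *\<^sub>R w + ((R\<^sup>2 - R) * f w) *\<^sub>R T"
      using R by (simp add: w W_def u_def R_def dil_inverse flip: dil_def)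
    have fus: "f (u s) = R\<^sup>2 * f w"
      using R by (simp add: w W_def u_def R_def dil_inverse flip: f_dil)
    have y: "y = gmult (z s) (u s)" by (simp add: u_def mult_cancel)
    have By: "B z' y = B z' (z s) + R * B z' w"
      by (subst y) (simp add: B_mult us B_simps)
    have z'_eq: "(\<Sum>j\<in>UNIV. (z' \<bullet> e j) *\<^sub>R e j) = z' - f z' *\<^sub>R T"
      using decomp[of z'] by (metis add_diff_cancel_right')
    have "(\<Sum>j\<in>UNIV. (z' \<bullet> e j) * B (e j) w) = B (\<Sum>j\<in>UNIV. (z' \<bullet> e j) *\<^sub>R e j) w"
      using bilin by (simp add: bilinear_def linear_sum[of "\<lambda>v. B v w"] B_simps)
    also have "\<dots> = B z' w" by (simp add: z'_eq B_simps)
    finally have Bsum: "(\<Sum>j\<in>UNIV. (z' \<bullet> e j) * B (e j) w) = B z' w" .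
    have "(\<Sum>j\<in>UNIV. (z' \<bullet> e j / R) *\<^sub>R (e j + (B (e j) w / 2) *\<^sub>R T)) =
        (1 / R) *\<^sub>R (\<Sum>j\<in>UNIV. (z' \<bullet> e j) *\<^sub>R e j) + ((\<Sum>j\<in>UNIV. (z' \<bullet> e j) * B (e j) w) / (2 * R)) *\<^sub>R T"
      by (simp add: scaleR_add_right sum.distrib sum_divide_distrib scaleR_sum_left scaleR_sum_right mult.commute)
    then have sum_eq: "(\<Sum>j\<in>UNIV. (z' \<bullet> e j / R) *\<^sub>R (e j + (B (e j) w / 2) *\<^sub>R T)) =
        (1 / R) *\<^sub>R z' + (B z' w / (2 * R) - f z' / R) *\<^sub>R T"
      unfolding z'_eq Bsum by (simp add: scaleR_diff_right scaleR_diff_left)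
    have skw: "B (z s) z' = - B z' (z s)" by (rule skew)
    show ?thesis
    \<comment> \<open>\<open>f T = 1\<close> is available only for nonzero T; otherwise all vertical
      terms vanish. In the main case the coefficients of w, z' and T are compared
      separately.\<close>
    proof (cases "T = 0")
      case True
      have "r' * R = - (\<rho>' / R)" using R by (simp add: r'_def R_def[symmetric] power2_eq_square)
      with True show ?thesis
        unfolding R_def[symmetric] sum_eq us u'_def by simp
    next
      case False
      have fu': "f u' = - f z' - B z' y / 2" using False by (simp add: u'_def f_simps T0)
      have lhs: "((1 / R) *\<^sub>R u' + r' *\<^sub>R u s) +
        ((2 * (1 / R) * r' - r') * f (u s) + ((1 / R)\<^sup>2 - 1 / R) * f u') *\<^sub>R T =
        (r' * R) *\<^sub>R w + (- (1 / R)) *\<^sub>R z' +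
        (- (1 / R) * (B z' y / 2) + r' * ((R\<^sup>2 - R) * f w) +
          ((2 * (1 / R) * r' - r') * f (u s) + ((1 / R)\<^sup>2 - 1 / R) * f u')) *\<^sub>R T"
        unfolding us u'_def by (simp only: scaleR_add_right scaleR_diff_right scaleR_add_left scaleR_scaleR) simp
      have rhs: "- ((\<rho>' / R) *\<^sub>R (w + f w *\<^sub>R T) + ((1 / R) *\<^sub>R z' + (B z' w / (2 * R) - f z' / R) *\<^sub>R T)
          + ((f z' - B (z s) z' / 2) / R\<^sup>2) *\<^sub>R T) =
        (- (\<rho>' / R)) *\<^sub>R w + (- (1 / R)) *\<^sub>R z' +
        (- (\<rho>' / R * f w) - (B z' w / (2 * R) - f z' / R) - (f z' - B (z s) z' / 2) / R\<^sup>2) *\<^sub>R T"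
        by (simp only: scaleR_add_right scaleR_diff_left scaleR_minus_left scaleR_scaleR) simp
      have c1: "r' * R = - (\<rho>' / R)" using R by (simp add: r'_def R_def[symmetric] power2_eq_square)
      have c2: "- (1 / R) * (B z' y / 2) + r' * ((R\<^sup>2 - R) * f w) +
          ((2 * (1 / R) * r' - r') * f (u s) + ((1 / R)\<^sup>2 - 1 / R) * f u') =
        - (\<rho>' / R * f w) - (B z' w / (2 * R) - f z' / R) - (f z' - B (z s) z' / 2) / R\<^sup>2"
        unfolding fus fu' By skw r'_def R_def[symmetric] using R
        by (simp add: field_simps power2_eq_square)
      show ?thesis
        unfolding R_def[symmetric] sum_eq lhs rhs c1 c2 ..
    qed
  qed
  ultimately show ?thesis by simp
qed

end

section \<open>Bumps moving along the group\<close>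

context step_two begin

text \<open>The factor makes this the density of the image of \<phi> under
  \<open>\<lambda>w. gmult z (dil \<rho> w)\<close>, so the mass does not depend on z and
  \<rho>.\<close>

definition bump :: "('a \<Rightarrow> real) \<Rightarrow> 'a \<Rightarrow> real \<Rightarrow> 'a \<Rightarrow> real" where
  "bump \<phi> z \<rho> y = \<rho> powr - Q * \<phi> (W z \<rho> y)"

lemma smooth_bump: "smooth_fn \<phi> \<Longrightarrow> smooth_fn (bump \<phi> z \<rho>)"
  unfolding bump_def by (intro smooth_fn_cmult smooth_W)

lemma smooth_measurable: "smooth_fn \<xi> \<Longrightarrow> \<xi> \<in> borel_measurable lebesgue"
  by (intro borel_measurable_lebesgue_continuous smooth_fn_continuous_on)

lemma test_function_W:
  assumes "smooth_fn \<xi>" "compact S" "\<And>w. w \<notin> S \<Longrightarrow> \<xi> w = 0" "0 < \<rho>"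
    and "\<And>w. w \<in> S \<Longrightarrow> gmult z (dil \<rho> w) \<in> \<Omega>"
  shows "test_function \<Omega> (\<lambda>y. \<xi> (W z \<rho> y))"
  unfolding test_function_def
proof (intro conjI allI)
  show "C_diff k (\<lambda>y. \<xi> (W z \<rho> y))" for k by (intro C_diff_smooth_fn smooth_W assms)
  let ?K = "(\<lambda>w. gmult z (dil \<rho> w)) ` S"
  have "compact ?K"
    using assms(2) by (intro compact_continuous_image continuous_on_compose2[OF continuous_mult continuous_dil]) auto
  moreover have "?K \<subseteq> \<Omega>" using assms(5) by auto
  moreover have "\<xi> (W z \<rho> y) = 0" if "y \<notin> ?K" for y
  proof (rule assms(3))
    show "W z \<rho> y \<notin> S" using that W_inverse[OF assms(4), of z y] by (metis image_eqI)
  qed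
  ultimately show "\<exists>K. compact K \<and> K \<subseteq> \<Omega> \<and> (\<forall>y. y \<notin> K \<longrightarrow> \<xi> (W z \<rho> y) = 0)" by blast
qed

text \<open>Integration by parts, one component of the frame at a time. The test functions vanish
  off U, so only the integral of |G| over U enters.\<close>

lemma weak_gradient_bound:
  assumes wg: "weak_gradient E \<Omega> g G"
    and G: "set_borel_measurable lebesgue \<Omega> G" and \<Omega>: "open \<Omega>"
    and \<psi>: "\<And>i. smooth_fn (\<psi> i)" "compact S" "\<And>i w. w \<notin> S \<Longrightarrow> \<psi> i w = 0" "\<And>i w. \<bar>\<psi> i w\<bar> \<le> P"
    and \<rho>: "0 < \<rho>" and U: "\<And>w. w \<in> S \<Longrightarrow> gmult z (dil \<rho> w) \<in> U" "U \<subseteq> \<Omega>" "U \<in> sets lebesgue"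
    and I: "(\<integral>\<^sup>+y\<in>U. ennreal (norm (G y)) \<partial>lebesgue) \<le> ennreal I" "0 \<le> I"
    and g: "set_integrable lebesgue \<Omega> g"
  shows "\<bar>LINT y:\<Omega>|lebesgue. g y * (\<Sum>i\<in>UNIV. X i (\<lambda>y. \<psi> i (W z \<rho> y)) y)\<bar> \<le> real CARD('m) * P * I"
proof -
  let ?\<Psi> = "\<lambda>i y. \<psi> i (W z \<rho> y)"
  have t: "test_function \<Omega> (?\<Psi> i)" for i
    using U(1,2) by (intro test_function_W[OF \<psi>(1,2,3) \<rho>]) auto
  have sm: "smooth_fn (?\<Psi> i)" for i by (intro smooth_W \<psi>)
  have "0 \<le> P" using \<psi>(4)[of undefined undefined] by linarith
  have meas[measurable]: "X i (?\<Psi> i) \<in> borel_measurable lebesgue" "?\<Psi> i \<in> borel_measurable lebesgue" for i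
    by (intro smooth_measurable smooth_X sm)+
  have W0: "?\<Psi> i y = 0" if "y \<notin> U" for i y
    using \<psi>(3)[of "W z \<rho> y" i] U(1)[of "W z \<rho> y"] W_inverse[OF \<rho>, of z y] that by metis
  have bd: "\<exists>M. \<forall>y. \<bar>X i (?\<Psi> i) y\<bar> \<le> M" for i
  proof -
    obtain M where M: "\<And>w. \<bar>X i (\<psi> i) w\<bar> \<le> M"
      using bounded_compact_support[OF smooth_X[OF \<psi>(1)] \<psi>(2) X_support[OF \<psi>(1,2,3)]] by blast
    show ?thesis using M \<rho> by (intro exI[of _ "M / \<rho>"]) (simp add: X_W[OF \<psi>(1) \<rho>] divide_right_mono)
  qed
  have gi: "integrable lebesgue (\<lambda>y. indicator \<Omega> y * g y)"
    using g by (simp add: set_integrable_def)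
  have int: "set_integrable lebesgue \<Omega> (\<lambda>y. g y * X i (?\<Psi> i) y)" for i
  proof -
    obtain M where M: "\<And>y. \<bar>X i (?\<Psi> i) y\<bar> \<le> M" using bd by blast
    have "integrable lebesgue (\<lambda>y. (indicator \<Omega> y * g y) * X i (?\<Psi> i) y)"
    proof (rule Bochner_Integration.integrable_bound)
      show "integrable lebesgue (\<lambda>y. M * (indicator \<Omega> y * g y))" using gi by simp
      show "(\<lambda>y. indicator \<Omega> y * g y * X i (?\<Psi> i) y) \<in> borel_measurable lebesgue"
        by (intro borel_measurable_times[OF borel_measurable_integrable[OF gi]] meas)
      show "AE y in lebesgue. norm (indicator \<Omega> y * g y * X i (?\<Psi> i) y) \<le> norm (M * (indicator \<Omega> y * g y))"
      proof (rule AE_I2)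
        fix y
        have "\<bar>indicator \<Omega> y * g y\<bar> * \<bar>X i (?\<Psi> i) y\<bar> \<le> \<bar>indicator \<Omega> y * g y\<bar> * \<bar>M\<bar>"
          using M[of y] by (intro mult_left_mono) auto
        then show "norm (indicator \<Omega> y * g y * X i (?\<Psi> i) y) \<le> norm (M * (indicator \<Omega> y * g y))"
          by (simp add: abs_mult mult_ac)
      qed
    qed
    then show ?thesis by (simp add: set_integrable_def mult.assoc)
  qed
  have bound: "\<bar>LINT y:\<Omega>|lebesgue. G y $ i * ?\<Psi> i y\<bar> \<le> P * I" for i
  proof -
    have "ennreal \<bar>LINT y:\<Omega>|lebesgue. G y $ i * ?\<Psi> i y\<bar> \<le>
        (\<integral>\<^sup>+y. ennreal \<bar>indicator \<Omega> y *\<^sub>R (G y $ i * ?\<Psi> i y)\<bar> \<partial>lebesgue)"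
    proof (cases "integrable lebesgue (\<lambda>y. indicator \<Omega> y *\<^sub>R (G y $ i * ?\<Psi> i y))")
      case True
      then show ?thesis
        using integral_norm_bound_ennreal[OF True] by (simp add: set_lebesgue_integral_def)
    next
      \<comment> \<open>The Bochner integral of a non-integrable function is 0 by convention, so the
        bound is trivial.\<close>
      case False
      then show ?thesis by (simp add: set_lebesgue_integral_def not_integrable_integral_eq)
    qed
    also have "\<dots> \<le> (\<integral>\<^sup>+y. ennreal P * (ennreal (norm (G y)) * indicator U y) \<partial>lebesgue)"
    proof (intro nn_integral_mono)
      fix y
      show "ennreal \<bar>indicator \<Omega> y *\<^sub>R (G y $ i * ?\<Psi> i y)\<bar> \<le> ennreal P * (ennreal (norm (G y)) * indicator U y)"
      proof (cases "y \<in> U")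
        case True
        have "\<bar>G y $ i\<bar> * \<bar>?\<Psi> i y\<bar> \<le> norm (G y) * P"
          using component_le_norm_cart[of "G y" i] \<psi>(4) \<open>0 \<le> P\<close> by (intro mult_mono) auto
        then show ?thesis using True U(2) \<open>0 \<le> P\<close>
          by (auto simp: ennreal_mult[symmetric] abs_mult mult.commute intro!: ennreal_leI)
      qed (simp add: W0)
    qed
    also have "\<dots> = ennreal P * (\<integral>\<^sup>+y\<in>U. ennreal (norm (G y)) \<partial>lebesgue)"
    proof (rule nn_integral_cmult)
      have "(\<lambda>y. ennreal (norm (indicator \<Omega> y *\<^sub>R G y)) * indicator U y) \<in> borel_measurable lebesgue"
        using G U(3) unfolding set_borel_measurable_def by measurable
      also have "(\<lambda>y. ennreal (norm (indicator \<Omega> y *\<^sub>R G y)) * indicator U y) = (\<lambda>y. ennreal (norm (G y)) * indicator U y)"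
        using U(2) by (auto simp: indicator_def fun_eq_iff)
      finally show "(\<lambda>y. ennreal (norm (G y)) * indicator U y) \<in> borel_measurable lebesgue" .
    qed
    also have "\<dots> \<le> ennreal P * ennreal I" by (intro mult_left_mono I) auto
    also have "\<dots> = ennreal (P * I)" using \<open>0 \<le> P\<close> I by (simp add: ennreal_mult)
    finally show ?thesis using \<open>0 \<le> P\<close> I by (simp add: ennreal_le_iff)
  qed
  have "(LINT y:\<Omega>|lebesgue. g y * (\<Sum>i\<in>UNIV. X i (?\<Psi> i) y)) = (LINT y:\<Omega>|lebesgue. (\<Sum>i\<in>UNIV. g y * X i (?\<Psi> i) y))"
    by (simp add: sum_distrib_left)
  also have "\<dots> = (\<Sum>i\<in>UNIV. LINT y:\<Omega>|lebesgue. g y * X i (?\<Psi> i) y)"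
    using int unfolding set_lebesgue_integral_def set_integrable_def scaleR_sum_right
    by (intro Bochner_Integration.integral_sum) auto
  also have "\<dots> = (\<Sum>i\<in>UNIV. - (LINT y:\<Omega>|lebesgue. G y $ i * ?\<Psi> i y))"
  proof (intro sum.cong refl)
    fix i
    show "(LINT y:\<Omega>|lebesgue. g y * X i (?\<Psi> i) y) = - (LINT y:\<Omega>|lebesgue. G y $ i * ?\<Psi> i y)"
      using wg t[of i] unfolding weak_gradient_def pd_def frame_eq by blast
  qed
  also have "\<bar>\<dots>\<bar> \<le> (\<Sum>i::'m\<in>UNIV. P * I)"
    using bound by (intro order_trans[OF sum_abs] sum_mono) auto
  finally show ?thesis by simp
qed

text \<open>Along a curve of centres and radii the time derivative of the bump is minus a horizontal
  divergence, so the weak gradient controls the derivative of its pairing with g. The vertical speed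
  is allowed to be \<open>k * \<rho> s\<close>: it is divided by \<rho>^2, so it then costs as much
  as a horizontal speed k, which is divided by \<rho>.\<close>

lemma flow:
  assumes \<phi>: "smooth_fn \<phi>" "compact S" "\<And>w. w \<notin> S \<Longrightarrow> \<phi> w = 0"
  obtains C where "0 \<le> C" "\<And>\<Omega> g G z z' \<rho> \<rho>' a b k \<rho>0 U I.
    \<lbrakk>weak_gradient E \<Omega> g G; set_borel_measurable lebesgue \<Omega> G; open \<Omega>; set_integrable lebesgue \<Omega> g;
     a \<le> b; 0 < \<rho>0;
     \<And>s. s \<in> {a..b} \<Longrightarrow> (z has_vector_derivative z' s) (at s within {a..b});
     \<And>s. s \<in> {a..b} \<Longrightarrow> (\<rho> has_real_derivative \<rho>' s) (at s within {a..b});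
     \<And>s. s \<in> {a..b} \<Longrightarrow> \<rho>0 \<le> \<rho> s;
     \<And>s i. s \<in> {a..b} \<Longrightarrow> \<bar>z' s \<bullet> e i\<bar> \<le> k; \<And>s. s \<in> {a..b} \<Longrightarrow> \<bar>\<rho>' s\<bar> \<le> k;
     \<And>s. s \<in> {a..b} \<Longrightarrow> \<bar>f (z' s) - B (z s) (z' s) / 2\<bar> \<le> k * \<rho> s;
     \<And>s w. s \<in> {a..b} \<Longrightarrow> w \<in> S \<Longrightarrow> gmult (z s) (dil (\<rho> s) w) \<in> U; U \<subseteq> \<Omega>; U \<in> sets lebesgue;
     (\<integral>\<^sup>+y\<in>U. ennreal (norm (G y)) \<partial>lebesgue) \<le> ennreal I; 0 \<le> I\<rbrakk> \<Longrightarrow>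
     \<bar>(LINT y:\<Omega>|lebesgue. g y * bump \<phi> (z b) (\<rho> b) y) - (LINT y:\<Omega>|lebesgue. g y * bump \<phi> (z a) (\<rho> a) y)\<bar>
       \<le> C * k * (b - a) * \<rho>0 powr - Q * I"
proof -
  obtain A C D M where M: "0 \<le> M"
    and sm_: "\<forall>i. smooth_fn (A i) \<and> (\<forall>j. smooth_fn (C j i)) \<and> smooth_fn (D i)"
    and supp_: "\<forall>i w. w \<notin> S \<longrightarrow> A i w = 0 \<and> (\<forall>j. C j i w = 0) \<and> D i w = 0"
    and bd_: "\<forall>i w. \<bar>A i w\<bar> \<le> M \<and> (\<forall>j. \<bar>C j i w\<bar> \<le> M) \<and> \<bar>D i w\<bar> \<le> M"
    and Xbd_: "\<forall>i w. \<bar>X i (A i) w\<bar> \<le> M \<and> (\<forall>j. \<bar>X i (C j i) w\<bar> \<le> M) \<and> \<bar>X i (D i) w\<bar> \<le> M"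
    and div_: "\<forall>w. (\<Sum>i\<in>UNIV. X i (A i) w) = Q * \<phi> w + pd (w + f w *\<^sub>R T) \<phi> w"
      "\<forall>j w. (\<Sum>i\<in>UNIV. X i (C j i) w) = pd (e j + (B (e j) w / 2) *\<^sub>R T) \<phi> w"
      "\<forall>w. (\<Sum>i\<in>UNIV. X i (D i) w) = pd T \<phi> w"
  proof (rule divergence_forms[OF \<phi>(1,2), elim_format])
    show "\<phi> w = 0" if "w \<notin> S" for w using that by (rule \<phi>(3))
  qed (elim exE conjE, rule that, assumption+)
  have sm: "\<And>i. smooth_fn (A i)" "\<And>i j. smooth_fn (C j i)" "\<And>i. smooth_fn (D i)"
    using sm_ by simp_all
  have supp: "\<And>i w. w \<notin> S \<Longrightarrow> A i w = 0" "\<And>i j w. w \<notin> S \<Longrightarrow> C j i w = 0" "\<And>i w. w \<notin> S \<Longrightarrow> D i w = 0"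
    using supp_ by simp_all
  have bd: "\<And>i w. \<bar>A i w\<bar> \<le> M" "\<And>i j w. \<bar>C j i w\<bar> \<le> M" "\<And>i w. \<bar>D i w\<bar> \<le> M"
    using bd_ by simp_all
  have Xbd: "\<And>i w. \<bar>X i (A i) w\<bar> \<le> M" "\<And>i j w. \<bar>X i (C j i) w\<bar> \<le> M" "\<And>i w. \<bar>X i (D i) w\<bar> \<le> M"
    using Xbd_ by simp_all
  note div = div_[rule_format]
  note lp = linear_pd[OF \<phi>(1)]
  define m where "m = real CARD('m)"
  have m: "0 \<le> m" by (simp add: m_def)
  define c where "c = m * ((m + 2) * M)"
  have c0: "0 \<le> c" using m M by (simp add: c_def)
  show thesis
  proof (rule that[OF c0])
    fix \<Omega> g G z z' \<rho> \<rho>' a b k \<rho>0 U I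
    assume wg: "weak_gradient E \<Omega> g G" and G: "set_borel_measurable lebesgue \<Omega> G" and \<Omega>: "open \<Omega>"
      and g: "set_integrable lebesgue \<Omega> g" and ab: "a \<le> b" and \<rho>0: "0 < \<rho>0"
      and z: "\<And>s. s \<in> {a..b} \<Longrightarrow> (z has_vector_derivative z' s) (at s within {a..b})"
      and \<rho>: "\<And>s. s \<in> {a..b} \<Longrightarrow> (\<rho> has_real_derivative \<rho>' s) (at s within {a..b})"
      and \<rho>ge: "\<And>s. s \<in> {a..b} \<Longrightarrow> \<rho>0 \<le> \<rho> s"
      and k1: "\<And>s i. s \<in> {a..b} \<Longrightarrow> \<bar>z' s \<bullet> e i\<bar> \<le> k" and k2: "\<And>s. s \<in> {a..b} \<Longrightarrow> \<bar>\<rho>' s\<bar> \<le> k"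
      and k3: "\<And>s. s \<in> {a..b} \<Longrightarrow> \<bar>f (z' s) - B (z s) (z' s) / 2\<bar> \<le> k * \<rho> s"
      and U: "\<And>s w. s \<in> {a..b} \<Longrightarrow> w \<in> S \<Longrightarrow> gmult (z s) (dil (\<rho> s) w) \<in> U" "U \<subseteq> \<Omega>" "U \<in> sets lebesgue"
      and I: "(\<integral>\<^sup>+y\<in>U. ennreal (norm (G y)) \<partial>lebesgue) \<le> ennreal I" "0 \<le> I"
    have k0: "0 \<le> k" using k2[of a] ab by auto
    \<comment> \<open>The fields of \<open>divergence_forms\<close> with the coefficients of
      \<open>W_time_derivative\<close>; the summand \<open>Q * \<phi> w\<close> in the divergence of
      \<open>A\<close> accounts for the derivative of the factor
      \<open>\<rho> s powr - Q\<close>.\<close>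
    define \<psi> where "\<psi> s i w = \<rho>' s / \<rho> s * A i w + (\<Sum>j\<in>UNIV. z' s \<bullet> e j / \<rho> s * C j i w)
        + (f (z' s) - B (z s) (z' s) / 2) / (\<rho> s)\<^sup>2 * D i w" for s i w
    have \<psi>s: "smooth_fn (\<psi> s i)" for s i
      unfolding \<psi>_def by (intro smooth_fn.add smooth_fn_cmult smooth_fn_sum sm)
    have \<psi>0: "\<psi> s i w = 0" if "w \<notin> S" for s i w
      using that by (simp add: \<psi>_def supp)
    have X\<psi>: "X i (\<psi> s i) w = \<rho>' s / \<rho> s * X i (A i) w + (\<Sum>j\<in>UNIV. z' s \<bullet> e j / \<rho> s * X i (C j i) w)
        + (f (z' s) - B (z s) (z' s) / 2) / (\<rho> s)\<^sup>2 * X i (D i) w" for s i w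
      unfolding \<psi>_def
      by (simp only: pd_add pd_cmult pd_sum smooth_fn.add smooth_fn_cmult smooth_fn_sum sm)
    have coeff: "\<bar>\<rho>' s / \<rho> s\<bar> \<le> k / \<rho> s" "\<bar>z' s \<bullet> e j / \<rho> s\<bar> \<le> k / \<rho> s"
      "\<bar>(f (z' s) - B (z s) (z' s) / 2) / (\<rho> s)\<^sup>2\<bar> \<le> k / \<rho> s" and \<rho>pos: "0 < \<rho> s" if s: "s \<in> {a..b}" for s j
    proof -
      show p: "0 < \<rho> s" using \<rho>ge[OF s] \<rho>0 by linarith
      show "\<bar>\<rho>' s / \<rho> s\<bar> \<le> k / \<rho> s" "\<bar>z' s \<bullet> e j / \<rho> s\<bar> \<le> k / \<rho> s"
        using k1[OF s] k2[OF s] p by (simp_all add: abs_divide divide_right_mono)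
      have "\<bar>(f (z' s) - B (z s) (z' s) / 2) / (\<rho> s)\<^sup>2\<bar> \<le> (k * \<rho> s) / (\<rho> s)\<^sup>2"
        using k3[OF s] unfolding abs_divide by (intro divide_mono) (use p in auto)
      also have "\<dots> = k / \<rho> s" using p by (simp add: power2_eq_square)
      finally show "\<bar>(f (z' s) - B (z s) (z' s) / 2) / (\<rho> s)\<^sup>2\<bar> \<le> k / \<rho> s" .
    qed
    \<comment> \<open>The factor m + 2 counts m horizontal terms, one for the dilation and one for
      the vertical direction.\<close>
    have comb: "\<bar>x0 * p + (\<Sum>j\<in>UNIV. y0 j * q j) + x1 * r\<bar> \<le> K * ((m + 2) * M)"
      if "\<bar>x0\<bar> \<le> K" "\<And>j::'m. \<bar>y0 j\<bar> \<le> K" "\<bar>x1\<bar> \<le> K" "\<bar>p\<bar> \<le> M" "\<And>j. \<bar>q j\<bar> \<le> M" "\<bar>r\<bar> \<le> M"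
      for x0 y0 x1 p q r K
    proof -
      have K: "0 \<le> K" using that(1) by linarith
      have "\<bar>x0 * p\<bar> \<le> K * M" "\<bar>x1 * r\<bar> \<le> K * M" "\<And>j. \<bar>y0 j * q j\<bar> \<le> K * M"
        unfolding abs_mult using that K by (auto intro!: mult_mono)
      moreover have "\<bar>\<Sum>j\<in>UNIV. y0 j * q j\<bar> \<le> (\<Sum>j::'m\<in>UNIV. K * M)"
        using calculation(3) by (intro order_trans[OF sum_abs] sum_mono)
      ultimately show ?thesis by (simp add: m_def algebra_simps)
    qed
    have \<psi>b: "\<bar>\<psi> s i w\<bar> \<le> k / \<rho> s * ((m + 2) * M)" and X\<psi>b: "\<bar>X i (\<psi> s i) w\<bar> \<le> k / \<rho> s * ((m + 2) * M)"
      if "s \<in> {a..b}" for s i w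
      unfolding X\<psi> unfolding \<psi>_def
      by (rule comb; intro coeff[OF that] bd Xbd)+
    define Dt where "Dt s y = - (\<rho> s powr - Q * (\<Sum>i\<in>UNIV. X i (\<psi> s i) (W (z s) (\<rho> s) y)))" for s y
    have deriv: "((\<lambda>s. bump \<phi> (z s) (\<rho> s) y) has_real_derivative Dt s y) (at s within {a..b})"
      if s: "s \<in> {a..b}" for s y
    proof -
      define w where "w = W (z s) (\<rho> s) y"
      define V where "V = (\<rho>' s / \<rho> s) *\<^sub>R (w + f w *\<^sub>R T)
         + (\<Sum>j\<in>UNIV. (z' s \<bullet> e j / \<rho> s) *\<^sub>R (e j + (B (e j) w / 2) *\<^sub>R T))
         + ((f (z' s) - B (z s) (z' s) / 2) / (\<rho> s)\<^sup>2) *\<^sub>R T"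
      have p: "0 < \<rho> s" by (rule \<rho>pos[OF s])
      have "((\<lambda>s. W (z s) (\<rho> s) y) has_vector_derivative - V) (at s within {a..b})"
        unfolding V_def by (rule W_time_derivative[OF z[OF s] \<rho>[OF s] p w_def])
      then have "((\<lambda>s. W (z s) (\<rho> s) y) has_derivative (\<lambda>h. h *\<^sub>R (- V))) (at s within {a..b})"
        by (simp add: has_vector_derivative_def)
      then have "((\<lambda>s. \<phi> (W (z s) (\<rho> s) y)) has_derivative (\<lambda>h. pd (h *\<^sub>R (- V)) \<phi> w)) (at s within {a..b})"
        unfolding w_def by (rule has_derivative_compose[OF _ smooth_fn_has_derivative[OF \<phi>(1)]])
      moreover have "(\<lambda>h. pd (h *\<^sub>R (- V)) \<phi> w) = (*) (- pd V \<phi> w)"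
        by (rule ext) (simp only: linear_scale[OF lp] linear_neg[OF lp] real_scaleR_def mult.commute)
      ultimately have d1: "((\<lambda>s. \<phi> (W (z s) (\<rho> s) y)) has_real_derivative - pd V \<phi> w) (at s within {a..b})"
        by (simp only: has_field_derivative_def)
      have d2: "((\<lambda>s. \<rho> s powr - Q) has_real_derivative - Q * \<rho> s powr (- Q - 1) * \<rho>' s) (at s within {a..b})"
        by (rule derivative_eq_intros \<rho>[OF s] p refl)+
      have "- Q * \<rho> s powr (- Q - 1) * \<rho>' s = \<rho> s powr - Q * (- (Q * (\<rho>' s / \<rho> s)))"
        using p by (simp add: powr_diff)
      with d2 have d2: "((\<lambda>s. \<rho> s powr - Q) has_real_derivative \<rho> s powr - Q * (- (Q * (\<rho>' s / \<rho> s)))) (at s within {a..b})"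
        by simp
      define V1 V2 V3 where V123: "V1 = (\<rho>' s / \<rho> s) *\<^sub>R (w + f w *\<^sub>R T)"
        "V2 = (\<Sum>j\<in>UNIV. (z' s \<bullet> e j / \<rho> s) *\<^sub>R (e j + (B (e j) w / 2) *\<^sub>R T))"
        "V3 = ((f (z' s) - B (z s) (z' s) / 2) / (\<rho> s)\<^sup>2) *\<^sub>R T"
      have "pd V \<phi> w = pd V1 \<phi> w + pd V2 \<phi> w + pd V3 \<phi> w"
        unfolding V_def V123[symmetric] by (simp only: linear_add[OF lp])
      moreover have "pd V1 \<phi> w = \<rho>' s / \<rho> s * pd (w + f w *\<^sub>R T) \<phi> w"
        unfolding V123 linear_scale[OF lp] real_scaleR_def ..
      moreover have "pd V2 \<phi> w = (\<Sum>j\<in>UNIV. z' s \<bullet> e j / \<rho> s * pd (e j + (B (e j) w / 2) *\<^sub>R T) \<phi> w)"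
        unfolding V123 linear_sum[OF lp] linear_scale[OF lp] real_scaleR_def ..
      moreover have "pd V3 \<phi> w = (f (z' s) - B (z s) (z' s) / 2) / (\<rho> s)\<^sup>2 * pd T \<phi> w"
        unfolding V123 linear_scale[OF lp] real_scaleR_def ..
      ultimately have V: "pd V \<phi> w = \<rho>' s / \<rho> s * pd (w + f w *\<^sub>R T) \<phi> w
          + (\<Sum>j\<in>UNIV. z' s \<bullet> e j / \<rho> s * pd (e j + (B (e j) w / 2) *\<^sub>R T) \<phi> w)
          + (f (z' s) - B (z s) (z' s) / 2) / (\<rho> s)\<^sup>2 * pd T \<phi> w" by (simp only:)
      have "(\<Sum>i\<in>UNIV. X i (\<psi> s i) w) = \<rho>' s / \<rho> s * (\<Sum>i\<in>UNIV. X i (A i) w)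
          + (\<Sum>j\<in>UNIV. z' s \<bullet> e j / \<rho> s * (\<Sum>i\<in>UNIV. X i (C j i) w))
          + (f (z' s) - B (z s) (z' s) / 2) / (\<rho> s)\<^sup>2 * (\<Sum>i\<in>UNIV. X i (D i) w)"
        unfolding X\<psi> sum.distrib sum_distrib_left by (subst sum.swap) (rule refl)
      also have "\<dots> = Q * (\<rho>' s / \<rho> s) * \<phi> w + pd V \<phi> w"
        unfolding div V by (simp add: algebra_simps)
      finally have *: "(\<Sum>i\<in>UNIV. X i (\<psi> s i) w) = Q * (\<rho>' s / \<rho> s) * \<phi> w + pd V \<phi> w" .
      have "((\<lambda>s. \<rho> s powr - Q * \<phi> (W (z s) (\<rho> s) y)) has_real_derivative
          \<rho> s powr - Q * (- (Q * (\<rho>' s / \<rho> s))) * \<phi> (W (z s) (\<rho> s) y) + (- pd V \<phi> w) * \<rho> s powr - Q)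
          (at s within {a..b})"
        by (rule DERIV_mult[OF d2 d1])
      moreover have "\<rho> s powr - Q * (- (Q * (\<rho>' s / \<rho> s))) * \<phi> (W (z s) (\<rho> s) y) + (- pd V \<phi> w) * \<rho> s powr - Q = Dt s y"
        unfolding Dt_def w_def[symmetric] * by (simp add: algebra_simps)
      ultimately show ?thesis by (simp add: bump_def)
    qed
    have \<rho>mono: "\<rho> s powr - Q \<le> \<rho>0 powr - Q" if "s \<in> {a..b}" for s
      using \<rho>ge[OF that] \<rho>0 Q_pos by (intro powr_mono2') auto
    have Dtb: "\<bar>Dt s y\<bar> \<le> \<rho>0 powr - Q * (m * (k / \<rho>0 * ((m + 2) * M)))" if s: "s \<in> {a..b}" for s y
    proof -
      have "\<bar>\<Sum>i\<in>UNIV. X i (\<psi> s i) (W (z s) (\<rho> s) y)\<bar> \<le> (\<Sum>i::'m\<in>UNIV. k / \<rho>0 * ((m + 2) * M))"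
      proof (intro order_trans[OF sum_abs] sum_mono)
        fix i
        have "\<bar>X i (\<psi> s i) (W (z s) (\<rho> s) y)\<bar> \<le> k / \<rho> s * ((m + 2) * M)" by (rule X\<psi>b[OF s])
        also have "\<dots> \<le> k / \<rho>0 * ((m + 2) * M)"
          using \<rho>ge[OF s] \<rho>0 k0 m M by (intro mult_right_mono divide_left_mono mult_pos_pos) auto
        finally show "\<bar>X i (\<psi> s i) (W (z s) (\<rho> s) y)\<bar> \<le> k / \<rho>0 * ((m + 2) * M)" .
      qed
      then show ?thesis
        unfolding Dt_def abs_minus_cancel abs_mult using \<rho>mono[OF s]
        by (intro mult_mono) (auto simp: m_def)
    qed
    let ?g = "\<lambda>y. indicator \<Omega> y * g y"
    have gi: "integrable lebesgue ?g" using g by (simp add: set_integrable_def)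
    obtain M\<phi> where M\<phi>: "\<And>w. \<bar>\<phi> w\<bar> \<le> M\<phi>" using bounded_compact_support[OF \<phi>] by blast
    have gb: "integrable lebesgue (\<lambda>y. ?g y * bump \<phi> (z s) (\<rho> s) y)" for s
    proof (rule Bochner_Integration.integrable_bound)
      show "integrable lebesgue (\<lambda>y. (\<rho> s powr - Q * M\<phi>) * ?g y)" using gi by simp
      show "(\<lambda>y. ?g y * bump \<phi> (z s) (\<rho> s) y) \<in> borel_measurable lebesgue"
        by (intro borel_measurable_times[OF borel_measurable_integrable[OF gi]] smooth_measurable smooth_bump \<phi>(1))
      have "\<bar>bump \<phi> (z s) (\<rho> s) y\<bar> \<le> \<bar>\<rho> s powr - Q * M\<phi>\<bar>" for y
        unfolding bump_def abs_mult using M\<phi>[of "W (z s) (\<rho> s) y"] by (intro mult_mono) auto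
      then have "\<bar>?g y\<bar> * \<bar>bump \<phi> (z s) (\<rho> s) y\<bar> \<le> \<bar>?g y\<bar> * \<bar>\<rho> s powr - Q * M\<phi>\<bar>" for y
        by (intro mult_left_mono) auto
      then show "AE y in lebesgue. norm (?g y * bump \<phi> (z s) (\<rho> s) y) \<le> norm ((\<rho> s powr - Q * M\<phi>) * ?g y)"
        by (intro AE_I2) (simp only: real_norm_def abs_mult mult_ac)
    qed
    have LINT: "(LINT y:\<Omega>|lebesgue. g y * h y) = (\<integral>y. ?g y * h y \<partial>lebesgue)" for h
      by (simp add: set_lebesgue_integral_def mult.assoc)
    have pull: "(\<integral>y. ?g y * (x * h y) \<partial>lebesgue) = x * (\<integral>y. ?g y * h y \<partial>lebesgue)" for x h
      unfolding mult.left_commute[of "?g _" x] by (rule integral_mult_right_zero)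
    define u where "u s = (\<integral>y. ?g y * bump \<phi> (z s) (\<rho> s) y \<partial>lebesgue)" for s
    have smD: "smooth_fn (Dt s)" for s
      unfolding Dt_def by (intro smooth_fn_minus smooth_fn_cmult smooth_fn_sum smooth_W[where \<xi> = "X _ (\<psi> _ _)"] smooth_X \<psi>s)
    have ud: "(u has_field_derivative (\<integral>y. ?g y * Dt s y \<partial>lebesgue)) (at s within {a..b})" if s: "s \<in> {a..b}" for s
      unfolding u_def
      by (rule has_derivative_parametric_integral[OF gi s deriv Dtb
            smooth_measurable[OF smooth_bump[OF \<phi>(1)]] smooth_measurable[OF smD] gb])
    have ub: "norm (\<integral>y. ?g y * Dt s y \<partial>lebesgue) \<le> c * k * \<rho>0 powr - Q * I" if s: "s \<in> {a..b}" for s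
    proof -
      have p: "0 < \<rho> s" by (rule \<rho>pos[OF s])
      \<comment> \<open>The factor \<open>\<rho> s\<close> undoes the division in
        \<open>X_W\<close>; it is cancelled below by the factor \<open>k / \<rho> s\<close> in the
        bound for \<psi>.\<close>
      have "Dt s y = (- (\<rho> s powr - Q * \<rho> s)) * (\<Sum>i\<in>UNIV. X i (\<lambda>y. \<psi> s i (W (z s) (\<rho> s) y)) y)" for y
        using p by (simp add: Dt_def X_W[OF \<psi>s p] flip: sum_divide_distrib)
      then have "(\<integral>y. ?g y * Dt s y \<partial>lebesgue) =
          (- (\<rho> s powr - Q * \<rho> s)) * (LINT y:\<Omega>|lebesgue. g y * (\<Sum>i\<in>UNIV. X i (\<lambda>y. \<psi> s i (W (z s) (\<rho> s) y)) y))"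
        unfolding LINT by (simp only: pull)
      then have "norm (\<integral>y. ?g y * Dt s y \<partial>lebesgue) = (\<rho> s powr - Q * \<rho> s) *
          \<bar>LINT y:\<Omega>|lebesgue. g y * (\<Sum>i\<in>UNIV. X i (\<lambda>y. \<psi> s i (W (z s) (\<rho> s) y)) y)\<bar>"
        using p by (simp add: abs_mult)
      also have "\<dots> \<le> (\<rho> s powr - Q * \<rho> s) * (real CARD('m) * (k / \<rho> s * ((m + 2) * M)) * I)"
      proof (intro mult_left_mono)
        show "\<bar>LINT y:\<Omega>|lebesgue. g y * (\<Sum>i\<in>UNIV. X i (\<lambda>y. \<psi> s i (W (z s) (\<rho> s) y)) y)\<bar> \<le>
            real CARD('m) * (k / \<rho> s * ((m + 2) * M)) * I"
          by (rule weak_gradient_bound[OF wg G \<Omega> \<psi>s \<phi>(2) \<psi>0 \<psi>b[OF s] p U(1)[OF s] U(2,3) I g])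
      qed (use p in auto)
      also have "\<dots> = \<rho> s powr - Q * (c * k * I)" using p by (simp add: c_def m_def)
      also have "\<dots> \<le> \<rho>0 powr - Q * (c * k * I)"
        using c0 k0 I by (intro mult_right_mono \<rho>mono s) auto
      finally show ?thesis by (simp add: mult_ac)
    qed
    have "norm (u b - u a) \<le> (c * k * \<rho>0 powr - Q * I) * norm (b - a)"
      using ab by (intro field_differentiable_bound[OF _ ud ub]) auto
    then show "\<bar>(LINT y:\<Omega>|lebesgue. g y * bump \<phi> (z b) (\<rho> b) y) - (LINT y:\<Omega>|lebesgue. g y * bump \<phi> (z a) (\<rho> a) y)\<bar>
       \<le> c * k * (b - a) * \<rho>0 powr - Q * I"
      unfolding LINT u_def using ab by (simp add: mult_ac)
  qed
qed

lemma bump_integral: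
  assumes \<phi>: "smooth_fn \<phi>" "\<And>w. 0 \<le> \<phi> w" "(\<integral>\<^sup>+w. ennreal (\<phi> w) \<partial>lborel) = 1" and \<rho>: "0 < \<rho>"
  shows "integrable lebesgue (bump \<phi> z \<rho>)" "(\<integral>y. bump \<phi> z \<rho> y \<partial>lebesgue) = 1"
proof -
  have [measurable]: "bump \<phi> z \<rho> \<in> borel_measurable borel"
    by (intro borel_measurable_continuous_onI smooth_fn_continuous_on smooth_bump \<phi>)
  have bm: "bump \<phi> z \<rho> \<in> borel_measurable lborel" by simp
  have nn: "0 \<le> bump \<phi> z \<rho> y" for y using \<phi>(2) by (simp add: bump_def)
  have "(\<integral>\<^sup>+y. ennreal (bump \<phi> z \<rho> y) \<partial>lborel) =
      ennreal (\<rho> powr Q) * (\<integral>\<^sup>+w. ennreal (bump \<phi> z \<rho> (gmult z (dil \<rho> w))) \<partial>lborel)"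
    using \<rho> by (subst nn_integral_transform[symmetric, where z = z and \<rho> = \<rho>]) auto
  also have "(\<integral>\<^sup>+w. ennreal (bump \<phi> z \<rho> (gmult z (dil \<rho> w))) \<partial>lborel) =
      (\<integral>\<^sup>+w. ennreal (\<rho> powr - Q) * ennreal (\<phi> w) \<partial>lborel)"
    using \<phi>(2) \<rho> by (intro nn_integral_cong) (simp add: bump_def W_def mult_cancel dil_inverse ennreal_mult)
  also have "\<dots> = ennreal (\<rho> powr - Q)"
    using borel_measurable_continuous_onI[OF smooth_fn_continuous_on[OF \<phi>(1)]]
    by (subst nn_integral_cmult) (auto simp: \<phi>(3))
  also have "ennreal (\<rho> powr Q) * ennreal (\<rho> powr - Q) = 1"
    using \<rho> by (simp add: ennreal_mult[symmetric] powr_add[symmetric])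
  finally have I: "(\<integral>\<^sup>+y. ennreal (bump \<phi> z \<rho> y) \<partial>lborel) = 1" .
  have "has_bochner_integral lborel (bump \<phi> z \<rho>) 1"
    by (rule has_bochner_integral_nn_integral) (use I nn in auto)
  then show "integrable lebesgue (bump \<phi> z \<rho>)" "(\<integral>y. bump \<phi> z \<rho> y \<partial>lebesgue) = 1"
    by (auto simp: has_bochner_integral_iff integrable_completion integral_completion)
qed

lemma standard_bump:
  obtains \<phi> S where "smooth_fn \<phi>" "compact S" "\<And>w. w \<notin> S \<Longrightarrow> \<phi> w = 0" "\<And>w. w \<in> S \<Longrightarrow> N w < 1"
    "\<And>w. 0 \<le> \<phi> w" "(\<integral>\<^sup>+w. ennreal (\<phi> w) \<partial>lborel) = 1"
proof -
  obtain d where d: "0 < d" "ball (0::'a) d \<subseteq> {w. N w < 1}"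
    using open_unit[unfolded open_contains_ball, rule_format, of 0] N_0 by auto
  define S where "S = cball (0::'a) (d / 2)"
  obtain \<phi> :: "'a \<Rightarrow> real" where \<phi>: "smooth_fn \<phi>" "\<And>x. 0 \<le> \<phi> x" "\<And>x. x \<notin> cball 0 (d / 2) \<Longrightarrow> \<phi> x = 0"
    "\<And>x. norm x < d / 2 \<Longrightarrow> 0 < \<phi> x"
    using bump_exists[of "d / 2", where ?'a = 'a] d by auto
  have [measurable]: "\<phi> \<in> borel_measurable borel"
    by (intro borel_measurable_continuous_onI smooth_fn_continuous_on \<phi>)
  have "\<exists>M\<ge>0. \<forall>w. \<bar>\<phi> w\<bar> \<le> M"
    by (rule bounded_compact_support[OF \<phi>(1) compact_cball[of 0 "d / 2"]]) (rule \<phi>(3))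
  then obtain M where M: "0 \<le> M" "\<And>w. \<bar>\<phi> w\<bar> \<le> M" by blast
  have \<phi>M: "\<phi> w \<le> M" for w using M(2)[of w] by simp
  define J where "J = (\<integral>\<^sup>+w. ennreal (\<phi> w) \<partial>lborel)"
  have "J \<le> (\<integral>\<^sup>+w. ennreal M * indicator S w \<partial>lborel)"
    unfolding J_def S_def
  proof (rule nn_integral_mono)
    fix w show "ennreal (\<phi> w) \<le> ennreal M * indicator (cball 0 (d / 2)) w"
      using \<phi>(3)[of w] \<phi>M[of w] by (cases "w \<in> cball 0 (d / 2)") (auto intro: ennreal_leI)
  qed
  also have "\<dots> < \<infinity>"
    using emeasure_bounded_finite[OF bounded_cball, of "0::'a" "d / 2"]
    by (simp add: S_def nn_integral_cmult_indicator ennreal_mult_less_top)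
  finally have Jfin: "J < \<infinity>" .
  have "J \<noteq> 0"
  proof
    assume "J = 0"
    then have "AE w in lborel. \<phi> w = 0"
      unfolding J_def using \<phi>(2) by (subst (asm) nn_integral_0_iff_AE) (auto simp: ennreal_eq_0_iff intro: antisym)
    then have "AE w in lborel. w \<notin> ball (0::'a) (d / 2)"
      by eventually_elim (use \<phi>(4) in force)
    then have "ball (0::'a) (d / 2) \<in> null_sets lborel"
      by (subst AE_iff_null_sets) auto
    then have "emeasure lborel (ball (0::'a) (d / 2)) = 0" by auto
    then show False using content_ball_pos[of "d / 2" "0::'a"] d by (simp add: measure_def)
  qed
  then obtain j where j: "J = ennreal j" "0 < j" using Jfin by (cases J) (auto simp: top_unique)
  show thesis
  proof (rule that)
    show "smooth_fn (\<lambda>w. \<phi> w / j)" by (intro smooth_fn_divide \<phi>)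
    show "compact S" by (simp add: S_def)
    show "\<phi> w / j = 0" if "w \<notin> S" for w using that \<phi>(3) by (simp add: S_def)
    show "N w < 1" if "w \<in> S" for w using that d by (auto simp: S_def subset_iff)
    show "0 \<le> \<phi> w / j" for w using \<phi>(2) j by simp
    have "(\<integral>\<^sup>+w. ennreal (\<phi> w / j) \<partial>lborel) = (\<integral>\<^sup>+w. ennreal (\<phi> w) / ennreal j \<partial>lborel)"
      using \<phi>(2) j by (simp add: divide_ennreal)
    also have "\<dots> = J / ennreal j" unfolding J_def by (subst nn_integral_divide) auto
    also have "\<dots> = 1" using j by (simp add: divide_ennreal)
    finally show "(\<integral>\<^sup>+w. ennreal (\<phi> w / j) \<partial>lborel) = 1" .
  qed
qed

end

context step_two begin

text \<open>The left factor enters affinely: translation of v by the points of a ray through q moves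
  it along the line through v and \<open>gmult q v\<close>. With the convexity of the unit ball this
  keeps a bump inside while its centre moves.\<close>

lemma minus_dil_scale: "gmult (k *\<^sub>R q) v = k *\<^sub>R gmult q v + (1 - k) *\<^sub>R v"
  by (simp add: mult_def B_simps algebra_simps)

text \<open>
  Inside a ball every point \<open>x\<close> is the vertex of a chain of shrinking bumps that starts at a
  bump depending on the ball only.
\<close>

lemma chain:
  obtains C R where "0 \<le> C" "1 \<le> R" "\<And>\<Omega> g G x0 r.
    \<lbrakk>weak_gradient E \<Omega> g G; set_borel_measurable lebesgue \<Omega> G; open \<Omega>; set_integrable lebesgue \<Omega> g;
     0 < r; gball E x0 r \<subseteq> \<Omega>; (\<integral>\<^sup>+y\<in>gball E x0 r. ennreal (norm (G y)) \<partial>lebesgue) < \<infinity>\<rbrakk> \<Longrightarrow>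
     \<exists>a. \<forall>x\<in>gball E x0 r. \<exists>F::nat \<Rightarrow> 'a \<Rightarrow> real.
       (\<forall>k. integrable lebesgue (F k) \<and> (\<integral>y. F k y \<partial>lebesgue) = 1 \<and>
         (\<forall>y. \<bar>F k y\<bar> \<le> C * (r / 2 ^ k) powr - Q) \<and>
         (\<forall>y. F k y \<noteq> 0 \<longrightarrow> y \<in> gball E x0 r \<inter> gball E x (R * (r / 2 ^ k))) \<and>
         ennreal \<bar>(LINT y:\<Omega>|lebesgue. g y * F k y) - a\<bar> \<le>
           ennreal C * (\<Sum>j\<le>k. ennreal ((r / 2 ^ j) powr (1 - Q)) *
             (\<integral>\<^sup>+y\<in>gball E x0 r \<inter> gball E x (R * (r / 2 ^ j)). ennreal (norm (G y)) \<partial>lebesgue)))"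
proof -
  obtain \<phi> S where \<phi>: "smooth_fn \<phi>" "compact S" "\<And>w. w \<notin> S \<Longrightarrow> \<phi> w = 0"
    and S: "\<And>w. w \<in> S \<Longrightarrow> N w < 1"
    and \<phi>1: "\<And>w. 0 \<le> \<phi> w" "(\<integral>\<^sup>+w. ennreal (\<phi> w) \<partial>lborel) = 1"
    using standard_bump by metis
  obtain C0 where C0: "0 \<le> C0" and flow: "\<And>\<Omega> g G z z' \<rho> \<rho>' a b k \<rho>0 U I.
    \<lbrakk>weak_gradient E \<Omega> g G; set_borel_measurable lebesgue \<Omega> G; open \<Omega>; set_integrable lebesgue \<Omega> g;
     a \<le> b; 0 < \<rho>0;
     \<And>s. s \<in> {a..b} \<Longrightarrow> (z has_vector_derivative z' s) (at s within {a..b});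
     \<And>s. s \<in> {a..b} \<Longrightarrow> (\<rho> has_real_derivative \<rho>' s) (at s within {a..b});
     \<And>s. s \<in> {a..b} \<Longrightarrow> \<rho>0 \<le> \<rho> s;
     \<And>s i. s \<in> {a..b} \<Longrightarrow> \<bar>z' s \<bullet> e i\<bar> \<le> k; \<And>s. s \<in> {a..b} \<Longrightarrow> \<bar>\<rho>' s\<bar> \<le> k;
     \<And>s. s \<in> {a..b} \<Longrightarrow> \<bar>f (z' s) - B (z s) (z' s) / 2\<bar> \<le> k * \<rho> s;
     \<And>s w. s \<in> {a..b} \<Longrightarrow> w \<in> S \<Longrightarrow> gmult (z s) (dil (\<rho> s) w) \<in> U; U \<subseteq> \<Omega>; U \<in> sets lebesgue;
     (\<integral>\<^sup>+y\<in>U. ennreal (norm (G y)) \<partial>lebesgue) \<le> ennreal I; 0 \<le> I\<rbrakk> \<Longrightarrow>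
     \<bar>(LINT y:\<Omega>|lebesgue. g y * bump \<phi> (z b) (\<rho> b) y) - (LINT y:\<Omega>|lebesgue. g y * bump \<phi> (z a) (\<rho> a) y)\<bar>
       \<le> C0 * k * (b - a) * \<rho>0 powr - Q * I"
    by (rule flow[OF \<phi>(1,2) \<phi>(3)]) auto
  obtain c Rp where c: "0 < c" "c < 1" and cone: "\<And>x. N x < 1 \<Longrightarrow> \<exists>p. norm p \<le> Rp \<and>
       (\<forall>s w. 0 < s \<and> s \<le> 1 \<and> N w < 1 \<longrightarrow> N (gmult x (dil s (gmult p (dil c w)))) < 1)"
    using cone by blast
  have Rp0: "0 \<le> Rp" using cone[of 0] N_0 norm_ge_zero order_trans by (metis zero_less_one)
  have "bounded_linear f" using f_lin by (simp add: linear_conv_bounded_linear)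
  then obtain Lf where Lf: "0 \<le> Lf" "\<And>x. \<bar>f x\<bar> \<le> norm x * Lf"
    using bounded_linear.nonneg_bounded by force
  obtain Kb0 where Kb0: "\<And>q. N q \<le> 1 \<Longrightarrow> norm q \<le> Kb0" using N_bounded by (auto simp: bounded_iff)
  define Kb where "Kb = Kb0 * (1 + Lf)"
  have Kb00: "0 \<le> Kb0" using Kb0[of 0] by (simp add: N_0)
  have Kb: "norm q \<le> Kb" "\<bar>f q\<bar> \<le> Kb" "0 \<le> Kb" if "N q \<le> 1" for q
  proof -
    have "norm q * Lf \<le> Kb0 * Lf" by (intro mult_right_mono Kb0 that Lf)
    moreover have "0 \<le> Kb0 * Lf" using Kb00 Lf by simp
    ultimately show "norm q \<le> Kb" "\<bar>f q\<bar> \<le> Kb" "0 \<le> Kb"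
      using Kb0[OF that] Lf(2)[of q] Kb00 by (simp_all add: Kb_def algebra_simps)
  qed
  have Kb_nn: "0 \<le> Kb" by (rule Kb(3)[of 0]) (simp add: N_0)
  obtain NP where NP: "\<And>p. norm p \<le> Rp \<Longrightarrow> N p \<le> NP"
  proof -
    have "compact (N ` cball 0 Rp)"
      by (intro compact_continuous_image continuous_on_subset[OF N_cont]) auto
    then obtain M where "\<forall>x\<in>N ` cball 0 Rp. norm x \<le> M" using compact_imp_bounded bounded_iff by blast
    then show thesis by (intro that[of M]) (force dest: abs_le_D1)
  qed
  define m where "m = max NP 1"
  \<comment> \<open>By the quasi-triangle inequality \<open>gmult p (dil c w)\<close> has gauge at
    most K * m, so the bump at scale s of the chain lies in the ball of radius R * s about
    x.\<close>
  define R where "R = K * m + 1"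
  have m1: "1 \<le> m" by (simp add: m_def)
  have "1 * 1 \<le> K * m" using K(1) m1 by (intro mult_mono) auto
  then have R1: "1 \<le> R" by (simp add: R_def)
  have "K * 1 \<le> K * m" using K(1) m1 by (intro mult_left_mono) auto
  then have KR: "K < R" by (simp add: R_def)
  have pR: "N (gmult p (dil c w)) < R" if "norm p \<le> Rp" "N w < 1" for p w
  proof -
    have "c * N w \<le> 1 * 1" using c that(2) N_nonneg[of w] by (intro mult_mono) auto
    then have "N (gmult p (dil c w)) \<le> K * m"
      using NP[OF that(1)] c m1 by (intro K(2)) (auto simp: N_dil m_def)
    then show ?thesis by (simp add: R_def)
  qed
  obtain M where M: "0 \<le> M" "\<And>w. \<bar>\<phi> w\<bar> \<le> M" using bounded_compact_support[OF \<phi>] by blast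
  \<comment> \<open>One bound for three speeds: the horizontal one is at most \<open>Rp\<close>, the
    radius changes at the rate c < 1, and the vertical speed \<open>2 * t * f p\<close> is at most
    \<open>2 * Lf * Rp / c\<close> times the radius c * t.\<close>
  define k1 where "k1 = Rp + 1 + 2 * Lf * Rp / c"
  have k1: "0 \<le> 2 * Lf * Rp / c" using Lf Rp0 c by simp
  \<comment> \<open>Halving the scale s takes a parameter interval of length s / 2, on which the
    radius is at least c * s / 2.\<close>
  define C1 where "C1 = C0 * k1 / 2 * (c / 2) powr - Q"
  have C1: "0 \<le> C1" using C0 k1 Rp0 by (simp add: C1_def k1_def)
  define C2 where "C2 = C0 * (Kb + Kb / c) * c powr - Q"
  have C2: "0 \<le> C2" using C0 Kb_nn c by (simp add: C2_def)
  define C3 where "C3 = M * c powr - Q"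
  have C3: "0 \<le> C3" using M by (simp add: C3_def)
  define C where "C = C1 + C2 + C3"
  have Cge: "C1 + C2 \<le> C" "C3 \<le> C" "0 \<le> C" using C1 C2 C3 by (auto simp: C_def)
  show thesis
  proof (rule that[OF Cge(3) R1])
    fix \<Omega> g G x0 r
    assume wg: "weak_gradient E \<Omega> g G" and G: "set_borel_measurable lebesgue \<Omega> G" and \<Omega>: "open \<Omega>"
      and g: "set_integrable lebesgue \<Omega> g" and r: "0 < r" and sub: "gball E x0 r \<subseteq> \<Omega>"
      and fin: "(\<integral>\<^sup>+y\<in>gball E x0 r. ennreal (norm (G y)) \<partial>lebesgue) < \<infinity>"
    let ?B = "gball E x0 r"
    let ?J = "\<lambda>U. \<integral>\<^sup>+y\<in>U. ennreal (norm (G y)) \<partial>lebesgue"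
    have J: "?J U = ennreal (enn2real (?J U))" if "U \<subseteq> ?B" for U
    proof -
      have "?J U \<le> ?J ?B" using that by (intro nn_integral_mono) (auto simp: indicator_def)
      then show ?thesis using fin by (simp add: le_less_trans)
    qed
    \<comment> \<open>The first bump is centred at x0 with radius c * r, so that this value does not
      depend on x.\<close>
    define a where "a = (LINT y:\<Omega>|lebesgue. g y * bump \<phi> x0 (c * r) y)"
    show "\<exists>a. \<forall>x\<in>?B. \<exists>F::nat \<Rightarrow> 'a \<Rightarrow> real.
       (\<forall>k. integrable lebesgue (F k) \<and> (\<integral>y. F k y \<partial>lebesgue) = 1 \<and>
         (\<forall>y. \<bar>F k y\<bar> \<le> C * (r / 2 ^ k) powr - Q) \<and>
         (\<forall>y. F k y \<noteq> 0 \<longrightarrow> y \<in> ?B \<inter> gball E x (R * (r / 2 ^ k))) \<and>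
         ennreal \<bar>(LINT y:\<Omega>|lebesgue. g y * F k y) - a\<bar> \<le>
           ennreal C * (\<Sum>j\<le>k. ennreal ((r / 2 ^ j) powr (1 - Q)) * ?J (?B \<inter> gball E x (R * (r / 2 ^ j)))))"
    proof (intro exI[of _ a] ballI)
      fix x assume x: "x \<in> ?B"
      obtain \<xi> where \<xi>: "N \<xi> < 1" "x = gmult x0 (dil r \<xi>)" using x gball_image[OF r] by auto
      obtain p where p: "norm p \<le> Rp"
        and pc: "\<And>s w. 0 < s \<Longrightarrow> s \<le> 1 \<Longrightarrow> N w < 1 \<Longrightarrow> N (gmult \<xi> (dil s (gmult p (dil c w)))) < 1"
        using cone[OF \<xi>(1)] by blast
      define q where "q = gmult \<xi> p"
      have q: "N q < 1" using pc[of 1 0] by (simp add: dil_1 dil_0 mult_0 q_def N_0)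
      \<comment> \<open>The axis of the twisted cone at x: the bump at scale s has centre
        \<open>Z s\<close> and radius c * s, so its distance from x and its size shrink
        together.\<close>
      define Z where "Z s = gmult x (dil s p)" for s
      define F where "F k = bump \<phi> (Z (r / 2 ^ k)) (c * (r / 2 ^ k))" for k :: nat
      let ?U = "\<lambda>s. ?B \<inter> gball E x (R * s)"
      have contain: "gmult (Z s) (dil (c * s) w) \<in> ?U s'" if "0 < s" "s \<le> s'" "s' \<le> r" "N w < 1" for s s' w
      proof -
        have eq: "gmult (Z s) (dil (c * s) w) = gmult x (dil s (gmult p (dil c w)))"
          by (simp add: Z_def mult_assoc dil_mult dil_dil mult.commute)
        \<comment> \<open>Rescaled to the unit ball, the point is the one in the cone condition at
          \<xi> with parameter s / r \<le> 1.\<close>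
        also have "\<dots> = gmult x0 (dil r (gmult \<xi> (dil (s / r) (gmult p (dil c w)))))"
          using r by (simp add: \<xi>(2) mult_assoc dil_mult dil_dil)
        also have "\<dots> \<in> ?B" unfolding mem_gball_iff[OF r]
          by (rule pc) (use that r in auto)
        finally have 1: "gmult (Z s) (dil (c * s) w) \<in> ?B" .
        have "s * N (gmult p (dil c w)) < s * R" using pR[OF p that(4)] that(1) by simp
        also have "\<dots> \<le> R * s'" using that(2) R1 by (simp add: mult.commute)
        finally have "gmult (Z s) (dil (c * s) w) \<in> gball E x (R * s')"
          unfolding eq gball_eq using that(1) by (simp add: mult_cancel N_dil)
        with 1 show ?thesis by simp
      qed
      have Bx: "?U r = ?B"
      proof -
        \<comment> \<open>R exceeds the quasi-triangle constant K, so at the top scale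
          \<open>?U r\<close> is the whole ball, and the bump coming from x0 may pass anywhere in
          it.\<close>
        have "?B \<subseteq> gball E x (R * r)"
        proof
          fix y assume y: "y \<in> ?B"
          have "N (gmult (- x) x0) \<le> r" using x N_minus[of "gmult (- x0) x"] by (simp add: gball_eq minus_mult)
          moreover have "N (gmult (- x0) y) \<le> r" using y by (simp add: gball_eq)
          ultimately have "N (gmult (gmult (- x) x0) (gmult (- x0) y)) \<le> K * r" by (rule K(2)[OF r])
          also have "\<dots> < R * r" using KR r by simp
          finally show "y \<in> gball E x (R * r)" by (simp add: gball_eq mult_assoc mult_cancel)
        qed
        then show ?thesis by auto
      qed
      have Usets: "?U s \<in> sets lebesgue" for s by auto
      have step1: "\<bar>(LINT y:\<Omega>|lebesgue. g y * bump \<phi> (Z s) (c * s) y) -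
          (LINT y:\<Omega>|lebesgue. g y * bump \<phi> (Z (s / 2)) (c * (s / 2)) y)\<bar> \<le> C1 * s powr (1 - Q) * enn2real (?J (?U s))"
        if s: "0 < s" "s \<le> r" for s
      proof -
        have "\<bar>(LINT y:\<Omega>|lebesgue. g y * bump \<phi> (Z s) (c * s) y) -
          (LINT y:\<Omega>|lebesgue. g y * bump \<phi> (Z (s / 2)) (c * (s / 2)) y)\<bar> \<le>
          C0 * k1 * (s - s / 2) * (c * s / 2) powr - Q * enn2real (?J (?U s))"
        proof (rule flow[OF wg G \<Omega> g, where z = Z and \<rho> = "\<lambda>s. c * s" and \<rho>' = "\<lambda>_. c" and U = "?U s"
              and z' = "\<lambda>t. p + ((2 * t - 1) * f p + B x p / 2) *\<^sub>R T"])
          fix t assume t: "t \<in> {s / 2..s}"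
          have tpos: "0 < t" using t s by auto
          have Z_eq: "Z = (\<lambda>t. x + t *\<^sub>R p + ((t\<^sup>2 - t) * f p + t * B x p / 2) *\<^sub>R T)"
            by (simp add: Z_def mult_def B_dil fun_eq_iff) (simp add: dil_def scaleR_add_left)
          have "((\<lambda>t. (t\<^sup>2 - t) * f p + t * B x p / 2) has_real_derivative (2 * t - 1) * f p + B x p / 2) (at t within {s / 2..s})"
            by (auto intro!: derivative_eq_intros)
          then show "(Z has_vector_derivative p + ((2 * t - 1) * f p + B x p / 2) *\<^sub>R T) (at t within {s / 2..s})"
            unfolding Z_eq by (auto intro!: derivative_eq_intros)
          show "((\<lambda>s. c * s) has_real_derivative c) (at t within {s / 2..s})" by (auto intro!: derivative_eq_intros)
          show "c * s / 2 \<le> c * t" using t c by auto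
          show "\<bar>(p + ((2 * t - 1) * f p + B x p / 2) *\<^sub>R T) \<bullet> e i\<bar> \<le> k1" for i
          proof -
            have "\<bar>p \<bullet> e i\<bar> \<le> norm p * norm (e i)" by (rule Cauchy_Schwarz_ineq2)
            also have "norm (e i) = 1" using e(1)[of i] by (simp add: norm_eq_sqrt_inner)
            finally show ?thesis using p k1 by (simp add: inner_add_left e k1_def)
          qed
          show "\<bar>c\<bar> \<le> k1" using c k1 Rp0 by (simp add: k1_def)
          have "f (p + ((2 * t - 1) * f p + B x p / 2) *\<^sub>R T) - B (Z t) (p + ((2 * t - 1) * f p + B x p / 2) *\<^sub>R T) / 2 = 2 * t * f p"
            by (cases "T = 0") (simp_all add: T0 f_simps Z_def B_mult B_simps B_dil algebra_simps)
          moreover have "\<bar>2 * t * f p\<bar> \<le> k1 * (c * t)"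
          proof -
            have "\<bar>f p\<bar> \<le> Rp * Lf" using Lf(2)[of p] mult_right_mono[OF p Lf(1)] by linarith
            then have "\<bar>f p\<bar> * (2 * t) \<le> Rp * Lf * (2 * t)" using tpos by (intro mult_right_mono) auto
            also have "\<dots> = (2 * Lf * Rp / c) * (c * t)" using c by simp
            also have "\<dots> \<le> k1 * (c * t)" using c tpos Rp0 by (intro mult_right_mono) (auto simp: k1_def)
            finally show ?thesis using tpos by (simp add: abs_mult mult_ac)
          qed
          ultimately show "\<bar>f (p + ((2 * t - 1) * f p + B x p / 2) *\<^sub>R T) -
              B (Z t) (p + ((2 * t - 1) * f p + B x p / 2) *\<^sub>R T) / 2\<bar> \<le> k1 * (c * t)" by simp
          show "gmult (Z t) (dil (c * t) w) \<in> ?U s" if "w \<in> S" for w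
            using contain[of t s w] S[OF that] tpos t s by auto
        qed (use s c sub Usets J[of "?U s"] in auto)
        also have "\<dots> = C1 * (s * s powr - Q) * enn2real (?J (?U s))"
        proof -
          have "(c * s / 2) powr - Q = (c / 2) powr - Q * s powr - Q"
            using c s by (simp add: powr_mult[symmetric])
          then show ?thesis by (simp add: C1_def)
        qed
        also have "s * s powr - Q = s powr (1 - Q)" using s by (simp add: powr_diff powr_minus field_simps)
        finally show ?thesis .
      qed
      have step2: "\<bar>(LINT y:\<Omega>|lebesgue. g y * bump \<phi> (Z r) (c * r) y) - a\<bar> \<le> C2 * r powr (1 - Q) * enn2real (?J (?U r))"
      proof -
        \<comment> \<open>The remaining step joins x0 to the top of the chain at fixed radius. The
          centre follows a straight line in the rescaled coordinates, so that
          \<open>minus_dil_scale\<close> and \<open>N_convex\<close> keep the bump inside the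
          ball.\<close>
        define z where "z t = gmult x0 (dil r (t *\<^sub>R q))" for t
        have z1: "z 1 = Z r" by (simp add: z_def Z_def q_def \<xi>(2) dil_mult mult_assoc)
        have z0: "z 0 = x0" by (simp add: z_def dil_0 mult_0)
        let ?z' = "dil r q + (r * B x0 q / 2) *\<^sub>R T"
        have "\<bar>(LINT y:\<Omega>|lebesgue. g y * bump \<phi> (z 1) (c * r) y) - (LINT y:\<Omega>|lebesgue. g y * bump \<phi> (z 0) (c * r) y)\<bar> \<le>
          C0 * (r * (Kb + Kb / c)) * (1 - 0) * (c * r) powr - Q * enn2real (?J (?U r))"
        proof (rule flow[OF wg G \<Omega> g, where z = z and \<rho> = "\<lambda>_. c * r" and \<rho>' = "\<lambda>_. 0" and U = "?U r"
              and z' = "\<lambda>_. ?z'" and a = 0 and b = 1])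
          fix t :: real assume t: "t \<in> {0..1}"
          have z_eq: "z = (\<lambda>t. x0 + t *\<^sub>R ?z')"
            by (simp add: z_def mult_def dil_scale B_dil B_simps fun_eq_iff algebra_simps)
          show "(z has_vector_derivative ?z') (at t within {0..1})"
            unfolding z_eq by (auto intro!: derivative_eq_intros)
          show "((\<lambda>_. c * r) has_real_derivative 0) (at t within {0..1})" by simp
          have Kr: "r * Kb \<le> r * (Kb + Kb / c)" "0 \<le> r * (Kb + Kb / c)" using r Kb_nn c by auto
          show "\<bar>?z' \<bullet> e i\<bar> \<le> r * (Kb + Kb / c)" for i
          proof -
            have "\<bar>q \<bullet> e i\<bar> \<le> norm q * norm (e i)" by (rule Cauchy_Schwarz_ineq2)
            also have "norm (e i) = 1" using e(1)[of i] by (simp add: norm_eq_sqrt_inner)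
            finally have "\<bar>q \<bullet> e i\<bar> \<le> Kb" using Kb(1)[of q] q by simp
            then have "r * \<bar>q \<bullet> e i\<bar> \<le> r * Kb" using r by (intro mult_left_mono) auto
            moreover have "?z' \<bullet> e i = r * (q \<bullet> e i)" by (simp add: dil_def inner_add_left e)
            ultimately show ?thesis using Kr r by (simp add: abs_mult)
          qed
          show "\<bar>0::real\<bar> \<le> r * (Kb + Kb / c)" using Kr by simp
          have "f ?z' - B (z t) ?z' / 2 = r\<^sup>2 * f q"
            by (cases "T = 0") (simp_all add: T0 f_simps f_dil z_def B_mult B_simps B_dil dil_scale algebra_simps)
          moreover have "\<bar>r\<^sup>2 * f q\<bar> \<le> r * (Kb + Kb / c) * (c * r)"
          proof -
            have "r\<^sup>2 * \<bar>f q\<bar> \<le> r\<^sup>2 * Kb" using Kb(2)[of q] q by (intro mult_left_mono) auto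
            also have "\<dots> = r * (Kb / c) * (c * r)" using c by (simp add: power2_eq_square)
            also have "\<dots> \<le> r * (Kb + Kb / c) * (c * r)"
              using c r Kb_nn by (intro mult_right_mono mult_left_mono) auto
            finally show ?thesis by (simp add: abs_mult)
          qed
          ultimately show "\<bar>f ?z' - B (z t) ?z' / 2\<bar> \<le> r * (Kb + Kb / c) * (c * r)" by simp
          show "gmult (z t) (dil (c * r) w) \<in> ?U r" if w: "w \<in> S" for w
          proof -
            have eq: "gmult (z t) (dil (c * r) w) = gmult x0 (dil r (gmult (t *\<^sub>R q) (dil c w)))"
              by (simp add: z_def mult_assoc dil_mult dil_dil mult.commute)
            have "N (dil c w) < 1"
            proof -
              have "c * N w \<le> N w" using c N_nonneg[of w] by (simp add: mult_left_le_one_le)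
              then show ?thesis using S[OF w] c by (simp add: N_dil)
            qed
            moreover have "N (gmult q (dil c w)) < 1"
              using pc[of 1 w] S[OF w] by (simp add: dil_1 q_def mult_assoc)
            ultimately have "N (t *\<^sub>R gmult q (dil c w) + (1 - t) *\<^sub>R dil c w) < 1"
              using convexD[OF N_convex, of "gmult q (dil c w)" "dil c w" t "1 - t"] t by simp
            then show ?thesis unfolding Bx eq mem_gball_iff[OF r] minus_dil_scale .
          qed
        qed (use r c sub Usets J[of "?U r"] in auto)
        also have "\<dots> = C2 * (r * r powr - Q) * enn2real (?J (?U r))"
          using c r by (simp add: C2_def powr_mult)
        also have "r * r powr - Q = r powr (1 - Q)" using r by (simp add: powr_diff powr_minus field_simps)
        finally show ?thesis unfolding z1 z0 a_def .
      qed
      define t where "t j = (r / 2 ^ j) powr (1 - Q) * enn2real (?J (?U (r / 2 ^ j)))" for j :: nat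
      have t0: "0 \<le> t j" for j by (simp add: t_def)
      have "\<bar>(LINT y:\<Omega>|lebesgue. g y * F k y) - a\<bar> \<le> C2 * t 0 + C1 * (\<Sum>j<k. t j)" for k
      proof (induction k)
        case 0
        then show ?case using step2 by (simp add: F_def t_def)
      next
        case (Suc k)
        have "\<bar>(LINT y:\<Omega>|lebesgue. g y * F k y) - (LINT y:\<Omega>|lebesgue. g y * F (Suc k) y)\<bar> \<le> C1 * t k"
        proof -
          have "r / 2 ^ k \<le> r" using r by (simp add: field_simps)
          then have "\<bar>(LINT y:\<Omega>|lebesgue. g y * bump \<phi> (Z (r / 2 ^ k)) (c * (r / 2 ^ k)) y) -
            (LINT y:\<Omega>|lebesgue. g y * bump \<phi> (Z (r / 2 ^ k / 2)) (c * (r / 2 ^ k / 2)) y)\<bar>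
            \<le> C1 * (r / 2 ^ k) powr (1 - Q) * enn2real (?J (?U (r / 2 ^ k)))"
            using r by (intro step1) auto
          moreover have "r / 2 ^ k / 2 = r / 2 ^ Suc k" by simp
          ultimately show ?thesis unfolding F_def t_def by (simp only: mult.assoc)
        qed
        with Suc.IH show ?case by (simp add: distrib_left)
      qed
      then have bound: "\<bar>(LINT y:\<Omega>|lebesgue. g y * F k y) - a\<bar> \<le> C * (\<Sum>j\<le>k. t j)" for k
      proof -
        have "C2 * t 0 + C1 * (\<Sum>j<k. t j) \<le> C2 * (\<Sum>j\<le>k. t j) + C1 * (\<Sum>j\<le>k. t j)"
          using t0 C1 C2
          by (intro add_mono mult_left_mono member_le_sum[of 0 "{..k}" t] sum_mono2) auto
        also have "\<dots> \<le> C * (\<Sum>j\<le>k. t j)"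
          unfolding distrib_right[symmetric] using Cge(1) t0 by (intro mult_right_mono sum_nonneg) auto
        finally show ?thesis using \<open>\<And>k. \<bar>(LINT y:\<Omega>|lebesgue. g y * F k y) - a\<bar> \<le> C2 * t 0 + C1 * (\<Sum>j<k. t j)\<close>[of k] by linarith
      qed
      show "\<exists>F::nat \<Rightarrow> 'a \<Rightarrow> real.
       (\<forall>k. integrable lebesgue (F k) \<and> (\<integral>y. F k y \<partial>lebesgue) = 1 \<and>
         (\<forall>y. \<bar>F k y\<bar> \<le> C * (r / 2 ^ k) powr - Q) \<and>
         (\<forall>y. F k y \<noteq> 0 \<longrightarrow> y \<in> ?B \<inter> gball E x (R * (r / 2 ^ k))) \<and>
         ennreal \<bar>(LINT y:\<Omega>|lebesgue. g y * F k y) - a\<bar> \<le>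
           ennreal C * (\<Sum>j\<le>k. ennreal ((r / 2 ^ j) powr (1 - Q)) * ?J (?U (r / 2 ^ j))))"
      proof (intro exI[of _ F] allI conjI impI)
        fix k y
        let ?s = "r / 2 ^ k"
        have s: "0 < ?s" "0 < c * ?s" "?s \<le> r" using r c by (simp_all add: field_simps)
        show "integrable lebesgue (F k)" "(\<integral>y. F k y \<partial>lebesgue) = 1"
          unfolding F_def by (rule bump_integral[OF \<phi>(1) \<phi>1 s(2)])+
        have "\<bar>F k y\<bar> \<le> (c * ?s) powr - Q * M"
          unfolding F_def bump_def abs_mult using M by (intro mult_mono) auto
        also have "\<dots> = C3 * ?s powr - Q" unfolding C3_def using c s(1) by (subst powr_mult) auto
        also have "\<dots> \<le> C * ?s powr - Q" using Cge(2) by (intro mult_right_mono) auto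
        finally show "\<bar>F k y\<bar> \<le> C * ?s powr - Q" .
        have "ennreal \<bar>(LINT y:\<Omega>|lebesgue. g y * F k y) - a\<bar> \<le> ennreal (C * (\<Sum>j\<le>k. t j))"
          by (intro ennreal_leI bound)
        also have "\<dots> = ennreal C * (\<Sum>j\<le>k. ennreal (t j))"
          using Cge(3) t0 by (simp add: ennreal_mult sum_nonneg sum_ennreal)
        also have "(\<Sum>j\<le>k. ennreal (t j)) = (\<Sum>j\<le>k. ennreal ((r / 2 ^ j) powr (1 - Q)) * ?J (?U (r / 2 ^ j)))"
        proof (intro sum.cong refl)
          fix j
          show "ennreal (t j) = ennreal ((r / 2 ^ j) powr (1 - Q)) * ?J (?U (r / 2 ^ j))"
            unfolding t_def ennreal_mult'[OF powr_ge_zero] by (subst J[symmetric]) auto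
        qed
        finally show "ennreal \<bar>(LINT y:\<Omega>|lebesgue. g y * F k y) - a\<bar> \<le>
           ennreal C * (\<Sum>j\<le>k. ennreal ((r / 2 ^ j) powr (1 - Q)) * ?J (?U (r / 2 ^ j)))" .
        assume "F k y \<noteq> 0"
        then have w: "W (Z ?s) (c * ?s) y \<in> S" using \<phi>(3) by (auto simp: F_def bump_def)
        have "y \<in> ?U ?s"
          using contain[of ?s ?s "W (Z ?s) (c * ?s) y"] S[OF w] s W_inverse[OF s(2), of "Z ?s" y] by auto
        then show "y \<in> ?U ?s" .
      qed
    qed
  qed
qed

end

section \<open>The Sobolev--Poincare inequality\<close>

text \<open>Hoelder's inequality up to a factor 2: integrate h \<le> t + t^(1 - p) h^p over D and
  choose t so that both terms are equal. For \<alpha> = 0 the optimum is only approached, as t tends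
  to 0.\<close>

lemma nn_integral_le_powr:
  fixes h :: "'a \<Rightarrow> real"
  assumes h[measurable]: "h \<in> borel_measurable M" and D[measurable]: "D \<in> sets M" and h0: "\<And>x. 0 \<le> h x"
    and p: "1 < p" and \<alpha>: "0 \<le> \<alpha>" "(\<integral>\<^sup>+x\<in>D. ennreal (h x powr p) \<partial>M) \<le> ennreal \<alpha>"
    and d: "0 < d" "emeasure M D = ennreal d"
  shows "(\<integral>\<^sup>+x\<in>D. ennreal (h x) \<partial>M) \<le> ennreal (2 * d powr (1 - 1 / p) * \<alpha> powr (1 / p))"
proof -
  have *: "(\<integral>\<^sup>+x\<in>D. ennreal (h x) \<partial>M) \<le> ennreal (t * d + t powr (1 - p) * \<alpha>)" if t: "0 < t" for t
  proof -
    have le: "h x \<le> t + t powr (1 - p) * h x powr p" for x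
    proof (cases "h x \<le> t")
      case False
      then have hx: "0 < h x" "t \<le> h x" using t by auto
      have "h x = h x powr (1 - p) * h x powr p" using hx by (simp add: powr_add[symmetric])
      also have "\<dots> \<le> t powr (1 - p) * h x powr p"
        using hx t p by (intro mult_right_mono powr_mono2') auto
      finally show ?thesis using t by linarith
    qed (simp add: add_increasing2)
    have "(\<integral>\<^sup>+x\<in>D. ennreal (h x) \<partial>M) \<le>
        (\<integral>\<^sup>+x. ennreal t * indicator D x + ennreal (t powr (1 - p)) * (ennreal (h x powr p) * indicator D x) \<partial>M)"
    proof (rule nn_integral_mono)
      fix x
      show "ennreal (h x) * indicator D x \<le>
          ennreal t * indicator D x + ennreal (t powr (1 - p)) * (ennreal (h x powr p) * indicator D x)"
        using le[of x] t by (auto simp: indicator_def ennreal_mult[symmetric] ennreal_plus[symmetric]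
            simp del: ennreal_plus intro!: ennreal_leI)
    qed
    also have "\<dots> = ennreal t * ennreal d + ennreal (t powr (1 - p)) * (\<integral>\<^sup>+x\<in>D. ennreal (h x powr p) \<partial>M)"
      by (subst nn_integral_add) (auto simp: nn_integral_cmult nn_integral_cmult_indicator d)
    also have "\<dots> \<le> ennreal t * ennreal d + ennreal (t powr (1 - p)) * ennreal \<alpha>"
      using \<alpha> by (intro add_left_mono mult_left_mono) auto
    also have "\<dots> = ennreal (t * d + t powr (1 - p) * \<alpha>)"
      using t d \<alpha> by (simp add: ennreal_mult)
    finally show ?thesis .
  qed
  show ?thesis
  proof (cases "\<alpha> = 0")
    case True
    have "(\<integral>\<^sup>+x\<in>D. ennreal (h x) \<partial>M) \<le> 0"
    proof (rule ennreal_le_epsilon)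
      fix \<epsilon> :: real assume "0 < \<epsilon>"
      then show "(\<integral>\<^sup>+x\<in>D. ennreal (h x) \<partial>M) \<le> 0 + ennreal \<epsilon>" using *[of "\<epsilon> / d"] d True by simp
    qed
    then show ?thesis by simp
  next
    case False
    define t where "t = (\<alpha> / d) powr (1 / p)"
    have a: "0 < \<alpha>" using False \<alpha> by simp
    have "t * d = d powr (1 - 1 / p) * \<alpha> powr (1 / p)"
      using a d by (simp add: t_def powr_divide powr_diff)
    moreover have "t powr (1 - p) * \<alpha> = d powr (1 - 1 / p) * \<alpha> powr (1 / p)"
    proof -
      have "1 / p * (1 - p) = 1 / p - 1" using p by (simp add: field_simps)
      then have "t powr (1 - p) = (\<alpha> / d) powr (1 / p - 1)" by (simp add: t_def powr_powr)
      then show ?thesis using a d by (simp add: powr_divide powr_diff field_simps)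
    qed
    ultimately have "t * d + t powr (1 - p) * \<alpha> = 2 * d powr (1 - 1 / p) * \<alpha> powr (1 / p)"
      by linarith
    moreover have "0 < t" using a d by (simp add: t_def)
    ultimately show ?thesis using *[of t] by metis
  qed
qed

text \<open>The terms grow geometrically up to the scale 2^j = y and decay geometrically after it.
  The telescoping sequences \<open>p\<close> and \<open>x\<close> capture the two regimes without
  locating that scale, so the bound depends neither on y nor on k.\<close>

lemma sum_min_geometric:
  fixes y \<gamma> :: real
  assumes y: "0 < y" and \<gamma>: "0 < \<gamma>"
  shows "(\<Sum>j\<le>k. min (y / 2 ^ j) ((y / 2 ^ j) powr - \<gamma>)) \<le> 2 + 1 / (1 - 2 powr - \<gamma>)"
proof -
  define c where "c = 1 - 2 powr - \<gamma>"
  have "2 powr - \<gamma> < 2 powr 0" using \<gamma> by (intro powr_less_mono) auto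
  then have c: "0 < c" "c \<le> 1" by (auto simp: c_def)
  define x where "x j = min 1 (y / 2 ^ j)" for j :: nat
  define p where "p j = min 1 (2 powr - \<gamma> * (y / 2 ^ j) powr - \<gamma>)" for j :: nat
  have half: "(y / 2 ^ Suc j) powr - \<gamma> * 2 powr - \<gamma> = (y / 2 ^ j) powr - \<gamma>" for j
  proof -
    have "(y / 2 ^ Suc j) powr - \<gamma> * 2 powr - \<gamma> = (y / 2 ^ Suc j * 2) powr - \<gamma>"
      using y by (intro powr_mult[symmetric])
    then show ?thesis by simp
  qed
  have le: "min (y / 2 ^ j) ((y / 2 ^ j) powr - \<gamma>) \<le> 2 * (x j - x (Suc j)) + (p (Suc j) - p j) / c" for j
  proof -
    have xm: "x (Suc j) \<le> x j" using y by (auto simp: x_def min_def field_simps)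
    have p_Suc: "p (Suc j) = min 1 ((y / 2 ^ j) powr - \<gamma>)"
      unfolding p_def using half[of j] by (simp only: mult.commute)
    have le1: "2 powr - \<gamma> * (y / 2 ^ j) powr - \<gamma> \<le> (y / 2 ^ j) powr - \<gamma>"
      using c by (intro mult_left_le_one_le) (auto simp: c_def)
    have "p j \<le> min 1 ((y / 2 ^ j) powr - \<gamma>)" unfolding p_def by (intro min.mono le1 order_refl)
    then have pm: "p j \<le> p (Suc j)" by (simp only: p_Suc)
    show ?thesis
    proof (cases "y / 2 ^ j \<le> 1")
      case True
      then have "y / 2 ^ j = 2 * (x j - x (Suc j))"
        using y by (auto simp: x_def min_def field_simps)
      then show ?thesis using pm c by (simp add: min.coboundedI1)
    next
      case False
      then have "(y / 2 ^ j) powr - \<gamma> \<le> 1 powr - \<gamma>"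
        using \<gamma> by (intro powr_mono2') auto
      then have "(y / 2 ^ j) powr - \<gamma> \<le> 1" by simp
      then have "p (Suc j) = (y / 2 ^ j) powr - \<gamma>" "p j = 2 powr - \<gamma> * (y / 2 ^ j) powr - \<gamma>"
        unfolding p_Suc using le1 by (simp_all add: p_def)
      then have "p (Suc j) - p j = c * (y / 2 ^ j) powr - \<gamma>"
        by (simp add: c_def left_diff_distrib)
      then show ?thesis using xm c by (simp add: min.coboundedI2)
    qed
  qed
  have "(\<Sum>j\<le>k. min (y / 2 ^ j) ((y / 2 ^ j) powr - \<gamma>)) \<le>
      (\<Sum>j\<le>k. 2 * (x j - x (Suc j)) + (p (Suc j) - p j) / c)"
    by (intro sum_mono le)
  also have "\<dots> = 2 * (\<Sum>j\<le>k. x j - x (Suc j)) + (\<Sum>j\<le>k. p (Suc j) - p j) / c"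
    by (simp add: sum.distrib sum_distrib_left sum_divide_distrib)
  also have "(\<Sum>j\<le>k. x j - x (Suc j)) = x 0 - x (Suc k)" by (induction k) auto
  also have "(\<Sum>j\<le>k. p (Suc j) - p j) = p (Suc k) - p 0" by (induction k) auto
  also have "2 * (x 0 - x (Suc k)) + (p (Suc k) - p 0) / c \<le> 2 + 1 / c"
  proof (intro add_mono divide_right_mono)
    have "0 \<le> x (Suc k)" "x 0 \<le> 1" using y by (auto simp: x_def)
    then have "x 0 - x (Suc k) \<le> 1" by (simp add: algebra_simps)
    then show "2 * (x 0 - x (Suc k)) \<le> 2" by simp
    have "0 \<le> p 0" "p (Suc k) \<le> 1" by (auto simp: p_def)
    then show "p (Suc k) - p 0 \<le> 1" by linarith
  qed (use c in auto)
  finally show ?thesis by (simp add: c_def)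
qed

text \<open>Hedberg's estimate: small scales are controlled by \<open>m\<close>, large ones by \<open>b\<close>.\<close>

lemma sum_dyadic_interpolation:
  fixes t :: "nat \<Rightarrow> real"
  assumes r: "0 < r" and \<gamma>: "0 < \<gamma>" and mb: "0 < m" "0 < b"
    and t: "\<And>j. t j \<le> c * ((r / 2 ^ j) * m)" "\<And>j. t j \<le> c * ((r / 2 ^ j) powr - \<gamma> * b)" and c: "0 \<le> c"
  shows "(\<Sum>j\<le>k. t j) \<le> c * (2 + 1 / (1 - 2 powr - \<gamma>)) * (m powr (\<gamma> / (1 + \<gamma>)) * b powr (1 / (1 + \<gamma>)))"
proof -
  \<comment> \<open>The scale at which both bounds agree,
    \<open>s * m = s powr - \<gamma> * b\<close>; \<open>v\<close> is their common value.\<close>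
  define s where "s = (b / m) powr (1 / (1 + \<gamma>))"
  define v where "v = m powr (\<gamma> / (1 + \<gamma>)) * b powr (1 / (1 + \<gamma>))"
  have s: "0 < s" using mb by (simp add: s_def)
  have e: "\<gamma> / (1 + \<gamma>) = 1 - 1 / (1 + \<gamma>)" using \<gamma> by (simp add: field_simps)
  have v1: "v = s * m"
    using mb unfolding v_def s_def e by (simp add: powr_divide powr_diff)
  have v2: "v = s powr - \<gamma> * b"
  proof -
    have "s powr - \<gamma> = (b / m) powr (1 / (1 + \<gamma>) - 1)"
    proof -
      have "1 / (1 + \<gamma>) * - \<gamma> = 1 / (1 + \<gamma>) - 1" using \<gamma> by (simp add: field_simps)
      then show ?thesis unfolding s_def powr_powr by (rule arg_cong)
    qed
    then show ?thesis using mb unfolding v_def e by (simp add: powr_divide powr_diff field_simps)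
  qed
  have v0: "0 \<le> v" using v1 s mb by simp
  have "t j \<le> c * v * min (r / s / 2 ^ j) ((r / s / 2 ^ j) powr - \<gamma>)" for j
  proof -
    have "(r / 2 ^ j) * m = v * (r / s / 2 ^ j)" using v1 s by simp
    moreover have "(r / 2 ^ j) powr - \<gamma> * b = v * (r / s / 2 ^ j) powr - \<gamma>"
    proof -
      have "(r / s / 2 ^ j) powr - \<gamma> = (r / 2 ^ j / s) powr - \<gamma>" by (simp add: mult.commute)
      also have "\<dots> = (r / 2 ^ j) powr - \<gamma> / s powr - \<gamma>" using r s by (intro powr_divide)
      finally show ?thesis using v2 s by simp
    qed
    ultimately have "t j \<le> c * v * (r / s / 2 ^ j)" "t j \<le> c * v * (r / s / 2 ^ j) powr - \<gamma>"
      using t[of j] by (simp_all only: mult.assoc)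
    then show ?thesis by (simp add: min_def)
  qed
  then have "(\<Sum>j\<le>k. t j) \<le> c * v * (\<Sum>j\<le>k. min (r / s / 2 ^ j) ((r / s / 2 ^ j) powr - \<gamma>))"
    by (simp add: sum_distrib_left sum_mono)
  also have "\<dots> \<le> c * v * (2 + 1 / (1 - 2 powr - \<gamma>))"
    using r s c v0 by (intro mult_left_mono sum_min_geometric \<gamma>) auto
  finally show ?thesis by (simp add: v_def mult_ac)
qed

context step_two begin

text \<open>Each term of the chain is at most a multiple of \<open>r / 2 ^ j\<close> times the
  maximal function and, by Hoelder, of a negative power of \<open>r / 2 ^ j\<close> times the
  L^\<theta> norm. The bumps have mass 1 and shrink to x at a rate comparable to their size, so at
  Lebesgue points their pairings with g tend to \<open>g x\<close>.\<close>

lemma sobolev_poincare_pointwise: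
  assumes \<theta>: "1 < \<theta>" "\<theta> < Q"
  obtains C where "0 \<le> C" "\<And>\<Omega> g G x0 r \<alpha>.
    \<lbrakk>weak_gradient E \<Omega> g G; set_borel_measurable lebesgue \<Omega> G; open \<Omega>; set_integrable lebesgue \<Omega> g;
     0 < r; gball E x0 r \<subseteq> \<Omega>; 0 \<le> \<alpha>;
     (\<integral>\<^sup>+y\<in>gball E x0 r. ennreal (norm (G y) powr \<theta>) \<partial>lebesgue) = ennreal \<alpha>\<rbrakk> \<Longrightarrow>
     \<exists>a. AE x in lebesgue. x \<in> gball E x0 r \<longrightarrow> ennreal \<bar>g x - a\<bar> \<le>
       ennreal (C * \<alpha> powr (1 / Q)) *
       ennreal_powr (max_fn (\<lambda>y. ennreal (indicator (gball E x0 r) y * norm (G y))) x) (1 - \<theta> / Q)"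
proof -
  obtain C0 R where C0: "0 \<le> C0" and R: "1 \<le> R" and chain: "\<And>\<Omega> g G x0 r.
    \<lbrakk>weak_gradient E \<Omega> g G; set_borel_measurable lebesgue \<Omega> G; open \<Omega>; set_integrable lebesgue \<Omega> g;
     0 < r; gball E x0 r \<subseteq> \<Omega>; (\<integral>\<^sup>+y\<in>gball E x0 r. ennreal (norm (G y)) \<partial>lebesgue) < \<infinity>\<rbrakk> \<Longrightarrow>
     \<exists>a. \<forall>x\<in>gball E x0 r. \<exists>F::nat \<Rightarrow> 'a \<Rightarrow> real.
       (\<forall>k. integrable lebesgue (F k) \<and> (\<integral>y. F k y \<partial>lebesgue) = 1 \<and>
         (\<forall>y. \<bar>F k y\<bar> \<le> C0 * (r / 2 ^ k) powr - Q) \<and>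
         (\<forall>y. F k y \<noteq> 0 \<longrightarrow> y \<in> gball E x0 r \<inter> gball E x (R * (r / 2 ^ k))) \<and>
         ennreal \<bar>(LINT y:\<Omega>|lebesgue. g y * F k y) - a\<bar> \<le>
           ennreal C0 * (\<Sum>j\<le>k. ennreal ((r / 2 ^ j) powr (1 - Q)) *
             (\<integral>\<^sup>+y\<in>gball E x0 r \<inter> gball E x (R * (r / 2 ^ j)). ennreal (norm (G y)) \<partial>lebesgue)))"
    using chain by blast
  \<comment> \<open>At scale s the factor s^(1 - Q) of the chain and the power 1 - 1/\<theta> of the
    volume combine to s^(- \<gamma>). Interpolation then has the exponents 1 - \<theta>/Q for the
    maximal function and \<theta>/Q for the norm.\<close>
  define \<gamma> where "\<gamma> = Q / \<theta> - 1"
  have \<gamma>: "0 < \<gamma>" using \<theta> by (simp add: \<gamma>_def)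
  have \<gamma>1: "1 + \<gamma> = Q / \<theta>" by (simp add: \<gamma>_def)
  have e1: "1 / (1 + \<gamma>) = \<theta> / Q" "\<gamma> / (1 + \<gamma>) = 1 - \<theta> / Q"
    unfolding \<gamma>1 unfolding \<gamma>_def using \<theta> by (simp_all add: field_simps)
  define c where "c = \<omega> * R powr Q + 2 * (\<omega> * R powr Q) powr (1 - 1 / \<theta>)"
  have c: "0 \<le> c" using omega_pos by (simp add: c_def)
  define c' where "c' = c * (2 + 1 / (1 - 2 powr - \<gamma>))"
  have "2 powr - \<gamma> < 2 powr 0" using \<gamma> by (intro powr_less_mono) auto
  then have c': "0 \<le> c'" using c by (simp add: c'_def)
  define C where "C = C0 * c'"
  show thesis
  proof (rule that)
    show "0 \<le> C" using C0 c' by (simp add: C_def)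
    fix \<Omega> g G x0 r \<alpha>
    assume wg: "weak_gradient E \<Omega> g G" and G: "set_borel_measurable lebesgue \<Omega> G" and \<Omega>: "open \<Omega>"
      and g: "set_integrable lebesgue \<Omega> g" and r: "0 < r" and sub: "gball E x0 r \<subseteq> \<Omega>" and \<alpha>0: "0 \<le> \<alpha>"
      and \<alpha>: "(\<integral>\<^sup>+y\<in>gball E x0 r. ennreal (norm (G y) powr \<theta>) \<partial>lebesgue) = ennreal \<alpha>"
    let ?B = "gball E x0 r"
    define h where "h y = indicator ?B y * norm (G y)" for y
    have h0: "0 \<le> h y" for y by (simp add: h_def)
    have h_eq: "h = (\<lambda>y. indicator ?B y * norm (indicator \<Omega> y *\<^sub>R G y))"
      using sub by (auto simp: h_def indicator_def fun_eq_iff)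
    have hm[measurable]: "h \<in> borel_measurable lebesgue"
      unfolding h_eq using G unfolding set_borel_measurable_def by measurable
    have J: "(\<integral>\<^sup>+y\<in>?B \<inter> U. ennreal (norm (G y)) \<partial>lebesgue) = (\<integral>\<^sup>+y\<in>U. ennreal (h y) \<partial>lebesgue)" for U
      by (intro nn_integral_cong) (auto simp: h_def indicator_def)
    have h\<alpha>: "(\<integral>\<^sup>+y\<in>U. ennreal (h y powr \<theta>) \<partial>lebesgue) \<le> ennreal \<alpha>" for U
      unfolding \<alpha>[symmetric] by (intro nn_integral_mono) (auto simp: h_def indicator_def)
    have far: "(\<integral>\<^sup>+y\<in>gball E x s. ennreal (h y) \<partial>lebesgue) \<le>
        ennreal (2 * (\<omega> * s powr Q) powr (1 - 1 / \<theta>) * \<alpha> powr (1 / \<theta>))" if "0 < s" for x s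
      using omega_pos that
      by (intro nn_integral_le_powr hm h0 \<theta> \<alpha>0 h\<alpha> ball_sets emeasure_gball) auto
    have fin: "(\<integral>\<^sup>+y\<in>?B. ennreal (norm (G y)) \<partial>lebesgue) < \<infinity>"
      using far[OF r, of x0] J[of ?B] by (simp add: le_less_trans)
    obtain a where a: "\<And>x. x \<in> ?B \<Longrightarrow> \<exists>F::nat \<Rightarrow> 'a \<Rightarrow> real.
       (\<forall>k. integrable lebesgue (F k) \<and> (\<integral>y. F k y \<partial>lebesgue) = 1 \<and>
         (\<forall>y. \<bar>F k y\<bar> \<le> C0 * (r / 2 ^ k) powr - Q) \<and>
         (\<forall>y. F k y \<noteq> 0 \<longrightarrow> y \<in> ?B \<inter> gball E x (R * (r / 2 ^ k))) \<and>
         ennreal \<bar>(LINT y:\<Omega>|lebesgue. g y * F k y) - a\<bar> \<le>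
           ennreal C0 * (\<Sum>j\<le>k. ennreal ((r / 2 ^ j) powr (1 - Q)) *
             (\<integral>\<^sup>+y\<in>?B \<inter> gball E x (R * (r / 2 ^ j)). ennreal (norm (G y)) \<partial>lebesgue)))"
      using chain[OF wg G \<Omega> g r sub fin] by blast
    \<comment> \<open>Extension by zero, because \<open>lebesgue_point\<close> asks for
      integrability on the whole space; on the ball it agrees with g.\<close>
    define gt where "gt y = indicator \<Omega> y * g y" for y
    have gt: "integrable lebesgue gt" using g by (simp add: gt_def[abs_def] set_integrable_def)
    have main: "ennreal \<bar>g x - a\<bar> \<le> ennreal (C * \<alpha> powr (1 / Q)) * ennreal_powr (max_fn h x) (1 - \<theta> / Q)"
      if x: "x \<in> ?B" and leb: "\<forall>e>0. \<exists>d>0. \<forall>s. 0 < s \<and> s < d \<longrightarrow>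
        (\<integral>\<^sup>+y\<in>gball E x s. ennreal \<bar>gt y - gt x\<bar> \<partial>lebesgue) \<le> ennreal e * emeasure lebesgue (gball E x s)" for x
    proof -
      obtain F :: "nat \<Rightarrow> 'a \<Rightarrow> real" where F: "\<And>k. integrable lebesgue (F k)" "\<And>k. (\<integral>y. F k y \<partial>lebesgue) = 1"
        "\<And>k y. \<bar>F k y\<bar> \<le> C0 * (r / 2 ^ k) powr - Q"
        "\<And>k y. F k y \<noteq> 0 \<Longrightarrow> y \<in> ?B \<inter> gball E x (R * (r / 2 ^ k))"
        and Fa: "\<And>k. ennreal \<bar>(LINT y:\<Omega>|lebesgue. g y * F k y) - a\<bar> \<le>
           ennreal C0 * (\<Sum>j\<le>k. ennreal ((r / 2 ^ j) powr (1 - Q)) *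
             (\<integral>\<^sup>+y\<in>?B \<inter> gball E x (R * (r / 2 ^ j)). ennreal (norm (G y)) \<partial>lebesgue))"
        using a[OF x] by blast
      have xo: "gt x = g x" using x sub by (auto simp: gt_def)
      let ?H = "ennreal (c' * \<alpha> powr (1 / Q)) * ennreal_powr (max_fn h x) (1 - \<theta> / Q)"
      have S: "(\<Sum>j\<le>k. ennreal ((r / 2 ^ j) powr (1 - Q)) *
             (\<integral>\<^sup>+y\<in>?B \<inter> gball E x (R * (r / 2 ^ j)). ennreal (norm (G y)) \<partial>lebesgue)) \<le> ?H" for k
      proof -
        define T' where "T' j = (\<integral>\<^sup>+y\<in>gball E x (R * (r / 2 ^ j)). ennreal (h y) \<partial>lebesgue)" for j :: nat
        have sj: "0 < r / 2 ^ j" "0 < R * (r / 2 ^ j)" for j :: nat using r R by auto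
        have T1: "T' j \<le> ennreal (2 * (\<omega> * (R * (r / 2 ^ j)) powr Q) powr (1 - 1 / \<theta>) * \<alpha> powr (1 / \<theta>))" for j
          unfolding T'_def by (rule far[OF sj(2)])
        have T2: "T' j \<le> max_fn h x * ennreal (\<omega> * (R * (r / 2 ^ j)) powr Q)" for j
          unfolding T'_def emeasure_gball[OF sj(2), of x, symmetric]
          by (rule nn_integral_ball_le_max_fn[OF sj(2) centre[OF sj(2)]])
        define t where "t j = (r / 2 ^ j) powr (1 - Q) * enn2real (T' j)" for j
        have t0: "0 \<le> t j" for j by (simp add: t_def)
        have T_t: "ennreal ((r / 2 ^ j) powr (1 - Q)) * T' j = ennreal (t j)" for j
        proof -
          have "T' j < top" by (rule le_less_trans[OF T1]) simp
          then show ?thesis by (simp add: t_def ennreal_mult)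
        qed
        have scale: "(\<omega> * (R * s) powr Q) powr u = (\<omega> * R powr Q) powr u * s powr (Q * u)" if "0 < s" for s u
          using omega_pos R that by (simp add: powr_mult powr_powr mult.assoc)
        have tb: "t j \<le> c * ((r / 2 ^ j) powr - \<gamma> * \<alpha> powr (1 / \<theta>))" for j
        proof -
          have "enn2real (T' j) \<le> 2 * (\<omega> * (R * (r / 2 ^ j)) powr Q) powr (1 - 1 / \<theta>) * \<alpha> powr (1 / \<theta>)"
            using T1[of j] by (intro enn2real_leI) auto
          then have "t j \<le> (r / 2 ^ j) powr (1 - Q) * (2 * (\<omega> * (R * (r / 2 ^ j)) powr Q) powr (1 - 1 / \<theta>) * \<alpha> powr (1 / \<theta>))"
            unfolding t_def by (intro mult_left_mono) auto
          also have "(\<omega> * (R * (r / 2 ^ j)) powr Q) powr (1 - 1 / \<theta>) =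
              (\<omega> * R powr Q) powr (1 - 1 / \<theta>) * (r / 2 ^ j) powr (Q * (1 - 1 / \<theta>))"
            by (rule scale[OF sj(1)])
          also have "(r / 2 ^ j) powr (1 - Q) * (2 * ((\<omega> * R powr Q) powr (1 - 1 / \<theta>) * (r / 2 ^ j) powr (Q * (1 - 1 / \<theta>))) * \<alpha> powr (1 / \<theta>))
             = 2 * (\<omega> * R powr Q) powr (1 - 1 / \<theta>) * (((r / 2 ^ j) powr (1 - Q) * (r / 2 ^ j) powr (Q * (1 - 1 / \<theta>))) * \<alpha> powr (1 / \<theta>))"
            by (simp only: mult_ac)
          also have "(r / 2 ^ j) powr (1 - Q) * (r / 2 ^ j) powr (Q * (1 - 1 / \<theta>)) = (r / 2 ^ j) powr - \<gamma>"
            unfolding powr_add[symmetric] by (rule arg_cong[where f = "\<lambda>u. _ powr u"]) (simp add: \<gamma>_def algebra_simps)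
          also have "2 * (\<omega> * R powr Q) powr (1 - 1 / \<theta>) * ((r / 2 ^ j) powr - \<gamma> * \<alpha> powr (1 / \<theta>)) \<le>
              c * ((r / 2 ^ j) powr - \<gamma> * \<alpha> powr (1 / \<theta>))"
            using omega_pos by (intro mult_right_mono) (auto simp: c_def)
          finally show ?thesis .
        qed
        have "(\<Sum>j\<le>k. ennreal (t j)) \<le> ?H"
        \<comment> \<open>\<open>sum_dyadic_interpolation\<close> asks for two positive quantities;
          if one of them is 0, all \<open>t j\<close> vanish.\<close>
        proof (cases "\<alpha> = 0 \<or> max_fn h x = 0")
          case True
          have "t j \<le> 0" for j
          proof (cases "\<alpha> = 0")
            case True
            then show ?thesis using tb[of j] by simp
          next
            case False
            then have "T' j = 0" using \<open>\<alpha> = 0 \<or> max_fn h x = 0\<close> T2[of j] by simp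
            then show ?thesis by (simp add: t_def)
          qed
          then have "t j = 0" for j using t0[of j] by (simp add: antisym)
          then show ?thesis by simp
        next
          case False
          then have a0: "0 < \<alpha>" using \<alpha>0 by simp
          have "0 < c'"
          proof -
            have "0 < \<omega> * R powr Q" using omega_pos R by (intro mult_pos_pos) auto
            then have "0 < c" by (auto simp: c_def intro!: add_pos_nonneg)
            moreover have "0 < 2 + 1 / (1 - 2 powr - \<gamma>)" using \<open>2 powr - \<gamma> < 2 powr 0\<close> by (simp add: add_pos_pos)
            ultimately show ?thesis by (simp add: c'_def)
          qed
          show ?thesis
          proof (cases "max_fn h x = \<infinity>")
            case True
            then have "?H = \<infinity>" using a0 \<open>0 < c'\<close> by (simp add: ennreal_powr_def ennreal_mult_eq_top_iff)
            then show ?thesis by simp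
          next
            case fin_M: False
            then obtain m where m: "max_fn h x = ennreal m" "0 < m"
              using False by (cases "max_fn h x") (auto simp: le_less)
            have tm: "t j \<le> c * ((r / 2 ^ j) * m)" for j
            proof -
              have "T' j \<le> ennreal (m * (\<omega> * (R * (r / 2 ^ j)) powr Q))"
                using T2[of j] m omega_pos by (simp add: ennreal_mult)
              then have "enn2real (T' j) \<le> m * (\<omega> * (R * (r / 2 ^ j)) powr Q)"
                using m omega_pos by (intro enn2real_leI) auto
              then have "t j \<le> (r / 2 ^ j) powr (1 - Q) * (m * (\<omega> * (R * (r / 2 ^ j)) powr Q))"
                unfolding t_def by (intro mult_left_mono) auto
              also have "\<dots> = \<omega> * R powr Q * (((r / 2 ^ j) powr (1 - Q) * (r / 2 ^ j) powr Q) * m)"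
                using R r by (subst powr_mult) (auto simp only: mult_ac)
              also have "(r / 2 ^ j) powr (1 - Q) * (r / 2 ^ j) powr Q = r / 2 ^ j"
                using r by (simp add: powr_add[symmetric])
              also have "\<omega> * R powr Q * (r / 2 ^ j * m) \<le> c * (r / 2 ^ j * m)"
                using m r omega_pos by (intro mult_right_mono) (auto simp: c_def)
              finally show ?thesis .
            qed
            have "0 < \<alpha> powr (1 / \<theta>)" using a0 by simp
            from sum_dyadic_interpolation[where t = t, OF r \<gamma> m(2) this tm tb c]
            have "(\<Sum>j\<le>k. t j) \<le> c' * (m powr (1 - \<theta> / Q) * (\<alpha> powr (1 / \<theta>)) powr (\<theta> / Q))"
              unfolding e1 c'_def .
            also have "(\<alpha> powr (1 / \<theta>)) powr (\<theta> / Q) = \<alpha> powr (1 / Q)" using \<theta> by (simp add: powr_powr)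
            finally have "ennreal (\<Sum>j\<le>k. t j) \<le> ennreal (c' * \<alpha> powr (1 / Q) * m powr (1 - \<theta> / Q))"
              by (intro ennreal_leI) (simp only: mult_ac)
            then show ?thesis using m c' t0 by (simp add: ennreal_powr_def ennreal_mult sum_ennreal)
          qed
        qed
        then show ?thesis unfolding J T'_def[symmetric] T_t .
      qed
      have close: "\<exists>k. \<bar>(LINT y:\<Omega>|lebesgue. g y * F k y) - g x\<bar> \<le> \<epsilon>" if \<epsilon>: "0 < \<epsilon>" for \<epsilon>
      proof -
        \<comment> \<open>The bump is at most C0 s^(- Q) on a ball of volume \<omega> (R s)^Q, so
          the error is at most C0 \<omega> R^Q times the mean oscillation; adding 1 makes the
          divisor positive.\<close>
        define b where "b = C0 * (\<omega> * R powr Q) + 1"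
        have b: "0 < b" using C0 omega_pos by (simp add: b_def add_nonneg_pos)
        have m3: "ennreal u * (ennreal v * ennreal w) = ennreal (u * (v * w))"
          if "0 \<le> u" "0 \<le> v" "0 \<le> w" for u v w :: real
          using that by (simp add: ennreal_mult)
        have eb: "0 < \<epsilon> / b" using \<epsilon> b by simp
        obtain d where d: "0 < d" "\<And>s. 0 < s \<Longrightarrow> s < d \<Longrightarrow>
          (\<integral>\<^sup>+y\<in>gball E x s. ennreal \<bar>gt y - gt x\<bar> \<partial>lebesgue) \<le> ennreal (\<epsilon> / b) * emeasure lebesgue (gball E x s)"
          using leb[rule_format, OF eb] by blast
        have "(\<lambda>k. R * (r * (1 / 2) ^ k)) \<longlonglongrightarrow> R * (r * 0)"
          by (intro tendsto_intros LIMSEQ_power_zero) auto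
        then have "\<forall>\<^sub>F k in sequentially. R * (r * (1 / 2) ^ k) < d"
          using d(1) by (intro order_tendstoD) auto
        then obtain k where "R * (r * (1 / 2) ^ k) < d" by (auto simp: eventually_sequentially)
        then have k: "R * (r / 2 ^ k) < d" by (simp add: power_divide)
        let ?s = "r / 2 ^ k"
        have s: "0 < ?s" "0 < R * ?s" using r R by auto
        have iF: "integrable lebesgue (\<lambda>y. gt y * F k y)"
        proof (rule Bochner_Integration.integrable_bound)
          show "integrable lebesgue (\<lambda>y. (C0 * ?s powr - Q) * gt y)" using gt by simp
          show "(\<lambda>y. gt y * F k y) \<in> borel_measurable lebesgue"
            by (intro borel_measurable_times borel_measurable_integrable gt F)
          show "AE y in lebesgue. norm (gt y * F k y) \<le> norm ((C0 * ?s powr - Q) * gt y)"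
          proof (rule AE_I2)
            fix y
            have "\<bar>F k y\<bar> * \<bar>gt y\<bar> \<le> (C0 * ?s powr - Q) * \<bar>gt y\<bar>" by (intro mult_right_mono F) auto
            then show "norm (gt y * F k y) \<le> norm ((C0 * ?s powr - Q) * gt y)"
              using C0 by (simp add: abs_mult mult.commute)
          qed
        qed
        have "(LINT y:\<Omega>|lebesgue. g y * F k y) - g x = (\<integral>y. gt y * F k y \<partial>lebesgue) - (\<integral>y. gt x * F k y \<partial>lebesgue)"
          using F(2)[of k] by (simp add: set_lebesgue_integral_def gt_def[abs_def] xo[unfolded gt_def] mult.assoc)
        also have "\<dots> = (\<integral>y. gt y * F k y - gt x * F k y \<partial>lebesgue)"
          using iF F(1)[of k] by (intro Bochner_Integration.integral_diff[symmetric]) auto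
        finally have eq: "(LINT y:\<Omega>|lebesgue. g y * F k y) - g x = (\<integral>y. gt y * F k y - gt x * F k y \<partial>lebesgue)" .
        have iD: "integrable lebesgue (\<lambda>y. gt y * F k y - gt x * F k y)" using iF F(1)[of k] by auto
        have "ennreal \<bar>(LINT y:\<Omega>|lebesgue. g y * F k y) - g x\<bar> \<le> (\<integral>\<^sup>+y. ennreal \<bar>gt y * F k y - gt x * F k y\<bar> \<partial>lebesgue)"
          unfolding eq using integral_norm_bound_ennreal[OF iD] by simp
        also have "\<dots> \<le> (\<integral>\<^sup>+y. ennreal (C0 * ?s powr - Q) * (ennreal \<bar>gt y - gt x\<bar> * indicator (gball E x (R * ?s)) y) \<partial>lebesgue)"
        proof (rule nn_integral_mono)
          fix y
          show "ennreal \<bar>gt y * F k y - gt x * F k y\<bar> \<le> ennreal (C0 * ?s powr - Q) * (ennreal \<bar>gt y - gt x\<bar> * indicator (gball E x (R * ?s)) y)"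
          proof (cases "F k y = 0")
            case False
            have "\<bar>gt y * F k y - gt x * F k y\<bar> = \<bar>F k y\<bar> * \<bar>gt y - gt x\<bar>"
              by (simp add: abs_mult[symmetric] algebra_simps)
            also have "\<dots> \<le> (C0 * ?s powr - Q) * \<bar>gt y - gt x\<bar>" by (intro mult_right_mono F) auto
            finally show ?thesis using F(4)[OF False] C0 by (auto simp: ennreal_mult[symmetric] intro!: ennreal_leI)
          qed simp
        qed
        also have "\<dots> = ennreal (C0 * ?s powr - Q) * (\<integral>\<^sup>+y\<in>gball E x (R * ?s). ennreal \<bar>gt y - gt x\<bar> \<partial>lebesgue)"
          using gt by (intro nn_integral_cmult) auto
        also have "\<dots> \<le> ennreal (C0 * ?s powr - Q) * (ennreal (\<epsilon> / b) * ennreal (\<omega> * (R * ?s) powr Q))"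
          using d(2)[OF s(2) k] unfolding emeasure_gball[OF s(2)] by (intro mult_left_mono) auto
        also have "\<dots> = ennreal (C0 * ?s powr - Q * (\<epsilon> / b * (\<omega> * (R * ?s) powr Q)))"
          by (rule m3) (use C0 eb omega_pos in auto)
        also have "C0 * ?s powr - Q * (\<epsilon> / b * (\<omega> * (R * ?s) powr Q)) = C0 * (\<omega> * R powr Q) * (\<epsilon> / b) * (?s powr - Q * ?s powr Q)"
          using R r by (subst powr_mult) (auto simp only: mult_ac)
        also have "?s powr - Q * ?s powr Q = 1" using r by (simp add: powr_add[symmetric])
        also have "C0 * (\<omega> * R powr Q) * (\<epsilon> / b) * 1 \<le> b * (\<epsilon> / b)"
          unfolding mult_1_right using \<epsilon> b by (intro mult_right_mono) (auto simp: b_def)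
        finally have "ennreal \<bar>(LINT y:\<Omega>|lebesgue. g y * F k y) - g x\<bar> \<le> ennreal \<epsilon>"
          using b by (simp add: ennreal_leI order_trans)
        then show ?thesis using \<epsilon> by (intro exI[of _ k]) (simp add: ennreal_le_iff)
      qed
      have "ennreal \<bar>g x - a\<bar> \<le> ennreal C0 * ?H"
      proof (rule ennreal_le_epsilon)
        fix \<epsilon> :: real assume \<epsilon>: "0 < \<epsilon>"
        obtain k where k: "\<bar>(LINT y:\<Omega>|lebesgue. g y * F k y) - g x\<bar> \<le> \<epsilon>" using close[OF \<epsilon>] by blast
        have "\<bar>g x - a\<bar> \<le> \<bar>(LINT y:\<Omega>|lebesgue. g y * F k y) - a\<bar> + \<epsilon>" using k by linarith
        then have "ennreal \<bar>g x - a\<bar> \<le> ennreal \<bar>(LINT y:\<Omega>|lebesgue. g y * F k y) - a\<bar> + ennreal \<epsilon>"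
          using \<epsilon> by (simp add: ennreal_plus[symmetric] ennreal_leI del: ennreal_plus)
        also have "ennreal \<bar>(LINT y:\<Omega>|lebesgue. g y * F k y) - a\<bar> \<le> ennreal C0 * ?H"
          by (rule order_trans[OF Fa mult_left_mono[OF S]]) simp
        finally show "ennreal \<bar>g x - a\<bar> \<le> ennreal C0 * ?H + ennreal \<epsilon>" by (simp add: add_right_mono)
      qed
      then show ?thesis using C0 c' by (simp add: C_def ennreal_mult mult.assoc)
    qed
    have "AE x in lebesgue. x \<in> ?B \<longrightarrow> ennreal \<bar>g x - a\<bar> \<le>
        ennreal (C * \<alpha> powr (1 / Q)) * ennreal_powr (max_fn h x) (1 - \<theta> / Q)"
      using lebesgue_point[OF gt] by eventually_elim (use main in blast)
    then show "\<exists>a. AE x in lebesgue. x \<in> ?B \<longrightarrow> ennreal \<bar>g x - a\<bar> \<le>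
       ennreal (C * \<alpha> powr (1 / Q)) *
       ennreal_powr (max_fn (\<lambda>y. ennreal (indicator ?B y * norm (G y))) x) (1 - \<theta> / Q)"
      unfolding h_def by (intro exI[of _ a])
  qed
qed

end

section \<open>Powers of extended nonnegative reals\<close>

lemma ennreal_powr_ennreal [simp]: "0 \<le> x \<Longrightarrow> ennreal_powr (ennreal x) p = ennreal (x powr p)"
  by (simp add: ennreal_powr_def)

lemma ennreal_powr_top [simp]: "ennreal_powr top p = top"
  by (simp add: ennreal_powr_def)

lemma ennreal_powr_mono: "x \<le> y \<Longrightarrow> 0 \<le> p \<Longrightarrow> ennreal_powr x p \<le> ennreal_powr y p"
  by (cases x; cases y) (auto intro!: ennreal_leI powr_mono2 simp: top_unique)

context step_two begin

text \<open>The pointwise bound is raised to the Sobolev conjugate q. As q (1 - \<theta>/Q) =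
  \<theta>, the maximal function appears to the power \<theta> and the strong type bound applies.
  The constant a is then exchanged for the mean, which is as close to it as the L^q mean of g - a,
  up to a factor.\<close>

lemma sobolev_poincare:
  assumes \<theta>: "1 < \<theta>" "\<theta> < Q"
  obtains C where "0 < C" "\<And>\<Omega> g G x0 r.
    \<lbrakk>weak_gradient E \<Omega> g G; set_borel_measurable lebesgue \<Omega> G; open \<Omega>; set_integrable lebesgue \<Omega> g;
     0 < r; gball E x0 r \<subseteq> \<Omega>\<rbrakk> \<Longrightarrow>
     Lp_mean (Q * \<theta> / (Q - \<theta>)) (\<lambda>x. g x - mean_on g (gball E x0 r)) (gball E x0 r) \<le>
       ennreal (C * r) * Lp_mean \<theta> G (gball E x0 r)"
proof -
  obtain Cp where Cp: "0 \<le> Cp" and pw: "\<And>\<Omega> g G x0 r \<alpha>.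
    \<lbrakk>weak_gradient E \<Omega> g G; set_borel_measurable lebesgue \<Omega> G; open \<Omega>; set_integrable lebesgue \<Omega> g;
     0 < r; gball E x0 r \<subseteq> \<Omega>; 0 \<le> \<alpha>;
     (\<integral>\<^sup>+y\<in>gball E x0 r. ennreal (norm (G y) powr \<theta>) \<partial>lebesgue) = ennreal \<alpha>\<rbrakk> \<Longrightarrow>
     \<exists>a. AE x in lebesgue. x \<in> gball E x0 r \<longrightarrow> ennreal \<bar>g x - a\<bar> \<le>
       ennreal (Cp * \<alpha> powr (1 / Q)) *
       ennreal_powr (max_fn (\<lambda>y. ennreal (indicator (gball E x0 r) y * norm (G y))) x) (1 - \<theta> / Q)"
    using sobolev_poincare_pointwise[OF \<theta>] by blast
  define q where "q = Q * \<theta> / (Q - \<theta>)"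
  have q\<theta>: "1 / \<theta> - 1 / q = 1 / Q" "q * (1 - \<theta> / Q) = \<theta>" "q / Q + 1 = q / \<theta>"
    unfolding q_def using \<theta> by (simp_all add: field_simps)
  have "0 < 1 / Q" "1 / \<theta> < 1" using \<theta> by simp_all
  with q\<theta>(1) have "1 / q < 1" by linarith
  moreover have "0 < q" using \<theta> by (simp add: q_def)
  ultimately have q: "1 < q" by (simp add: field_simps)
  define Cs where "Cs = 2 powr \<theta> * (2 * K * K) powr Q * \<theta> / (\<theta> - 1)"
  have Cs: "0 \<le> Cs" using \<theta> by (simp add: Cs_def)
  define \<kappa> where "\<kappa> = Cp powr q * Cs"
  have \<kappa>: "0 \<le> \<kappa>" using Cs by (simp add: \<kappa>_def)
  define \<kappa>2 where "\<kappa>2 = (2 powr q * (1 + 2 powr q) * \<kappa>) powr (1 / q)"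
  \<comment> \<open>The summand 1 keeps the constant positive even if \<open>\<kappa>2\<close> is
    0.\<close>
  define C where "C = \<kappa>2 * \<omega> powr (1 / Q) + 1"
  have C: "0 < C" by (simp add: C_def \<kappa>2_def add_nonneg_pos)
  show thesis
  proof (rule that[OF C], unfold q_def[symmetric])
    fix \<Omega> g G x0 r
    assume wg: "weak_gradient E \<Omega> g G" and G: "set_borel_measurable lebesgue \<Omega> G" and \<Omega>: "open \<Omega>"
      and g: "set_integrable lebesgue \<Omega> g" and r: "0 < r" and sub: "gball E x0 r \<subseteq> \<Omega>"
    let ?B = "gball E x0 r"
    define d where "d = \<omega> * r powr Q"
    have d: "0 < d" using omega_pos r by (simp add: d_def)
    have Bd: "emeasure lebesgue ?B = ennreal d" using emeasure_gball[OF r] by (simp add: d_def)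
    have Bs[measurable]: "?B \<in> sets lebesgue" by auto
    show "Lp_mean q (\<lambda>x. g x - mean_on g ?B) ?B \<le> ennreal (C * r) * Lp_mean \<theta> G ?B"
    proof (cases "(\<integral>\<^sup>+y\<in>?B. ennreal (norm (G y) powr \<theta>) \<partial>lebesgue)")
      case top
      then have "Lp_mean \<theta> G ?B = top"
        using d by (simp add: Lp_mean_def Bd ennreal_top_divide)
      then show ?thesis using C r by (simp add: ennreal_mult_top)
    next
      case (real \<alpha>)
      obtain a where a: "AE x in lebesgue. x \<in> ?B \<longrightarrow> ennreal \<bar>g x - a\<bar> \<le>
         ennreal (Cp * \<alpha> powr (1 / Q)) *
         ennreal_powr (max_fn (\<lambda>y. ennreal (indicator ?B y * norm (G y))) x) (1 - \<theta> / Q)"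
        using pw[OF wg G \<Omega> g r sub real(1)] real(2) by auto
      define h where "h y = indicator ?B y * norm (G y)" for y
      have h0: "0 \<le> h y" for y by (simp add: h_def)
      have h_eq: "h = (\<lambda>y. indicator ?B y * norm (indicator \<Omega> y *\<^sub>R G y))"
        using sub by (auto simp: h_def indicator_def fun_eq_iff)
      have hm[measurable]: "h \<in> borel_measurable lebesgue"
        unfolding h_eq using G unfolding set_borel_measurable_def by measurable
      have h\<alpha>: "(\<integral>\<^sup>+y. ennreal (h y powr \<theta>) \<partial>lebesgue) = ennreal \<alpha>"
        unfolding real(2)[symmetric] by (intro nn_integral_cong) (auto simp: h_def indicator_def)
      define u where "u = Cp * \<alpha> powr (1 / Q)"
      have u: "0 \<le> u" using Cp by (simp add: u_def)
      define gt where "gt y = indicator \<Omega> y * g y" for y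
      have gt: "integrable lebesgue gt" using g by (simp add: gt_def[abs_def] set_integrable_def)
      then have gtm[measurable]: "gt \<in> borel_measurable lebesgue" by simp
      have gt_B: "gt y = g y" if "y \<in> ?B" for y using that sub by (auto simp: gt_def)
      define \<beta> where "\<beta> = \<kappa> * \<alpha> powr (q / \<theta>)"
      have \<beta>: "0 \<le> \<beta>" using \<kappa> by (simp add: \<beta>_def)
      have I: "(\<integral>\<^sup>+x\<in>?B. ennreal (\<bar>gt x - a\<bar> powr q) \<partial>lebesgue) \<le> ennreal \<beta>"
      proof -
        have "(\<integral>\<^sup>+x\<in>?B. ennreal (\<bar>gt x - a\<bar> powr q) \<partial>lebesgue) \<le>
          (\<integral>\<^sup>+x. ennreal (u powr q) * ennreal_powr (max_fn h x) \<theta> \<partial>lebesgue)"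
        proof (rule nn_integral_mono_AE)
          show "AE x in lebesgue. ennreal (\<bar>gt x - a\<bar> powr q) * indicator ?B x \<le> ennreal (u powr q) * ennreal_powr (max_fn h x) \<theta>"
            using a
          proof eventually_elim
            case (elim x)
            show ?case
            proof (cases "x \<in> ?B")
              case True
              then have le: "ennreal \<bar>gt x - a\<bar> \<le> ennreal u * ennreal_powr (max_fn h x) (1 - \<theta> / Q)"
                using elim by (simp add: gt_B u_def h_def)
              show ?thesis
              proof (cases "max_fn h x")
                case (real m)
                have "\<bar>gt x - a\<bar> \<le> u * m powr (1 - \<theta> / Q)"
                  using le u real by (simp add: ennreal_mult[symmetric] ennreal_le_iff)
                then have "\<bar>gt x - a\<bar> powr q \<le> (u * m powr (1 - \<theta> / Q)) powr q"
                  using q by (intro powr_mono2) auto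
                also have "\<dots> = u powr q * m powr \<theta>"
                  using u real(1) q\<theta>(2) by (simp add: powr_mult powr_powr mult.commute)
                finally show ?thesis using real True by (simp add: ennreal_mult[symmetric] ennreal_leI)
              next
                case top
                show ?thesis
                \<comment> \<open>Zero times infinity is 0 in \<open>ennreal\<close>, so for
                  \<open>u = 0\<close> the bound \<open>le\<close> already says that
                  \<open>gt x = a\<close>.\<close>
                proof (cases "u = 0")
                  case True
                  then show ?thesis using le by simp
                next
                  case False
                  then have "ennreal (u powr q) * top = top" using u by (simp add: ennreal_mult_top)
                  then show ?thesis using top by simp
                qed
              qed
            qed simp
          qed
        qed
        also have "\<dots> = ennreal (u powr q) * (\<integral>\<^sup>+x. ennreal_powr (max_fn h x) \<theta> \<partial>lebesgue)"
          by (intro nn_integral_cmult) (simp add: ennreal_powr_def[abs_def])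
        also have "\<dots> \<le> ennreal (u powr q) * (ennreal Cs * ennreal \<alpha>)"
          unfolding Cs_def h\<alpha>[symmetric] by (intro mult_left_mono strong_type hm h0 \<theta>) auto
        also have "\<dots> = ennreal (u powr q * (Cs * \<alpha>))"
          using Cs real(1) by (simp add: ennreal_mult)
        also have "u powr q * (Cs * \<alpha>) = \<beta>"
        proof (cases "\<alpha> = 0")
          case False
          then have a0: "0 < \<alpha>" using real(1) by simp
          have "u powr q = Cp powr q * \<alpha> powr (q / Q)"
            using Cp a0 by (simp add: u_def powr_mult powr_powr)
          moreover have "\<alpha> powr (q / Q) * \<alpha> = \<alpha> powr (q / \<theta>)"
            using a0 q\<theta>(3)[symmetric] by (simp add: powr_add)
          ultimately show ?thesis by (simp add: \<beta>_def \<kappa>_def mult_ac)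
        qed (simp add: \<beta>_def)
        finally show ?thesis .
      qed
      \<comment> \<open>The bound that Hoelder's inequality on the ball gives for the mean of |g -
        a|; the 2 is the one of \<open>nn_integral_le_powr\<close>.\<close>
      define D where "D = 2 * (\<beta> / d) powr (1 / q)"
      have D: "0 \<le> D" by (simp add: D_def)
      have mean: "\<bar>a - mean_on g ?B\<bar> \<le> D"
      proof -
        have int: "integrable lebesgue (\<lambda>x. indicator ?B x * gt x)"
          using integrable_mult_indicator[OF Bs gt] by simp
        have inta: "integrable lebesgue (\<lambda>x. indicator ?B x * a)"
          using d Bd by (intro integrable_mult_left integrable_real_indicator) auto
        have "measure lebesgue ?B = d" using Bd d by (simp add: measure_def)
        moreover have "(LINT x:?B|lebesgue. g x) = (\<integral>x. indicator ?B x * gt x \<partial>lebesgue)"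
          unfolding set_lebesgue_integral_def by (intro Bochner_Integration.integral_cong) (auto simp: indicator_def gt_B)
        ultimately have "d * (mean_on g ?B - a) = (\<integral>x. indicator ?B x * gt x \<partial>lebesgue) - (\<integral>x. indicator ?B x * a \<partial>lebesgue)"
          using d by (simp add: mean_on_def right_diff_distrib)
        also have "\<dots> = (\<integral>x. indicator ?B x * gt x - indicator ?B x * a \<partial>lebesgue)"
          using int inta by (intro Bochner_Integration.integral_diff[symmetric])
        finally have eq: "d * (mean_on g ?B - a) = (\<integral>x. indicator ?B x * gt x - indicator ?B x * a \<partial>lebesgue)" .
        have "ennreal \<bar>d * (mean_on g ?B - a)\<bar> \<le> (\<integral>\<^sup>+x. ennreal \<bar>indicator ?B x * gt x - indicator ?B x * a\<bar> \<partial>lebesgue)"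
          unfolding eq using integral_norm_bound_ennreal[OF Bochner_Integration.integrable_diff[OF int inta]] by simp
        also have "\<dots> = (\<integral>\<^sup>+x\<in>?B. ennreal \<bar>gt x - a\<bar> \<partial>lebesgue)"
          by (intro nn_integral_cong) (auto simp: indicator_def)
        also have "\<dots> \<le> ennreal (2 * d powr (1 - 1 / q) * \<beta> powr (1 / q))"
          by (intro nn_integral_le_powr q \<beta> I d Bd Bs) auto
        finally have "\<bar>d * (mean_on g ?B - a)\<bar> \<le> 2 * d powr (1 - 1 / q) * \<beta> powr (1 / q)"
          using \<beta> by (simp add: ennreal_le_iff)
        also have "\<dots> = d * D" using d \<beta> by (simp add: D_def powr_divide powr_diff)
        finally show ?thesis using d by (simp add: abs_mult abs_minus_commute)
      qed
      have Dq: "d * D powr q = 2 powr q * \<beta>"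
        using d \<beta> q by (simp add: D_def powr_mult powr_powr)
      have "(\<integral>\<^sup>+x\<in>?B. ennreal (norm (g x - mean_on g ?B) powr q) \<partial>lebesgue) \<le>
        (\<integral>\<^sup>+x. ennreal (2 powr q) * (ennreal (\<bar>gt x - a\<bar> powr q) * indicator ?B x) + ennreal (2 powr q * D powr q) * indicator ?B x \<partial>lebesgue)"
      proof (rule nn_integral_mono)
        fix x
        show "ennreal (norm (g x - mean_on g ?B) powr q) * indicator ?B x \<le>
          ennreal (2 powr q) * (ennreal (\<bar>gt x - a\<bar> powr q) * indicator ?B x) + ennreal (2 powr q * D powr q) * indicator ?B x"
        proof (cases "x \<in> ?B")
          case True
          define M where "M = max \<bar>gt x - a\<bar> D"
          have "norm (g x - mean_on g ?B) \<le> \<bar>gt x - a\<bar> + D"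
            using mean gt_B[OF True] by (simp add: abs_if split: if_splits)
          also have "\<dots> \<le> 2 * M"
          proof -
            have "\<bar>gt x - a\<bar> \<le> M" "D \<le> M" by (simp_all add: M_def)
            then show ?thesis by linarith
          qed
          finally have "norm (g x - mean_on g ?B) powr q \<le> (2 * M) powr q"
            using q by (intro powr_mono2) auto
          also have "\<dots> = 2 powr q * M powr q" using D by (intro powr_mult)
          also have "\<dots> \<le> 2 powr q * (\<bar>gt x - a\<bar> powr q + D powr q)"
            by (intro mult_left_mono) (auto simp: M_def max_def)
          finally show ?thesis using True
            by (simp add: ennreal_mult[symmetric] ennreal_plus[symmetric] distrib_left ennreal_leI del: ennreal_plus)
        qed simp
      qed
      also have "\<dots> = ennreal (2 powr q) * (\<integral>\<^sup>+x\<in>?B. ennreal (\<bar>gt x - a\<bar> powr q) \<partial>lebesgue) + ennreal (2 powr q * D powr q) * ennreal d"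
        unfolding Bd[symmetric] by (subst nn_integral_add) (auto simp: nn_integral_cmult nn_integral_cmult_indicator)
      also have "\<dots> \<le> ennreal (2 powr q) * ennreal \<beta> + ennreal (2 powr q * D powr q) * ennreal d"
        by (intro add_right_mono mult_left_mono I) auto
      also have "\<dots> = ennreal (2 powr q * \<beta> + 2 powr q * D powr q * d)"
        using \<beta> d by (simp add: ennreal_mult)
      also have "2 powr q * \<beta> + 2 powr q * D powr q * d = 2 powr q * (1 + 2 powr q) * \<beta>"
        using Dq by (simp add: algebra_simps)
      finally have "Lp_mean q (\<lambda>x. g x - mean_on g ?B) ?B \<le> ennreal_powr (ennreal (2 powr q * (1 + 2 powr q) * \<beta>) / ennreal d) (1 / q)"
        unfolding Lp_mean_def Bd using q d by (intro ennreal_powr_mono divide_right_mono_ennreal) auto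
      also have "\<dots> = ennreal ((2 powr q * (1 + 2 powr q) * \<beta> / d) powr (1 / q))"
        using d \<beta> by (simp add: divide_ennreal)
      also have "(2 powr q * (1 + 2 powr q) * \<beta> / d) powr (1 / q) = \<kappa>2 * \<alpha> powr (1 / \<theta>) * d powr - (1 / q)"
      proof -
        have "(2 powr q * (1 + 2 powr q) * \<beta> / d) powr (1 / q) =
            ((2 powr q * (1 + 2 powr q) * \<kappa>) * \<alpha> powr (q / \<theta>)) powr (1 / q) / d powr (1 / q)"
          unfolding \<beta>_def using d \<kappa> by (subst powr_divide) (auto simp: mult.assoc)
        also have "((2 powr q * (1 + 2 powr q) * \<kappa>) * \<alpha> powr (q / \<theta>)) powr (1 / q) = \<kappa>2 * \<alpha> powr (1 / \<theta>)"
          unfolding \<kappa>2_def using \<kappa> q by (subst powr_mult) (auto simp: powr_powr)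
        finally show ?thesis by (simp add: powr_minus_divide)
      qed
      also have "d powr - (1 / q) = d powr (1 / Q) * d powr - (1 / \<theta>)"
      proof -
        have "- (1 / q) = 1 / Q + - (1 / \<theta>)" using q\<theta>(1) by linarith
        then show ?thesis by (simp only: powr_add)
      qed
      also have "d powr (1 / Q) = \<omega> powr (1 / Q) * r"
        using omega_pos r Q_pos by (simp add: d_def powr_mult powr_powr)
      also have "\<kappa>2 * \<alpha> powr (1 / \<theta>) * (\<omega> powr (1 / Q) * r * d powr - (1 / \<theta>)) = (\<kappa>2 * \<omega> powr (1 / Q)) * r * (\<alpha> / d) powr (1 / \<theta>)"
        using real(1) d by (simp add: powr_divide powr_minus_divide)
      also have "ennreal \<dots> \<le> ennreal (C * r * (\<alpha> / d) powr (1 / \<theta>))"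
        using r by (intro ennreal_leI mult_right_mono) (auto simp: C_def)
      also have "\<dots> = ennreal (C * r) * Lp_mean \<theta> G ?B"
        using C r d real by (simp add: Lp_mean_def Bd divide_ennreal ennreal_mult)
      finally show ?thesis .
    qed
  qed
qed

end

section \<open>Dyadic sums and the Lorentz norm\<close>

lemma ennreal_powr_mult:
  "0 \<le> c \<Longrightarrow> 0 < c \<or> x \<noteq> top \<Longrightarrow> ennreal_powr (ennreal c * x) p = ennreal (c powr p) * ennreal_powr x p"
proof (cases x)
  case (real t)
  assume "0 \<le> c"
  with real show ?thesis by (simp add: ennreal_mult[symmetric] powr_mult)
next
  case top
  assume "0 \<le> c" "0 < c \<or> x \<noteq> top"
  with top have "0 < c" by simp
  then have "ennreal (c powr p) * top = top" "ennreal c * top = top" by (simp_all add: ennreal_mult_top)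
  then show ?thesis using top by simp
qed

lemma ennreal_powr_powr: "0 < p \<Longrightarrow> ennreal_powr (ennreal_powr x p) (1 / p) = x"
  by (cases x) (simp_all add: powr_powr)

text \<open>Each term is at most the sum S, so its p-th power is at most the term times S^(p -
  1).\<close>

lemma suminf_ennreal_powr_le:
  assumes p: "1 \<le> p"
  shows "(\<Sum>i. ennreal_powr (a i) p) \<le> ennreal_powr (\<Sum>i. a i) p"
proof (cases "\<Sum>i. a i")
  case top
  then show ?thesis by simp
next
  case (real S)
  have le: "a i \<le> ennreal S" for i
  proof -
    have "sum a {i} \<le> suminf a" by (intro sum_le_suminf) auto
    then show ?thesis using real(2) by simp
  qed
  have "ennreal_powr (a i) p \<le> a i * ennreal (S powr (p - 1))" for i
  proof -
    obtain t where t: "a i = ennreal t" "0 \<le> t" "t \<le> S"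
      using le[of i] real(1) by (cases "a i") (auto simp: ennreal_le_iff top_unique)
    have "t powr p = t * t powr (p - 1)" using t by (cases "t = 0") (simp_all add: powr_diff)
    also have "\<dots> \<le> t * S powr (p - 1)" using t p by (intro mult_left_mono powr_mono2) auto
    finally show ?thesis using t by (simp add: ennreal_mult[symmetric] ennreal_leI)
  qed
  then have "(\<Sum>i. ennreal_powr (a i) p) \<le> (\<Sum>i. a i * ennreal (S powr (p - 1)))"
    by (intro suminf_le) auto
  also have "\<dots> = ennreal S * ennreal (S powr (p - 1))" using real by simp
  also have "\<dots> = ennreal (S powr p)"
  proof -
    have "S * S powr (p - 1) = S powr p" using real(1) by (cases "S = 0") (simp_all add: powr_diff)
    then show ?thesis using real(1) by (simp add: ennreal_mult[symmetric])
  qed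
  finally show ?thesis using real by simp
qed

lemma suminf_swap_ennreal: "(\<Sum>j. \<Sum>i. f j i) = (\<Sum>i. \<Sum>j. f j i :: ennreal)"
proof -
  have "(\<Sum>j. \<Sum>i. f j i) = (\<integral>\<^sup>+j. (\<Sum>i. f j i) \<partial>count_space UNIV)"
    by (simp add: nn_integral_count_space_nat)
  also have "\<dots> = (\<Sum>i. \<integral>\<^sup>+j. f j i \<partial>count_space UNIV)"
    by (intro nn_integral_suminf) auto
  also have "\<dots> = (\<Sum>i. \<Sum>j. f j i)" by (simp add: nn_integral_count_space_nat)
  finally show ?thesis .
qed

lemma suminf_shift_le: "(\<Sum>j. f (j + i)) \<le> (\<Sum>k. f k :: ennreal)"
proof (rule suminf_le_const)
  fix n
  have "(\<Sum>j<n. f (j + i)) = sum f ((\<lambda>j. j + i) ` {..<n})"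
    by (simp add: sum.reindex)
  also have "\<dots> \<le> suminf f" by (intro sum_le_suminf) auto
  finally show "(\<Sum>j<n. f (j + i)) \<le> suminf f" .
qed simp

section \<open>Nonincreasing rearrangements\<close>

lemma rearrangement_antimono: "s \<le> t \<Longrightarrow> rearrangement U F t \<le> rearrangement U F s"
  unfolding rearrangement_def
  by (intro INF_superset_mono) (auto intro: order_trans ennreal_leI)

text \<open>The infimum in the definition is attained: the set above it is the increasing union of
  the sets above slightly larger heights, each of measure at most s.\<close>

lemma emeasure_above_rearrangement:
  fixes F :: "'a::euclidean_space \<Rightarrow> 'b::real_normed_vector"
  assumes meas: "\<And>l. {x\<in>U. l < norm (F x)} \<in> sets lebesgue"
  shows "emeasure lebesgue {x\<in>U. rearrangement U F s < ennreal (norm (F x))} \<le> ennreal s"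
proof (cases "rearrangement U F s")
  case (real m)
  define A where "A n = {x\<in>U. m + 1 / real (Suc n) < norm (F x)}" for n
  have An: "emeasure lebesgue (A n) \<le> ennreal s" for n
  proof -
    have "rearrangement U F s < ennreal (m + 1 / real (Suc n))"
      using real by (simp add: ennreal_lessI)
    then obtain l where l: "0 \<le> l" "emeasure lebesgue {x\<in>U. l < norm (F x)} \<le> ennreal s"
      "ennreal l < ennreal (m + 1 / real (Suc n))"
      unfolding rearrangement_def by (auto simp: INF_less_iff)
    then have "A n \<subseteq> {x\<in>U. l < norm (F x)}" by (auto simp: A_def ennreal_less_iff)
    then have "emeasure lebesgue (A n) \<le> emeasure lebesgue {x\<in>U. l < norm (F x)}"
      by (rule emeasure_mono) (rule meas)
    then show ?thesis using l(2) by (rule order_trans)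
  qed
  have "incseq A"
  proof (rule incseq_SucI)
    fix n
    have "1 / real (Suc (Suc n)) \<le> 1 / real (Suc n)" by (simp add: field_simps)
    then show "A n \<subseteq> A (Suc n)" unfolding A_def by auto
  qed
  moreover have "range A \<subseteq> sets lebesgue" using meas by (auto simp: A_def)
  ultimately have "emeasure lebesgue (\<Union>n. A n) = (SUP n. emeasure lebesgue (A n))"
    by (intro SUP_emeasure_incseq[symmetric])
  also have "\<dots> \<le> ennreal s" by (intro SUP_least An)
  also have "(\<Union>n. A n) = {x\<in>U. rearrangement U F s < ennreal (norm (F x))}"
  proof -
    have "\<exists>n. m + 1 / real (Suc n) < norm (F x)" if "m < norm (F x)" for x
      using reals_Archimedean[of "norm (F x) - m"] that by (auto simp: inverse_eq_divide algebra_simps)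
    moreover have "m < norm (F x)" if "m + 1 / real (Suc n) < norm (F x)" for x n
      by (rule less_trans[OF _ that]) simp
    ultimately show ?thesis using real by (auto simp: A_def ennreal_less_iff)
  qed
  finally show ?thesis .
qed simp

lemma rearrangement_le_max_rearrangement:
  assumes "0 < \<rho>"
  shows "rearrangement U F \<rho> \<le> max_rearrangement U F \<rho>"
proof -
  have "rearrangement U F \<rho> * ennreal \<rho> = (\<integral>\<^sup>+s\<in>{0<..<\<rho>}. rearrangement U F \<rho> \<partial>lborel)"
    using assms by (simp add: nn_integral_cmult_indicator)
  also have "\<dots> \<le> (\<integral>\<^sup>+s\<in>{0<..<\<rho>}. rearrangement U F s \<partial>lborel)"
    by (intro nn_integral_mono) (auto simp: indicator_def intro: rearrangement_antimono)
  finally have "rearrangement U F \<rho> * ennreal \<rho> / ennreal \<rho> \<le> max_rearrangement U F \<rho>"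
    unfolding max_rearrangement_def by (rule divide_right_mono_ennreal)
  then show ?thesis using assms by (simp add: ennreal_mult_divide_eq)
qed

context homogeneous_balls begin

text \<open>Let \<open>l k\<close> be the rearrangement on the largest ball, taken at the volume
  \<open>V k\<close> of the k-th ball. Since |G| exceeds \<open>l (j + i)\<close> only on a set of
  measure \<open>V (j + i)\<close>, the L^\<theta> mean over the j-th ball is at most the sum over i
  of \<tau>^(i Q/\<theta>) \<open>l (Suc (j + i))\<close>. Replacing the radius \<open>R j\<close>
  by \<open>R (j + i)\<close> turns the factor into \<delta>^i, and replacing it in the weight costs
  1 + i L; the product is summable in i. The sum over k = j + i that remains is a lower sum of the
  integral.\<close>

lemma lorentz_sum_bound:
  assumes \<theta>: "1 < \<theta>" "\<theta> < Q" and \<tau>: "0 < \<tau>" "\<tau> < 1"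
  obtains C where "0 < C" "\<And>G :: 'a \<Rightarrow> 'b::real_normed_vector. \<And>x0 r \<beta>.
    \<lbrakk>\<beta> \<in> {0, 1}; 0 < r; \<And>l. {x\<in>Bl x0 r. l < norm (G x)} \<in> sets lebesgue\<rbrakk> \<Longrightarrow>
    (\<Sum>j. ennreal (\<tau> ^ j * r * log_weight \<beta> (\<tau> ^ j * r)) * Lp_mean \<theta> G (Bl x0 (\<tau> ^ j * r)))
      \<le> ennreal C * lz_norm Q \<beta> (Bl x0 r) G"
proof -
  define L where "L = ln (1 / \<tau>)"
  have L: "0 < L" using \<tau> by (simp add: L_def)
  define \<delta> where "\<delta> = \<tau> powr (Q / \<theta> - 1)"
  have \<delta>: "0 < \<delta>" "\<delta> < 1"
    using \<tau> \<theta> powr_less_mono2[of "Q / \<theta> - 1" \<tau> 1] by (auto simp: \<delta>_def)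
  have \<tau>Q: "0 < \<tau> powr Q" "\<tau> powr Q < 1"
    using \<tau> pos powr_less_mono2[of Q \<tau> 1] by auto
  define C1 where "C1 = (1 + L) * (1 / (1 - \<delta>)\<^sup>2)"
  \<comment> \<open>On the k-th interval \<rho> lies between volumes of neighbouring balls, so ln
    \<rho> is \<open>ln \<omega> + Q * ln (R k)\<close> up to 2 Q L; \<open>K4\<close> converts the
    weight in \<open>R k\<close> into the weight in \<rho>.\<close>
  define K4 where "K4 = 1 + (1 + \<bar>ln \<omega>\<bar> + 2 * Q * L) / Q"
  have K4: "1 \<le> K4" using L pos by (simp add: K4_def)
  \<comment> \<open>\<tau>^2 arises because \<rho>^(1/Q) is bounded below by its value at the left
    end, the volume of the ball with index k + 2; 1 - \<tau>^Q comes from the length of the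
    interval.\<close>
  define C2 where "C2 = K4 / (\<omega> powr (1 / Q) * \<tau>\<^sup>2 * (1 - \<tau> powr Q))"
  have C2den: "0 < \<omega> powr (1 / Q) * \<tau>\<^sup>2 * (1 - \<tau> powr Q)" using pos \<tau> \<tau>Q by (intro mult_pos_pos) auto
  have C1: "0 < C1" using L \<delta> by (simp add: C1_def)
  have C2: "0 < C2" using C2den K4 by (simp add: C2_def)
  show thesis
  proof (rule that[of "C1 * C2"])
    show "0 < C1 * C2" using C1 C2 by simp
    fix G :: "'a \<Rightarrow> 'b" and x0 r and \<beta> :: nat
    assume \<beta>: "\<beta> \<in> {0, 1}" and r: "0 < r" and meas: "\<And>l. {x\<in>Bl x0 r. l < norm (G x)} \<in> sets lebesgue"
    define U where "U = Bl x0 r"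
    define R where "R k = \<tau> ^ k * r" for k
    define V where "V k = \<omega> * R k powr Q" for k
    define l where "l k = rearrangement U G (V k)" for k
    \<comment> \<open>The 1 makes weights at different radii comparable by a factor even where a
      logarithm vanishes.\<close>
    define w where "w k = (1 + \<bar>ln (R k)\<bar>) ^ \<beta>" for k
    have R: "0 < R k" for k using r \<tau> by (simp add: R_def)
    have V: "0 < V k" for k using pos(1) R[of k] by (simp add: V_def)
    have R_add: "R (j + i) = \<tau> ^ i * R j" for i j by (simp add: R_def power_add mult_ac)
    have R_le: "R k \<le> r" for k using r \<tau> by (simp add: R_def mult_left_le_one_le power_le_one)
    have V_add: "V (j + i) = (\<tau> powr Q) ^ i * V j" for i j
      using \<tau> R[of j] by (simp add: V_def R_add powr_mult powr_power mult_ac flip: powr_realpow) (simp add: powr_powr mult.commute)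
    have eB: "emeasure lebesgue (Bl x0 (R k)) = ennreal (V k)" for k
      using emeasure_ball[OF R] by (simp add: V_def)
    have BU: "Bl x0 (R k) \<subseteq> U" for k using ball_mono[OF R_le] by (simp add: U_def)
    have w0: "0 \<le> w k" for k by (simp add: w_def)
    define W where "W = (\<Sum>k. ennreal (R k * w k) * l (Suc k))"
    have mean: "Lp_mean \<theta> G (Bl x0 (R j)) \<le> (\<Sum>i. ennreal ((\<tau> powr (Q / \<theta>)) ^ i) * l (Suc (j + i)))" for j
    proof -
      \<comment> \<open>A point is charged to the least i with
        \<open>norm (G x) \<le> l (Suc (j + i))\<close>; leastness puts it into \<open>S i\<close>.
        For i = 0 there is no lower height, so the whole ball is taken.\<close>
      define S where "S i = (if i = 0 then Bl x0 (R j) else {x\<in>U. l (j + i) < ennreal (norm (G x))})" for i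
      have S_meas: "S i \<in> sets lebesgue" for i
      proof (cases "l (j + i)")
        case (real m)
        then have "{x\<in>U. l (j + i) < ennreal (norm (G x))} = {x\<in>U. m < norm (G x)}"
          by (auto simp: ennreal_less_iff)
        then show ?thesis using meas by (simp add: S_def U_def)
      qed (simp add: S_def)
      have S_em: "emeasure lebesgue (S i) \<le> ennreal (V (j + i))" for i
        using emeasure_above_rearrangement[of U G "V (j + i)"] meas eB[of j]
        by (auto simp: S_def l_def U_def)
      \<comment> \<open>The points that exceed all heights \<open>l k\<close>; as the volumes
        \<open>V k\<close> tend to 0, they form a null set.\<close>
      define N where "N = {x\<in>U. \<forall>k. l k < ennreal (norm (G x))}"
      have N_null: "AE x in lebesgue. x \<notin> N"
      proof (rule AE_not_in)
        have N_eq: "N = (\<Inter>i. S (Suc i)) \<inter> {x\<in>U. \<forall>k\<le>j. l k < ennreal (norm (G x))}"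
        proof -
          have "l k < ennreal (norm (G x))" if "\<forall>i. l (j + Suc i) < ennreal (norm (G x))" "\<forall>k\<le>j. l k < ennreal (norm (G x))" for k x
          proof (cases "k \<le> j")
            case False
            then obtain i where "k = j + Suc i" using less_imp_Suc_add[of j k] by auto
            then show ?thesis using that(1) by simp
          qed (use that in auto)
          then show ?thesis by (auto simp: N_def S_def)
        qed
        have sets1: "{x\<in>U. l k < ennreal (norm (G x))} \<in> sets lebesgue" for k
        proof (cases "l k")
          case (real m)
          then have "{x\<in>U. l k < ennreal (norm (G x))} = {x\<in>U. m < norm (G x)}"
            by (auto simp: ennreal_less_iff)
          then show ?thesis using meas by (simp add: U_def)
        qed simp
        have "N = (\<Inter>k. {x\<in>U. l k < ennreal (norm (G x))})" by (auto simp: N_def)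
        then have N_sets: "N \<in> sets lebesgue" using sets1 by auto
        have "emeasure lebesgue N \<le> ennreal (V k)" for k
        proof -
          have "emeasure lebesgue N \<le> emeasure lebesgue {x\<in>U. l k < ennreal (norm (G x))}"
            using sets1 by (intro emeasure_mono) (auto simp: N_def)
          also have "\<dots> \<le> ennreal (V k)"
            unfolding l_def using meas by (intro emeasure_above_rearrangement) (simp add: U_def)
          finally show ?thesis .
        qed
        moreover have "(\<lambda>k. ennreal (V k)) \<longlonglongrightarrow> ennreal (0 * V 0)"
        proof -
          have "(\<lambda>k. ennreal ((\<tau> powr Q) ^ k * V 0)) \<longlonglongrightarrow> ennreal (0 * V 0)"
            using \<tau>Q by (intro tendsto_ennrealI tendsto_mult LIMSEQ_power_zero tendsto_const) auto
          moreover have "(\<tau> powr Q) ^ k * V 0 = V k" for k using V_add[of 0 k] by simp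
          ultimately show ?thesis by (simp only:)
        qed
        ultimately have "emeasure lebesgue N \<le> ennreal (0 * V 0)"
          by (intro LIMSEQ_le_const[where X = "\<lambda>k. ennreal (V k)"] exI[of _ 0]) auto
        then show "N \<in> null_sets lebesgue" using N_sets by (simp add: null_sets_def)
      qed
      have "(\<integral>\<^sup>+x\<in>Bl x0 (R j). ennreal (norm (G x) powr \<theta>) \<partial>lebesgue) \<le>
          (\<integral>\<^sup>+x. (\<Sum>i. ennreal_powr (l (Suc (j + i))) \<theta> * indicator (S i) x) \<partial>lebesgue)"
      proof (rule nn_integral_mono_AE)
        show "AE x in lebesgue. ennreal (norm (G x) powr \<theta>) * indicator (Bl x0 (R j)) x \<le>
            (\<Sum>i. ennreal_powr (l (Suc (j + i))) \<theta> * indicator (S i) x)"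
          using N_null
        proof eventually_elim
          case (elim x)
          show ?case
          proof (cases "x \<in> Bl x0 (R j)")
            case True
            then have xU: "x \<in> U" using BU by auto
            have "\<exists>i. ennreal (norm (G x)) \<le> l (Suc (j + i))"
            proof (rule ccontr)
              assume "\<nexists>i. ennreal (norm (G x)) \<le> l (Suc (j + i))"
              then have gt: "l (Suc (j + i)) < ennreal (norm (G x))" for i by (simp add: not_le)
              have "l k < ennreal (norm (G x))" for k
              proof -
                have "l k \<le> l (Suc (j + k))"
                  unfolding l_def
                proof (rule rearrangement_antimono)
                  have "V (k + Suc j) \<le> 1 * V k"
                    unfolding V_add using \<tau>Q V[of k] by (intro mult_right_mono power_le_one) auto
                  then show "V (Suc (j + k)) \<le> V k" by (simp add: add.commute)
                qed
                then show ?thesis using gt[of k] by (rule le_less_trans)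
              qed
              then show False using elim xU by (simp add: N_def)
            qed
            then obtain i where i: "ennreal (norm (G x)) \<le> l (Suc (j + i))"
              and least: "\<And>i'. i' < i \<Longrightarrow> \<not> ennreal (norm (G x)) \<le> l (Suc (j + i'))"
              using exists_least_iff[of "\<lambda>i. ennreal (norm (G x)) \<le> l (Suc (j + i))"] by auto
            have "x \<in> S i"
            proof (cases i)
              case 0 then show ?thesis using True by (simp add: S_def)
            next
              case (Suc i') then show ?thesis using least[of i'] xU by (simp add: S_def not_le)
            qed
            have "ennreal (norm (G x) powr \<theta>) \<le> ennreal_powr (l (Suc (j + i))) \<theta>"
              using ennreal_powr_mono[OF i, of \<theta>] \<theta> by simp
            also have "\<dots> = (\<Sum>n\<in>{i}. ennreal_powr (l (Suc (j + n))) \<theta> * indicator (S n) x)"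
              using \<open>x \<in> S i\<close> by simp
            also have "\<dots> \<le> (\<Sum>n. ennreal_powr (l (Suc (j + n))) \<theta> * indicator (S n) x)"
              by (intro sum_le_suminf) auto
            finally show ?thesis using True by simp
          qed simp
        qed
      qed
      also have "\<dots> = (\<Sum>i. ennreal_powr (l (Suc (j + i))) \<theta> * emeasure lebesgue (S i))"
        using S_meas by (subst nn_integral_suminf) (auto simp: nn_integral_cmult_indicator)
      also have "\<dots> \<le> (\<Sum>i. ennreal_powr (l (Suc (j + i))) \<theta> * ennreal (V (j + i)))"
        using S_em by (intro suminf_le mult_left_mono) auto
      also have "\<dots> = (\<Sum>i. ennreal_powr (ennreal ((\<tau> powr (Q / \<theta>)) ^ i) * l (Suc (j + i))) \<theta>) * ennreal (V j)"
      proof -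
        have "ennreal_powr (ennreal ((\<tau> powr (Q / \<theta>)) ^ i) * l (Suc (j + i))) \<theta> * ennreal (V j) =
            ennreal_powr (l (Suc (j + i))) \<theta> * ennreal (V (j + i))" for i
        proof -
          have "((\<tau> powr (Q / \<theta>)) ^ i) powr \<theta> = (\<tau> powr Q) ^ i"
            using \<tau> \<theta> by (simp add: powr_power powr_powr flip: powr_realpow)
          moreover have "ennreal_powr (ennreal ((\<tau> powr (Q / \<theta>)) ^ i) * l (Suc (j + i))) \<theta> =
              ennreal (((\<tau> powr (Q / \<theta>)) ^ i) powr \<theta>) * ennreal_powr (l (Suc (j + i))) \<theta>"
            using \<tau> by (intro ennreal_powr_mult) auto
          ultimately show ?thesis using \<tau>Q V[of j] by (simp add: V_add ennreal_mult mult_ac)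
        qed
        then show ?thesis unfolding ennreal_suminf_multc[symmetric] by (simp only:)
      qed
      also have "\<dots> \<le> ennreal_powr (\<Sum>i. ennreal ((\<tau> powr (Q / \<theta>)) ^ i) * l (Suc (j + i))) \<theta> * ennreal (V j)"
        using \<theta> by (intro mult_right_mono suminf_ennreal_powr_le) auto
      finally have "(\<integral>\<^sup>+x\<in>Bl x0 (R j). ennreal (norm (G x) powr \<theta>) \<partial>lebesgue) / ennreal (V j) \<le>
          ennreal_powr (\<Sum>i. ennreal ((\<tau> powr (Q / \<theta>)) ^ i) * l (Suc (j + i))) \<theta> * ennreal (V j) / ennreal (V j)"
        by (rule divide_right_mono_ennreal)
      also have "\<dots> = ennreal_powr (\<Sum>i. ennreal ((\<tau> powr (Q / \<theta>)) ^ i) * l (Suc (j + i))) \<theta>"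
        using V[of j] by (intro ennreal_mult_divide_eq) auto
      finally have "Lp_mean \<theta> G (Bl x0 (R j)) \<le>
          ennreal_powr (ennreal_powr (\<Sum>i. ennreal ((\<tau> powr (Q / \<theta>)) ^ i) * l (Suc (j + i))) \<theta>) (1 / \<theta>)"
        unfolding Lp_mean_def eB using \<theta> by (intro ennreal_powr_mono) auto
      then show ?thesis using \<theta> by (simp add: ennreal_powr_powr)
    qed
    have weight: "log_weight \<beta> (R j) \<le> (1 + real i * L) * w (j + i)" for i j
    proof -
      have "ln (R (j + i)) = real i * ln \<tau> + ln (R j)"
        using \<tau> R[of j] by (simp add: R_add ln_mult ln_realpow)
      moreover have "L = - ln \<tau>" using \<tau> by (simp add: L_def ln_div)
      ultimately have eq: "ln (R j) = ln (R (j + i)) + real i * L" by simp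
      have "\<bar>ln (1 / R j)\<bar> = \<bar>ln (R j)\<bar>" using R[of j] by (simp add: ln_div)
      also have "\<dots> \<le> \<bar>ln (R (j + i))\<bar> + real i * L" unfolding eq using L by (intro order_trans[OF abs_triangle_ineq]) auto
      also have "\<dots> \<le> (1 + real i * L) * (1 + \<bar>ln (R (j + i))\<bar>)"
        using L by (simp add: algebra_simps)
      finally show ?thesis using \<beta> L by (auto simp: log_weight_def w_def)
    qed
    have "(\<Sum>j. ennreal (R j * log_weight \<beta> (R j)) * Lp_mean \<theta> G (Bl x0 (R j))) \<le>
        (\<Sum>j. ennreal (R j * log_weight \<beta> (R j)) * (\<Sum>i. ennreal ((\<tau> powr (Q / \<theta>)) ^ i) * l (Suc (j + i))))"
      by (intro suminf_le mult_left_mono mean) auto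
    also have "\<dots> = (\<Sum>j. \<Sum>i. ennreal (R j * log_weight \<beta> (R j)) * (ennreal ((\<tau> powr (Q / \<theta>)) ^ i) * l (Suc (j + i))))"
      by simp
    also have "\<dots> \<le> (\<Sum>j. \<Sum>i. ennreal (\<delta> ^ i * (1 + real i * L)) * (ennreal (R (j + i) * w (j + i)) * l (Suc (j + i))))"
    proof (intro suminf_le)
      fix j i
      have "R j * log_weight \<beta> (R j) * (\<tau> powr (Q / \<theta>)) ^ i \<le> R j * ((1 + real i * L) * w (j + i)) * (\<tau> powr (Q / \<theta>)) ^ i"
        using R[of j] by (intro mult_right_mono mult_left_mono weight) auto
      also have "\<dots> = \<delta> ^ i * (1 + real i * L) * (R (j + i) * w (j + i))"
      proof -
        have "\<delta> ^ i * \<tau> ^ i = (\<tau> powr (Q / \<theta>)) ^ i"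
          using \<tau> by (simp add: \<delta>_def powr_diff flip: power_mult_distrib)
        then have "(\<tau> powr (Q / \<theta>)) ^ i * R j = \<delta> ^ i * R (j + i)" by (simp add: R_add mult_ac)
        then show ?thesis by (simp add: mult_ac)
      qed
      finally have "ennreal (R j * log_weight \<beta> (R j) * (\<tau> powr (Q / \<theta>)) ^ i) \<le> ennreal (\<delta> ^ i * (1 + real i * L) * (R (j + i) * w (j + i)))"
        by (rule ennreal_leI)
      then have "ennreal (R j * log_weight \<beta> (R j) * (\<tau> powr (Q / \<theta>)) ^ i) * l (Suc (j + i)) \<le>
          ennreal (\<delta> ^ i * (1 + real i * L) * (R (j + i) * w (j + i))) * l (Suc (j + i))"
        by (rule mult_right_mono) simp
      then show "ennreal (R j * log_weight \<beta> (R j)) * (ennreal ((\<tau> powr (Q / \<theta>)) ^ i) * l (Suc (j + i))) \<le>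
          ennreal (\<delta> ^ i * (1 + real i * L)) * (ennreal (R (j + i) * w (j + i)) * l (Suc (j + i)))"
        using R w0 \<delta> L by (simp add: ennreal_mult'' mult.assoc[symmetric] less_imp_le)
    qed auto
    also have "\<dots> = (\<Sum>i. \<Sum>j. ennreal (\<delta> ^ i * (1 + real i * L)) * (ennreal (R (j + i) * w (j + i)) * l (Suc (j + i))))"
      by (rule suminf_swap_ennreal)
    also have "\<dots> = (\<Sum>i. ennreal (\<delta> ^ i * (1 + real i * L)) * (\<Sum>j. ennreal (R (j + i) * w (j + i)) * l (Suc (j + i))))"
      by simp
    also have "\<dots> \<le> (\<Sum>i. ennreal (\<delta> ^ i * (1 + real i * L)) * W)"
      unfolding W_def by (intro suminf_le mult_left_mono suminf_shift_le[where f = "\<lambda>k. ennreal (R k * w k) * l (Suc k)"]) auto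
    also have "\<dots> = (\<Sum>i. ennreal (\<delta> ^ i * (1 + real i * L))) * W" by simp
    also have "(\<Sum>i. ennreal (\<delta> ^ i * (1 + real i * L))) \<le> ennreal C1"
    proof -
      have sums: "(\<lambda>i. (1 + L) * (real (Suc i) * \<delta> ^ i)) sums C1"
        unfolding C1_def using \<delta> by (intro sums_mult geometric_deriv_sums) auto
      have "(\<Sum>i. ennreal (\<delta> ^ i * (1 + real i * L))) \<le> (\<Sum>i. ennreal ((1 + L) * (real (Suc i) * \<delta> ^ i)))"
      proof (intro suminf_le ennreal_leI)
        fix i
        have "1 + real i * L \<le> (1 + L) * real (Suc i)" using L by (simp add: algebra_simps)
        then have "\<delta> ^ i * (1 + real i * L) \<le> \<delta> ^ i * ((1 + L) * real (Suc i))"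
          using \<delta> by (intro mult_left_mono) auto
        then show "\<delta> ^ i * (1 + real i * L) \<le> (1 + L) * (real (Suc i) * \<delta> ^ i)" by (simp add: mult_ac)
      qed auto
      also have "\<dots> = ennreal C1"
        using sums \<delta> L by (subst suminf_ennreal2) (auto simp: sums_iff)
      finally show ?thesis .
    qed
    also have "W \<le> ennreal C2 * lz_norm Q \<beta> U G"
    proof -
      \<comment> \<open>A lower bound of the integrand on \<open>I k\<close>, normalised so that
        \<open>C2\<close> times its integral over \<open>I k\<close> is the k-th term of
        \<open>W\<close>.\<close>
      define c where "c k = ennreal (R k * w k / (C2 * (1 - \<tau> powr Q)) / V (Suc k)) * l (Suc k)" for k
      \<comment> \<open>The index is shifted by one so that \<rho> stays below
        \<open>V (Suc k)\<close>, where \<open>l (Suc k)\<close> bounds the rearrangement from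
        below.\<close>
      define I where "I k = {V (Suc (Suc k))<..<V (Suc k)}" for k
      have VS: "V (Suc k) = \<tau> powr Q * V k" for k using V_add[of k 1] by simp
      have V_anti: "V k \<le> V m" if "m \<le> k" for k m
      proof -
        have "V (m + (k - m)) \<le> 1 * V m"
          unfolding V_add using \<tau>Q V[of m] by (intro mult_right_mono power_le_one) auto
        then show ?thesis using that by simp
      qed
      have disj: "disjoint_family I"
        unfolding disjoint_family_on_def
      proof (intro ballI impI)
        fix m n :: nat assume "m \<noteq> n"
        then consider "Suc m \<le> n" | "Suc n \<le> m" by linarith
        then show "I m \<inter> I n = {}"
        proof cases
          case 1 then show ?thesis using V_anti[of "Suc m" n] V_anti[of "Suc (Suc m)" "Suc n"] by (auto simp: I_def)
        next
          case 2 then show ?thesis using V_anti[of "Suc n" m] V_anti[of "Suc (Suc n)" "Suc m"] by (auto simp: I_def)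
        qed
      qed
      have eU: "emeasure lebesgue U = ennreal (V 0)" using eB[of 0] by (simp add: U_def R_def)
      have ck: "c k \<le> ennreal (\<rho> powr (1 / Q) * (1 + \<bar>ln \<rho>\<bar>) ^ \<beta> / \<rho>) * max_rearrangement U G \<rho>"
        and Ik: "0 < \<rho>" "ennreal \<rho> < emeasure lebesgue U" if \<rho>: "\<rho> \<in> I k" for k \<rho>
      proof -
        have \<rho>1: "V (Suc (Suc k)) < \<rho>" "\<rho> < V (Suc k)" using \<rho> by (auto simp: I_def)
        then show p: "0 < \<rho>" using V[of "Suc (Suc k)"] by linarith
        show "ennreal \<rho> < emeasure lebesgue U"
          using \<rho>1 p V_anti[of 0 "Suc k"] unfolding eU by (intro ennreal_lessI V) auto
        have RS: "R (Suc (Suc k)) = \<tau>\<^sup>2 * R k" by (simp add: R_def power2_eq_square)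
        have "V (Suc (Suc k)) powr (1 / Q) \<le> \<rho> powr (1 / Q)"
          using \<rho>1 V[of "Suc (Suc k)"] pos by (intro powr_mono2) auto
        moreover have "V (Suc (Suc k)) powr (1 / Q) = \<omega> powr (1 / Q) * (\<tau>\<^sup>2 * R k)"
          unfolding V_def RS using pos R[of k] \<tau> by (simp add: powr_mult powr_powr)
        ultimately have a1: "\<omega> powr (1 / Q) * (\<tau>\<^sup>2 * R k) \<le> \<rho> powr (1 / Q)" by simp
        have a2: "w k \<le> K4 * (1 + \<bar>ln \<rho>\<bar>) ^ \<beta>"
        proof -
          have lnV: "ln (V (k + i)) = ln \<omega> + Q * ln (R k) - real i * (Q * L)" for i
            using pos \<tau> R[of k] V[of k] \<tau>Q
            by (simp add: V_add ln_mult ln_realpow ln_powr L_def ln_div) (simp add: V_def ln_mult ln_powr)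
          have "ln (V (k + 2)) \<le> ln \<rho>" "ln \<rho> \<le> ln (V (k + 1))" using \<rho>1 V p by simp_all
          then have ln1: "ln \<omega> + Q * ln (R k) - 2 * (Q * L) \<le> ln \<rho>" and ln2: "ln \<rho> \<le> ln \<omega> + Q * ln (R k) - 1 * (Q * L)"
            unfolding lnV by simp_all
          have QL: "0 \<le> Q * L" using pos L by simp
          have "\<bar>Q * ln (R k)\<bar> \<le> \<bar>ln \<rho>\<bar> + \<bar>ln \<omega>\<bar> + 2 * (Q * L)" using ln1 ln2 QL by linarith
          then have "\<bar>ln (R k)\<bar> \<le> (\<bar>ln \<rho>\<bar> + \<bar>ln \<omega>\<bar> + 2 * (Q * L)) / Q"
            using pos by (simp add: abs_mult field_simps)
          also have "\<dots> \<le> (1 + \<bar>ln \<omega>\<bar> + 2 * Q * L) / Q * (1 + \<bar>ln \<rho>\<bar>)"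
          proof -
            have "0 \<le> (\<bar>ln \<omega>\<bar> + 2 * (Q * L)) * \<bar>ln \<rho>\<bar>" using QL by (intro mult_nonneg_nonneg) auto
            then have "\<bar>ln \<rho>\<bar> + \<bar>ln \<omega>\<bar> + 2 * (Q * L) \<le> (1 + \<bar>ln \<omega>\<bar> + 2 * Q * L) * (1 + \<bar>ln \<rho>\<bar>)"
              by (simp add: algebra_simps)
            then show ?thesis using pos by (simp add: divide_right_mono)
          qed
          finally have "1 + \<bar>ln (R k)\<bar> \<le> K4 * (1 + \<bar>ln \<rho>\<bar>)"
            unfolding K4_def distrib_right mult_1_left by linarith
          then show ?thesis using \<beta> K4 by (auto simp: w_def)
        qed
        have "R k * w k / (C2 * (1 - \<tau> powr Q)) / V (Suc k) = (\<omega> powr (1 / Q) * (\<tau>\<^sup>2 * R k)) * (w k / K4) / V (Suc k)"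
        proof -
          have "K4 / (x * t) * t = K4 / x" if "0 < t" for x t :: real using that by simp
          then have "C2 * (1 - \<tau> powr Q) = K4 / (\<omega> powr (1 / Q) * \<tau>\<^sup>2)"
            unfolding C2_def using \<tau>Q by simp
          then show ?thesis by (simp add: mult_ac)
        qed
        also have "\<dots> \<le> \<rho> powr (1 / Q) * (1 + \<bar>ln \<rho>\<bar>) ^ \<beta> / \<rho>"
        proof (intro frac_le mult_mono a1)
          show "w k / K4 \<le> (1 + \<bar>ln \<rho>\<bar>) ^ \<beta>" using a2 K4 by (simp add: divide_le_eq mult.commute)
        qed (use \<rho>1 p w0 K4 in auto)
        finally have "ennreal (R k * w k / (C2 * (1 - \<tau> powr Q)) / V (Suc k)) \<le> ennreal (\<rho> powr (1 / Q) * (1 + \<bar>ln \<rho>\<bar>) ^ \<beta> / \<rho>)"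
          by (rule ennreal_leI)
        moreover have "l (Suc k) \<le> max_rearrangement U G \<rho>"
          unfolding l_def using \<rho>1(2)
          by (intro order_trans[OF rearrangement_antimono rearrangement_le_max_rearrangement[OF p]]) simp
        ultimately show "c k \<le> ennreal (\<rho> powr (1 / Q) * (1 + \<bar>ln \<rho>\<bar>) ^ \<beta> / \<rho>) * max_rearrangement U G \<rho>"
          unfolding c_def by (intro mult_mono) auto
      qed
      have "(\<Sum>k. c k * ennreal (V (Suc k) * (1 - \<tau> powr Q))) = (\<Sum>k. \<integral>\<^sup>+\<rho>. c k * indicator (I k) \<rho> \<partial>lborel)"
      proof -
        have "(\<integral>\<^sup>+\<rho>. c k * indicator (I k) \<rho> \<partial>lborel) = c k * ennreal (V (Suc k) * (1 - \<tau> powr Q))" for k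
          using V_anti[of "Suc k" "Suc (Suc k)"]
          by (subst nn_integral_cmult_indicator) (auto simp: I_def VS[of "Suc k"] algebra_simps)
        then show ?thesis by simp
      qed
      also have "\<dots> = (\<integral>\<^sup>+\<rho>. (\<Sum>k. c k * indicator (I k) \<rho>) \<partial>lborel)"
        by (subst nn_integral_suminf) (auto simp: I_def)
      also have "\<dots> \<le> lz_norm Q \<beta> U G"
        unfolding lz_norm_def
      proof (rule nn_integral_mono)
        fix \<rho> :: real
        show "(\<Sum>k. c k * indicator (I k) \<rho>) \<le> ennreal (\<rho> powr (1 / Q) * (1 + \<bar>ln \<rho>\<bar>) ^ \<beta> / \<rho>) * max_rearrangement U G \<rho> *
            indicator {\<rho>. 0 < \<rho> \<and> ennreal \<rho> < emeasure lebesgue U} \<rho>"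
        proof (cases "\<exists>k. \<rho> \<in> I k")
          case True
          then obtain k where k: "\<rho> \<in> I k" by blast
          have "(\<Sum>n. c n * indicator (I n) \<rho>) = (\<Sum>n\<in>{k}. c n * indicator (I n) \<rho>)"
            using k disj by (intro suminf_finite) (auto simp: disjoint_family_on_def indicator_def)
          then show ?thesis using k ck[OF k] Ik[OF k] by simp
        next
          case False
          then have "(\<Sum>n. c n * indicator (I n) \<rho>) = 0" by simp
          then show ?thesis by simp
        qed
      qed
      finally have lz: "(\<Sum>k. c k * ennreal (V (Suc k) * (1 - \<tau> powr Q))) \<le> lz_norm Q \<beta> U G" .
      have "ennreal C2 * (c k * ennreal (V (Suc k) * (1 - \<tau> powr Q))) = ennreal (R k * w k) * l (Suc k)" for k
      proof -
        have nz: "0 < C2 * (1 - \<tau> powr Q)" "0 \<le> R k * w k" using C2 \<tau>Q w0 R[of k] by simp_all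
        have "C2 * (R k * w k / (C2 * (1 - \<tau> powr Q)) / V (Suc k)) * (V (Suc k) * (1 - \<tau> powr Q)) = R k * w k"
          using V[of "Suc k"] C2 \<tau>Q by simp
        moreover have "ennreal C2 * (ennreal x * y * ennreal z) = ennreal (C2 * x * z) * y" if "0 \<le> x" "0 \<le> z" for x z y
          using C2 that by (simp add: ennreal_mult mult_ac)
        ultimately show ?thesis unfolding c_def using nz V[of "Suc k"] \<tau>Q by simp
      qed
      then have "W = ennreal C2 * (\<Sum>k. c k * ennreal (V (Suc k) * (1 - \<tau> powr Q)))"
        unfolding W_def by (simp flip: ennreal_suminf_cmult)
      also have "\<dots> \<le> ennreal C2 * lz_norm Q \<beta> U G" by (intro mult_left_mono lz) auto
      finally show ?thesis .
    qed
    finally have "(\<Sum>j. ennreal (R j * log_weight \<beta> (R j)) * Lp_mean \<theta> G (Bl x0 (R j))) \<le> ennreal C1 * (ennreal C2 * lz_norm Q \<beta> U G)"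
      by (simp add: mult_left_mono mult_right_mono)
    then show "(\<Sum>j. ennreal (\<tau> ^ j * r * log_weight \<beta> (\<tau> ^ j * r)) * Lp_mean \<theta> G (Bl x0 (\<tau> ^ j * r))) \<le> ennreal (C1 * C2) * lz_norm Q \<beta> (Bl x0 r) G"
      using C1 C2 by (simp add: R_def U_def ennreal_mult mult.assoc)
  qed
qed

end

section \<open>Oscillation estimates\<close>

text \<open>A superlevel set of a monotone function is closed upwards, hence an interval.\<close>

lemma borel_measurable_mono_ennreal:
  fixes h :: "real \<Rightarrow> ennreal"
  assumes "mono h"
  shows "h \<in> borel_measurable borel"
proof (rule borel_measurableI_greater)
  fix y
  let ?S = "{x \<in> space borel. y < h x}"
  have up: "b \<in> ?S" if "a \<in> ?S" "a \<le> b" for a b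
    using that monoD[OF assms, of a b] by auto
  have "is_interval ?S"
    unfolding is_interval_1 using up by blast
  then show "?S \<in> sets borel" by (rule real_interval_borel_measurable)
qed

lemma measurable_max_rearrangement:
  "max_rearrangement U F \<in> borel_measurable borel"
proof -
  have "mono (\<lambda>\<rho>. \<integral>\<^sup>+s\<in>{0<..<\<rho>}. rearrangement U F s \<partial>lborel)"
    by (intro monoI nn_integral_mono) (auto simp: indicator_def)
  note borel_measurable_mono_ennreal[OF this, measurable]
  show ?thesis unfolding max_rearrangement_def by measurable
qed

text \<open>\<open>nn_integral_le_powr\<close> is applied to |h|^q with exponent p / q; its factor 2
  becomes 2^(1/q) \<le> 2.\<close>

lemma Lp_mean_le_Lp_mean:
  fixes h :: "'a::euclidean_space \<Rightarrow> real"
  assumes q: "1 < q" "q \<le> p" and B: "B \<in> sets lebesgue" "emeasure lebesgue B = ennreal d" "0 < d"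
    and h: "set_borel_measurable lebesgue B h"
  shows "Lp_mean q h B \<le> ennreal 2 * Lp_mean p h B"
proof (cases "q = p")
  case True
  have "1 * Lp_mean p h B \<le> ennreal 2 * Lp_mean p h B" by (intro mult_right_mono) auto
  then show ?thesis using True by simp
next
  case False
  then have qp: "q < p" using q by simp
  show ?thesis
  proof (cases "\<integral>\<^sup>+x\<in>B. ennreal (norm (h x) powr p) \<partial>lebesgue")
    case top
    then have "Lp_mean p h B = top" using B by (simp add: Lp_mean_def ennreal_top_divide)
    then show ?thesis by (simp add: ennreal_mult_top)
  next
    case (real \<alpha>)
    define k where "k x = norm (indicator B x *\<^sub>R h x) powr q" for x
    have [measurable]: "(\<lambda>x. indicator B x *\<^sub>R h x) \<in> borel_measurable lebesgue"
      using h by (simp add: set_borel_measurable_def)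
    have km: "k \<in> borel_measurable lebesgue" unfolding k_def by measurable
    have "(\<integral>\<^sup>+x\<in>B. ennreal (k x powr (p / q)) \<partial>lebesgue) = ennreal \<alpha>"
      unfolding real(2)[symmetric] using q by (intro nn_integral_cong) (auto simp: k_def indicator_def powr_powr)
    then have "(\<integral>\<^sup>+x\<in>B. ennreal (k x) \<partial>lebesgue) \<le> ennreal (2 * d powr (1 - 1 / (p / q)) * \<alpha> powr (1 / (p / q)))"
      using q qp real B by (intro nn_integral_le_powr km) (auto simp: k_def)
    moreover have "(\<integral>\<^sup>+x\<in>B. ennreal (k x) \<partial>lebesgue) = (\<integral>\<^sup>+x\<in>B. ennreal (norm (h x) powr q) \<partial>lebesgue)"
      by (intro nn_integral_cong) (auto simp: k_def indicator_def)
    ultimately have "Lp_mean q h B \<le> ennreal_powr (ennreal (2 * d powr (1 - q / p) * \<alpha> powr (q / p)) / ennreal d) (1 / q)"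
      unfolding Lp_mean_def B(2) using q by (intro ennreal_powr_mono divide_right_mono_ennreal) auto
    also have "\<dots> = ennreal ((2 * d powr (1 - q / p) * \<alpha> powr (q / p) / d) powr (1 / q))"
      using B(3) by (simp add: divide_ennreal)
    also have "2 * d powr (1 - q / p) * \<alpha> powr (q / p) / d = 2 * (\<alpha> / d) powr (q / p)"
      using B(3) real(1) by (simp add: powr_divide powr_diff)
    also have "(2 * (\<alpha> / d) powr (q / p)) powr (1 / q) = 2 powr (1 / q) * (\<alpha> / d) powr (1 / p)"
      using q by (subst powr_mult) (auto simp: powr_powr)
    also have "ennreal \<dots> \<le> ennreal (2 powr 1 * (\<alpha> / d) powr (1 / p))"
      using q by (intro ennreal_leI mult_right_mono powr_mono) auto
    also have "\<dots> = ennreal 2 * Lp_mean p h B"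
      using real B(3) by (simp add: Lp_mean_def B(2) divide_ennreal ennreal_mult)
    finally show ?thesis .
  qed
qed

lemma rearrangement_mono_set:
  fixes F :: "'a::euclidean_space \<Rightarrow> 'b::real_normed_vector"
  assumes "U \<subseteq> V" "\<And>l. {x\<in>V. l < norm (F x)} \<in> sets lebesgue"
  shows "rearrangement U F s \<le> rearrangement V F s"
  unfolding rearrangement_def
proof (rule INF_superset_mono)
  show "{l. 0 \<le> l \<and> emeasure lebesgue {x \<in> V. l < norm (F x)} \<le> ennreal s} \<subseteq>
      {l. 0 \<le> l \<and> emeasure lebesgue {x \<in> U. l < norm (F x)} \<le> ennreal s}"
  proof clarify
    fix l assume "emeasure lebesgue {x \<in> V. l < norm (F x)} \<le> ennreal s"
    moreover have "emeasure lebesgue {x \<in> U. l < norm (F x)} \<le> emeasure lebesgue {x \<in> V. l < norm (F x)}"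
      using assms by (intro emeasure_mono) auto
    ultimately show "emeasure lebesgue {x \<in> U. l < norm (F x)} \<le> ennreal s" by (rule order_trans[rotated])
  qed
qed simp

text \<open>The norm on U integrates only up to the volume of U, and the rearrangement on U lies
  below the one on V. So it is at most the part of one convergent integral near 0, wherever U is
  located; this is the source of uniformity in the centre.\<close>

lemma lz_norm_vanishes:
  fixes F :: "'a::euclidean_space \<Rightarrow> 'b::real_normed_vector"
  assumes fin: "lz_norm Q \<beta> V F < \<infinity>" and meas: "\<And>l. {x\<in>V. l < norm (F x)} \<in> sets lebesgue"
    and V: "V \<in> sets lebesgue" and e: "0 < e"
  obtains d where "0 < d" "\<And>U. U \<subseteq> V \<Longrightarrow> emeasure lebesgue U \<le> ennreal d \<Longrightarrow> lz_norm Q \<beta> U F < ennreal e"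
proof -
  define D where "D = {\<rho>. 0 < \<rho> \<and> ennreal \<rho> < emeasure lebesgue V}"
  define k where "k \<rho> = ennreal (\<rho> powr (1 / Q) * (1 + \<bar>ln \<rho>\<bar>) ^ \<beta> / \<rho>) * max_rearrangement V F \<rho> * indicator D \<rho>" for \<rho>
  note measurable_max_rearrangement[measurable]
  have D[measurable]: "D \<in> sets borel" unfolding D_def by measurable
  have km[measurable]: "k \<in> borel_measurable lborel" unfolding k_def by measurable
  have k: "(\<integral>\<^sup>+\<rho>. k \<rho> \<partial>lborel) < \<infinity>" using fin unfolding lz_norm_def k_def D_def .
  have "(\<lambda>n. \<integral>\<^sup>+\<rho>. k \<rho> * indicator {..<1 / real (Suc n)} \<rho> \<partial>lborel) \<longlonglongrightarrow> (\<integral>\<^sup>+\<rho>. 0 \<partial>(lborel :: real measure))"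
  proof (rule nn_integral_dominated_convergence[where w = k])
    show "AE \<rho> in lborel. (\<lambda>n. k \<rho> * indicator {..<1 / real (Suc n)} \<rho>) \<longlonglongrightarrow> 0"
    proof (rule AE_I2)
      fix \<rho> :: real
      show "(\<lambda>n. k \<rho> * indicator {..<1 / real (Suc n)} \<rho>) \<longlonglongrightarrow> 0"
      proof (cases "0 < \<rho>")
        case True
        then obtain n0 where n0: "inverse (real (Suc n0)) < \<rho>" using reals_Archimedean by blast
        have "k \<rho> * indicator {..<1 / real (Suc n)} \<rho> = 0" if "n0 \<le> n" for n
        proof -
          have "1 / real (Suc n) \<le> inverse (real (Suc n0))" using that by (simp add: inverse_eq_divide frac_le)
          then show ?thesis using n0 by (auto simp: indicator_def)
        qed
        then have "\<forall>\<^sub>F n in sequentially. 0 = k \<rho> * indicator {..<1 / real (Suc n)} \<rho>"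
          unfolding eventually_sequentially by (intro exI[of _ n0]) simp
        then show ?thesis by (rule Lim_transform_eventually[OF tendsto_const])
      next
        case False
        then have "k \<rho> = 0" by (simp add: k_def D_def)
        then show ?thesis by simp
      qed
    qed
    show "AE \<rho> in lborel. k \<rho> * indicator {..<1 / real (Suc n)} \<rho> \<le> k \<rho>" for n
      by (rule AE_I2) (auto simp: indicator_def)
  qed (use k in auto)
  then have "\<forall>\<^sub>F n in sequentially. (\<integral>\<^sup>+\<rho>. k \<rho> * indicator {..<1 / real (Suc n)} \<rho> \<partial>lborel) < ennreal e"
    using e by (intro order_tendstoD(2)[where y = 0]) auto
  then obtain n where n: "(\<integral>\<^sup>+\<rho>. k \<rho> * indicator {..<1 / real (Suc n)} \<rho> \<partial>lborel) < ennreal e"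
    by (auto simp: eventually_sequentially)
  show thesis
  proof (rule that)
    show "0 < 1 / real (Suc n)" by simp
    fix U assume U: "U \<subseteq> V" "emeasure lebesgue U \<le> ennreal (1 / real (Suc n))"
    have "lz_norm Q \<beta> U F \<le> (\<integral>\<^sup>+\<rho>. k \<rho> * indicator {..<1 / real (Suc n)} \<rho> \<partial>lborel)"
      unfolding lz_norm_def
    proof (rule nn_integral_mono)
      fix \<rho> :: real
      show "ennreal (\<rho> powr (1 / Q) * (1 + \<bar>ln \<rho>\<bar>) ^ \<beta> / \<rho>) * max_rearrangement U F \<rho> *
          indicator {\<rho>. 0 < \<rho> \<and> ennreal \<rho> < emeasure lebesgue U} \<rho> \<le> k \<rho> * indicator {..<1 / real (Suc n)} \<rho>"
      proof (cases "0 < \<rho> \<and> ennreal \<rho> < emeasure lebesgue U")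
        case True
        have "max_rearrangement U F \<rho> \<le> max_rearrangement V F \<rho>"
          unfolding max_rearrangement_def using U(1) meas
          by (intro divide_right_mono_ennreal nn_integral_mono mult_right_mono rearrangement_mono_set) auto
        moreover have "ennreal \<rho> < emeasure lebesgue V"
          using True emeasure_mono[OF U(1) V] by auto
        moreover have "ennreal \<rho> < ennreal (1 / real (Suc n))" using True U(2) by (meson less_le_trans)
        then have "\<rho> < 1 / real (Suc n)" using True by (subst (asm) ennreal_less_iff) auto
        ultimately show ?thesis using True unfolding k_def D_def
          by (auto simp del: of_nat_Suc intro: mult_left_mono)
      qed simp
    qed
    also note n
    finally show "lz_norm Q \<beta> U F < ennreal e" .
  qed
qed

context step_two begin

lemma admissible_meas:
  assumes "admissible E \<Omega> \<beta> g G" "U \<subseteq> \<Omega>" "U \<in> sets lebesgue"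
  shows "{x\<in>U. l < norm (G x)} \<in> sets lebesgue"
proof -
  have [measurable]: "(\<lambda>x. indicator \<Omega> x *\<^sub>R G x) \<in> borel_measurable lebesgue"
    using assms(1) by (simp add: admissible_def lz_space_def set_borel_measurable_def)
  have "{x \<in> space lebesgue. l < norm (indicator \<Omega> x *\<^sub>R G x)} \<in> sets lebesgue" by measurable
  then have "U \<inter> {x \<in> space lebesgue. l < norm (indicator \<Omega> x *\<^sub>R G x)} \<in> sets lebesgue"
    using assms(3) by auto
  also have "U \<inter> {x \<in> space lebesgue. l < norm (indicator \<Omega> x *\<^sub>R G x)} = {x\<in>U. l < norm (G x)}"
    using assms(2) by (auto simp: indicator_def)
  finally show ?thesis .
qed

theorem oscillation_estimate:
  assumes Q: "hdim E = Q" and \<theta>: "1 < \<theta>" "\<theta> < hdim E" and \<tau>: "0 < \<tau>" "\<tau> < 1 / 4"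
  shows "\<exists>c1>0. \<exists>c2>0. \<forall>\<Omega> \<beta> g G x0 r. admissible E \<Omega> \<beta> g G \<and> 0 < r \<and> gball E x0 r \<subseteq> \<Omega> \<longrightarrow>
    oscillation_sum E g (sobolev_exp (hdim E) \<theta>) \<tau> \<beta> x0 r \<le> ennreal c1 * potential_sum E G \<theta> \<tau> \<beta> x0 r \<and>
    ennreal c1 * potential_sum E G \<theta> \<tau> \<beta> x0 r \<le> ennreal c2 * lz_norm (hdim E) \<beta> (gball E x0 r) G"
proof -
  have \<theta>Q: "\<theta> < Q" using \<theta> Q by simp
  obtain C where C: "0 < C" and SP: "\<And>\<Omega> g G x0 r.
    \<lbrakk>weak_gradient E \<Omega> g G; set_borel_measurable lebesgue \<Omega> G; open \<Omega>; set_integrable lebesgue \<Omega> g;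
     0 < r; gball E x0 r \<subseteq> \<Omega>\<rbrakk> \<Longrightarrow>
     Lp_mean (Q * \<theta> / (Q - \<theta>)) (\<lambda>x. g x - mean_on g (gball E x0 r)) (gball E x0 r) \<le>
       ennreal (C * r) * Lp_mean \<theta> G (gball E x0 r)"
    using sobolev_poincare[OF \<theta>(1) \<theta>Q] by blast
  have \<tau>1: "\<tau> < 1" using \<tau> by simp
  obtain C' where C': "0 < C'" and LZ: "\<And>G :: 'a \<Rightarrow> real^'m. \<And>x0 r \<beta>.
    \<lbrakk>\<beta> \<in> {0, 1}; 0 < r; \<And>l. {x\<in>gball E x0 r. l < norm (G x)} \<in> sets lebesgue\<rbrakk> \<Longrightarrow>
    (\<Sum>j. ennreal (\<tau> ^ j * r * log_weight \<beta> (\<tau> ^ j * r)) * Lp_mean \<theta> G (gball E x0 (\<tau> ^ j * r)))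
      \<le> ennreal C' * lz_norm Q \<beta> (gball E x0 r) G"
    using lorentz_sum_bound[OF \<theta>(1) \<theta>Q \<tau>(1) \<tau>1] by blast
  show ?thesis
  \<comment> \<open>\<open>C\<close> is the Sobolev-Poincare constant, the same for all balls of the
    sequence; the second constant multiplies it by the one of \<open>lorentz_sum_bound\<close> for
    the ratio \<tau>.\<close>
  proof (rule exI[of _ C], rule conjI[OF C], rule exI[of _ "C * C'"], intro conjI allI impI)
    show "0 < C * C'" using C C' by simp
    fix \<Omega> \<beta> and g :: "'a \<Rightarrow> real" and G :: "'a \<Rightarrow> real^'m" and x0 r
    assume asm: "admissible E \<Omega> \<beta> g G \<and> 0 < r \<and> gball E x0 r \<subseteq> \<Omega>"
    then have adm: "weak_gradient E \<Omega> g G" "set_borel_measurable lebesgue \<Omega> G" "open \<Omega>" "set_integrable lebesgue \<Omega> g"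
      "\<beta> \<in> {0, 1}" and r: "0 < r" and sub: "gball E x0 r \<subseteq> \<Omega>"
      by (auto simp: admissible_def lz_space_def)
    have "oscillation_sum E g (sobolev_exp (hdim E) \<theta>) \<tau> \<beta> x0 r \<le>
        (\<Sum>j. ennreal C * (ennreal (\<tau> ^ j * r * log_weight \<beta> (\<tau> ^ j * r)) * Lp_mean \<theta> G (gball E x0 (\<tau> ^ j * r))))"
      unfolding oscillation_sum_def
    proof (intro suminf_le)
      fix j
      let ?r = "\<tau> ^ j * r"
      have rj: "0 < ?r" "?r \<le> r" using r \<tau> by (simp_all add: mult_left_le_one_le power_le_one)
      have lw: "0 \<le> log_weight \<beta> ?r" by (simp add: log_weight_def)
      have "ennreal (log_weight \<beta> ?r) * Lp_mean (sobolev_exp (hdim E) \<theta>) (\<lambda>x. g x - mean_on g (gball E x0 ?r)) (gball E x0 ?r)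
        \<le> ennreal (log_weight \<beta> ?r) * (ennreal (C * ?r) * Lp_mean \<theta> G (gball E x0 ?r))"
        unfolding sobolev_exp_def Q using ball_mono[OF rj(2), of x0] sub
        by (intro mult_left_mono SP[OF adm(1-4) rj(1)]) auto
      also have "\<dots> = ennreal C * (ennreal (?r * log_weight \<beta> ?r) * Lp_mean \<theta> G (gball E x0 ?r))"
        unfolding ennreal_mult[OF less_imp_le[OF C] less_imp_le[OF rj(1)]] ennreal_mult[OF less_imp_le[OF rj(1)] lw]
        by (simp only: mult_ac)
      finally show "ennreal (log_weight \<beta> ?r) * Lp_mean (sobolev_exp (hdim E) \<theta>) (\<lambda>x. g x - mean_on g (gball E x0 ?r)) (gball E x0 ?r)
        \<le> ennreal C * (ennreal (?r * log_weight \<beta> ?r) * Lp_mean \<theta> G (gball E x0 ?r))" .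
    qed auto
    then show "oscillation_sum E g (sobolev_exp (hdim E) \<theta>) \<tau> \<beta> x0 r \<le> ennreal C * potential_sum E G \<theta> \<tau> \<beta> x0 r"
      unfolding potential_sum_def by simp
    have "potential_sum E G \<theta> \<tau> \<beta> x0 r \<le> ennreal C' * lz_norm Q \<beta> (gball E x0 r) G"
      unfolding potential_sum_def
      using asm by (intro LZ adm r admissible_meas[of \<Omega> \<beta> g G]) auto
    then have "ennreal C * potential_sum E G \<theta> \<tau> \<beta> x0 r \<le> ennreal C * (ennreal C' * lz_norm Q \<beta> (gball E x0 r) G)"
      by (rule mult_left_mono) simp
    then show "ennreal C * potential_sum E G \<theta> \<tau> \<beta> x0 r \<le> ennreal (C * C') * lz_norm (hdim E) \<beta> (gball E x0 r) G"
      using C C' by (simp add: Q ennreal_mult mult.assoc)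
  qed
qed

text \<open>A Lebesgue number argument: S is covered by finitely many balls of radius
  \<open>R x / (2 * K)\<close>, and by the quasi-triangle inequality a ball of no larger radius
  about a point of one of them stays in the ball of radius \<open>R x\<close>.\<close>

lemma uniform_ball_inside:
  assumes Kc: "compact S" "S \<subseteq> \<Omega>" and \<Omega>: "open \<Omega>"
  obtains d where "0 < d" "\<And>x r. x \<in> S \<Longrightarrow> r \<le> d \<Longrightarrow> gball E x r \<subseteq> \<Omega>"
proof -
  have "\<forall>x\<in>S. \<exists>r>0. gball E x r \<subseteq> \<Omega>" using shrink[OF \<Omega>] Kc by blast
  then obtain R where R: "\<And>x. x \<in> S \<Longrightarrow> 0 < R x" "\<And>x. x \<in> S \<Longrightarrow> gball E x (R x) \<subseteq> \<Omega>" by metis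
  define R' where "R' x = R x / (2 * K)" for x
  have R': "0 < R' x" if "x \<in> S" for x using R(1)[OF that] K(1) by (simp add: R'_def)
  have "S \<subseteq> (\<Union>x\<in>S. gball E x (R' x))" using R' centre by blast
  then obtain F where F: "F \<subseteq> S" "finite F" "S \<subseteq> (\<Union>x\<in>F. gball E x (R' x))"
    by (rule compactE_image[OF Kc(1), rotated]) (auto intro: open_ball)
  define d where "d = Min (insert 1 (R' ` F))"
  have d: "0 < d" unfolding d_def using F R' by (subst Min_gr_iff) auto
  show thesis
  proof (rule that[OF d])
    fix y r assume y: "y \<in> S" and r: "r \<le> d"
    obtain x where x: "x \<in> F" "y \<in> gball E x (R' x)" using F(3) y by auto
    have xS: "x \<in> S" using x F by auto
    have "d \<le> R' x" unfolding d_def using F x by (intro Min_le) auto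
    have "gball E y r \<subseteq> gball E x (R x)"
    proof
      fix v assume "v \<in> gball E y r"
      then have "N (gmult (- y) v) \<le> R' x" using r \<open>d \<le> R' x\<close> by (auto simp: gball_eq)
      moreover have "N (gmult (- x) y) \<le> R' x" using x by (simp add: gball_eq)
      ultimately have "N (gmult (gmult (- x) y) (gmult (- y) v)) \<le> K * R' x"
        using K(2)[OF R'[OF xS]] by blast
      then have "N (gmult (- x) v) \<le> R x / 2" using K(1) by (simp add: mult_assoc mult_cancel R'_def)
      then show "v \<in> gball E x (R x)" using R(1)[OF xS] by (simp add: gball_eq)
    qed
    then show "gball E y r \<subseteq> \<Omega>" using R(2)[OF xS] by blast
  qed
qed

text \<open>For \<theta> close enough to Q the Sobolev conjugate is at least q, so the sum is
  bounded by the Lorentz-Zygmund norm over the ball, which is small once the volume is.\<close>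

theorem oscillation_vanishes:
  assumes Q: "hdim E = Q" "1 < Q" and adm: "admissible E \<Omega> \<beta> g G" and q: "1 < q" and \<tau>: "0 < \<tau>" "\<tau> < 1 / 4"
    and S: "compact S" "S \<subseteq> \<Omega>" and \<epsilon>: "0 < (\<epsilon>::real)"
  shows "\<forall>\<^sub>F r in at_right 0. \<forall>x0\<in>S. oscillation_sum E g q \<tau> \<beta> x0 r < ennreal \<epsilon>"
proof -
  \<comment> \<open>\<open>Q * q / (Q + q)\<close> is the exponent with Sobolev conjugate q, and the
    conjugate increases with \<theta>; the midpoint of 1 and Q ensures 1 < \<theta>.\<close>
  define \<theta> where "\<theta> = max (Q * q / (Q + q)) ((1 + Q) / 2)"
  have "Q * q / (Q + q) < Q" using Q q by (simp add: field_simps)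
  then have \<theta>: "1 < \<theta>" "\<theta> < hdim E" using Q by (auto simp: \<theta>_def less_max_iff_disj)
  have "Q * q / (Q + q) \<le> \<theta>" by (simp add: \<theta>_def)
  then have "Q * q \<le> \<theta> * (Q + q)" using Q q by (simp add: pos_divide_le_eq)
  then have q\<theta>: "q \<le> sobolev_exp (hdim E) \<theta>"
    using \<theta> Q by (simp add: sobolev_exp_def pos_le_divide_eq algebra_simps)
  obtain c1 c2 where c: "0 < c1" "0 < c2" and est: "\<And>x0 r. 0 < r \<Longrightarrow> gball E x0 r \<subseteq> \<Omega> \<Longrightarrow>
    oscillation_sum E g (sobolev_exp (hdim E) \<theta>) \<tau> \<beta> x0 r \<le> ennreal c1 * potential_sum E G \<theta> \<tau> \<beta> x0 r \<and>
    ennreal c1 * potential_sum E G \<theta> \<tau> \<beta> x0 r \<le> ennreal c2 * lz_norm (hdim E) \<beta> (gball E x0 r) G"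
    using oscillation_estimate[OF Q(1) \<theta> \<tau>] adm by blast
  have \<Omega>: "open \<Omega>" "lz_norm Q \<beta> \<Omega> G < \<infinity>" "set_integrable lebesgue \<Omega> g"
    using adm Q by (auto simp: admissible_def lz_space_def)
  have \<Omega>s: "\<Omega> \<in> sets lebesgue" using \<Omega> by auto
  have e2: "0 < \<epsilon> / (2 * c2)" using c \<epsilon> by simp
  obtain d where d: "0 < d" "\<And>U. U \<subseteq> \<Omega> \<Longrightarrow> emeasure lebesgue U \<le> ennreal d \<Longrightarrow> lz_norm Q \<beta> U G < ennreal (\<epsilon> / (2 * c2))"
    using lz_norm_vanishes[OF \<Omega>(2) admissible_meas[OF adm order_refl \<Omega>s] \<Omega>s e2] by blast
  obtain d' where d': "0 < d'" "\<And>x r. x \<in> S \<Longrightarrow> r \<le> d' \<Longrightarrow> gball E x r \<subseteq> \<Omega>"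
    using uniform_ball_inside[OF S \<Omega>(1)] by blast
  \<comment> \<open>The second entry is the radius of the balls of volume d.\<close>
  define r0 where "r0 = min d' ((d / \<omega>) powr (1 / Q))"
  have r0: "0 < r0" using d d' omega_pos by (simp add: r0_def)
  show ?thesis
    unfolding eventually_at_right_field
  proof (intro exI[of _ r0] conjI allI impI ballI r0)
    fix r x0 assume r: "0 < r" "r < r0" and x0: "x0 \<in> S"
    have sub: "gball E x0 r \<subseteq> \<Omega>" using d'(2)[OF x0, of r] r by (simp add: r0_def)
    have "r powr Q \<le> ((d / \<omega>) powr (1 / Q)) powr Q" using r Q by (intro powr_mono2) (auto simp: r0_def)
    also have "\<dots> = d / \<omega>" using d omega_pos Q by (simp add: powr_powr)
    finally have "\<omega> * r powr Q \<le> d" using omega_pos by (simp add: field_simps)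
    then have "emeasure lebesgue (gball E x0 r) \<le> ennreal d"
      unfolding emeasure_gball[OF r(1)] by (rule ennreal_leI)
    then have lz: "lz_norm Q \<beta> (gball E x0 r) G < ennreal (\<epsilon> / (2 * c2))" using d(2) sub by blast
    have "oscillation_sum E g q \<tau> \<beta> x0 r \<le> (\<Sum>j. ennreal 2 * (ennreal (log_weight \<beta> (\<tau> ^ j * r)) *
           Lp_mean (sobolev_exp (hdim E) \<theta>) (\<lambda>x. g x - mean_on g (gball E x0 (\<tau> ^ j * r))) (gball E x0 (\<tau> ^ j * r))))"
      unfolding oscillation_sum_def
    proof (intro suminf_le)
      fix j
      let ?r = "\<tau> ^ j * r"
      let ?B = "gball E x0 ?r"
      have rj: "0 < ?r" "?r \<le> r" using r \<tau> by (simp_all add: mult_left_le_one_le power_le_one)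
      have B: "?B \<subseteq> \<Omega>" "?B \<in> sets lebesgue" using ball_mono[OF rj(2), of x0] sub by auto
      have "set_integrable lebesgue ?B g" by (rule set_integrable_subset[OF \<Omega>(3) B(2,1)])
      then have gm: "(\<lambda>x. indicator ?B x *\<^sub>R g x) \<in> borel_measurable lebesgue"
        by (simp add: set_integrable_def)
      have "(\<lambda>x. indicator ?B x *\<^sub>R g x - indicator ?B x * mean_on g ?B) \<in> borel_measurable lebesgue"
        using gm B(2) by (intro borel_measurable_diff borel_measurable_times borel_measurable_indicator) auto
      then have "set_borel_measurable lebesgue ?B (\<lambda>x. g x - mean_on g ?B)"
        by (simp add: set_borel_measurable_def right_diff_distrib)
      note gm' = this
      have "Lp_mean q (\<lambda>x. g x - mean_on g ?B) ?B \<le> ennreal 2 * Lp_mean (sobolev_exp (hdim E) \<theta>) (\<lambda>x. g x - mean_on g ?B) ?B"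
      proof (rule Lp_mean_le_Lp_mean[OF q q\<theta> B(2) emeasure_gball[OF rj(1)] _ gm'])
        have "?r \<noteq> 0" using rj(1) by (rule less_imp_neq[THEN not_sym])
        then have "0 < ?r powr Q" by (simp only: powr_gt_zero simp_thms)
        then show "0 < \<omega> * ?r powr Q" using omega_pos by (rule mult_pos_pos[rotated])
      qed
      then have "ennreal (log_weight \<beta> ?r) * Lp_mean q (\<lambda>x. g x - mean_on g ?B) ?B \<le>
          ennreal (log_weight \<beta> ?r) * (ennreal 2 * Lp_mean (sobolev_exp (hdim E) \<theta>) (\<lambda>x. g x - mean_on g ?B) ?B)"
        by (rule mult_left_mono) simp
      then show "ennreal (log_weight \<beta> ?r) * Lp_mean q (\<lambda>x. g x - mean_on g ?B) ?B \<le>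
          ennreal 2 * (ennreal (log_weight \<beta> ?r) * Lp_mean (sobolev_exp (hdim E) \<theta>) (\<lambda>x. g x - mean_on g ?B) ?B)"
        by (simp only: mult.left_commute)
    qed auto
    also have "\<dots> = ennreal 2 * oscillation_sum E g (sobolev_exp (hdim E) \<theta>) \<tau> \<beta> x0 r"
      unfolding oscillation_sum_def by (rule ennreal_suminf_cmult)
    also have "\<dots> \<le> ennreal 2 * (ennreal c2 * lz_norm Q \<beta> (gball E x0 r) G)"
      using est[OF r(1) sub] unfolding Q(1) by (intro mult_left_mono) (auto intro: order_trans)
    also have "\<dots> = ennreal (2 * c2) * lz_norm Q \<beta> (gball E x0 r) G" using c by (simp add: ennreal_mult mult.assoc)
    also have "\<dots> < ennreal (2 * c2) * ennreal (\<epsilon> / (2 * c2))"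
      using c lz by (intro ennreal_mult_strict_left_mono) auto
    also have "\<dots> = ennreal \<epsilon>" using c \<epsilon> by (simp add: ennreal_mult[symmetric])
    finally show "oscillation_sum E g q \<tau> \<beta> x0 r < ennreal \<epsilon>" .
  qed
qed

end

section \<open>Euclidean space and the Heisenberg group\<close>

lemma nn_integral_lborel_affine:
  fixes F :: "'a::euclidean_space \<Rightarrow> ennreal"
  assumes [measurable]: "F \<in> borel_measurable borel" and c: "0 < c"
  shows "(\<integral>\<^sup>+y. F y \<partial>lborel) = ennreal (c ^ DIM('a)) * (\<integral>\<^sup>+x. F (t + c *\<^sub>R x) \<partial>lborel)"
  using c by (subst lborel_affine[of c t]) (simp_all add: nn_integral_density nn_integral_distr nn_integral_cmult)

lemma sum_inner_axis: "(\<Sum>i\<in>UNIV. (c \<bullet> axis i 1) *\<^sub>R axis i 1) = (c :: real^'n::finite)"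
  unfolding cart_eq_inner_axis[symmetric]
  by (simp add: vec_eq_iff axis_def if_distrib[where f = "\<lambda>y. _ * y"] cong: if_cong)

lemma step_two_euclid:
  "step_two (euclid :: (real^'n, 'n::finite) ambient) (\<lambda>_ _. 0) (\<lambda>_. 0) 0 (\<lambda>i. axis i 1) norm (real CARD('n))"
proof (rule step_two.intro)
  show "bilinear (\<lambda>(_::real^'n) (_::real^'n). 0::real)" by (auto simp: bilinear_def intro: linearI)
  show "linear (\<lambda>_::real^'n. 0::real)" by (auto intro: linearI)
  show "x = (\<Sum>i\<in>UNIV. (x \<bullet> axis i 1) *\<^sub>R axis i 1) + 0 *\<^sub>R 0" for x :: "real^'n"
    by (simp add: sum_inner_axis)
  show "axis i 1 \<bullet> (axis i 1 :: real^'n) = 1" for i :: 'n by (simp add: inner_axis_axis)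
  show "gdist euclid x y = norm (step_mult (\<lambda>_ _. 0) 0 (- y) x)" for x y :: "real^'n"
    by (simp add: euclid_def step_mult_def dist_norm)
  show "frame euclid i x = axis i 1 + (0 / 2) *\<^sub>R 0" for i and x :: "real^'n"
    by (simp add: euclid_def)
  show "convex {x::real^'n. norm x < 1}"
    using convex_ball[of "0::real^'n" 1] by (simp add: ball_def)
  show "bounded {x::real^'n. norm x \<le> 1}"
    using bounded_cball[of "0::real^'n" 1] by (simp add: cball_def)
  show "\<exists>c R. 0 < c \<and> c < 1 \<and> (\<forall>x::real^'n. norm x < 1 \<longrightarrow> (\<exists>p. norm p \<le> R \<and>
       (\<forall>s w. 0 < s \<and> s \<le> 1 \<and> norm w < 1 \<longrightarrow>
          norm (step_mult (\<lambda>_ _. 0) 0 x (step_dil (\<lambda>_. 0) 0 s (step_mult (\<lambda>_ _. 0) 0 p (step_dil (\<lambda>_. 0) 0 c w)))) < 1)))"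
  proof (rule exI[of _ "1/2"], rule exI[of _ 1], intro conjI allI impI)
    fix x :: "real^'n" assume x: "norm x < 1"
    show "\<exists>p. norm p \<le> 1 \<and> (\<forall>s w. 0 < s \<and> s \<le> 1 \<and> norm w < 1 \<longrightarrow>
          norm (step_mult (\<lambda>_ _. 0) 0 x (step_dil (\<lambda>_. 0) 0 s (step_mult (\<lambda>_ _. 0) 0 p (step_dil (\<lambda>_. 0) 0 (1/2) w)))) < 1)"
    \<comment> \<open>The axis of the cone points to the centre: the point in question is (1 - s) x
      + (s/2) w.\<close>
    proof (intro exI[of _ "- x"] conjI allI impI)
      fix s :: real and w :: "real^'n" assume s: "0 < s \<and> s \<le> 1 \<and> norm w < 1"
      have "norm ((1 - s) *\<^sub>R x + (s / 2) *\<^sub>R w) \<le> (1 - s) * norm x + (s / 2) * norm w"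
        using s by (intro norm_triangle_le) simp
      also have "\<dots> \<le> (1 - s) * 1 + (s / 2) * 1" using s x by (intro add_mono mult_left_mono) auto
      also have "\<dots> < 1" using s by simp
      finally show "norm (step_mult (\<lambda>_ _. 0) 0 x (step_dil (\<lambda>_. 0) 0 s (step_mult (\<lambda>_ _. 0) 0 (- x) (step_dil (\<lambda>_. 0) 0 (1/2) w)))) < 1"
        by (simp add: step_mult_def step_dil_def algebra_simps)
    qed (use x in auto)
  qed auto
  show "ennreal (\<rho> powr real CARD('n)) * (\<integral>\<^sup>+w. F (step_mult (\<lambda>_ _. 0) 0 z (step_dil (\<lambda>_. 0) 0 \<rho> w)) \<partial>lborel) = (\<integral>\<^sup>+y. F y \<partial>lborel)"
    if "F \<in> borel_measurable borel" "0 < \<rho>" for F and \<rho> and z :: "real^'n"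
    using nn_integral_lborel_affine[OF that, of z] that(2) by (simp add: step_mult_def step_dil_def powr_realpow)
qed (auto simp: step_dil_def intro: continuous_intros)

section \<open>The Heisenberg group as a step-two group\<close>

definition heis_form :: "'n::finite heis \<Rightarrow> 'n heis \<Rightarrow> real" where
  "heis_form x y = fst x \<bullet> fst (snd y) - fst (snd x) \<bullet> fst y"

definition heis_vert :: "'n::finite heis" where "heis_vert = (0, 0, 1)"

definition heis_axis :: "'n + 'n \<Rightarrow> 'n::finite heis" where
  "heis_axis i = (case i of Inl k \<Rightarrow> (axis k 1, 0, 0) | Inr k \<Rightarrow> (0, axis k 1, 0))"

definition heis_height :: "'n::finite heis \<Rightarrow> real" where "heis_height x = snd (snd x)"

abbreviation "heis_dil \<equiv> step_dil heis_height heis_vert"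

lemma heis_mult_eq: "step_mult heis_form heis_vert x y = heis_mult x y"
  by (cases x; cases y) (simp add: step_mult_def heis_form_def heis_vert_def inner_vec_def sum_subtractf)

lemma heis_mult_triple:
  "step_mult heis_form heis_vert (a, b, t) (a', b', s) = (a + a', b + b', t + s + (a \<bullet> b' - b \<bullet> a') / 2)"
  by (simp add: step_mult_def heis_form_def heis_vert_def)

lemma heis_dil_eq: "heis_dil \<rho> (a, b, t) = (\<rho> *\<^sub>R a, \<rho> *\<^sub>R b, \<rho>\<^sup>2 * t)"
  by (simp add: step_dil_def heis_height_def heis_vert_def algebra_simps)

text \<open>The fourth power of the Koranyi gauge; conditions on the unit ball become
  polynomial.\<close>

definition heis_gauge4 :: "'n::finite heis \<Rightarrow> real" where
  "heis_gauge4 x = norm (fst x, fst (snd x)) ^ 4 + (snd (snd x))\<^sup>2"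

lemma koranyi_norm_eq: "koranyi_norm x = root 4 (heis_gauge4 x)"
  by (cases x) (simp add: heis_gauge4_def)

lemma koranyi_norm_less_1: "koranyi_norm x < 1 \<longleftrightarrow> heis_gauge4 x < 1"
  and koranyi_norm_le_1: "koranyi_norm x \<le> 1 \<longleftrightarrow> heis_gauge4 x \<le> 1"
  by (simp_all add: koranyi_norm_eq)

text \<open>With x = (a, b) and j = (- b, a) the vector is the horizontal gradient of
  \<open>heis_gauge4\<close> at (x, t); its two parts are orthogonal.\<close>

lemma norm_koranyi_gradient:
  fixes x j :: "'v::real_inner"
  assumes "x \<bullet> j = 0" "norm j = norm x"
  shows "norm ((4 * (norm x)\<^sup>2) *\<^sub>R x + t *\<^sub>R j) = norm x * sqrt (16 * norm x ^ 4 + t\<^sup>2)"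
proof -
  define n where "n = norm x"
  have xx: "x \<bullet> x = n\<^sup>2" by (simp add: n_def power2_norm_eq_inner)
  have jj: "j \<bullet> j = n\<^sup>2" unfolding n_def assms(2)[symmetric] by (simp add: power2_norm_eq_inner)
  have jx: "j \<bullet> x = 0" using assms(1) by (simp add: inner_commute)
  have "((4 * n\<^sup>2) *\<^sub>R x + t *\<^sub>R j) \<bullet> ((4 * n\<^sup>2) *\<^sub>R x + t *\<^sub>R j) = n\<^sup>2 * (16 * n ^ 4 + t\<^sup>2)"
    by (simp add: inner_add_left inner_add_right xx jj jx assms(1) power2_eq_square power4_eq_xxxx algebra_simps)
  then have "norm ((4 * n\<^sup>2) *\<^sub>R x + t *\<^sub>R j) = sqrt (n\<^sup>2 * (16 * n ^ 4 + t\<^sup>2))"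
    by (simp only: norm_eq_sqrt_inner)
  then show ?thesis by (simp add: real_sqrt_mult n_def)
qed

text \<open>
  The interior cone at a point \<open>(x, t)\<close> of the unit ball; \<open>j\<close> is the rotated vector for which
  \<open>j \<bullet> y\<close> is the symplectic form. The horizontal axis \<open>v\<close> of the cone is the normalised negative
  horizontal gradient of the gauge; where that gradient degenerates, near the poles \<open>x = 0\<close>,
  the vertical component \<open>- t\<close> of the axis takes over.
\<close>

lemma koranyi_cone:
  fixes x j v w :: "'v::real_inner" and t s \<theta> wt :: real
  assumes xj: "x \<bullet> j = 0" "norm j = norm x" and P: "norm x ^ 4 + t\<^sup>2 < 1"
    and D: "D = sqrt (16 * norm x ^ 4 + t\<^sup>2)"
    and v: "v = (- 1 / (norm x * D)) *\<^sub>R ((4 * (norm x)\<^sup>2) *\<^sub>R x + t *\<^sub>R j)"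
    and w: "norm w \<le> 1" "\<bar>wt\<bar> \<le> 1" "\<bar>\<theta>\<bar> \<le> 1 / 400" and s: "0 < s" "s \<le> 1 / 5"
    and q: "q = (1 / 10) *\<^sub>R v + (1 / 20) *\<^sub>R w" and qt: "qt = - t + wt / 400 + \<theta>"
  shows "norm (x + s *\<^sub>R q) ^ 4 + (t + s\<^sup>2 * qt + s / 2 * (j \<bullet> q))\<^sup>2 < 1"
proof -
  define n where "n = norm x"
  define g where "g = (4 * n\<^sup>2) *\<^sub>R x + t *\<^sub>R j"
  have n0: "0 \<le> n" by (simp add: n_def)
  have xx: "x \<bullet> x = n\<^sup>2" by (simp add: n_def power2_norm_eq_inner)
  have jj: "j \<bullet> j = n\<^sup>2" unfolding n_def xj(2)[symmetric] by (simp add: power2_norm_eq_inner)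
  have jx: "j \<bullet> x = 0" using xj(1) by (simp add: inner_commute)
  have t2: "t\<^sup>2 < 1" "\<bar>t\<bar> \<le> 1" "n ^ 4 < 1"
  proof -
    have "0 \<le> n ^ 4" "0 \<le> t\<^sup>2" by simp_all
    moreover have "n ^ 4 + t\<^sup>2 < 1" using P by (simp add: n_def)
    ultimately show "t\<^sup>2 < 1" "n ^ 4 < 1" by linarith+
    then show "\<bar>t\<bar> \<le> 1" using abs_square_le_1[of t] by linarith
  qed
  have n1: "n \<le> 1" using t2(3) n0 power_le_one_iff[of n 4] by simp
  have n2: "n\<^sup>2 \<le> 1" using n0 n1 by (simp add: power_le_one)
  have D0: "0 \<le> D" using D by simp
  have D2: "D\<^sup>2 = 16 * n ^ 4 + t\<^sup>2" using D by (simp add: n_def)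
  have gg: "norm g = n * D" using norm_koranyi_gradient[OF xj, of t] by (simp add: g_def n_def D)
  have vg: "v = (- 1 / (n * D)) *\<^sub>R g" using v by (simp add: n_def g_def)
  have nv: "norm v \<le> 1"
    unfolding vg norm_scaleR gg using n0 D0 by (cases "n * D = 0") (auto simp: abs_mult)
  have gv: "g \<bullet> v = - (n * D)"
  proof (cases "n * D = 0")
    case True
    then have "norm g = 0" using gg by (simp only:)
    then have "g = 0" by simp
    then show ?thesis using True by simp
  next
    case False
    have "g \<bullet> v = - (norm g)\<^sup>2 / (n * D)" by (simp add: vg power2_norm_eq_inner)
    then show ?thesis unfolding gg using False by (simp add: power2_eq_square)
  qed
  \<comment> \<open>The first-order gain: the axis contributes - n D / 10, and the spread w of the
    cone takes back at most n D / 20.\<close>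
  have gq: "g \<bullet> q \<le> - (n * D) / 20"
  proof -
    have "g \<bullet> w \<le> norm g * norm w" by (rule norm_cauchy_schwarz)
    also have "\<dots> \<le> n * D * 1" unfolding gg using w n0 D0 by (intro mult_left_mono) auto
    finally show ?thesis by (simp add: q inner_add_right gv)
  qed
  define k where "k = norm q"
  have k: "0 \<le> k" "k \<le> 3 / 20"
  proof -
    have "norm q \<le> norm ((1 / 10) *\<^sub>R v) + norm ((1 / 20) *\<^sub>R w)" unfolding q by (rule norm_triangle_ineq)
    also have "\<dots> \<le> 1 / 10 + 1 / 20" using nv w by simp
    finally show "k \<le> 3 / 20" by (simp add: k_def)
  qed (simp add: k_def)
  have k2: "k\<^sup>2 \<le> 9 / 400" using power_mono[OF k(2,1), of 2] by (simp add: power2_eq_square)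
  have k4: "k ^ 4 \<le> 1 / 1000"
  proof -
    have "k ^ 4 \<le> (3 / 20) ^ 4" by (rule power_mono[OF k(2,1)])
    then show ?thesis by (simp add: power4_eq_xxxx)
  qed
  define a b A C where "a = x \<bullet> q" and "b = j \<bullet> q" and "A = 2 * s * a + s\<^sup>2 * k\<^sup>2" and "C = s\<^sup>2 * qt + s / 2 * b"
  have ab: "a\<^sup>2 \<le> n\<^sup>2 * k\<^sup>2" "b\<^sup>2 \<le> n\<^sup>2 * k\<^sup>2"
    using Cauchy_Schwarz_ineq[of x q] Cauchy_Schwarz_ineq[of j q]
    by (simp_all add: a_def b_def xx jj k_def power2_norm_eq_inner)
  have nk: "n\<^sup>2 * k\<^sup>2 \<le> 9 / 400"
    using mult_mono[OF n2 k2] by simp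
  have qt2: "qt\<^sup>2 \<le> 102 / 100"
  proof -
    have "\<bar>qt\<bar> \<le> 1 + 1 / 200" using t2(2) w by (simp add: qt abs_if split: if_splits)
    then have "\<bar>qt\<bar>\<^sup>2 \<le> (1 + 1 / 200)\<^sup>2" by (intro power_mono) auto
    also have "\<dots> \<le> 102 / 100" by (simp add: power2_eq_square)
    finally show ?thesis by simp
  qed
  have tqt: "t * qt \<le> - t\<^sup>2 + 1 / 200"
  proof -
    have "\<bar>wt / 400 + \<theta>\<bar> \<le> 1 / 200" using w by (simp add: abs_if split: if_splits)
    then have "\<bar>t\<bar> * \<bar>wt / 400 + \<theta>\<bar> \<le> 1 * (1 / 200)" using t2(2) by (intro mult_mono) auto
    then have "t * (wt / 400 + \<theta>) \<le> 1 / 200" unfolding abs_mult[symmetric] by linarith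
    then show ?thesis by (simp add: qt power2_eq_square algebra_simps)
  qed
  have "(norm (x + s *\<^sub>R q))\<^sup>2 = n\<^sup>2 + A"
    unfolding power2_norm_eq_inner
    by (simp add: inner_add_left inner_add_right xx A_def a_def k_def power2_norm_eq_inner inner_commute[of q x] power2_eq_square[of s] distrib_left)
  then have n4: "norm (x + s *\<^sub>R q) ^ 4 = (n\<^sup>2 + A)\<^sup>2"
    by (metis mult_2 numeral_Bit0 power_add power2_eq_square)
  have g_ab: "g \<bullet> q = 4 * n\<^sup>2 * a + t * b" by (simp add: g_def inner_add_left a_def b_def)
  \<comment> \<open>The term linear in s is the derivative along q. Among the terms of order s^2,
    \<open>t * qt\<close> is close to - t^2: this is the gain near the poles.\<close>
  have expand: "(n\<^sup>2 + A)\<^sup>2 + (t + C)\<^sup>2 = n ^ 4 + t\<^sup>2 + s * (g \<bullet> q) + 2 * s\<^sup>2 * (n\<^sup>2 * k\<^sup>2) + A\<^sup>2 + 2 * s\<^sup>2 * (t * qt) + C\<^sup>2"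
    unfolding g_ab by (simp add: A_def C_def power2_eq_square power4_eq_xxxx algebra_simps)
  have s2: "0 < s\<^sup>2" "s\<^sup>2 \<le> s / 5" "s\<^sup>2 \<le> 1 / 25"
    using s mult_left_mono[OF s(2), of s] power_mono[OF s(2), of 2] by (auto simp: power2_eq_square)
  have A2: "A\<^sup>2 \<le> s\<^sup>2 * (19 / 100)"
  proof -
    have "A\<^sup>2 \<le> 2 * (2 * s * a)\<^sup>2 + 2 * (s\<^sup>2 * k\<^sup>2)\<^sup>2"
      unfolding A_def using sum_squares_bound[of "2 * s * a" "s\<^sup>2 * k\<^sup>2"] by (simp add: power2_sum)
    also have "\<dots> = s\<^sup>2 * (8 * a\<^sup>2 + 2 * s\<^sup>2 * k ^ 4)" by (simp add: power2_eq_square power4_eq_xxxx algebra_simps)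
    also have "\<dots> \<le> s\<^sup>2 * (19 / 100)"
    proof (intro mult_left_mono)
      have "s\<^sup>2 * k ^ 4 \<le> 1 / 25 * (1 / 1000)" using s2 k4 k by (intro mult_mono) auto
      then show "8 * a\<^sup>2 + 2 * s\<^sup>2 * k ^ 4 \<le> 19 / 100" using ab(1) nk by simp
    qed simp
    finally show ?thesis .
  qed
  have C2: "C\<^sup>2 \<le> s\<^sup>2 * (94 / 1000)"
  proof -
    have "C\<^sup>2 \<le> 2 * (s\<^sup>2 * qt)\<^sup>2 + 2 * (s / 2 * b)\<^sup>2"
      unfolding C_def using sum_squares_bound[of "s\<^sup>2 * qt" "s / 2 * b"] by (simp add: power2_sum)
    also have "\<dots> = s\<^sup>2 * (2 * (s\<^sup>2 * qt\<^sup>2) + b\<^sup>2 / 2)" by (simp add: power2_eq_square algebra_simps)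
    also have "\<dots> \<le> s\<^sup>2 * (94 / 1000)"
    proof (intro mult_left_mono)
      have "s\<^sup>2 * qt\<^sup>2 \<le> 1 / 25 * (102 / 100)" using s2 qt2 by (intro mult_mono) auto
      then show "2 * (s\<^sup>2 * qt\<^sup>2) + b\<^sup>2 / 2 \<le> 94 / 1000" using ab(2) nk by simp
    qed simp
    finally show ?thesis .
  qed
  define F where "F = (n\<^sup>2 + A)\<^sup>2 + (t + C)\<^sup>2"
  \<comment> \<open>The errors of order s^2 add up to 9/200 + 19/100 + 1/100 + 94/1000 \<le>
    34/100.\<close>
  have F: "F \<le> n ^ 4 + t\<^sup>2 - s * (n * D) / 20 - 2 * s\<^sup>2 * t\<^sup>2 + s\<^sup>2 * (34 / 100)"
  proof -
    have "s * (g \<bullet> q) \<le> s * (- (n * D) / 20)" using gq s by (intro mult_left_mono) auto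
    then have 1: "s * (g \<bullet> q) \<le> - (s * (n * D) / 20)" by (simp only: mult_minus_right times_divide_eq_right minus_divide_left)
    have "2 * s\<^sup>2 * (n\<^sup>2 * k\<^sup>2) \<le> 2 * s\<^sup>2 * (9 / 400)" using nk by (intro mult_left_mono) auto
    then have 2: "2 * s\<^sup>2 * (n\<^sup>2 * k\<^sup>2) \<le> s\<^sup>2 * (9 / 200)" by linarith
    have "2 * s\<^sup>2 * (t * qt) \<le> 2 * s\<^sup>2 * (- t\<^sup>2 + 1 / 200)" using tqt by (intro mult_left_mono) auto
    also have "\<dots> = - (2 * s\<^sup>2 * t\<^sup>2) + s\<^sup>2 * (1 / 100)" by (simp add: right_diff_distrib)
    finally show ?thesis unfolding F_def expand using 1 2 A2 C2 s2(1) by linarith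
  qed
  have nD: "0 \<le> s * (n * D)" using s n0 D0 by simp
  have st: "0 \<le> s\<^sup>2 * t\<^sup>2" by simp
  have P': "n ^ 4 + t\<^sup>2 < 1" using P by (simp add: n_def)
  have "F < 1"
  \<comment> \<open>Far from the sphere there is room for the error. Near the poles, where t^2 \<ge>
    1/4, the gain 2 s^2 t^2 exceeds it. Elsewhere n D \<ge> 7/5, and the linear gain 7/100 s exceeds
    the error 34/100 s^2 because s \<le> 1/5.\<close>
  proof (cases "n ^ 4 + t\<^sup>2 < 1 / 2")
    case True
    then show ?thesis using F nD st s2 by linarith
  next
    case half: False
    show ?thesis
    proof (cases "1 / 4 \<le> t\<^sup>2")
      case True
      then have "s\<^sup>2 * (1 / 4) \<le> s\<^sup>2 * t\<^sup>2" by (intro mult_left_mono) auto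
      then show ?thesis using F nD P' s2(1) by linarith
    next
      case False
      then have "(1 / 2)\<^sup>2 \<le> (n\<^sup>2)\<^sup>2" using half by (simp add: power2_eq_square power4_eq_xxxx)
      then have nn: "1 / 2 \<le> n\<^sup>2" by (rule power2_le_imp_le) simp
      have "(7 / 10)\<^sup>2 \<le> n\<^sup>2" using nn by (simp add: power2_eq_square)
      then have n7: "7 / 10 \<le> n" using n0 by (rule power2_le_imp_le)
      have "2\<^sup>2 \<le> D\<^sup>2" unfolding D2 using half False by (simp add: zero_le_power2)
      then have "2 \<le> D" using D0 by (rule power2_le_imp_le)
      then have "7 / 10 * 2 \<le> n * D" using n7 by (intro mult_mono) auto
      then have "s * (7 / 10 * 2) \<le> s * (n * D)" using s by (intro mult_left_mono) auto
      then show ?thesis using F st P' s2 s(1) by linarith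
    qed
  qed
  then show ?thesis unfolding n4 F_def C_def b_def by (simp add: add.assoc)
qed

lemma heis_cone_ex:
  fixes x :: "'n::finite heis"
  assumes x: "koranyi_norm x < 1"
  shows "\<exists>p. norm p \<le> 1 \<and> (\<forall>s w. 0 < s \<and> s \<le> 1 \<and> koranyi_norm w < 1 \<longrightarrow>
     koranyi_norm (step_mult heis_form heis_vert x (heis_dil s (step_mult heis_form heis_vert p (heis_dil (1 / 100) w)))) < 1)"
proof -
  obtain a b t where xe: "x = (a, b, t)" by (cases x)
  define h j where "h = (a, b)" and "j = (- b, a)"
  define D where "D = sqrt (16 * norm h ^ 4 + t\<^sup>2)"
  define v where "v = (- 1 / (norm h * D)) *\<^sub>R ((4 * (norm h)\<^sup>2) *\<^sub>R h + t *\<^sub>R j)"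
  have P: "norm h ^ 4 + t\<^sup>2 < 1" using x by (simp add: koranyi_norm_less_1 heis_gauge4_def xe h_def)
  have hj: "h \<bullet> j = 0" "norm j = norm h"
    by (simp_all add: h_def j_def inner_commute norm_Pair add.commute)
  have t1: "\<bar>t\<bar> \<le> 1"
  proof -
    have "0 \<le> norm h ^ 4" by simp
    then have "t\<^sup>2 \<le> 1" using P by linarith
    then show ?thesis by (simp add: abs_square_le_1)
  qed
  have nv: "norm v \<le> 1"
  proof -
    have "norm ((4 * (norm h)\<^sup>2) *\<^sub>R h + t *\<^sub>R j) = norm h * D"
      unfolding D_def by (rule norm_koranyi_gradient[OF hj])
    moreover have "0 \<le> norm h * D" by (simp add: D_def)
    ultimately show ?thesis unfolding v_def norm_scaleR
      by (cases "norm h * D = 0") (auto simp: abs_mult)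
  qed
  \<comment> \<open>\<open>koranyi_cone\<close> is used at \<sigma> = s / 5: its axis (v / 10, - t)
    becomes (v / 50, - t / 25), and its spread 1/20 becomes the dilation factor 1/100.\<close>
  define p where "p = ((1 / 50) *\<^sub>R fst v, (1 / 50) *\<^sub>R snd v, - t / 25)"
  show ?thesis
  proof (intro exI[of _ p] conjI allI impI)
    have "norm p \<le> norm ((1 / 50) *\<^sub>R fst v) + (norm ((1 / 50) *\<^sub>R snd v) + norm (- t / 25))"
      unfolding p_def by (intro order_trans[OF norm_Pair_le] add_left_mono norm_Pair_le)
    also have "\<dots> \<le> 1" using norm_fst_le[of "fst v" "snd v"] norm_snd_le[of "snd v" "fst v"] nv t1 by simp
    finally show "norm p \<le> 1" .
    fix s :: real and w :: "'n heis" assume s: "0 < s \<and> s \<le> 1 \<and> koranyi_norm w < 1"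
    obtain wa wb wt where we: "w = (wa, wb, wt)" by (cases w)
    define W where "W = (wa, wb)"
    have gw: "norm W ^ 4 + wt\<^sup>2 < 1" using s by (simp add: koranyi_norm_less_1 heis_gauge4_def we W_def)
    have W1: "norm W \<le> 1" "\<bar>wt\<bar> \<le> 1"
    proof -
      have "0 \<le> norm W ^ 4" "0 \<le> wt\<^sup>2" by simp_all
      then have "norm W ^ 4 \<le> 1" "wt\<^sup>2 \<le> 1" using gw by linarith+
      then show "norm W \<le> 1" "\<bar>wt\<bar> \<le> 1" by (simp_all add: power_le_one_iff abs_square_le_1)
    qed
    \<comment> \<open>The symplectic cross term in the product of p and
      \<open>heis_dil (1 / 100) w\<close>, in units of \<sigma>^2.\<close>
    define \<theta> where "\<theta> = (fst v \<bullet> wb - snd v \<bullet> wa) / 400"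
    have \<theta>: "\<bar>\<theta>\<bar> \<le> 1 / 400"
    proof -
      have "fst v \<bullet> wb - snd v \<bullet> wa = (- snd v, fst v) \<bullet> W" by (simp add: W_def)
      also have "\<bar>\<dots>\<bar> \<le> norm (- snd v, fst v) * norm W" by (rule Cauchy_Schwarz_ineq2)
      also have "norm (- snd v, fst v) = norm v" by (simp add: norm_Pair norm_prod_def add.commute)
      also have "norm v * norm W \<le> 1 * 1" using nv W1 by (intro mult_mono) auto
      finally show ?thesis by (simp add: \<theta>_def)
    qed
    define \<sigma> where "\<sigma> = s / 5"
    define q where "q = (1 / 10) *\<^sub>R v + (1 / 20) *\<^sub>R W"
    have "norm (h + \<sigma> *\<^sub>R q) ^ 4 + (t + \<sigma>\<^sup>2 * (- t + wt / 400 + \<theta>) + \<sigma> / 2 * (j \<bullet> q))\<^sup>2 < 1"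
      by (rule koranyi_cone[OF hj P D_def v_def W1 \<theta> _ _ q_def refl]) (use s in \<open>auto simp: \<sigma>_def\<close>)
    also have "norm (h + \<sigma> *\<^sub>R q) ^ 4 + (t + \<sigma>\<^sup>2 * (- t + wt / 400 + \<theta>) + \<sigma> / 2 * (j \<bullet> q))\<^sup>2 =
       heis_gauge4 (step_mult heis_form heis_vert x (heis_dil s (step_mult heis_form heis_vert p (heis_dil (1 / 100) w))))"
    proof -
      let ?y = "step_mult heis_form heis_vert x (heis_dil s (step_mult heis_form heis_vert p (heis_dil (1 / 100) w)))"
      have "(fst ?y, fst (snd ?y)) = h + \<sigma> *\<^sub>R q"
        unfolding we p_def xe heis_dil_eq heis_mult_triple
        by (simp add: h_def q_def W_def \<sigma>_def prod_eq_iff algebra_simps)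
      moreover have "snd (snd ?y) = t + \<sigma>\<^sup>2 * (- t + wt / 400 + \<theta>) + \<sigma> / 2 * (j \<bullet> q)"
        unfolding we p_def xe heis_dil_eq heis_mult_triple
        by (simp add: q_def W_def \<sigma>_def j_def \<theta>_def inner_prod_def inner_add_right power2_eq_square field_simps)
      ultimately show ?thesis by (simp only: heis_gauge4_def)
    qed
    finally show "koranyi_norm (step_mult heis_form heis_vert x (heis_dil s (step_mult heis_form heis_vert p (heis_dil (1 / 100) w)))) < 1"
      by (simp only: koranyi_norm_less_1)
  qed
qed

lemma power2_convex_combination:
  fixes p q u v :: real
  assumes "0 \<le> u" "0 \<le> v" "u + v = 1"
  shows "(u * p + v * q)\<^sup>2 \<le> u * p\<^sup>2 + v * q\<^sup>2"
proof -
  have "u * p\<^sup>2 + v * q\<^sup>2 - (u * p + v * q)\<^sup>2 = u * v * (p - q)\<^sup>2"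
  proof -
    have v: "v = 1 - u" using assms by simp
    show ?thesis unfolding v by (simp add: power2_eq_square algebra_simps)
  qed
  moreover have "0 \<le> u * v * (p - q)\<^sup>2" using assms by simp
  ultimately show ?thesis by linarith
qed

text \<open>Convexity of the square is used twice for the horizontal norm and once for t.\<close>

lemma convex_heis_gauge4: "convex {x :: 'n::finite heis. heis_gauge4 x < 1}"
proof (rule convexI, clarsimp simp del: split_paired_All)
  fix a b a' b' :: "real^'n" and t t' u v :: real
  assume x: "heis_gauge4 (a, b, t) < 1" and y: "heis_gauge4 (a', b', t') < 1" and uv: "0 \<le> u" "0 \<le> v" "u + v = 1"
  define p q where "p = norm (a, b)" and "q = norm (a', b')"
  have pq: "0 \<le> p" "0 \<le> q" by (simp_all add: p_def q_def)
  have "norm (u *\<^sub>R a + v *\<^sub>R a', u *\<^sub>R b + v *\<^sub>R b') = norm (u *\<^sub>R (a, b) + v *\<^sub>R (a', b'))" by simp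
  also have "\<dots> \<le> u * p + v * q"
    using uv by (intro norm_triangle_le) (simp add: p_def q_def del: scaleR_Pair)
  finally have "norm (u *\<^sub>R a + v *\<^sub>R a', u *\<^sub>R b + v *\<^sub>R b') ^ 4 \<le> (u * p + v * q) ^ 4"
    by (intro power_mono) auto
  also have "\<dots> = ((u * p + v * q)\<^sup>2)\<^sup>2" by (simp add: power_mult[symmetric])
  also have "\<dots> \<le> (u * p\<^sup>2 + v * q\<^sup>2)\<^sup>2"
    using power2_convex_combination[OF uv] by (intro power_mono) auto
  also have "\<dots> \<le> u * (p\<^sup>2)\<^sup>2 + v * (q\<^sup>2)\<^sup>2" by (rule power2_convex_combination[OF uv])
  finally have 1: "norm (u *\<^sub>R a + v *\<^sub>R a', u *\<^sub>R b + v *\<^sub>R b') ^ 4 \<le> u * p ^ 4 + v * q ^ 4"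
    by (simp add: power_mult[symmetric])
  have 2: "(u * t + v * t')\<^sup>2 \<le> u * t\<^sup>2 + v * t'\<^sup>2" by (rule power2_convex_combination[OF uv])
  have "u * (p ^ 4 + t\<^sup>2) + v * (q ^ 4 + t'\<^sup>2) < 1"
  proof -
    have "u * (p ^ 4 + t\<^sup>2) + v * (q ^ 4 + t'\<^sup>2) < u * 1 + v * 1 \<or> u * (p ^ 4 + t\<^sup>2) + v * (q ^ 4 + t'\<^sup>2) < 1"
      using convex_bound_lt[of "p ^ 4 + t\<^sup>2" 1 "q ^ 4 + t'\<^sup>2" u v] x y uv by (simp add: heis_gauge4_def p_def q_def)
    then show ?thesis using uv by auto
  qed
  then show "heis_gauge4 (u *\<^sub>R a + v *\<^sub>R a', u *\<^sub>R b + v *\<^sub>R b', u * t + v * t') < 1"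
    using 1 2 by (simp add: heis_gauge4_def algebra_simps)
qed

text \<open>The map is triangular: for fixed (a, b) the variable t is scaled by \<rho>^2 and shifted
  by an amount depending on (a, b), while a and b are scaled by \<rho> and shifted by constants.
  Tonelli's theorem multiplies the factors to \<rho>^(2 n + 2).\<close>

lemma heis_nn_integral_transform:
  fixes F :: "'n::finite heis \<Rightarrow> ennreal"
  assumes F[measurable]: "F \<in> borel_measurable borel" and \<rho>: "0 < \<rho>"
  shows "ennreal (\<rho> powr (2 * real CARD('n) + 2)) * (\<integral>\<^sup>+w. F (step_mult heis_form heis_vert z (heis_dil \<rho> w)) \<partial>lborel)
    = (\<integral>\<^sup>+y. F y \<partial>lborel)"
proof -
  obtain za zb zt where z: "z = (za, zb, zt)" by (cases z)
  define G where "G w = F (step_mult heis_form heis_vert z (heis_dil \<rho> w))" for w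
  have G_eq: "G (a, b, t) = F (za + \<rho> *\<^sub>R a, zb + \<rho> *\<^sub>R b, (zt + \<rho> * (za \<bullet> b - zb \<bullet> a) / 2) + \<rho>\<^sup>2 *\<^sub>R t)" for a b t
    unfolding G_def z heis_dil_eq heis_mult_triple by (simp add: algebra_simps)
  have "G = (\<lambda>w. F (za + \<rho> *\<^sub>R fst w, zb + \<rho> *\<^sub>R fst (snd w), (zt + \<rho> * (za \<bullet> fst (snd w) - zb \<bullet> fst w) / 2) + \<rho>\<^sup>2 *\<^sub>R snd (snd w)))"
    by (auto simp: fun_eq_iff G_eq)
  moreover have "(\<lambda>w :: 'n heis. (za + \<rho> *\<^sub>R fst w, zb + \<rho> *\<^sub>R fst (snd w), (zt + \<rho> * (za \<bullet> fst (snd w) - zb \<bullet> fst w) / 2) + \<rho>\<^sup>2 *\<^sub>R snd (snd w))) \<in> borel_measurable borel"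
    by (intro borel_measurable_continuous_onI continuous_intros) auto
  ultimately have G[measurable]: "G \<in> borel_measurable borel"
    using measurable_compose[OF _ F] by simp
  have iter: "(\<integral>\<^sup>+w. H w \<partial>lborel) = (\<integral>\<^sup>+a. \<integral>\<^sup>+b. \<integral>\<^sup>+t. H (a, b, t) \<partial>lborel \<partial>lborel \<partial>lborel)"
    if H: "H \<in> borel_measurable borel" for H :: "'n heis \<Rightarrow> ennreal"
  proof -
    have H1: "H \<in> borel_measurable (lborel \<Otimes>\<^sub>M (lborel :: ((real^'n) \<times> real) measure))"
      using H by (simp add: lborel_prod)
    have "(\<integral>\<^sup>+w. H w \<partial>lborel) = (\<integral>\<^sup>+a. \<integral>\<^sup>+r. H (a, r) \<partial>lborel \<partial>lborel)"
      unfolding lborel_prod[symmetric, where 'a = "real^'n" and 'b = "(real^'n) \<times> real"] by (rule lborel.nn_integral_fst[OF H1, symmetric])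
    also have "\<dots> = (\<integral>\<^sup>+a. \<integral>\<^sup>+b. \<integral>\<^sup>+t. H (a, b, t) \<partial>lborel \<partial>lborel \<partial>lborel)"
    proof (intro nn_integral_cong)
      fix a :: "real^'n"
      have "(\<lambda>r. H (a, r)) \<in> borel_measurable borel"
        by (rule measurable_compose[OF _ H]) (intro borel_measurable_continuous_onI continuous_intros)
      then have "(\<lambda>r. H (a, r)) \<in> borel_measurable (lborel \<Otimes>\<^sub>M (lborel :: real measure))"
        by (simp add: lborel_prod)
      from lborel.nn_integral_fst[OF this, symmetric]
      show "(\<integral>\<^sup>+r. H (a, r) \<partial>lborel) = (\<integral>\<^sup>+b. \<integral>\<^sup>+t. H (a, b, t) \<partial>lborel \<partial>lborel)"
        unfolding lborel_prod[symmetric, where 'a = "real^'n" and 'b = real] .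
    qed
    finally show ?thesis .
  qed
  have sec[measurable]: "(\<lambda>t. F (a, b, t)) \<in> borel_measurable borel" for a b
    by (rule measurable_compose[OF _ F]) (intro borel_measurable_continuous_onI continuous_intros)
  have inner_meas: "(\<lambda>(a, b). \<integral>\<^sup>+t. H (a, b, t) \<partial>lborel) \<in> borel_measurable (lborel \<Otimes>\<^sub>M lborel)"
    if H: "H \<in> borel_measurable borel" for H :: "'n heis \<Rightarrow> ennreal"
  proof -
    have "(\<lambda>q :: ((real^'n) \<times> (real^'n)) \<times> real. H (fst (fst q), snd (fst q), snd q)) \<in> borel_measurable borel"
      by (rule measurable_compose[OF _ H]) (intro borel_measurable_continuous_onI continuous_intros)
    then have "(\<lambda>(p, t). H (fst p, snd p, t)) \<in> borel_measurable ((lborel :: ((real^'n) \<times> (real^'n)) measure) \<Otimes>\<^sub>M (lborel :: real measure))"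
      by (simp add: lborel_prod split_beta)
    from lborel.borel_measurable_nn_integral[OF this] show ?thesis
      by (simp add: lborel_prod split_beta)
  qed
  define I1 where "I1 a b = (\<integral>\<^sup>+t. F (a, b, t) \<partial>lborel)" for a b
  define I2 where "I2 a = (\<integral>\<^sup>+b. I1 a b \<partial>lborel)" for a
  have Im: "(\<lambda>(a, b). I1 a b) \<in> borel_measurable (lborel \<Otimes>\<^sub>M lborel)"
    unfolding I1_def by (rule inner_meas[OF F])
  have I1m[measurable]: "I1 a \<in> borel_measurable borel" for a
    using measurable_compose[OF measurable_Pair1'[of a] Im] by simp
  have I2m[measurable]: "I2 \<in> borel_measurable borel"
    using lborel.borel_measurable_nn_integral[OF Im] unfolding I2_def by simp
  have dimv: "DIM(real^'n) = CARD('n)" by simp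
  have "(\<integral>\<^sup>+y. F y \<partial>lborel) = (\<integral>\<^sup>+a. I2 a \<partial>lborel)" unfolding iter[OF F] I2_def I1_def ..
  also have "\<dots> = ennreal (\<rho> ^ CARD('n)) * (\<integral>\<^sup>+a. I2 (za + \<rho> *\<^sub>R a) \<partial>lborel)"
    unfolding dimv[symmetric] by (rule nn_integral_lborel_affine[OF I2m \<rho>])
  also have "(\<lambda>a. I2 (za + \<rho> *\<^sub>R a)) = (\<lambda>a. ennreal (\<rho> ^ CARD('n)) * (\<integral>\<^sup>+b. I1 (za + \<rho> *\<^sub>R a) (zb + \<rho> *\<^sub>R b) \<partial>lborel))"
    unfolding I2_def dimv[symmetric] by (rule ext) (rule nn_integral_lborel_affine[OF I1m \<rho>])
  also have "(\<lambda>a. ennreal (\<rho> ^ CARD('n)) * (\<integral>\<^sup>+b. I1 (za + \<rho> *\<^sub>R a) (zb + \<rho> *\<^sub>R b) \<partial>lborel)) =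
      (\<lambda>a. ennreal (\<rho> ^ CARD('n)) * (\<integral>\<^sup>+b. ennreal (\<rho>\<^sup>2) * (\<integral>\<^sup>+t. G (a, b, t) \<partial>lborel) \<partial>lborel))"
  proof -
    have "I1 (za + \<rho> *\<^sub>R a) (zb + \<rho> *\<^sub>R b) = ennreal (\<rho>\<^sup>2) * (\<integral>\<^sup>+t. G (a, b, t) \<partial>lborel)" for a b
      unfolding I1_def G_eq using nn_integral_lborel_affine[OF sec, of "\<rho>\<^sup>2"] \<rho> by simp
    then show ?thesis by simp
  qed
  finally have eq: "(\<integral>\<^sup>+y. F y \<partial>lborel) = ennreal (\<rho> ^ CARD('n)) * (\<integral>\<^sup>+a. ennreal (\<rho> ^ CARD('n)) *
      (\<integral>\<^sup>+b. ennreal (\<rho>\<^sup>2) * (\<integral>\<^sup>+t. G (a, b, t) \<partial>lborel) \<partial>lborel) \<partial>lborel)" .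
  have Jm: "(\<lambda>(a, b). \<integral>\<^sup>+t. G (a, b, t) \<partial>lborel) \<in> borel_measurable (lborel \<Otimes>\<^sub>M lborel)"
    by (rule inner_meas[OF G])
  have J1m: "(\<lambda>b. \<integral>\<^sup>+t. G (a, b, t) \<partial>lborel) \<in> borel_measurable lborel" for a
    using measurable_compose[OF measurable_Pair1'[of a] Jm] by simp
  have J2m: "(\<lambda>a. \<integral>\<^sup>+b. \<integral>\<^sup>+t. G (a, b, t) \<partial>lborel \<partial>lborel) \<in> borel_measurable lborel"
    using lborel.borel_measurable_nn_integral[OF Jm] by simp
  have "(\<integral>\<^sup>+y. F y \<partial>lborel) = ennreal (\<rho> ^ CARD('n)) * (ennreal (\<rho> ^ CARD('n)) * (ennreal (\<rho>\<^sup>2) * (\<integral>\<^sup>+w. G w \<partial>lborel)))"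
    unfolding eq iter[OF G] using J1m J2m by (simp add: nn_integral_cmult)
  also have "\<dots> = ennreal (\<rho> powr (2 * real CARD('n) + 2)) * (\<integral>\<^sup>+w. G w \<partial>lborel)"
  proof -
    have "\<rho> powr (2 * real CARD('n) + 2) = \<rho> powr real (CARD('n) + CARD('n) + 2)" by (simp add: add.commute)
    also have "\<dots> = \<rho> ^ CARD('n) * (\<rho> ^ CARD('n) * \<rho>\<^sup>2)"
      using \<rho> by (simp only: powr_realpow) (simp add: power_add power2_eq_square)
    finally show ?thesis using \<rho> by (simp add: ennreal_mult mult.assoc)
  qed
  finally show ?thesis by (simp add: G_def)
qed

lemma step_two_heisenberg:
  "step_two (heisenberg :: ('n::finite heis, 'n + 'n) ambient) heis_form heis_height heis_vert heis_axis
     koranyi_norm (2 * real CARD('n) + 2)"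
proof (rule step_two.intro)
  show "bilinear (heis_form :: 'n heis \<Rightarrow> _)"
    by (auto simp: bilinear_def heis_form_def inner_add_left inner_add_right algebra_simps intro!: linearI)
  show "linear (heis_height :: 'n heis \<Rightarrow> real)" by (auto simp: heis_height_def intro: linearI)
  show "heis_form x x = 0" "heis_form heis_vert x = 0" for x :: "'n heis"
    by (simp_all add: heis_form_def heis_vert_def inner_commute)
  show "heis_height x = 0" "heis_form x y = 0" if "heis_vert = (0 :: 'n heis)" for x y :: "'n heis"
    using that by (simp_all add: heis_vert_def zero_prod_def)
  show "heis_height (heis_vert :: 'n heis) = 1" by (simp add: heis_height_def heis_vert_def)
  show "x = (\<Sum>i\<in>UNIV. (x \<bullet> heis_axis i) *\<^sub>R heis_axis i) + heis_height x *\<^sub>R heis_vert" for x :: "'n heis"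
  proof -
    obtain a b t where x: "x = (a, b, t)" by (cases x)
    have "(\<Sum>i\<in>UNIV. (x \<bullet> heis_axis i) *\<^sub>R heis_axis i) =
        (\<Sum>k\<in>UNIV. (x \<bullet> heis_axis (Inl k)) *\<^sub>R heis_axis (Inl k)) + (\<Sum>k\<in>UNIV. (x \<bullet> heis_axis (Inr k)) *\<^sub>R heis_axis (Inr k))"
      unfolding UNIV_Plus_UNIV[symmetric] by (subst sum.Plus) auto
    also have "\<dots> = (\<Sum>k\<in>UNIV. ((a \<bullet> axis k 1) *\<^sub>R axis k 1, 0, 0)) + (\<Sum>k\<in>UNIV. (0, (b \<bullet> axis k 1) *\<^sub>R axis k 1, 0))"
      by (simp add: heis_axis_def x)
    also have "\<dots> = (a, b, 0)"
      by (simp add: prod_eq_iff fst_sum snd_sum sum_inner_axis)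
    finally show ?thesis by (simp add: x heis_height_def heis_vert_def)
  qed
  show "heis_axis i \<bullet> heis_axis i = (1::real)" "heis_vert \<bullet> heis_axis i = (0::real)" "heis_height (heis_axis i) = 0" for i :: "'n + 'n"
    by (auto simp: heis_axis_def heis_vert_def heis_height_def inner_axis_axis split: sum.splits)
  \<comment> \<open>Two conjugate directions, with the same arbitrary index in both summands, have
    bracket T.\<close>
  show "\<exists>i j :: 'n + 'n. heis_form (heis_axis i) (heis_axis j) *\<^sub>R heis_vert = (heis_vert :: 'n heis)"
    by (intro exI[of _ "Inl undefined"] exI[of _ "Inr undefined"]) (simp add: heis_form_def heis_axis_def inner_axis_axis)
  show "frame heisenberg i x = heis_axis i + (heis_form x (heis_axis i) / 2) *\<^sub>R heis_vert" for i and x :: "'n heis"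
    by (cases x; cases i) (simp_all add: heisenberg_def heis_axis_def heis_form_def heis_vert_def inner_axis)
  show "2 * real CARD('n) + 2 = real CARD('n + 'n) + 2 * heis_height (heis_vert :: 'n heis)"
    by (simp add: heis_height_def heis_vert_def)
  show "gdist heisenberg x y = koranyi_norm (step_mult heis_form heis_vert (- y) x)" for x y :: "'n heis"
    by (simp add: heisenberg_def koranyi_dist_def heis_mult_eq)
  show "continuous_on UNIV (koranyi_norm :: 'n heis \<Rightarrow> real)"
    unfolding koranyi_norm_eq[abs_def] heis_gauge4_def by (intro continuous_intros)
  show "koranyi_norm (heis_dil \<rho> x) = \<rho> * koranyi_norm x" if \<rho>: "0 < \<rho>" for \<rho> and x :: "'n heis"
  proof -
    obtain a b t where x: "x = (a, b, t)" by (cases x)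
    have "norm (\<rho> *\<^sub>R a, \<rho> *\<^sub>R b) = \<rho> * norm (a, b)"
      using \<rho> by (simp flip: scaleR_Pair)
    then have "heis_gauge4 (heis_dil \<rho> x) = \<rho> ^ 4 * heis_gauge4 x"
      by (simp add: heis_gauge4_def x heis_dil_eq power_mult_distrib distrib_left power_mult[symmetric])
    then show ?thesis using \<rho> by (simp add: koranyi_norm_eq real_root_mult real_root_power_cancel)
  qed
  show "koranyi_norm (- x) = koranyi_norm x" for x :: "'n heis"
    by (cases x) (simp add: norm_Pair)
  show "0 \<le> koranyi_norm x" for x :: "'n heis"
    by (cases x) simp
  show "bounded {x :: 'n heis. koranyi_norm x \<le> 1}"
    unfolding bounded_iff
  proof (intro exI[of _ 2] ballI)
    fix x :: "'n heis" assume "x \<in> {x. koranyi_norm x \<le> 1}"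
    moreover obtain a b t where x: "x = (a, b, t)" by (cases x)
    ultimately have le: "norm (a, b) ^ 4 + t\<^sup>2 \<le> 1" by (simp add: koranyi_norm_le_1 heis_gauge4_def)
    moreover have "0 \<le> norm (a, b) ^ 4" "0 \<le> t\<^sup>2" by simp_all
    ultimately have "norm (a, b) ^ 4 \<le> 1" "t\<^sup>2 \<le> 1" by linarith+
    then have "norm (a, b) \<le> 1" "\<bar>t\<bar> \<le> 1" by (simp_all add: power_le_one_iff abs_square_le_1)
    moreover have "norm x = norm ((a, b), t)" by (simp add: x norm_Pair)
    ultimately show "norm x \<le> 2" using norm_Pair_le[of "(a, b)" t] by simp
  qed
  show "convex {x :: 'n heis. koranyi_norm x < 1}"
    unfolding koranyi_norm_less_1 by (rule convex_heis_gauge4)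
  show "\<exists>c R. 0 < c \<and> c < 1 \<and> (\<forall>x :: 'n heis. koranyi_norm x < 1 \<longrightarrow> (\<exists>p. norm p \<le> R \<and>
       (\<forall>s w. 0 < s \<and> s \<le> 1 \<and> koranyi_norm w < 1 \<longrightarrow>
          koranyi_norm (step_mult heis_form heis_vert x (heis_dil s (step_mult heis_form heis_vert p (heis_dil c w)))) < 1)))"
    by (rule exI[of _ "1 / 100"], rule exI[of _ 1], intro conjI allI impI heis_cone_ex) auto
  show "ennreal (\<rho> powr (2 * real CARD('n) + 2)) * (\<integral>\<^sup>+w. F (step_mult heis_form heis_vert z (heis_dil \<rho> w)) \<partial>lborel) = (\<integral>\<^sup>+y. F y \<partial>lborel)"
    if "F \<in> borel_measurable borel" "0 < \<rho>" for F and \<rho> and z :: "'n heis"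
    using that by (rule heis_nn_integral_transform)
qed

theorem proposition13:
  shows
    "(CARD('n::finite) \<ge> 2 \<longrightarrow>
       (\<forall>\<theta> \<tau>. 1 < \<theta> \<and> \<theta> < hdim (euclid :: (real^'n, 'n) ambient) \<and> 0 < \<tau> \<and> \<tau> < 1/4 \<longrightarrow>
          (\<exists>c1>0. \<exists>c2>0. \<forall>(\<Omega> :: (real^'n) set) \<beta> g (G :: real^'n \<Rightarrow> real^'n) x0 r.
            admissible euclid \<Omega> \<beta> g G \<and> 0 < r \<and> gball euclid x0 r \<subseteq> \<Omega> \<longrightarrow>
              oscillation_sum euclid g (sobolev_exp (hdim (euclid :: (real^'n, 'n) ambient)) \<theta>) \<tau> \<beta> x0 r
                \<le> ennreal c1 * potential_sum euclid G \<theta> \<tau> \<beta> x0 r \<and>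
              ennreal c1 * potential_sum euclid G \<theta> \<tau> \<beta> x0 r
                \<le> ennreal c2 * lz_norm (hdim (euclid :: (real^'n, 'n) ambient)) \<beta> (gball euclid x0 r) G)) \<and>
       (\<forall>(\<Omega> :: (real^'n) set) \<beta> g (G :: real^'n \<Rightarrow> real^'n) q \<tau> K \<epsilon>.
          admissible euclid \<Omega> \<beta> g G \<and> 1 < q \<and> 0 < \<tau> \<and> \<tau> < 1/4 \<and>
          compact K \<and> K \<subseteq> \<Omega> \<and> (0::real) < \<epsilon> \<longrightarrow>
            (\<forall>\<^sub>F r in at_right 0. \<forall>x0\<in>K. oscillation_sum euclid g q \<tau> \<beta> x0 r < ennreal \<epsilon>))) \<and>
     ((\<forall>\<theta> \<tau>. 1 < \<theta> \<and> \<theta> < hdim (heisenberg :: ('n heis, 'n + 'n) ambient) \<and> 0 < \<tau> \<and> \<tau> < 1/4 \<longrightarrow>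
          (\<exists>c1>0. \<exists>c2>0. \<forall>(\<Omega> :: ('n heis) set) \<beta> g (G :: 'n heis \<Rightarrow> real^('n + 'n)) x0 r.
            admissible heisenberg \<Omega> \<beta> g G \<and> 0 < r \<and> gball heisenberg x0 r \<subseteq> \<Omega> \<longrightarrow>
              oscillation_sum heisenberg g (sobolev_exp (hdim (heisenberg :: ('n heis, 'n + 'n) ambient)) \<theta>) \<tau> \<beta> x0 r
                \<le> ennreal c1 * potential_sum heisenberg G \<theta> \<tau> \<beta> x0 r \<and>
              ennreal c1 * potential_sum heisenberg G \<theta> \<tau> \<beta> x0 r
                \<le> ennreal c2 * lz_norm (hdim (heisenberg :: ('n heis, 'n + 'n) ambient)) \<beta> (gball heisenberg x0 r) G)) \<and>
       (\<forall>(\<Omega> :: ('n heis) set) \<beta> g (G :: 'n heis \<Rightarrow> real^('n + 'n)) q \<tau> K \<epsilon>.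
          admissible heisenberg \<Omega> \<beta> g G \<and> 1 < q \<and> 0 < \<tau> \<and> \<tau> < 1/4 \<and>
          compact K \<and> K \<subseteq> \<Omega> \<and> (0::real) < \<epsilon> \<longrightarrow>
            (\<forall>\<^sub>F r in at_right 0. \<forall>x0\<in>K. oscillation_sum heisenberg g q \<tau> \<beta> x0 r < ennreal \<epsilon>)))"
proof (intro conjI impI allI)
  fix \<theta> \<tau> :: real
  assume "1 < \<theta> \<and> \<theta> < hdim (euclid :: (real^'n, 'n) ambient) \<and> 0 < \<tau> \<and> \<tau> < 1 / 4"
  then show "\<exists>c1>0. \<exists>c2>0. \<forall>(\<Omega> :: (real^'n) set) \<beta> g (G :: real^'n \<Rightarrow> real^'n) x0 r.
            admissible euclid \<Omega> \<beta> g G \<and> 0 < r \<and> gball euclid x0 r \<subseteq> \<Omega> \<longrightarrow>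
              oscillation_sum euclid g (sobolev_exp (hdim (euclid :: (real^'n, 'n) ambient)) \<theta>) \<tau> \<beta> x0 r
                \<le> ennreal c1 * potential_sum euclid G \<theta> \<tau> \<beta> x0 r \<and>
              ennreal c1 * potential_sum euclid G \<theta> \<tau> \<beta> x0 r
                \<le> ennreal c2 * lz_norm (hdim (euclid :: (real^'n, 'n) ambient)) \<beta> (gball euclid x0 r) G"
    by (intro step_two.oscillation_estimate[OF step_two_euclid]) (auto simp: euclid_def)
next
  fix \<Omega> :: "(real^'n) set" and \<beta> :: nat and g and G :: "real^'n \<Rightarrow> real^'n" and q \<tau> :: real and K and \<epsilon> :: real
  assume n: "2 \<le> CARD('n)"
    and asm: "admissible euclid \<Omega> \<beta> g G \<and> 1 < q \<and> 0 < \<tau> \<and> \<tau> < 1 / 4 \<and> compact K \<and> K \<subseteq> \<Omega> \<and> 0 < \<epsilon>"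
  have "hdim (euclid :: (real^'n, 'n) ambient) = real CARD('n)" "1 < real CARD('n)"
    using n by (simp_all add: euclid_def)
  from step_two.oscillation_vanishes[OF step_two_euclid this] asm
  show "\<forall>\<^sub>F r in at_right 0. \<forall>x0\<in>K. oscillation_sum euclid g q \<tau> \<beta> x0 r < ennreal \<epsilon>" by blast
next
  fix \<theta> \<tau> :: real
  assume "1 < \<theta> \<and> \<theta> < hdim (heisenberg :: ('n heis, 'n + 'n) ambient) \<and> 0 < \<tau> \<and> \<tau> < 1 / 4"
  then show "\<exists>c1>0. \<exists>c2>0. \<forall>(\<Omega> :: ('n heis) set) \<beta> g (G :: 'n heis \<Rightarrow> real^('n + 'n)) x0 r.
            admissible heisenberg \<Omega> \<beta> g G \<and> 0 < r \<and> gball heisenberg x0 r \<subseteq> \<Omega> \<longrightarrow>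
              oscillation_sum heisenberg g (sobolev_exp (hdim (heisenberg :: ('n heis, 'n + 'n) ambient)) \<theta>) \<tau> \<beta> x0 r
                \<le> ennreal c1 * potential_sum heisenberg G \<theta> \<tau> \<beta> x0 r \<and>
              ennreal c1 * potential_sum heisenberg G \<theta> \<tau> \<beta> x0 r
                \<le> ennreal c2 * lz_norm (hdim (heisenberg :: ('n heis, 'n + 'n) ambient)) \<beta> (gball heisenberg x0 r) G"
    by (intro step_two.oscillation_estimate[OF step_two_heisenberg]) (auto simp: heisenberg_def)
next
  fix \<Omega> :: "('n heis) set" and \<beta> :: nat and g and G :: "'n heis \<Rightarrow> real^('n + 'n)" and q \<tau> :: real and K and \<epsilon> :: real
  assume asm: "admissible heisenberg \<Omega> \<beta> g G \<and> 1 < q \<and> 0 < \<tau> \<and> \<tau> < 1 / 4 \<and> compact K \<and> K \<subseteq> \<Omega> \<and> 0 < \<epsilon>"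
  have "hdim (heisenberg :: ('n heis, 'n + 'n) ambient) = 2 * real CARD('n) + 2" "1 < 2 * real CARD('n) + 2"
    by (simp_all add: heisenberg_def)
  from step_two.oscillation_vanishes[OF step_two_heisenberg this] asm
  show "\<forall>\<^sub>F r in at_right 0. \<forall>x0\<in>K. oscillation_sum heisenberg g q \<tau> \<beta> x0 r < ennreal \<epsilon>" by blast
qed

end
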